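(* Let $\rho:S\to\mathbb{A}^1$ be the $\mathbb{A}^1$-fibration of Miyanishi's $\mathbb{Q}$-acyclic surface $S$ and let $\sigma:S\to\mathbb{A}^2=\operatorname{Spec}(\mathbb{C}[x,y])$ be the birational morphism described in the context. Then for every $n\geq 2$ and every polynomial $b\in\mathbb{C}[x]$ such that $$b\Bigl(\cos\bigl(\tfrac{k\pi}{n}\bigr)\Bigr)=\pm\sqrt{-1}\,/\sin\bigl(\tfrac{k\pi}{n}\bigr)\quad\text{for } k=1,\ldots,n-1,$$ the endomorphism $\eta_0:\mathbb{A}^2\to\mathbb{A}^2$ defined by $$\eta_0(x,y)=\Bigl(T_n(x),\ \tfrac1n U_{n-1}^2(x)\,y+(x^2-1)U_{n-1}(x)b(x)\Bigr)$$ lifts via $\sigma:S\to\mathbb{A}^2$ to an étale endomorphism $\eta:S\to S$ of degree $n$ respecting $\rho$. In particular, the monoid $\operatorname{\acute{E}t}(S,\rho)$ of étale endomorphisms of $S$ respecting $\rho$ contains endomorphisms of every positive degree.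
   Context: $T_n,U_n\in\mathbb{C}[x]$ are the Chebyshev polynomials of the first and second kind: $T_n(\cos\theta)=\cos n\theta$ and $U_{n-1}(\cos\theta)=\sin n\theta/\sin\theta$. Miyanishi's surface: let $(C,p_{-1},p_1,p_\infty)$ be a smooth plane conic with a triple of distinct points on it. Let $F_{\pm1}$ be the lines tangent to $C$ at $p_{\pm1}$, let $q=F_1\cap F_{-1}$ and let $F_\infty$ be the line joining $p_\infty$ and $q$. Blow up once over $q$ and three times over each of $p_{\pm1}$, each time at a point on the proper transform of $C$; let $E_{\pm1}$ be the last exceptional curves over $p_{\pm1}$, and $\bar S$ the resulting projective surface. Let $D$ be the total reduced transform of $F_1+F_\infty+F_{-1}$ with $E_1+E_{-1}$ subtracted, and $S=\bar S\setminus D$. The linear system of the proper transform of $F_\infty$ (the pencil of lines through $q$) induces a $\mathbb{P}^1$-fibration of $\bar S$, whose restriction to $S$ is an $\mathbb{A}^1$-fibration $\rho:S\to\mathbb{A}^1$. It has exactly two degenerate fibers, over the points $x=\pm1$ corresponding to $F_{\pm1}$, both isomorphic to $2\mathbb{A}^1$. The morphism $\sigma$: contract successively, over each of $x=\pm1$, the $(-1)$-curves in the degenerate fibers of the $\mathbb{P}^1$-fibration of $\bar S$, keeping the fiber components which meet the section contained in $D$ (the exceptional curve over $q$), i.e. the proper transforms of $F_{\pm1}$. The result is a $\mathbb{P}^1$-bundle over $\mathbb{P}^1$, and the complement in it of the image of that section and of the fiber at infinity $F_\infty$ is $\mathbb{A}^2=\operatorname{Spec}(\mathbb{C}[x,y])$,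 with the induced fibration being the projection to $x$; the coordinate $y$ is chosen so that the fibers $\rho^{-1}(\pm1)$ are contracted to the points $(\pm1,0)$. The restriction of the contraction to $S$ is $\sigma:S\to\mathbb{A}^2$. It is a birational morphism which is an isomorphism off the fibers over $x=\pm1$ and satisfies $\rho=\mathrm{pr}_x\circ\sigma$. Over each of $(\pm1,0)$ it arises by blowing up the point, then the intersection of the exceptional curve with the proper transform of the line $x=\pm1$, then a point of the last exceptional curve at which $(x^2-1)/y^2$ has some value in $\mathbb{C}^*$ (the same value over $x=1$ and $x=-1$), and removing everything over $x=\pm1$ except the last exceptional curves. That $\eta_0$ lifts via $\sigma$ to $\eta$ means that $\sigma\circ\eta=\eta_0\circ\sigma$. An endomorphism $\eta$ of $S$ respects $\rho$ if there is an endomorphism $\eta_\rho$ of $\mathbb{A}^1$ with $\rho\circ\eta=\eta_\rho\circ\rho$.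
   Formalization: The coordinate y is also required to be scaled so that (x²−1)/y² has value 1 at the last blown-up points over (±1,0); for any other common value in ℂ* no lift exists, since near x=cos(kπ/n) the image of η₀ has (x²−1)/y² tending to 1. *)

theory Defs
  imports
    "HOL-Analysis.Analysis"
    "HOL-Computational_Algebra.Computational_Algebra"
begin

section \<open>Chebyshev polynomials\<close>

definition cheb_T :: "nat \<Rightarrow> complex poly" where
  "cheb_T n = (THE p. \<forall>\<theta>. poly p (cos \<theta>) = cos (of_nat n * \<theta>))"

definition cheb_U :: "nat \<Rightarrow> complex poly" where
  "cheb_U n = (THE p. \<forall>\<theta>. sin \<theta> \<noteq> 0 \<longrightarrow> poly p (cos \<theta>) = sin (of_nat (n + 1) * \<theta>) / sin \<theta>)"

lemma cheb_T_exists: "\<exists>p::complex poly. \<forall>\<theta>. poly p (cos \<theta>) = cos (of_nat n * \<theta>)"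
proof (induction n rule: less_induct)
  case (less n)
  consider "n = 0" | "n = 1" | m where "n = m + 2"
    by (metis One_nat_def add_2_eq_Suc' not0_implies_Suc)
  then show ?case
  proof cases
    case 1
    then show ?thesis by (intro exI[of _ 1]) simp
  next
    case 2
    then show ?thesis by (intro exI[of _ "[:0, 1:]"]) simp
  next
    case 3
    obtain p where p: "\<And>\<theta>. poly p (cos \<theta>) = cos (of_nat m * \<theta> :: complex)"
      using less.IH[of m] 3 by auto
    obtain q where q: "\<And>\<theta>. poly q (cos \<theta>) = cos (of_nat (m + 1) * \<theta> :: complex)"
      using less.IH[of "m + 1"] 3 by auto
    have "poly ([:0, 2:] * q - p) (cos \<theta>) = cos (of_nat n * \<theta>)" for \<theta> :: complex
    proof -
      let ?a = "of_nat (m + 1) * \<theta>"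
      have e: "of_nat n * \<theta> = ?a + \<theta>" "of_nat m * \<theta> = ?a - \<theta>"
        using 3 by (simp_all add: algebra_simps)
      show ?thesis
        unfolding poly_diff poly_mult p q e cos_add cos_diff by simp
    qed
    then show ?thesis by blast
  qed
qed

lemma cheb_T_cos: "poly (cheb_T n) (cos \<theta>) = cos (of_nat n * \<theta>)"
proof -
  have "\<exists>!p::complex poly. \<forall>\<theta>. poly p (cos \<theta>) = cos (of_nat n * \<theta>)"
  proof (rule ex_ex1I[OF cheb_T_exists])
    fix p q :: "complex poly"
    assume "\<forall>\<theta>. poly p (cos \<theta>) = cos (of_nat n * \<theta>)" "\<forall>\<theta>. poly q (cos \<theta>) = cos (of_nat n * \<theta>)"
    then have "poly p z = poly q z" for z
      by (metis cos_Arccos)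
    then show "p = q" by (simp add: poly_eq_poly_eq_iff[symmetric] fun_eq_iff)
  qed
  from theI'[OF this] show ?thesis unfolding cheb_T_def by blast
qed

lemma cheb_U_exists:
  "\<exists>p::complex poly. \<forall>\<theta>. sin \<theta> \<noteq> 0 \<longrightarrow> poly p (cos \<theta>) = sin (of_nat (n + 1) * \<theta>) / sin \<theta>"
proof (induction n rule: less_induct)
  case (less n)
  consider "n = 0" | "n = 1" | m where "n = m + 2"
    by (metis One_nat_def add_2_eq_Suc' not0_implies_Suc)
  then show ?case
  proof cases
    case 1
    then show ?thesis by (intro exI[of _ 1]) simp
  next
    case 2
    then show ?thesis by (intro exI[of _ "[:0, 2:]"]) (simp add: sin_double)
  next
    case 3
    obtain p where p: "\<And>\<theta>. sin \<theta> \<noteq> 0 \<Longrightarrow> poly p (cos \<theta>) = sin (of_nat (m + 1) * \<theta> :: complex) / sin \<theta>"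
      using less.IH[of m] 3 by auto
    obtain q where q: "\<And>\<theta>. sin \<theta> \<noteq> 0 \<Longrightarrow> poly q (cos \<theta>) = sin (of_nat (m + 1 + 1) * \<theta> :: complex) / sin \<theta>"
      using less.IH[of "m + 1"] 3 by auto
    have "poly ([:0, 2:] * q - p) (cos \<theta>) = sin (of_nat (n + 1) * \<theta>) / sin \<theta>"
      if nz: "sin \<theta> \<noteq> 0" for \<theta> :: complex
    proof -
      let ?a = "of_nat (m + 1 + 1) * \<theta>"
      have e: "of_nat (n + 1) * \<theta> = ?a + \<theta>" "of_nat (m + 1) * \<theta> = ?a - \<theta>"
        using 3 by (simp_all add: algebra_simps)
      show ?thesis
        unfolding poly_diff poly_mult p[OF nz] q[OF nz] e sin_add sin_diff
        using nz by (simp add: field_simps)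
    qed
    then show ?thesis by blast
  qed
qed

lemma cheb_U_cos:
  assumes "sin \<theta> \<noteq> 0"
  shows "poly (cheb_U n) (cos \<theta>) = sin (of_nat (n + 1) * \<theta>) / sin \<theta>"
proof -
  let ?P = "\<lambda>p::complex poly. \<forall>\<theta>. sin \<theta> \<noteq> 0 \<longrightarrow> poly p (cos \<theta>) = sin (of_nat (n + 1) * \<theta>) / sin \<theta>"
  have "\<exists>!p. ?P p"
  proof (rule ex_ex1I[OF cheb_U_exists])
    fix p q assume pq: "?P p" "?P q"
    have eq: "poly p z = poly q z" if "z \<noteq> 1" "z \<noteq> -1" for z
    proof -
      have "sin (Arccos z) \<noteq> 0"
      proof
        assume "sin (Arccos z) = 0"
        then have "z\<^sup>2 = 1"
          using sin_cos_squared_add[of "Arccos z"] by simp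
        then show False using that by (simp add: power2_eq_1_iff)
      qed
      then show ?thesis using pq by (metis cos_Arccos)
    qed
    show "p = q"
    proof (rule ccontr)
      assume "p \<noteq> q"
      then have "finite {z. poly (p - q) z = 0}"
        using poly_roots_finite[of "p - q"] by simp
      moreover have "- {1, -1} \<subseteq> {z. poly (p - q) z = 0}"
        using eq by auto
      ultimately have "finite (- {1, -1 :: complex})"
        by (rule finite_subset[rotated])
      then have "finite (UNIV :: complex set)"
        by (metis Compl_partition finite.emptyI finite.insertI finite_Un)
      then show False using infinite_UNIV_char_0 by blast
    qed
  qed
  from theI'[OF this] show ?thesis using assms unfolding cheb_U_def by blast
qed

section \<open>Rational surfaces as sets of local rings\<close>

text \<open>
  All surfaces here are birational to the projective plane, so they are described in the
  language of Zariski and Chevalley, as models of the function field $K = \mathbf{C}(s, t)$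
  of the plane: a surface is identified with the set of the local rings, inside $K$, of its
  closed points. The surfaces of a birational chain share $K$; a birational morphism sends a
  local ring to the unique local ring of the target that it dominates.
  As usual for varieties over $\mathbf{C}$, points are closed points.
\<close>

type_synonym ratfun = "complex poly poly fract"
type_synonym point = "ratfun set"
type_synonym model = "point set"

definition const :: "complex \<Rightarrow> ratfun" where
  "const c = to_fract [:[:c:]:]"

subsection \<open>Subrings and localization\<close>

definition adjoin :: "ratfun set \<Rightarrow> ratfun \<Rightarrow> ratfun set" where
  "adjoin A w = {poly f w | f. \<forall>i. coeff f i \<in> A}"

definition ideal2 :: "ratfun set \<Rightarrow> ratfun \<Rightarrow> ratfun \<Rightarrow> ratfun set" where
  "ideal2 A u v = {a * u + b * v | a b. a \<in> A \<and> b \<in> A}"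

definition local_at :: "ratfun set \<Rightarrow> ratfun \<Rightarrow> ratfun \<Rightarrow> point" where
  "local_at A u v = {f / g | f g. f \<in> A \<and> g \<in> A - ideal2 A u v}"

definition max_ideal :: "point \<Rightarrow> ratfun set" where
  "max_ideal P = {h \<in> P. h = 0 \<or> inverse h \<notin> P}"

definition max_ideal_sq :: "point \<Rightarrow> ratfun set" where
  "max_ideal_sq P = {\<Sum>i<k. a i * b i | (k::nat) a b. \<forall>i<k. a i \<in> max_ideal P \<and> b i \<in> max_ideal P}"

definition has_value :: "point \<Rightarrow> ratfun \<Rightarrow> complex \<Rightarrow> bool" where
  "has_value P h c \<longleftrightarrow> h - const c \<in> max_ideal P"

definition val :: "point \<Rightarrow> ratfun \<Rightarrow> complex" where
  "val P h = (THE c. has_value P h c)"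

definition dominates :: "point \<Rightarrow> point \<Rightarrow> bool" where
  "dominates R P \<longleftrightarrow> P \<subseteq> R \<and> max_ideal P \<subseteq> max_ideal R"

text \<open>
  On a (separated) variety the domain of definition of a rational function is open, and every
  affine open subset is the common domain of the generators of its coordinate ring; so the
  domains of rational functions form a subbasis of the Zariski topology.
\<close>

definition zariski :: "model \<Rightarrow> point topology" where
  "zariski X = topology_generated_by {{P \<in> X. h \<in> P} | h. True}"

subsection \<open>The projective plane and the affine planes\<close>

definition form :: "nat \<Rightarrow> (nat \<Rightarrow> nat \<Rightarrow> 'a) \<Rightarrow> 'a::comm_ring_1 ^ 3 \<Rightarrow> 'a" where
  "form d c v = (\<Sum>i\<le>d. \<Sum>j\<le>d - i. c i j * (v $ 1) ^ (d - i - j) * (v $ 2) ^ i * (v $ 3) ^ j)"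

text \<open>The homogeneous coordinates, divided by the first one.\<close>

definition hcoord :: "ratfun ^ 3" where
  "hcoord = vector [1, to_fract [:[:0, 1:]:], to_fract [:0, 1:]]"

text \<open>The local ring at $[a_1 : a_2 : a_3]$: quotients of forms of equal degree.\<close>

definition pt :: "complex ^ 3 \<Rightarrow> point" where
  "pt a = {form d (\<lambda>i j. const (f i j)) hcoord / form d (\<lambda>i j. const (g i j)) hcoord
           | d f g. form d g a \<noteq> 0}"

definition proj_plane :: model where
  "proj_plane = {pt a | a. a \<noteq> 0}"

text \<open>The plane $\mathrm{Spec}\,\mathbf{C}[x, y]$, for $x, y$ generating $K$, and its points.\<close>

definition plane_pt :: "ratfun \<Rightarrow> ratfun \<Rightarrow> complex \<Rightarrow> complex \<Rightarrow> point" where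
  "plane_pt x y a b = local_at (adjoin (adjoin (range const) x) y) (x - const a) (y - const b)"

definition affine_plane :: "ratfun \<Rightarrow> ratfun \<Rightarrow> model" where
  "affine_plane x y = {plane_pt x y a b | a b. True}"

subsection \<open>Blowing up\<close>

text \<open>
  The exceptional curve over $P$ with regular parameters $u, v$ consists of the localizations
  of $P[v/u]$ at the ideals $(u, v/u - \lambda)$, and of the analogous one for $\lambda = \infty$,
  which is obtained from the parameters $v, u$.
\<close>

definition exc :: "point \<Rightarrow> model" where
  "exc P = {local_at (adjoin P (v / u)) u (v / u - const l) | u v l. max_ideal P = ideal2 P u v}"

definition blowup :: "model \<Rightarrow> point \<Rightarrow> model" where
  "blowup X P = (X - {P}) \<union> exc P"

definition blowups :: "model \<Rightarrow> point list \<Rightarrow> model" where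
  "blowups X Ps = foldl blowup X Ps"

primrec proper_transform :: "model \<Rightarrow> point list \<Rightarrow> model \<Rightarrow> model" where
  "proper_transform X [] Z = Z"
| "proper_transform X (P # Ps) Z =
     proper_transform (blowup X P) Ps (zariski (blowup X P) closure_of (Z - {P}))"

section \<open>Morphisms\<close>

text \<open>
  Morphisms in the sense of classical varieties: continuous maps under which regular functions
  on open sets pull back to regular functions. A regular function on an open set $V$ of a model
  is an element of $K$ lying in all the local rings of $V$.
\<close>

definition morphism :: "model \<Rightarrow> model \<Rightarrow> (point \<Rightarrow> point) \<Rightarrow> bool" where
  "morphism X Y f \<longleftrightarrow>
     continuous_map (zariski X) (zariski Y) f \<and>
     (\<forall>V h. openin (zariski Y) V \<and> (\<forall>Q\<in>V. h \<in> Q) \<longrightarrow>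
        (\<exists>k. \<forall>P\<in>X. f P \<in> V \<longrightarrow> k \<in> P \<and> val P k = val (f P) h))"

text \<open>The germ \<open>k\<close> at \<open>P\<close> is the pullback of the germ \<open>h\<close> at \<open>f P\<close>.\<close>

definition pullback :: "model \<Rightarrow> (point \<Rightarrow> point) \<Rightarrow> point \<Rightarrow> ratfun \<Rightarrow> ratfun \<Rightarrow> bool" where
  "pullback X f P h k \<longleftrightarrow>
     (\<exists>U. openin (zariski X) U \<and> P \<in> U \<and>
          (\<forall>Q\<in>U. h \<in> f Q \<and> k \<in> Q \<and> val Q k = val (f Q) h))"

text \<open>
  Etale morphisms of smooth complex varieties: the differential is an isomorphism of Zariski
  tangent spaces at every point, equivalently its transpose
  $\mathfrak m_{f(P)}/\mathfrak m_{f(P)}^2 \to \mathfrak m_P/\mathfrak m_P^2$ is bijective.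
  The two conjuncts express injectivity and surjectivity of this linear map.
\<close>

definition etale :: "model \<Rightarrow> model \<Rightarrow> (point \<Rightarrow> point) \<Rightarrow> bool" where
  "etale X Y f \<longleftrightarrow> morphism X Y f \<and>
     (\<forall>P\<in>X.
        (\<forall>h\<in>max_ideal (f P). \<forall>k\<in>max_ideal_sq P. pullback X f P h k \<longrightarrow> h \<in> max_ideal_sq (f P)) \<and>
        (\<forall>k\<in>max_ideal P. \<exists>h\<in>max_ideal (f P). \<exists>k'. pullback X f P h k' \<and> k - k' \<in> max_ideal_sq P))"

text \<open>The embedding of function fields given by a dominant morphism.\<close>

definition comorphism :: "model \<Rightarrow> (point \<Rightarrow> point) \<Rightarrow> (ratfun \<Rightarrow> ratfun) \<Rightarrow> bool" where
  "comorphism X f \<phi> \<longleftrightarrow>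
     (\<forall>g h. \<phi> (g + h) = \<phi> g + \<phi> h) \<and> (\<forall>g h. \<phi> (g * h) = \<phi> g * \<phi> h) \<and>
     (\<forall>c. \<phi> (const c) = const c) \<and>
     (\<forall>P\<in>X. \<forall>h\<in>f P. \<phi> h \<in> P \<and> val P (\<phi> h) = val (f P) h)"

text \<open>
  The degree is the dimension of $K$ over its subfield $\varphi(K)$; \<open>vector_space.dim\<close> of an
  infinite-dimensional space is 0, which is excluded.
\<close>

definition has_degree :: "model \<Rightarrow> (point \<Rightarrow> point) \<Rightarrow> nat \<Rightarrow> bool" where
  "has_degree X f n \<longleftrightarrow> n > 0 \<and>
     (\<exists>\<phi>. comorphism X f \<phi> \<and> vector_space.dim (\<lambda>a h. \<phi> a * h) UNIV = n)"

section \<open>Miyanishi's surface\<close>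

definition dot :: "complex ^ 3 \<Rightarrow> complex ^ 3 \<Rightarrow> complex" where
  "dot l a = (\<Sum>i\<in>UNIV. l $ i * a $ i)"

definition line :: "complex ^ 3 \<Rightarrow> model" where
  "line l = {pt a | a. a \<noteq> 0 \<and> dot l a = 0}"

definition join :: "complex ^ 3 \<Rightarrow> complex ^ 3 \<Rightarrow> model" where
  "join a b = {pt (\<alpha> *s a + \<beta> *s b) | \<alpha> \<beta>. \<alpha> *s a + \<beta> *s b \<noteq> 0}"

text \<open>
  \<open>conic_mat\<close> is the Gram matrix of the conic; \<open>pp\<close>, \<open>pm\<close>, \<open>pinf\<close> and \<open>qq\<close> are homogeneous coordinates
  of $p_1$, $p_{-1}$, $p_\infty$ and $q$. The centres of the second and third blowup are
  \<open>pp2\<close>, \<open>pp3\<close> over $p_1$ and \<open>pm2\<close>, \<open>pm3\<close> over $p_{-1}$.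
\<close>

record datum =
  conic_mat :: "complex ^ 3 ^ 3"
  pp :: "complex ^ 3"
  pm :: "complex ^ 3"
  pinf :: "complex ^ 3"
  qq :: "complex ^ 3"
  pp2 :: point
  pp3 :: point
  pm2 :: point
  pm3 :: point

definition conic :: "datum \<Rightarrow> model" where
  "conic d = {pt a | a. a \<noteq> 0 \<and> dot a (conic_mat d *v a) = 0}"

definition F_plus :: "datum \<Rightarrow> model" where
  "F_plus d = line (conic_mat d *v pp d)"

definition F_minus :: "datum \<Rightarrow> model" where
  "F_minus d = line (conic_mat d *v pm d)"

definition F_inf :: "datum \<Rightarrow> model" where
  "F_inf d = join (pinf d) (qq d)"

definition centres :: "datum \<Rightarrow> point list" where
  "centres d = [pt (qq d), pt (pp d), pp2 d, pp3 d, pt (pm d), pm2 d, pm3 d]"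

definition miyanishi_datum :: "datum \<Rightarrow> bool" where
  "miyanishi_datum d \<longleftrightarrow>
     transpose (conic_mat d) = conic_mat d \<and> det (conic_mat d) \<noteq> 0 \<and>
     pp d \<noteq> 0 \<and> pm d \<noteq> 0 \<and> pinf d \<noteq> 0 \<and> qq d \<noteq> 0 \<and>
     {pt (pp d), pt (pm d), pt (pinf d)} \<subseteq> conic d \<and>
     distinct [pt (pp d), pt (pm d), pt (pinf d)] \<and>
     F_plus d \<inter> F_minus d = {pt (qq d)} \<and>
     pp2 d \<in> exc (pt (pp d)) \<inter> proper_transform proj_plane (take 2 (centres d)) (conic d) \<and>
     pp3 d \<in> exc (pp2 d) \<inter> proper_transform proj_plane (take 3 (centres d)) (conic d) \<and>
     pm2 d \<in> exc (pt (pm d)) \<inter> proper_transform proj_plane (take 5 (centres d)) (conic d) \<and>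
     pm3 d \<in> exc (pm2 d) \<inter> proper_transform proj_plane (take 6 (centres d)) (conic d)"

definition S_bar :: "datum \<Rightarrow> model" where
  "S_bar d = blowups proj_plane (centres d)"

definition E_plus :: "datum \<Rightarrow> model" where
  "E_plus d = exc (pp3 d)"

definition E_minus :: "datum \<Rightarrow> model" where
  "E_minus d = exc (pm3 d)"

definition total_transform :: "datum \<Rightarrow> model" where
  "total_transform d =
     {R \<in> S_bar d. \<exists>P \<in> F_plus d \<union> F_inf d \<union> F_minus d. dominates R P}"

text \<open>
  Subtracting the components $E_1, E_{-1}$ from a reduced divisor leaves the union of the other
  components, which is the closure of the complement of $E_1 \cup E_{-1}$ in the divisor.
\<close>

definition bdry :: "datum \<Rightarrow> model" where
  "bdry d = zariski (S_bar d) closure_of (total_transform d - (E_plus d \<union> E_minus d))"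

definition surf :: "datum \<Rightarrow> model" where
  "surf d = S_bar d - bdry d"

subsection \<open>The fibration\<close>

definition lin :: "complex ^ 3 \<Rightarrow> ratfun" where
  "lin l = (\<Sum>i\<in>UNIV. const (l $ i) * hcoord $ i)"

text \<open>
  The coordinate on the pencil of lines through $q$ which is $1$, $-1$, $\infty$ on
  $F_1$, $F_{-1}$, $F_\infty$. The fibration $\rho$ is $R \mapsto$ \<open>val R x\<close>.
\<close>

definition pencil_coord :: "datum \<Rightarrow> ratfun \<Rightarrow> bool" where
  "pencil_coord d x \<longleftrightarrow>
     (\<exists>l m. x = lin l / lin m \<and>
            F_inf d = line m \<and> F_plus d = line (l - m) \<and> F_minus d = line (l + m))"

definition rho :: "ratfun \<Rightarrow> point \<Rightarrow> complex" where
  "rho x R = val R x"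

definition respects_rho :: "datum \<Rightarrow> ratfun \<Rightarrow> (point \<Rightarrow> point) \<Rightarrow> bool" where
  "respects_rho d x f \<longleftrightarrow> (\<exists>r::complex poly. \<forall>R\<in>surf d. rho x (f R) = poly r (rho x R))"

definition Et :: "datum \<Rightarrow> ratfun \<Rightarrow> (point \<Rightarrow> point) set" where
  "Et d x = {f. etale (surf d) (surf d) f \<and> respects_rho d x f}"

subsection \<open>The contraction\<close>

text \<open>
  The degenerate fibre of \<open>S_bar d\<close> over $x = \pm 1$ has the last exceptional curve as its only
  $(-1)$-curve. Contracting it makes the second exceptional curve a $(-1)$-curve, and
  contracting that one makes the first exceptional curve a $(-1)$-curve. So the contraction
  that keeps the proper transforms of $F_{\pm 1}$ undoes the blowups over $p_{\pm 1}$
  and ends in the blowup of the projective plane at $q$, whose section is \<open>exc (pt (qq d))\<close>.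
\<close>

definition ruled_surface :: "datum \<Rightarrow> model" where
  "ruled_surface d = blowups proj_plane [pt (qq d)]"

definition base_plane :: "datum \<Rightarrow> model" where
  "base_plane d = ruled_surface d -
     (exc (pt (qq d)) \<union> proper_transform proj_plane [pt (qq d)] (F_inf d))"

definition sigma_map :: "datum \<Rightarrow> point \<Rightarrow> point" where
  "sigma_map d R = (THE Q. Q \<in> base_plane d \<and> dominates R Q)"

text \<open>
  The points of \<open>surf d\<close> over $x = \pm 1$ are contracted to $p_{\pm 1}$.
  The coordinate $y$ is determined up to $y \mapsto \alpha y + (x^2 - 1) r(x)$ with
  $\alpha \neq 0$, which divides the value of $(x^2 - 1)/y^2$ at the centres of the last
  blowups by $\alpha^2$; so $y$ can be rescaled to make this value equal to $1$.
\<close>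

definition fibre_coord :: "datum \<Rightarrow> ratfun \<Rightarrow> ratfun \<Rightarrow> bool" where
  "fibre_coord d x y \<longleftrightarrow>
     base_plane d = affine_plane x y \<and>
     pt (pp d) = plane_pt x y 1 0 \<and> pt (pm d) = plane_pt x y (- 1) 0"

definition normalized :: "datum \<Rightarrow> ratfun \<Rightarrow> ratfun \<Rightarrow> bool" where
  "normalized d x y \<longleftrightarrow>
     has_value (pp3 d) ((x\<^sup>2 - 1) / y\<^sup>2) 1 \<and> has_value (pm3 d) ((x\<^sup>2 - 1) / y\<^sup>2) 1"

definition eta0 :: "ratfun \<Rightarrow> ratfun \<Rightarrow> nat \<Rightarrow> complex poly \<Rightarrow> point \<Rightarrow> point" where
  "eta0 x y n b Q =
     (let a = val Q x; c = val Q y; u = poly (cheb_U (n - 1)) a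
      in plane_pt x y (poly (cheb_T n) a) (1 / of_nat n * u\<^sup>2 * c + (a\<^sup>2 - 1) * u * poly b a))"

end

theory Submission
  imports Defs "HOL-Computational_Algebra.Field_as_Ring"
begin

text \<open>
  Put \<open>w = x\<^sup>2 - 1\<close>. The pencil coordinate \<open>x\<close> and a suitably scaled equation \<open>y\<close> of the chord through
  $p_1$ and $p_{-1}$ are affine coordinates on the complement of $F_\infty$ in which the conic is
  \<open>w = y\<^sup>2\<close>, the lines $F_{\pm 1}$ are \<open>x = \<plusminus>1\<close> and $p_{\pm 1} = (\pm 1, 0)$ (\<open>adapted_exists\<close>).
  The three blowups over $(\pm 1, 0)$ adjoin successively the functions \<open>w / y\<close>, \<open>w / y\<^sup>2\<close> and
  \<open>z = (w / y\<^sup>2 - 1) / y\<close>: the proper transform of the conic passes through the points \<open>w / y = 0\<close> and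
  \<open>w / y\<^sup>2 = 1\<close> (\<open>near_point1\<close>, \<open>near_point2\<close>). Hence the surface consists of the points of the
  plane with \<open>x \<noteq> \<plusminus>1\<close> and of two affine lines with coordinate \<open>z\<close>, near which \<open>y\<close> and \<open>z\<close> are
  local parameters and \<open>w = y\<^sup>2 (1 + y z)\<close> (\<open>surf_eq\<close>).

  Write \<open>T\<close> and \<open>U\<close> for $T_n$ and $U_{n-1}$; they satisfy \<open>T\<^sup>2 - 1 = w U\<^sup>2\<close> and \<open>T' = n U\<close>. The
  endomorphism is induced by the field homomorphism \<open>\<phi>\<close> with \<open>\<phi> x = T\<close> and \<open>\<phi> y = U V\<close>, where
  \<open>V = U y / n + w b\<close>. Since \<open>\<phi> w = w U\<^sup>2\<close>, one finds \<open>\<phi> z = (w - V\<^sup>2) / (U V\<^sup>3)\<close>, and there are three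
  kinds of points.

    \<^item> Where \<open>T \<noteq> \<plusminus>1\<close>, the functions \<open>\<phi> x\<close>, \<open>\<phi> y\<close> are local parameters up to constants, because the
      Jacobian determinant is \<open>U\<^sup>3\<close> (\<open>params_open\<close>).

    \<^item> At a zero \<open>a \<noteq> \<plusminus>1\<close> of \<open>U\<close>, the point is sent to one of the two affine lines. The condition on
      \<open>b\<close> says that \<open>w b\<^sup>2 = 1\<close> there. So \<open>w - V\<^sup>2\<close> vanishes along with the simple zero of \<open>U\<close>, the
      function \<open>\<phi> z\<close> is regular, and modulo \<open>x - a\<close> it is affine in \<open>y\<close> with nonzero slope, whereas
      \<open>\<phi> y\<close> is a unit times \<open>x - a\<close> (\<open>params_root\<close>).

    \<^item> On the affine lines over \<open>x = \<plusminus>1\<close>, where \<open>U\<^sup>2 = n\<^sup>2\<close>, the function \<open>\<phi> y\<close> is a unit times \<open>y\<close>,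
      and modulo \<open>y\<close> the function \<open>\<phi> z\<close> is affine in \<open>z\<close> with slope \<open>1 / n\<close> (\<open>params_special\<close>).

  In each case \<open>\<phi>\<close> maps local parameters at the image point to local parameters, which makes the
  map etale (\<open>local_endo.etale\<close>). Its degree is \<open>n\<close>, because the powers \<open>x\<^sup>i\<close> with \<open>i < n\<close> form a
  basis of the function field over the image of \<open>\<phi>\<close> (\<open>degree_eta\<close>).

  Any other normalized coordinate is \<open>\<plusminus>y + w r(x)\<close> (\<open>normalized_coordinate\<close>), and replacing \<open>y\<close> by it
  changes \<open>b\<close>, at the zeros of \<open>U\<close> only by a sign; this reduces the theorem to the coordinate \<open>y\<close>
  (\<open>lift_of_eta0\<close>).
\<close>

section \<open>Evaluation of polynomials\<close>

text \<open>
  A predicate on functions, so that it also covers the evaluations of polynomials with polynomial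
  coefficients, which arise by iterating \<open>hev\<close> below.
\<close>

definition rhom :: "('a::comm_ring_1 \<Rightarrow> 'b::comm_ring_1) \<Rightarrow> bool" where
  "rhom f \<longleftrightarrow> f 1 = 1 \<and> (\<forall>a b. f (a + b) = f a + f b) \<and>
     (\<forall>a b. f (a * b) = f a * f b)"

lemma rhom_1: "rhom f \<Longrightarrow> f 1 = 1"
  and rhom_add: "rhom f \<Longrightarrow> f (a + b) = f a + f b"
  and rhom_mult: "rhom f \<Longrightarrow> f (a * b) = f a * f b"
  by (auto simp: rhom_def)

lemma rhom_0: "rhom f \<Longrightarrow> f 0 = 0"
  using rhom_add[of f 0 0] by simp

lemma rhom_minus: "rhom f \<Longrightarrow> f (- a) = - f a"
  by (rule minus_unique[symmetric]) (simp add: rhom_0 flip: rhom_add)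

lemma rhom_diff: "rhom f \<Longrightarrow> f (a - b) = f a - f b"
  using rhom_add[of f a "- b"] by (simp add: rhom_minus)

lemma rhom_power: "rhom f \<Longrightarrow> f (a ^ n) = f a ^ n"
  by (induction n) (simp_all add: rhom_1 rhom_mult)

lemma rhom_sum: "rhom f \<Longrightarrow> f (sum g A) = (\<Sum>i\<in>A. f (g i))"
  by (induction A rule: infinite_finite_induct) (simp_all add: rhom_0 rhom_add)

lemmas rhom_simps = rhom_0 rhom_1 rhom_add rhom_mult rhom_minus rhom_diff rhom_power rhom_sum

lemma rhom_inverse:
  fixes f :: "'a::field \<Rightarrow> 'b::field"
  assumes "rhom f"
  shows "f (inverse a) = inverse (f a)"
proof (cases "a = 0")
  case False
  then have "f a * f (inverse a) = 1"
    by (metis assms rhom_1 rhom_mult right_inverse)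
  then show ?thesis by (metis inverse_unique)
qed (use assms in \<open>simp add: rhom_0\<close>)

lemma rhom_divide:
  fixes f :: "'a::field \<Rightarrow> 'b::field"
  shows "rhom f \<Longrightarrow> f (a / b) = f a / f b"
  by (simp add: divide_inverse rhom_mult rhom_inverse)

lemma rhom_field_eq_0_iff:
  fixes f :: "'a::field \<Rightarrow> 'b::field"
  assumes "rhom f"
  shows "f a = 0 \<longleftrightarrow> a = 0"
proof
  assume "f a = 0"
  then show "a = 0"
    using rhom_mult[OF assms, of a "inverse a"] rhom_1[OF assms] by (cases "a = 0") auto
qed (use assms in \<open>simp add: rhom_0\<close>)

text \<open>
  The extension of a coefficient homomorphism to polynomials that sends the variable to \<open>w\<close>. Evaluation
  of $\mathbf{C}[X][Y]$ at a pair is obtained by using it twice: for rational functions in \<open>ev\<close>, for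
  complex numbers in \<open>pv\<close>.
\<close>

definition hev :: "('a::comm_ring_1 \<Rightarrow> 'b::comm_ring_1) \<Rightarrow> 'b \<Rightarrow> 'a poly \<Rightarrow> 'b" where
  "hev f w p = poly (map_poly f p) w"

lemma hev_0 [simp]: "hev f w 0 = 0"
  by (simp add: hev_def)

lemma hev_pCons: "rhom f \<Longrightarrow> hev f w (pCons a p) = f a + w * hev f w p"
  by (simp add: hev_def map_poly_pCons rhom_0)

lemma hev_const: "rhom f \<Longrightarrow> hev f w [:a:] = f a"
  by (simp add: hev_pCons)

lemma hev_add: "rhom f \<Longrightarrow> hev f w (p + q) = hev f w p + hev f w q"
proof (induction p arbitrary: q)
  case (pCons a p)
  show ?case
    by (cases q) (use pCons in \<open>simp add: hev_pCons rhom_add algebra_simps\<close>)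
qed simp

lemma hev_smult: "rhom f \<Longrightarrow> hev f w (smult a p) = f a * hev f w p"
  by (induction p) (simp_all add: hev_pCons rhom_mult algebra_simps)

lemma rhom_hev: assumes "rhom f" shows "rhom (hev f w)"
proof -
  have "hev f w (p * q) = hev f w p * hev f w q" for p q
    using assms by (induction p) (simp_all add: hev_add hev_smult hev_pCons rhom_0 algebra_simps)
  then show ?thesis
    using assms by (simp add: rhom_def hev_add) (metis assms hev_const one_pCons rhom_1)
qed

lemma rhom_id: "rhom (\<lambda>a. a)"
  by (simp add: rhom_def)

lemma rhom_poly: "rhom (\<lambda>p. poly p a)"
  by (simp add: rhom_def)

lemma rhom_const: "rhom const"
proof -
  have "to_fract [:[:1 :: complex:]:] = 1" by (metis one_pCons to_fract_1)
  then show ?thesis by (simp add: rhom_def const_def flip: to_fract_add to_fract_mult)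
qed

lemma const_0 [simp]: "const 0 = 0" and const_1 [simp]: "const 1 = 1"
  and const_add: "const (a + b) = const a + const b"
  and const_mult: "const (a * b) = const a * const b"
  and const_minus: "const (- a) = - const a"
  and const_diff: "const (a - b) = const a - const b"
  and const_inverse: "const (inverse a) = inverse (const a)"
  and const_power: "const (a ^ n) = const a ^ n"
  using rhom_const by (auto simp: rhom_simps rhom_inverse)

lemma const_eq_0_iff [simp]: "const a = 0 \<longleftrightarrow> a = 0"
  by (rule rhom_field_eq_0_iff[OF rhom_const])

definition ev :: "ratfun \<Rightarrow> ratfun \<Rightarrow> complex poly poly \<Rightarrow> ratfun" where
  "ev x y = hev (hev const x) y"

definition pv :: "complex \<Rightarrow> complex \<Rightarrow> complex poly poly \<Rightarrow> complex" where
  "pv a c = hev (\<lambda>q. poly q a) c"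

lemma rhom_px: "rhom (hev const x)"
  by (rule rhom_hev[OF rhom_const])

lemma rhom_ev: "rhom (ev x y)"
  unfolding ev_def by (rule rhom_hev[OF rhom_px])

lemma rhom_pv: "rhom (pv a c)"
  unfolding pv_def by (rule rhom_hev[OF rhom_poly])

lemma ev_pCons: "ev x y (pCons q p) = hev const x q + y * ev x y p"
  by (simp add: ev_def hev_pCons[OF rhom_px])

lemma px_pCons: "hev const x (pCons c q) = const c + x * hev const x q"
  by (rule hev_pCons[OF rhom_const])

lemma pv_pCons: "pv a c (pCons q p) = poly q a + c * pv a c p"
  by (simp add: pv_def hev_pCons[OF rhom_poly])

lemma pv_0 [simp]: "pv a c 0 = 0" and ev_0 [simp]: "ev x y 0 = 0"
  by (simp_all add: pv_def ev_def)

lemma pv_altdef: "pv a c p = poly (poly p [:c:]) a"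
  by (induction p) (simp_all add: pv_pCons)

lemma pv_eq_0_imp:
  assumes "\<And>a c. pv a c p = 0" shows "p = 0"
proof -
  have "poly (map_poly (\<lambda>q. poly q a) p) c = 0" for a c
    using assms[of a c] by (simp add: pv_def hev_def)
  then have "map_poly (\<lambda>q. poly q a) p = 0" for a
    by (metis poly_all_0_iff_0)
  then have "poly (coeff p i) a = 0" for a i
    by (metis coeff_0 coeff_map_poly poly_0)
  then show ?thesis
    by (metis leading_coeff_0_iff poly_all_0_iff_0)
qed

text \<open>
  Algebraic independence over the complex numbers.
\<close>

definition indep :: "ratfun \<Rightarrow> ratfun \<Rightarrow> bool" where
  "indep x y \<longleftrightarrow> (\<forall>p. ev x y p = 0 \<longrightarrow> p = 0)"

section \<open>Local rings of closed points\<close>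

text \<open>
  The properties of a local ring with residue field $\mathbf{C}$ that do not refer to generators of its
  maximal ideal. The evaluation \<open>\<epsilon>\<close> is unique: it is \<open>val P\<close>.
\<close>

definition closed_point :: "point \<Rightarrow> bool" where
  "closed_point P \<longleftrightarrow> range const \<subseteq> P \<and> (\<forall>a\<in>P. \<forall>b\<in>P. a + b \<in> P \<and> a * b \<in> P) \<and>
     (\<exists>\<epsilon>. (\<forall>c. \<epsilon> (const c) = c) \<and> (\<forall>a\<in>P. \<forall>b\<in>P. \<epsilon> (a + b) = \<epsilon> a + \<epsilon> b \<and> \<epsilon> (a * b) = \<epsilon> a * \<epsilon> b) \<and>
          (\<forall>a\<in>P. \<epsilon> a \<noteq> 0 \<longrightarrow> inverse a \<in> P))"

text \<open>
  An element and its inverse cannot both have value zero, so the nonunits are exactly the elements of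
  value zero.
\<close>

lemma closed_pointI:
  assumes const: "\<And>c. const c \<in> P"
    and add: "\<And>a b. a \<in> P \<Longrightarrow> b \<in> P \<Longrightarrow> a + b \<in> P" and mult: "\<And>a b. a \<in> P \<Longrightarrow> b \<in> P \<Longrightarrow> a * b \<in> P"
    and ec: "\<And>c. \<epsilon> (const c) = c"
    and ea: "\<And>a b. a \<in> P \<Longrightarrow> b \<in> P \<Longrightarrow> \<epsilon> (a + b) = \<epsilon> a + \<epsilon> b"
    and em: "\<And>a b. a \<in> P \<Longrightarrow> b \<in> P \<Longrightarrow> \<epsilon> (a * b) = \<epsilon> a * \<epsilon> b"
    and inv: "\<And>a. a \<in> P \<Longrightarrow> \<epsilon> a \<noteq> 0 \<Longrightarrow> inverse a \<in> P"
  shows "closed_point P" and "h \<in> P \<Longrightarrow> val P h = \<epsilon> h"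
proof -
  show "closed_point P"
    unfolding closed_point_def using assms by (intro conjI exI[of _ \<epsilon>]) auto
  have e0: "\<epsilon> 0 = 0" and e1: "\<epsilon> 1 = 1" using ec[of 0] ec[of 1] by auto
  have max: "h \<in> max_ideal P \<longleftrightarrow> h \<in> P \<and> \<epsilon> h = 0" for h
  proof -
    have "\<epsilon> h \<noteq> 0" if "h \<in> P" "h \<noteq> 0" "inverse h \<in> P"
      using em[of h "inverse h"] that e1 by auto
    then show ?thesis using e0 inv by (auto simp: max_ideal_def)
  qed
  show "val P h = \<epsilon> h" if "h \<in> P"
  proof -
    have eq: "\<epsilon> (h - const c) = \<epsilon> h - c" for c
      using ea[of h "const (- c)"] that const[of "- c"] ec[of "- c"] by (simp add: const_minus)
    have "h - const c \<in> P" for c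
      using add[of h "const (- c)"] that const[of "- c"] by (simp add: const_minus)
    then have "has_value P h c \<longleftrightarrow> c = \<epsilon> h" for c
      by (auto simp: has_value_def max eq)
    then show ?thesis by (simp add: val_def)
  qed
qed

lemma closed_point_val:
  assumes "closed_point P"
  shows "val P (const c) = c"
    and "a \<in> P \<Longrightarrow> b \<in> P \<Longrightarrow> val P (a + b) = val P a + val P b"
    and "a \<in> P \<Longrightarrow> b \<in> P \<Longrightarrow> val P (a * b) = val P a * val P b"
    and "a \<in> P \<Longrightarrow> val P a \<noteq> 0 \<Longrightarrow> inverse a \<in> P"
    and "const c \<in> P"
    and "a \<in> P \<Longrightarrow> b \<in> P \<Longrightarrow> a + b \<in> P"
    and "a \<in> P \<Longrightarrow> b \<in> P \<Longrightarrow> a * b \<in> P"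
proof -
  have c: "const c \<in> P" for c using assms by (auto simp: closed_point_def)
  have am: "a + b \<in> P \<and> a * b \<in> P" if "a \<in> P" "b \<in> P" for a b
    using assms that by (simp add: closed_point_def)
  obtain \<epsilon> where \<epsilon>': "(\<forall>c. \<epsilon> (const c) = c) \<and>
      (\<forall>a\<in>P. \<forall>b\<in>P. \<epsilon> (a + b) = \<epsilon> a + \<epsilon> b \<and> \<epsilon> (a * b) = \<epsilon> a * \<epsilon> b) \<and>
      (\<forall>a\<in>P. \<epsilon> a \<noteq> 0 \<longrightarrow> inverse a \<in> P)"
    using assms[unfolded closed_point_def] by (elim conjE exE) (rule that, simp)
  then have \<epsilon>: "\<epsilon> (const c) = c" "a \<in> P \<Longrightarrow> b \<in> P \<Longrightarrow> \<epsilon> (a + b) = \<epsilon> a + \<epsilon> b \<and> \<epsilon> (a * b) = \<epsilon> a * \<epsilon> b"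
      "a \<in> P \<Longrightarrow> \<epsilon> a \<noteq> 0 \<Longrightarrow> inverse a \<in> P" for a b c
    by simp_all
  have v: "h \<in> P \<Longrightarrow> val P h = \<epsilon> h" for h
    using closed_pointI(2)[of P \<epsilon> h] c am \<epsilon> by blast
  show "val P (const c) = c" using v c \<epsilon> by simp
  show "a \<in> P \<Longrightarrow> b \<in> P \<Longrightarrow> val P (a + b) = val P a + val P b" using v am \<epsilon> by simp
  show "a \<in> P \<Longrightarrow> b \<in> P \<Longrightarrow> val P (a * b) = val P a * val P b" using v am \<epsilon> by simp
  show "a \<in> P \<Longrightarrow> val P a \<noteq> 0 \<Longrightarrow> inverse a \<in> P" using v \<epsilon> by simp
  show "const c \<in> P" by (rule c)
  show "a \<in> P \<Longrightarrow> b \<in> P \<Longrightarrow> a + b \<in> P" "a \<in> P \<Longrightarrow> b \<in> P \<Longrightarrow> a * b \<in> P" using am by auto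
qed

lemma cp_more:
  assumes P: "closed_point P"
  shows cp_0: "0 \<in> P" and cp_1: "1 \<in> P" and val_0: "val P 0 = 0" and val_1: "val P 1 = 1"
    and cp_minus: "a \<in> P \<Longrightarrow> - a \<in> P" and val_minus: "a \<in> P \<Longrightarrow> val P (- a) = - val P a"
    and cp_diff: "a \<in> P \<Longrightarrow> b \<in> P \<Longrightarrow> a - b \<in> P"
    and val_diff: "a \<in> P \<Longrightarrow> b \<in> P \<Longrightarrow> val P (a - b) = val P a - val P b"
    and cp_power: "a \<in> P \<Longrightarrow> a ^ n \<in> P" and val_power: "a \<in> P \<Longrightarrow> val P (a ^ n) = val P a ^ n"
    and val_inverse: "a \<in> P \<Longrightarrow> val P a \<noteq> 0 \<Longrightarrow> val P (inverse a) = inverse (val P a)"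
    and cp_divide: "a \<in> P \<Longrightarrow> b \<in> P \<Longrightarrow> val P b \<noteq> 0 \<Longrightarrow> a / b \<in> P"
    and val_divide: "a \<in> P \<Longrightarrow> b \<in> P \<Longrightarrow> val P b \<noteq> 0 \<Longrightarrow> val P (a / b) = val P a / val P b"
proof -
  note V = closed_point_val[OF P]
  show 0: "0 \<in> P" "1 \<in> P" "val P 0 = 0" "val P 1 = 1"
    using V(5)[of 0] V(5)[of 1] V(1)[of 0] V(1)[of 1] by simp_all
  show m: "- a \<in> P" "val P (- a) = - val P a" if "a \<in> P" for a
    using V(7)[OF V(5)[of "-1"] that] V(3)[OF V(5)[of "-1"] that] V(1)[of "-1"]
    by (simp_all add: const_minus)
  show "a - b \<in> P" "val P (a - b) = val P a - val P b" if "a \<in> P" "b \<in> P" for a b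
    using V(6)[OF that(1) m(1)[OF that(2)]] V(2)[OF that(1) m(1)[OF that(2)]] m(2)[OF that(2)] by simp_all
  show pw: "a ^ n \<in> P" if "a \<in> P" for a n
    by (induction n) (simp_all add: 0 V(7)[OF that])
  show "val P (a ^ n) = val P a ^ n" if "a \<in> P" for a
    by (induction n) (simp_all add: 0 V(3) pw that)
  show vi: "val P (inverse a) = inverse (val P a)" if "a \<in> P" "val P a \<noteq> 0" for a
  proof -
    have "a \<noteq> 0" using that 0 by auto
    then have "val P a * val P (inverse a) = 1"
      using V(3)[OF that(1) V(4)[OF that]] 0 by simp
    then show ?thesis by (metis inverse_unique)
  qed
  show "a / b \<in> P" "val P (a / b) = val P a / val P b" if "a \<in> P" "b \<in> P" "val P b \<noteq> 0" for a b
    using V(7)[OF that(1) V(4)[OF that(2,3)]] V(3)[OF that(1) V(4)[OF that(2,3)]] vi[OF that(2,3)]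
    by (simp_all add: divide_inverse)
qed

lemmas cp_const = closed_point_val(5) and cp_add = closed_point_val(6) and cp_mult = closed_point_val(7)
  and cp_inverse = closed_point_val(4)
lemmas val_const = closed_point_val(1) and val_add = closed_point_val(2) and val_mult = closed_point_val(3)

lemmas cp_simps = cp_0 cp_1 cp_const cp_add cp_mult cp_minus cp_diff cp_power cp_inverse cp_divide
  val_0 val_1 val_const val_add val_mult val_minus val_diff val_power val_inverse val_divide

lemma cp_sum: "closed_point P \<Longrightarrow> (\<And>i. i \<in> A \<Longrightarrow> f i \<in> P) \<Longrightarrow> sum f A \<in> P"
  by (induction A rule: infinite_finite_induct) (simp_all add: cp_simps)

lemma val_sum:
  assumes "closed_point P" and "\<And>i. i \<in> A \<Longrightarrow> f i \<in> P"
  shows "val P (sum f A) = (\<Sum>i\<in>A. val P (f i))"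
  using assms(2) by (induction A rule: infinite_finite_induct) (simp_all add: assms(1) cp_simps cp_sum)

lemma max_ideal_iff:
  assumes "closed_point P"
  shows "h \<in> max_ideal P \<longleftrightarrow> h \<in> P \<and> val P h = 0"
proof -
  have "val P h \<noteq> 0" if "h \<in> P" "h \<noteq> 0" "inverse h \<in> P"
    using val_mult[OF assms that(1) that(3)] that assms by (auto simp: val_1)
  then show ?thesis
    using cp_inverse[OF assms, of h] val_0[OF assms] cp_0[OF assms] by (auto simp: max_ideal_def)
qed

lemma has_value_iff:
  assumes "closed_point P"
  shows "has_value P h c \<longleftrightarrow> h \<in> P \<and> val P h = c"
proof -
  have "h \<in> P" if "h - const c \<in> P"
    using cp_add[OF assms that cp_const[OF assms, of c]] by simp
  then show ?thesis using assms by (auto simp: has_value_def max_ideal_iff cp_simps)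
qed

lemma inverse_notin:
  assumes "closed_point P" "h \<in> P" "val P h = 0" "h \<noteq> 0"
  shows "inverse h \<notin> P"
  using assms max_ideal_iff[OF assms(1), of h] by (auto simp: max_ideal_def)

lemma cp_px:
  assumes "closed_point P" "x \<in> P"
  shows "hev const x q \<in> P" "val P (hev const x q) = poly q (val P x)"
proof -
  have "hev const x q \<in> P \<and> val P (hev const x q) = poly q (val P x)"
    by (induction q) (use assms in \<open>simp_all add: px_pCons cp_simps\<close>)
  then show "hev const x q \<in> P" "val P (hev const x q) = poly q (val P x)" by auto
qed

lemma cp_ev:
  assumes "closed_point P" "x \<in> P" "y \<in> P"
  shows "ev x y p \<in> P" "val P (ev x y p) = pv (val P x) (val P y) p"
proof -
  have "ev x y p \<in> P \<and> val P (ev x y p) = pv (val P x) (val P y) p"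
    by (induction p) (use assms in \<open>simp_all add: ev_pCons pv_pCons cp_simps cp_px\<close>)
  then show "ev x y p \<in> P" "val P (ev x y p) = pv (val P x) (val P y) p" by auto
qed

text \<open>
  A ring of functions together with a complex point of its spectrum.
\<close>

definition eval_on :: "ratfun set \<Rightarrow> (ratfun \<Rightarrow> complex) \<Rightarrow> bool" where
  "eval_on A e \<longleftrightarrow> range const \<subseteq> A \<and> (\<forall>c. e (const c) = c) \<and>
     (\<forall>a\<in>A. \<forall>b\<in>A. a + b \<in> A \<and> a * b \<in> A \<and> e (a + b) = e a + e b \<and> e (a * b) = e a * e b)"

text \<open>
  If \<open>u\<close>, \<open>v\<close> generate the kernel of an evaluation of \<open>A\<close>, then \<open>local_at A u v\<close> is the localization at
  the corresponding maximal ideal. The evaluation extends to quotients by cross multiplication.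
\<close>

lemma local_at_point:
  assumes A: "eval_on A e" and ker: "ideal2 A u v = {h \<in> A. e h = 0}" and uv: "u \<in> A" "v \<in> A"
  defines "P \<equiv> local_at A u v"
  shows "closed_point P" and "\<And>h. h \<in> A \<Longrightarrow> h \<in> P \<and> val P h = e h"
    and "max_ideal P = ideal2 P u v"
    and "\<And>h. h \<in> P \<longleftrightarrow> (\<exists>f\<in>A. \<exists>g\<in>A. e g \<noteq> 0 \<and> h = f / g)"
proof -
  have const: "const c \<in> A" "e (const c) = c" for c using A by (auto simp: eval_on_def)
  have am: "a + b \<in> A" "a * b \<in> A" "e (a + b) = e a + e b" "e (a * b) = e a * e b"
    if "a \<in> A" "b \<in> A" for a b using A that by (auto simp: eval_on_def)
  have e0: "e 0 = 0" and e1: "e 1 = 1" and A1: "1 \<in> A" using const[of 0] const[of 1] by auto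
  show mem: "h \<in> P \<longleftrightarrow> (\<exists>f\<in>A. \<exists>g\<in>A. e g \<noteq> 0 \<and> h = f / g)" for h
    unfolding P_def local_at_def ker by auto
  define \<epsilon> where "\<epsilon> h = (SOME c. \<exists>f\<in>A. \<exists>g\<in>A. e g \<noteq> 0 \<and> h = f / g \<and> c = e f / e g)" for h
  have \<epsilon>: "\<epsilon> (f / g) = e f / e g" if "f \<in> A" "g \<in> A" "e g \<noteq> 0" for f g
  proof -
    have "\<epsilon> (f / g) = c" if c: "c = e f / e g" for c
    proof (unfold \<epsilon>_def, rule some_equality)
      show "\<exists>f'\<in>A. \<exists>g'\<in>A. e g' \<noteq> 0 \<and> f / g = f' / g' \<and> c = e f' / e g'"
        using \<open>f \<in> A\<close> \<open>g \<in> A\<close> \<open>e g \<noteq> 0\<close> c by blast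
    next
      fix c' assume "\<exists>f'\<in>A. \<exists>g'\<in>A. e g' \<noteq> 0 \<and> f / g = f' / g' \<and> c' = e f' / e g'"
      then obtain f' g' where *: "f' \<in> A" "g' \<in> A" "e g' \<noteq> 0" "f / g = f' / g'" "c' = e f' / e g'" by blast
      have "g \<noteq> 0" "g' \<noteq> 0" using * \<open>e g \<noteq> 0\<close> e0 by auto
      then have "f * g' = f' * g" using *(4) by (simp add: frac_eq_eq)
      then have "e f * e g' = e f' * e g" using am * that \<open>f \<in> A\<close> \<open>g \<in> A\<close> by metis
      then have "e f / e g = e f' / e g'" using * \<open>e g \<noteq> 0\<close> by (simp add: frac_eq_eq)
      then show "c' = c" using * c by simp
    qed
    then show ?thesis by blast
  qed
  have cP: "const c \<in> P" "\<epsilon> (const c) = c" for c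
  proof -
    have "\<exists>f\<in>A. \<exists>g\<in>A. e g \<noteq> 0 \<and> const c = f / g"
      using const A1 e1 by (intro bexI[of _ "const c"] bexI[of _ 1]) auto
    then show "const c \<in> P" by (simp add: mem)
    show "\<epsilon> (const c) = c" using \<epsilon>[of "const c" 1] const A1 e1 by simp
  qed
  have ops: "a + b \<in> P \<and> a * b \<in> P \<and> \<epsilon> (a + b) = \<epsilon> a + \<epsilon> b \<and> \<epsilon> (a * b) = \<epsilon> a * \<epsilon> b"
    if ab: "a \<in> P" "b \<in> P" for a b
  proof -
    obtain f g f' g' where *: "f \<in> A" "g \<in> A" "e g \<noteq> 0" "a = f / g" "f' \<in> A" "g' \<in> A" "e g' \<noteq> 0" "b = f' / g'"
      using ab mem by metis
    have "g \<noteq> 0" "g' \<noteq> 0" using * e0 by auto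
    then have s: "a + b = (f * g' + f' * g) / (g * g')" "a * b = (f * f') / (g * g')"
      using * by (simp_all add: add_frac_eq)
    have "\<epsilon> a = e f / e g" "\<epsilon> b = e f' / e g'" using * \<epsilon> by auto
    moreover have gg: "g * g' \<in> A" "e (g * g') \<noteq> 0" "f * g' + f' * g \<in> A" "f * f' \<in> A" using am * by auto
    moreover have "a + b \<in> P" "a * b \<in> P"
      unfolding mem s using gg by blast+
    moreover have "\<epsilon> (a + b) = e (f * g' + f' * g) / e (g * g')" "\<epsilon> (a * b) = e (f * f') / e (g * g')"
      using gg \<epsilon> s by auto
    moreover have "e (f * g' + f' * g) / e (g * g') = e f / e g + e f' / e g'"
      "e (f * f') / e (g * g') = e f / e g * (e f' / e g')"
      using am * by (simp_all add: add_frac_eq)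
    ultimately show ?thesis by simp
  qed
  have inv: "inverse a \<in> P" if a: "a \<in> P" "\<epsilon> a \<noteq> 0" for a
  proof -
    obtain f g where *: "f \<in> A" "g \<in> A" "e g \<noteq> 0" "a = f / g" using a mem by metis
    then have "e f \<noteq> 0" using a \<epsilon> by auto
    then show ?thesis unfolding mem using * by (metis inverse_divide)
  qed
  have cp: "closed_point P" and valP: "h \<in> P \<Longrightarrow> val P h = \<epsilon> h" for h
    using closed_pointI[of P \<epsilon>] cP ops inv by blast+
  show "closed_point P" by (rule cp)
  show *: "h \<in> P \<and> val P h = e h" if "h \<in> A" for h
  proof -
    have "\<exists>f\<in>A. \<exists>g\<in>A. e g \<noteq> 0 \<and> h = f / g"
      using that A1 e1 by (intro bexI[of _ h] bexI[of _ 1]) auto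
    then have "h \<in> P" by (simp add: mem)
    then show ?thesis using \<epsilon>[of h 1] that A1 e1 valP[of h] by simp
  qed
  show "max_ideal P = ideal2 P u v"
  proof (intro equalityI subsetI)
    fix h assume h: "h \<in> max_ideal P"
    then have hP: "h \<in> P" and h0: "val P h = 0" using max_ideal_iff[OF cp] by auto
    obtain f g where fg: "f \<in> A" "g \<in> A" "e g \<noteq> 0" "h = f / g" using hP mem by metis
    have "e f = 0" using h0 valP[OF hP] \<epsilon> fg by simp
    then have "f \<in> ideal2 A u v" using ker fg by simp
    then obtain a b where ab: "a \<in> A" "b \<in> A" "f = a * u + b * v" unfolding ideal2_def by blast
    have "a / g \<in> P" "b / g \<in> P" using mem ab fg by blast+
    moreover have "h = a / g * u + b / g * v" using ab fg by (simp add: add_divide_distrib)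
    ultimately show "h \<in> ideal2 P u v" unfolding ideal2_def by blast
  next
    fix h assume "h \<in> ideal2 P u v"
    then obtain a b where ab: "a \<in> P" "b \<in> P" "h = a * u + b * v" unfolding ideal2_def by blast
    have "u \<in> ideal2 A u v" "v \<in> ideal2 A u v"
      unfolding ideal2_def using A1 const[of 0] by (force intro: exI[of _ 1] exI[of _ 0])+
    then have "u \<in> P" "v \<in> P" "val P u = 0" "val P v = 0" using * uv ker by auto
    then show "h \<in> max_ideal P" using ab cp by (simp add: max_ideal_iff cp_simps)
  qed
qed

section \<open>Regular points and the rings of a blowup\<close>

text \<open>
  A two-dimensional regular local ring with regular parameters \<open>u\<close>, \<open>v\<close>. The last clause says that
  \<open>v\<close> is not a zero divisor modulo \<open>u\<close>, in a form that is symmetric in \<open>u\<close> and \<open>v\<close>.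
\<close>

definition regular_point :: "point \<Rightarrow> ratfun \<Rightarrow> ratfun \<Rightarrow> bool" where
  "regular_point P u v \<longleftrightarrow> closed_point P \<and> max_ideal P = ideal2 P u v \<and> u \<noteq> 0 \<and> v \<noteq> 0 \<and>
     (\<forall>p\<in>P. \<forall>q\<in>P. p * u = q * v \<longrightarrow> (\<exists>r\<in>P. p = r * v \<and> q = r * u))"

text \<open>
  The point with \<open>v / u = l\<close> of the exceptional curve. The remaining point, where \<open>v / u\<close> has a pole,
  is \<open>bl P v u 0\<close>.
\<close>

definition bl :: "point \<Rightarrow> ratfun \<Rightarrow> ratfun \<Rightarrow> complex \<Rightarrow> point" where
  "bl P u v l = local_at (adjoin P (v / u)) u (v / u - const l)"

lemma ideal2_memI: "a \<in> A \<Longrightarrow> b \<in> A \<Longrightarrow> a * u + b * v \<in> ideal2 A u v"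
  unfolding ideal2_def by blast

lemma ideal2_commute: "ideal2 A u v = ideal2 A v u"
proof -
  have "a * u + b * v \<in> ideal2 A v u" if "a \<in> A" "b \<in> A" for a b u v
    using ideal2_memI[of b A a v u] that by (simp add: add.commute)
  then show ?thesis by (auto simp: ideal2_def)
qed

lemma ideal2_gens:
  assumes "closed_point P" shows "u \<in> ideal2 P u v" "v \<in> ideal2 P u v"
  using ideal2_memI[of 1 P 0 u v] ideal2_memI[of 0 P 1 u v] assms by (simp_all add: cp_simps)

lemma regular_point_cp: "regular_point P u v \<Longrightarrow> closed_point P"
  by (simp add: regular_point_def)

lemma regular_point_params:
  assumes "regular_point P u v"
  shows "u \<in> P" "v \<in> P" "val P u = 0" "val P v = 0" "u \<noteq> 0" "v \<noteq> 0"
proof -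
  have cp: "closed_point P" using assms by (rule regular_point_cp)
  show "u \<in> P" "v \<in> P" "val P u = 0" "val P v = 0" 
    using ideal2_gens(1)[OF cp, of u v] ideal2_gens(2)[OF cp, of v u] assms max_ideal_iff[OF cp] by (auto simp: regular_point_def)
  show "u \<noteq> 0" "v \<noteq> 0" using assms by (auto simp: regular_point_def)
qed

lemma regular_point_rel:
  assumes "regular_point P u v" "p \<in> P" "q \<in> P" "p * u = q * v"
  obtains r where "r \<in> P" "p = r * v" "q = r * u"
  using assms unfolding regular_point_def by blast

lemma regular_point_commute: "regular_point P u v \<Longrightarrow> regular_point P v u"
  unfolding regular_point_def by (metis ideal2_commute)

lemma regular_point_max:
  assumes "regular_point P u v" "h \<in> P" "val P h = 0"
  obtains a b where "a \<in> P" "b \<in> P" "h = a * u + b * v"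
  using assms max_ideal_iff[OF regular_point_cp[OF assms(1)], of h]
  unfolding regular_point_def ideal2_def by auto

text \<open>
  The parameters are linearly independent in the cotangent space.
\<close>

lemma regular_point_rel_val:
  assumes "regular_point P u v" "p \<in> P" "q \<in> P" "p * u + q * v = 0"
  shows "val P p = 0" "val P q = 0"
proof -
  have cp: "closed_point P" using assms(1) by (rule regular_point_cp)
  have "p * u = (- q) * v" using assms(4) by (simp add: eq_neg_iff_add_eq_0)
  then obtain r where r: "r \<in> P" "p = r * v" "- q = r * u"
    using regular_point_rel[OF assms(1,2), of "- q"] cp_minus[OF cp assms(3)] by blast
  then have "q = - (r * u)" by (metis minus_minus)
  then show "val P p = 0" "val P q = 0"
    using r regular_point_params[OF assms(1)] cp by (simp_all add: cp_simps)
qed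

lemma regular_point_dvd:
  assumes "regular_point P u v"
  shows "a \<in> P \<Longrightarrow> b \<in> P \<Longrightarrow> a * v ^ k = b * u \<Longrightarrow> \<exists>r\<in>P. a = r * u"
proof (induction k arbitrary: a b)
  case (Suc k)
  have "a * v ^ k \<in> P"
    using Suc.prems regular_point_cp[OF assms] regular_point_params[OF assms] by (simp add: cp_simps)
  moreover have "b * u = (a * v ^ k) * v" using Suc.prems by (simp add: mult_ac)
  ultimately obtain r where "r \<in> P" "b = r * v" "a * v ^ k = r * u"
    using regular_point_rel[OF assms \<open>b \<in> P\<close>] by metis
  then show ?case using Suc by blast
qed auto

text \<open>
  Polynomials with coefficients in the ring of a point; their values at \<open>w\<close> form \<open>adjoin P w\<close>.
\<close>

definition pcoef :: "point \<Rightarrow> ratfun poly set" where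
  "pcoef P = {f. \<forall>i. coeff f i \<in> P}"

lemma poly_sum_upto:
  fixes f :: "'a::comm_ring_1 poly"
  assumes "degree f \<le> n" shows "poly f x = (\<Sum>i\<le>n. coeff f i * x ^ i)"
  unfolding poly_altdef
  by (rule sum.mono_neutral_left) (use assms in \<open>auto simp: coeff_eq_0\<close>)

text \<open>
  The homogeneous form of \<open>f\<close> vanishes at \<open>(u, v)\<close>; hence \<open>u\<close> divides the leading coefficient times a
  power of \<open>v\<close>, and so it divides the leading coefficient itself. Moving this multiple of \<open>u\<close> to the
  next coefficient, by means of \<open>u * (v / u) = v\<close>, lowers the degree.
\<close>

lemma quasi_regular:
  assumes P: "regular_point P u v"
  shows "degree f \<le> n \<Longrightarrow> f \<in> pcoef P \<Longrightarrow> poly f (v / u) = 0 \<Longrightarrow> val P (coeff f i) = 0"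
proof (induction n arbitrary: f i)
  case 0
  then obtain c where "f = [:c:]" by (metis degree_eq_zeroE le_zero_eq)
  then show ?case using 0 regular_point_cp[OF P] by (auto simp: coeff_pCons cp_simps split: nat.splits)
next
  case (Suc n)
  note cp = regular_point_cp[OF P] and uv = regular_point_params[OF P]
  define a where "a = coeff f (Suc n)"
  define b where "b = - (\<Sum>i\<le>n. coeff f i * v ^ i * u ^ (n - i))"
  have fP: "coeff f i \<in> P" for i using Suc.prems by (simp add: pcoef_def)
  have aP: "a \<in> P" using fP by (simp add: a_def)
  have bP: "b \<in> P" unfolding b_def using fP uv cp by (intro cp_simps cp_sum) auto
  have pw: "(v / u) ^ i * u ^ Suc n = v ^ i * u ^ (Suc n - i)" if "i \<le> Suc n" for i
  proof -
    have "u ^ Suc n = u ^ i * u ^ (Suc n - i)" using that by (simp flip: power_add)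
    then show ?thesis using uv by (simp add: power_divide)
  qed
  have "0 = poly f (v / u) * u ^ Suc n" using Suc.prems by simp
  also have "\<dots> = (\<Sum>i\<le>Suc n. coeff f i * ((v / u) ^ i * u ^ Suc n))"
    by (simp only: poly_sum_upto[OF Suc.prems(1)] sum_distrib_right mult.assoc)
  also have "\<dots> = (\<Sum>i\<le>Suc n. coeff f i * (v ^ i * u ^ (Suc n - i)))"
    by (intro sum.cong) (use pw in auto)
  also have "\<dots> = (\<Sum>i\<le>n. coeff f i * (v ^ i * u ^ (Suc n - i))) + a * v ^ Suc n"
    by (simp add: a_def)
  also have "(\<Sum>i\<le>n. coeff f i * (v ^ i * u ^ (Suc n - i))) = - b * u"
    unfolding b_def minus_minus sum_distrib_right
    by (intro sum.cong) (auto simp: Suc_diff_le mult_ac)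
  finally have "a * v ^ Suc n = b * u" by (simp add: algebra_simps)
  then obtain r where r: "r \<in> P" "a = r * u"
    using regular_point_dvd[OF P aP bP] by blast
  define g where "g = f - monom a (Suc n) + monom (r * v) n"
  have "a * (v / u) ^ Suc n = r * v * (v / u) ^ n" using r uv by simp
  then have "poly g (v / u) = 0" using Suc.prems by (simp add: g_def poly_monom)
  moreover have gP: "g \<in> pcoef P"
    unfolding pcoef_def g_def using fP aP r uv cp by (auto simp: cp_simps)
  moreover have "degree g \<le> n"
  proof (rule degree_le, intro allI impI)
    fix j assume "n < j"
    then show "coeff g j = 0"
      using Suc.prems(1) by (cases "j = Suc n") (auto simp: g_def a_def coeff_eq_0)
  qed
  ultimately have IH: "val P (coeff g i) = 0" for i using Suc.IH by blast
  have "coeff f i = coeff g i + coeff (monom a (Suc n)) i - coeff (monom (r * v) n) i"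
    by (simp add: g_def)
  moreover have "coeff (monom a (Suc n)) i \<in> P" "val P (coeff (monom a (Suc n)) i) = 0"
    "coeff (monom (r * v) n) i \<in> P" "val P (coeff (monom (r * v) n) i) = 0"
    using r uv cp by (auto simp: cp_simps)
  ultimately show ?case using IH gP cp by (simp add: cp_simps pcoef_def)
qed

abbreviation vm :: "point \<Rightarrow> ratfun poly \<Rightarrow> complex poly" where
  "vm P \<equiv> map_poly (val P)"

lemma pcoef_ops:
  assumes P: "closed_point P"
  shows "f \<in> pcoef P \<Longrightarrow> g \<in> pcoef P \<Longrightarrow> f + g \<in> pcoef P"
    and "f \<in> pcoef P \<Longrightarrow> g \<in> pcoef P \<Longrightarrow> f - g \<in> pcoef P"
    and "f \<in> pcoef P \<Longrightarrow> g \<in> pcoef P \<Longrightarrow> f * g \<in> pcoef P"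
    and "f \<in> pcoef P \<Longrightarrow> g \<in> pcoef P \<Longrightarrow> vm P (f + g) = vm P f + vm P g"
    and "f \<in> pcoef P \<Longrightarrow> g \<in> pcoef P \<Longrightarrow> vm P (f - g) = vm P f - vm P g"
    and "f \<in> pcoef P \<Longrightarrow> g \<in> pcoef P \<Longrightarrow> vm P (f * g) = vm P f * vm P g"
    and "pCons c f \<in> pcoef P \<longleftrightarrow> c \<in> P \<and> f \<in> pcoef P"
    and "0 \<in> pcoef P"
    and "vm P (pCons c f) = pCons (val P c) (vm P f)"
    and "map_poly const q \<in> pcoef P" and "vm P (map_poly const q) = q"
proof -
  have v0: "val P 0 = 0" using P by (rule val_0)
  show "f \<in> pcoef P \<Longrightarrow> g \<in> pcoef P \<Longrightarrow> f + g \<in> pcoef P"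
    and "f \<in> pcoef P \<Longrightarrow> g \<in> pcoef P \<Longrightarrow> f - g \<in> pcoef P"
    using P by (simp_all add: pcoef_def cp_simps)
  show "f \<in> pcoef P \<Longrightarrow> g \<in> pcoef P \<Longrightarrow> f * g \<in> pcoef P"
    using P by (simp add: pcoef_def coeff_mult cp_sum cp_simps)
  show "f \<in> pcoef P \<Longrightarrow> g \<in> pcoef P \<Longrightarrow> vm P (f + g) = vm P f + vm P g"
    and "f \<in> pcoef P \<Longrightarrow> g \<in> pcoef P \<Longrightarrow> vm P (f - g) = vm P f - vm P g"
    using P by (auto intro!: poly_eqI simp: pcoef_def coeff_map_poly v0 cp_simps)
  show "f \<in> pcoef P \<Longrightarrow> g \<in> pcoef P \<Longrightarrow> vm P (f * g) = vm P f * vm P g"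
    using P by (auto intro!: poly_eqI simp: pcoef_def coeff_map_poly v0 coeff_mult val_sum cp_simps)
  show "pCons c f \<in> pcoef P \<longleftrightarrow> c \<in> P \<and> f \<in> pcoef P"
    by (auto simp: pcoef_def coeff_pCons split: nat.splits)
  show "0 \<in> pcoef P" using P by (simp add: pcoef_def cp_simps)
  show "vm P (pCons c f) = pCons (val P c) (vm P f)"
    using v0 by (simp add: map_poly_pCons)
  show "map_poly const q \<in> pcoef P" using P by (simp add: pcoef_def coeff_map_poly cp_simps)
  show "vm P (map_poly const q) = q"
    using P v0 by (auto intro!: poly_eqI simp: coeff_map_poly cp_simps)
qed

lemma adjoin_pcoef: "adjoin P w = (\<lambda>f. poly f w) ` pcoef P"
  by (auto simp: adjoin_def pcoef_def)

text \<open>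
  Modulo \<open>u\<close>, and hence modulo \<open>v = u * (v / u)\<close>, every coefficient is equal to its residue. So
  \<open>P[v / u]\<close> modulo \<open>u\<close> is generated by \<open>v / u\<close> over the complex numbers.
\<close>

lemma residue_decomp:
  assumes P: "regular_point P u v"
  shows "f \<in> pcoef P \<Longrightarrow> \<exists>a\<in>pcoef P. poly f (v / u) = u * poly a (v / u) + hev const (v / u) (vm P f)"
proof (induction f)
  case 0
  show ?case by (rule bexI[of _ 0]) (use pcoef_ops(8)[OF regular_point_cp[OF P]] in auto)
next
  case (pCons c f)
  note cp = regular_point_cp[OF P] and uv = regular_point_params[OF P]
  have cf: "c \<in> P" "f \<in> pcoef P" using pCons.prems pcoef_ops(7)[OF cp] by auto
  obtain a where a: "a \<in> pcoef P" "poly f (v / u) = u * poly a (v / u) + hev const (v / u) (vm P f)"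
    using pCons.IH cf by blast
  obtain r s where rs: "r \<in> P" "s \<in> P" "c - const (val P c) = r * u + s * v"
    using regular_point_max[OF P, of "c - const (val P c)"] cf cp by (auto simp: cp_simps)
  have "pCons r (a + [:s:]) \<in> pcoef P"
    using a rs pcoef_ops[OF cp] by simp
  moreover have "poly (pCons c f) (v / u) = u * poly (pCons r (a + [:s:])) (v / u) + hev const (v / u) (vm P (pCons c f))"
  proof -
    have c: "c = const (val P c) + r * u + u * (v / u * s)" using rs uv by (simp add: algebra_simps)
    have "poly (pCons c f) (v / u) = c + v / u * poly f (v / u)" by simp
    also have "\<dots> = const (val P c) + r * u + u * (v / u * s)
        + v / u * (u * poly a (v / u) + hev const (v / u) (vm P f))"
      using c a(2) by presburger
    also have "\<dots> = u * (r + v / u * (poly a (v / u) + s))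
        + (const (val P c) + v / u * hev const (v / u) (vm P f))"
      by (simp only: algebra_simps)
    finally show ?thesis by (simp add: pcoef_ops(9)[OF cp] px_pCons)
  qed
  ultimately show ?case by blast
qed

text \<open>
  By \<open>quasi_regular\<close>, \<open>v / u\<close> is transcendental modulo \<open>u\<close>: the exceptional curve is an affine line.
\<close>

lemma residue_zero_of_dvd:
  assumes P: "regular_point P u v" and k: "k \<in> pcoef P" and eq: "hev const (v / u) q = u * poly k (v / u)"
  shows "q = 0"
proof -
  note cp = regular_point_cp[OF P] and uv = regular_point_params[OF P]
  define f where "f = map_poly const q - [:u:] * k"
  have f: "f \<in> pcoef P" unfolding f_def using k uv pcoef_ops[OF cp] by (intro pcoef_ops[OF cp]) auto
  have "poly f (v / u) = 0" using eq by (simp add: f_def hev_def)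
  then have "val P (coeff f i) = 0" for i using quasi_regular[OF P order_refl f] by blast
  moreover have "vm P f = q"
  proof -
    have "[:u:] \<in> pcoef P" using uv pcoef_ops[OF cp] by simp
    then have "vm P f = vm P (map_poly const q) - vm P [:u:] * vm P k"
      unfolding f_def using k pcoef_ops(3,5,6,10)[OF cp] by metis
    then show ?thesis using uv by (simp add: pcoef_ops(9,11)[OF cp])
  qed
  ultimately show "q = 0"
    by (intro poly_eqI) (metis cp coeff_0 coeff_map_poly val_0)
qed

text \<open>
  The ring \<open>P[v / u]\<close> modulo \<open>u\<close> is a polynomial ring in one variable over the complex numbers. This
  makes evaluation at \<open>v / u = l\<close> well defined, with kernel generated by \<open>u\<close> and \<open>v / u - l\<close>, and it
  makes these two elements a regular sequence, as \<open>v / u - l\<close> is not a zero divisor in that polynomial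
  ring.
\<close>

lemma bl_point:
  fixes l :: complex
  assumes P: "regular_point P u v"
  defines "R \<equiv> bl P u v l"
  shows "regular_point R u (v / u - const l)"
    and "\<And>h. h \<in> P \<Longrightarrow> h \<in> R" and "\<And>h. h \<in> P \<Longrightarrow> val R h = val P h"
    and "v / u \<in> R" "val R (v / u) = l"
    and "\<And>h. h \<in> R \<Longrightarrow> \<exists>f\<in>pcoef P. \<exists>g\<in>pcoef P. poly (vm P g) l \<noteq> 0 \<and> h = poly f (v / u) / poly g (v / u)"
proof -
  note cp = regular_point_cp[OF P] and uv = regular_point_params[OF P]
  note pc = pcoef_ops[OF cp]
  define \<tau> where "\<tau> = v / u"
  define A where "A = adjoin P \<tau>"
  define e where "e h = (SOME c. \<exists>f\<in>pcoef P. h = poly f \<tau> \<and> c = poly (vm P f) l)" for h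
  have vm_eq: "vm P f = vm P g" if "f \<in> pcoef P" "g \<in> pcoef P" "poly f \<tau> = poly g \<tau>" for f g
  proof -
    have "val P (coeff (f - g) i) = 0" for i
      using quasi_regular[OF P order_refl pc(2)[OF that(1,2)]] that(3) by (simp add: \<tau>_def)
    then have "vm P (f - g) = 0"
      by (intro poly_eqI) (simp add: coeff_map_poly val_0[OF cp])
    then show ?thesis using pc(5)[OF that(1,2)] by simp
  qed
  have e: "e (poly f \<tau>) = poly (vm P f) l" if f: "f \<in> pcoef P" for f
    unfolding e_def
  proof (rule some_equality)
    show "\<exists>g\<in>pcoef P. poly f \<tau> = poly g \<tau> \<and> poly (vm P f) l = poly (vm P g) l" using f by blast
    fix c assume "\<exists>g\<in>pcoef P. poly f \<tau> = poly g \<tau> \<and> c = poly (vm P g) l"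
    then obtain g where "g \<in> pcoef P" "poly f \<tau> = poly g \<tau>" "c = poly (vm P g) l" by blast
    then show "c = poly (vm P f) l" using vm_eq[OF f] by simp
  qed
  have A_iff: "h \<in> A \<longleftrightarrow> (\<exists>f\<in>pcoef P. h = poly f \<tau>)" for h
    by (auto simp: A_def adjoin_pcoef)
  have polyA: "f \<in> pcoef P \<Longrightarrow> poly f \<tau> \<in> A" for f using A_iff by blast
  have PA: "h \<in> A" "e h = val P h" if "h \<in> P" for h
    using polyA[of "[:h:]"] e[of "[:h:]"] that pc by simp_all
  have \<tau>A: "\<tau> \<in> A" "e \<tau> = l"
    using polyA[of "[:0, 1:]"] e[of "[:0, 1:]"] pc cp by (simp_all add: cp_simps)
  have eval: "eval_on A e"
    unfolding eval_on_def
  proof (intro conjI ballI allI)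
    show "range const \<subseteq> A" using PA cp by (auto simp: cp_simps)
    show "e (const c) = c" for c using PA cp by (simp add: cp_simps)
    fix a b assume "a \<in> A" "b \<in> A"
    then obtain f g where fg: "f \<in> pcoef P" "g \<in> pcoef P" "a = poly f \<tau>" "b = poly g \<tau>"
      using A_iff by auto
    have s: "a + b = poly (f + g) \<tau>" "a * b = poly (f * g) \<tau>" using fg by simp_all
    show "a + b \<in> A" "a * b \<in> A" using fg s pc(1,3) A_iff by metis+
    show "e (a + b) = e a + e b" using fg e[OF pc(1)[OF fg(1,2)]] e pc(4) s by simp
    show "e (a * b) = e a * e b" using fg e[OF pc(3)[OF fg(1,2)]] e pc(6) s by simp
  qed
  have Aop: "a + b \<in> A" "a * b \<in> A" "e (a + b) = e a + e b" "e (a * b) = e a * e b"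
    if "a \<in> A" "b \<in> A" for a b using eval that by (auto simp: eval_on_def)
  have tl: "\<tau> - const l \<in> A" "e (\<tau> - const l) = 0"
    using Aop[of \<tau> "const (- l)"] \<tau>A PA[of "const (- l)"] cp by (simp_all add: const_minus cp_simps)
  have pxA: "hev const \<tau> q \<in> A" "e (hev const \<tau> q) = poly q l" for q
    using polyA[OF pc(10), of q] e[OF pc(10), of q] pc(11)[of q] by (simp_all add: hev_def)
  have ker: "ideal2 A u (\<tau> - const l) = {h \<in> A. e h = 0}"
  proof (intro equalityI subsetI)
    fix h assume "h \<in> ideal2 A u (\<tau> - const l)"
    then obtain a b where "a \<in> A" "b \<in> A" "h = a * u + b * (\<tau> - const l)" unfolding ideal2_def by blast
    then show "h \<in> {h \<in> A. e h = 0}" using Aop tl PA uv by auto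
  next
    fix h assume "h \<in> {h \<in> A. e h = 0}"
    then obtain f where f: "f \<in> pcoef P" "h = poly f \<tau>" "poly (vm P f) l = 0" using A_iff e by auto
    then obtain q where q: "vm P f = [:- l, 1:] * q" using poly_eq_0_iff_dvd by (metis dvdE)
    obtain a where a: "a \<in> pcoef P" "h = u * poly a \<tau> + hev const \<tau> (vm P f)"
      using residue_decomp[OF P f(1)] f by (auto simp: \<tau>_def)
    have "hev const \<tau> (vm P f) = hev const \<tau> q * (\<tau> - const l)"
      unfolding q rhom_mult[OF rhom_px] by (simp add: px_pCons const_minus)
    then have "h = poly a \<tau> * u + hev const \<tau> q * (\<tau> - const l)" using a by simp
    then show "h \<in> ideal2 A u (\<tau> - const l)" using polyA[OF a(1)] pxA ideal2_memI by metis
  qed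
  have uA: "u \<in> A" using PA uv by simp
  have R: "R = local_at A u (\<tau> - const l)" by (simp add: R_def bl_def A_def \<tau>_def)
  note L = local_at_point[OF eval ker uA tl(1), folded R]
  show "\<And>h. h \<in> P \<Longrightarrow> h \<in> R" "\<And>h. h \<in> P \<Longrightarrow> val R h = val P h" using L(2) PA by auto
  show "v / u \<in> R" "val R (v / u) = l" using L(2)[OF \<tau>A(1)] \<tau>A by (auto simp: \<tau>_def)
  show "\<exists>f\<in>pcoef P. \<exists>g\<in>pcoef P. poly (vm P g) l \<noteq> 0 \<and> h = poly f (v / u) / poly g (v / u)" if hR: "h \<in> R" for h
  proof -
    obtain f g where fg: "f \<in> A" "g \<in> A" "e g \<noteq> 0" "h = f / g" using hR L(4)[of h] by blast
    obtain F where F: "F \<in> pcoef P" "f = poly F \<tau>" using fg(1) A_iff[of f] by blast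
    obtain G where G: "G \<in> pcoef P" "g = poly G \<tau>" using fg(2) A_iff[of g] by blast
    have "poly (vm P G) l \<noteq> 0" "h = poly F (v / u) / poly G (v / u)"
      using fg e[OF G(1)] F G by (auto simp: \<tau>_def)
    then show ?thesis using F(1) G(1) by blast
  qed
  show "regular_point R u (v / u - const l)"
    unfolding regular_point_def \<tau>_def[symmetric]
  proof (intro conjI ballI impI)
    show "closed_point R" "max_ideal R = ideal2 R u (\<tau> - const l)" using L by auto
    show "u \<noteq> 0" using uv by simp
    show "\<tau> - const l \<noteq> 0"
    proof
      assume "\<tau> - const l = 0"
      then have "hev const (v / u) [:- l, 1:] = u * poly 0 (v / u)"
        by (simp add: px_pCons const_minus \<tau>_def)
      then show False using residue_zero_of_dvd[OF P pc(8)] by force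
    qed
    fix p q assume p: "p \<in> R" and q: "q \<in> R" and pq: "p * u = q * (\<tau> - const l)"
    obtain f g where fg: "f \<in> A" "g \<in> A" "e g \<noteq> 0" "p = f / g" using p L(4)[of p] by blast
    obtain f' g' where fg': "f' \<in> A" "g' \<in> A" "e g' \<noteq> 0" "q = f' / g'" using q L(4)[of q] by blast
    have e0: "e 0 = 0" using PA[of 0] cp by (simp add: cp_simps)
    then have g0: "g \<noteq> 0" "g' \<noteq> 0" using fg fg' by auto
    have eq: "(f * g') * u = (f' * g) * (\<tau> - const l)"
      using pq g0 unfolding fg(4) fg'(4) by (simp add: divide_simps mult_ac)
    obtain F where F: "F \<in> pcoef P" "f * g' = poly F \<tau>" using Aop(2)[OF fg(1) fg'(2)] A_iff by auto
    obtain G where G: "G \<in> pcoef P" "f' * g = poly G \<tau>" using Aop(2)[OF fg'(1) fg(2)] A_iff by auto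
    obtain a where a: "a \<in> pcoef P" "poly G \<tau> = u * poly a \<tau> + hev const \<tau> (vm P G)"
      using residue_decomp[OF P G(1)] by (auto simp: \<tau>_def)
    define k where "k = F - a * [:- const l, 1:]"
    have "[:- const l, 1:] \<in> pcoef P" using cp by (simp add: pc(7,8) cp_simps)
    then have k: "k \<in> pcoef P" unfolding k_def using F(1) a(1) pc(2,3) by blast
    have "hev const \<tau> (vm P G * [:- l, 1:]) = u * poly k \<tau>"
      unfolding rhom_mult[OF rhom_px] k_def using eq F G a
      by (simp add: px_pCons const_minus algebra_simps)
    then have "vm P G * [:- l, 1:] = 0" unfolding \<tau>_def by (rule residue_zero_of_dvd[OF P k])
    then have "vm P G = 0" by (simp only: mult_eq_0_iff) auto
    then have 1: "f' * g = u * poly a \<tau>" using a G by simp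
    then have "(f * g') * u = (poly a \<tau> * (\<tau> - const l)) * u" using eq by (simp add: mult_ac)
    then have 2: "f * g' = poly a \<tau> * (\<tau> - const l)" using uv by simp
    define r where "r = poly a \<tau> / (g * g')"
    have "r \<in> R" unfolding L(4) r_def using polyA[OF a(1)] Aop[OF fg(2) fg'(2)] fg(3) fg'(3)
      by (intro bexI[of _ "poly a \<tau>"] bexI[of _ "g * g'"]) auto
    moreover have "p = r * (\<tau> - const l)"
      using 2 g0 unfolding fg(4) r_def by (simp add: field_simps)
    moreover have "q = r * u"
      using 1 g0 unfolding fg'(4) r_def by (simp add: field_simps)
    ultimately show "\<exists>r\<in>R. p = r * (\<tau> - const l) \<and> q = r * u" by blast
  qed
qed

section \<open>Changes of regular parameters\<close>

text \<open>
  Cramer's rule for the transition matrix, whose determinant is a unit.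
\<close>

lemma regular_point_change:
  assumes P: "regular_point P u v"
    and m: "\<alpha> \<in> P" "\<beta> \<in> P" "\<gamma> \<in> P" "\<delta> \<in> P" "val P (\<alpha> * \<delta> - \<beta> * \<gamma>) \<noteq> 0"
    and u': "u' = \<alpha> * u + \<beta> * v" and v': "v' = \<gamma> * u + \<delta> * v"
  shows "regular_point P u' v'"
proof -
  note cp = regular_point_cp[OF P] and uv = regular_point_params[OF P]
  define D where "D = \<alpha> * \<delta> - \<beta> * \<gamma>"
  have D: "D \<in> P" "val P D \<noteq> 0" using m cp by (simp_all add: D_def cp_simps)
  then have D0: "D \<noteq> 0" using cp by (auto simp: cp_simps)
  have Du: "D * u = \<delta> * u' - \<beta> * v'" and Dv: "D * v = \<alpha> * v' - \<gamma> * u'"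
    unfolding u' v' D_def by (simp_all add: algebra_simps)
  have u: "u = (\<delta> / D) * u' + (- \<beta> / D) * v'" and v: "v = (- \<gamma> / D) * u' + (\<alpha> / D) * v'"
    using Du Dv D0 by (simp_all add: field_simps)
  have "ideal2 P u v = ideal2 P u' v'"
  proof (intro equalityI subsetI)
    fix h assume "h \<in> ideal2 P u v"
    then obtain a b where ab: "a \<in> P" "b \<in> P" "h = a * u + b * v" unfolding ideal2_def by blast
    have "h = (a * (\<delta> / D) + b * (- \<gamma> / D)) * u' + (a * (- \<beta> / D) + b * (\<alpha> / D)) * v'"
      unfolding ab(3) by (subst u, subst v) (simp add: algebra_simps)
    moreover have "a * (\<delta> / D) + b * (- \<gamma> / D) \<in> P" "a * (- \<beta> / D) + b * (\<alpha> / D) \<in> P"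
      using ab m D cp by (simp_all add: cp_simps)
    ultimately show "h \<in> ideal2 P u' v'" using ideal2_memI by metis
  next
    fix h assume "h \<in> ideal2 P u' v'"
    then obtain a b where ab: "a \<in> P" "b \<in> P" "h = a * u' + b * v'" unfolding ideal2_def by blast
    then have "h = (a * \<alpha> + b * \<gamma>) * u + (a * \<beta> + b * \<delta>) * v"
      unfolding u' v' by (simp add: algebra_simps)
    then show "h \<in> ideal2 P u v" using ideal2_memI ab m cp by (metis cp_add cp_mult)
  qed
  moreover have "\<exists>r\<in>P. p = r * v' \<and> q = r * u'" if pq: "p \<in> P" "q \<in> P" "p * u' = q * v'" for p q
  proof -
    have "(p * \<alpha> - q * \<gamma>) * u = (q * \<delta> - p * \<beta>) * v"
      using pq(3) unfolding u' v' by (simp add: algebra_simps)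
    moreover have "p * \<alpha> - q * \<gamma> \<in> P" "q * \<delta> - p * \<beta> \<in> P" using pq m cp by (simp_all add: cp_simps)
    ultimately obtain r where r: "r \<in> P" "p * \<alpha> - q * \<gamma> = r * v" "q * \<delta> - p * \<beta> = r * u"
      using regular_point_rel[OF P] by metis
    have "p * D = (p * \<alpha> - q * \<gamma>) * \<delta> + (q * \<delta> - p * \<beta>) * \<gamma>" by (simp add: D_def algebra_simps)
    also have "\<dots> = r * v'" unfolding r v' by (simp add: algebra_simps)
    finally have p: "p = r / D * v'" using D0 by (simp add: field_simps)
    have "q * D = (p * \<alpha> - q * \<gamma>) * \<beta> + (q * \<delta> - p * \<beta>) * \<alpha>" by (simp add: D_def algebra_simps)
    also have "\<dots> = r * u'" unfolding r u' by (simp add: algebra_simps)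
    finally have q: "q = r / D * u'" using D0 by (simp add: field_simps)
    have "r / D \<in> P" using r D cp by (simp add: cp_simps)
    then show ?thesis using p q by blast
  qed
  moreover have "val P \<alpha> = 0 \<and> val P \<beta> = 0" if "u' = 0"
    using regular_point_rel_val[OF P m(1,2)] that u' by auto
  moreover have "val P \<gamma> = 0 \<and> val P \<delta> = 0" if "v' = 0"
    using regular_point_rel_val[OF P m(3,4)] that v' by auto
  moreover have "val P D = val P \<alpha> * val P \<delta> - val P \<beta> * val P \<gamma>"
    using m cp by (simp add: D_def cp_simps)
  ultimately show ?thesis using P D unfolding regular_point_def by auto
qed

text \<open>
  Each pair of generators is expressed by the other one. The product of the two matrices is the identity
  modulo the maximal ideal, because the parameters satisfy no relation with unit coefficients.
\<close>

lemma generators_change: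
  assumes P: "regular_point P u v" and max: "max_ideal P = ideal2 P u' v'"
  obtains \<alpha> \<beta> \<gamma> \<delta> where "\<alpha> \<in> P" "\<beta> \<in> P" "\<gamma> \<in> P" "\<delta> \<in> P" "val P (\<alpha> * \<delta> - \<beta> * \<gamma>) \<noteq> 0"
    "u' = \<alpha> * u + \<beta> * v" "v' = \<gamma> * u + \<delta> * v"
proof -
  note cp = regular_point_cp[OF P] and uv = regular_point_params[OF P]
  have "u' \<in> max_ideal P" "v' \<in> max_ideal P" unfolding max by (rule ideal2_gens[OF cp])+
  then have "u' \<in> ideal2 P u v" "v' \<in> ideal2 P u v" using P by (auto simp: regular_point_def)
  then obtain \<alpha> \<beta> \<gamma> \<delta> where m: "\<alpha> \<in> P" "\<beta> \<in> P" "\<gamma> \<in> P" "\<delta> \<in> P"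
    and u': "u' = \<alpha> * u + \<beta> * v" and v': "v' = \<gamma> * u + \<delta> * v" unfolding ideal2_def by auto
  have "u \<in> ideal2 P u' v'" "v \<in> ideal2 P u' v'"
    using uv max_ideal_iff[OF cp] by (auto simp flip: max)
  then obtain a b c d where w: "a \<in> P" "b \<in> P" "c \<in> P" "d \<in> P"
    and u: "u = a * u' + b * v'" and v: "v = c * u' + d * v'" unfolding ideal2_def by auto
  have "(a * \<alpha> + b * \<gamma> - 1) * u + (a * \<beta> + b * \<delta>) * v = 0"
    "(c * \<alpha> + d * \<gamma>) * u + (c * \<beta> + d * \<delta> - 1) * v = 0"
    using u v unfolding u' v' by (simp_all add: algebra_simps)
  moreover have "a * \<alpha> + b * \<gamma> - 1 \<in> P" "a * \<beta> + b * \<delta> \<in> P" "c * \<alpha> + d * \<gamma> \<in> P" "c * \<beta> + d * \<delta> - 1 \<in> P"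
    using m w cp by (simp_all add: cp_simps)
  ultimately have "val P (a * \<alpha> + b * \<gamma> - 1) = 0" "val P (a * \<beta> + b * \<delta>) = 0"
    "val P (c * \<alpha> + d * \<gamma>) = 0" "val P (c * \<beta> + d * \<delta> - 1) = 0"
    using regular_point_rel_val[OF P] by blast+
  then have *: "val P a * val P \<alpha> + val P b * val P \<gamma> = 1" "val P a * val P \<beta> + val P b * val P \<delta> = 0"
    "val P c * val P \<alpha> + val P d * val P \<gamma> = 0" "val P c * val P \<beta> + val P d * val P \<delta> = 1"
    using m w cp by (simp_all add: cp_simps)
  have "(val P a * val P d - val P b * val P c) * (val P \<alpha> * val P \<delta> - val P \<beta> * val P \<gamma>)
    = (val P a * val P \<alpha> + val P b * val P \<gamma>) * (val P c * val P \<beta> + val P d * val P \<delta>)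
     - (val P a * val P \<beta> + val P b * val P \<delta>) * (val P c * val P \<alpha> + val P d * val P \<gamma>)"
    by (simp add: algebra_simps)
  also have "\<dots> = 1" by (simp add: *)
  finally have "val P \<alpha> * val P \<delta> - val P \<beta> * val P \<gamma> \<noteq> 0" by auto
  then have "val P (\<alpha> * \<delta> - \<beta> * \<gamma>) \<noteq> 0" using m cp by (simp add: cp_simps)
  then show thesis using that m u' v' by blast
qed

lemma regular_point_gens:
  assumes "regular_point P u v" "max_ideal P = ideal2 P u' v'"
  shows "regular_point P u' v'"
  by (rule generators_change[OF assms]) (rule regular_point_change[OF assms(1)])

section \<open>Local homomorphisms and exceptional curves\<close>

definition fhom :: "(ratfun \<Rightarrow> ratfun) \<Rightarrow> bool" where
  "fhom \<phi> \<longleftrightarrow> rhom \<phi> \<and> (\<forall>c. \<phi> (const c) = const c)"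

text \<open>
  The homomorphism \<open>\<phi>\<close> restricts to a local homomorphism between the two rings, and therefore induces a
  map of germs which sends the point \<open>R\<close> to the point \<open>Q\<close>.
\<close>

definition locmap :: "(ratfun \<Rightarrow> ratfun) \<Rightarrow> point \<Rightarrow> point \<Rightarrow> bool" where
  "locmap \<phi> Q R \<longleftrightarrow> (\<forall>h\<in>Q. \<phi> h \<in> R \<and> val R (\<phi> h) = val Q h)"

abbreviation lies_over :: "point \<Rightarrow> point \<Rightarrow> bool" where
  "lies_over R Q \<equiv> locmap (\<lambda>h. h) Q R"

lemma fhom_id: "fhom (\<lambda>h. h)"
  by (simp add: fhom_def rhom_id)

lemma lies_over_subset: "lies_over R Q \<Longrightarrow> Q \<subseteq> R"
  by (auto simp: locmap_def)

lemma lies_over_refl: "lies_over R R"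
  by (simp add: locmap_def)

lemma lies_over_trans: "lies_over R Q \<Longrightarrow> lies_over Q P \<Longrightarrow> lies_over R P"
  by (auto simp: locmap_def)

lemma lies_overD: "lies_over R Q \<Longrightarrow> h \<in> Q \<Longrightarrow> h \<in> R \<and> val R h = val Q h"
  by (auto simp: locmap_def)

text \<open>
  Both notions agree because every element of the ring of a closed point is a constant plus an element
  of the maximal ideal.
\<close>

lemma dominates_iff:
  assumes R: "closed_point R" and Q: "closed_point Q"
  shows "dominates R Q \<longleftrightarrow> lies_over R Q"
proof
  assume d: "dominates R Q"
  show "lies_over R Q" unfolding locmap_def
  proof
    fix h assume h: "h \<in> Q"
    then have "h - const (val Q h) \<in> max_ideal Q" using Q by (simp add: max_ideal_iff cp_simps)
    then have "h - const (val Q h) \<in> max_ideal R" using d by (auto simp: dominates_def)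
    moreover have "h \<in> R" using d h by (auto simp: dominates_def)
    ultimately show "h \<in> R \<and> val R h = val Q h" using R by (simp add: max_ideal_iff cp_simps)
  qed
next
  assume "lies_over R Q"
  then show "dominates R Q"
    using R Q by (auto simp: dominates_def locmap_def max_ideal_iff)
qed

lemma locmap_poly:
  assumes \<phi>: "fhom \<phi>" and R: "closed_point R" and P: "closed_point P" and loc: "locmap \<phi> P R" and w: "\<phi> w \<in> R"
  shows "f \<in> pcoef P \<Longrightarrow> \<phi> (poly f w) \<in> R \<and> val R (\<phi> (poly f w)) = poly (vm P f) (val R (\<phi> w))"
proof (induction f)
  case 0
  then show ?case using \<phi> R by (simp add: fhom_def rhom_0 cp_simps)
next
  case (pCons c f)
  then have "c \<in> P" "f \<in> pcoef P" using pcoef_ops(7)[OF P] by auto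
  moreover have "\<phi> c \<in> R" "val R (\<phi> c) = val P c" using loc \<open>c \<in> P\<close> by (auto simp: locmap_def)
  ultimately show ?case
    using pCons.IH \<phi> R w by (simp add: fhom_def rhom_add rhom_mult cp_simps pcoef_ops(9)[OF P])
qed

text \<open>
  The universal property by which images under a morphism are computed in the rings of a blowup: it is
  enough to know where the new generator goes.
\<close>

lemma locmap_bl:
  assumes P: "regular_point P u v" and \<phi>: "fhom \<phi>" and R: "closed_point R" and loc: "locmap \<phi> P R"
    and w: "\<phi> (v / u) \<in> R" "val R (\<phi> (v / u)) = l"
  shows "locmap \<phi> (bl P u v l) R"
  unfolding locmap_def
proof
  fix h assume h: "h \<in> bl P u v l"
  note cp = regular_point_cp[OF P]
  note B = bl_point[OF P, where l = l]
  note cb = regular_point_cp[OF B(1)]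
  obtain f g where fg: "f \<in> pcoef P" "g \<in> pcoef P" "poly (vm P g) l \<noteq> 0" "h = poly f (v / u) / poly g (v / u)"
    using B(6)[OF h] by blast
  have "lies_over (bl P u v l) P" using B by (simp add: locmap_def)
  then have 1: "poly f (v / u) \<in> bl P u v l \<and> val (bl P u v l) (poly f (v / u)) = poly (vm P f) l"
    if "f \<in> pcoef P" for f
    using locmap_poly[OF fhom_id cb cp _ B(4) that] B(5) by simp
  have 2: "\<phi> (poly f (v / u)) \<in> R \<and> val R (\<phi> (poly f (v / u))) = poly (vm P f) l" if "f \<in> pcoef P" for f
    using locmap_poly[OF \<phi> R cp loc w(1) that] w(2) by simp
  have 3: "\<phi> h = \<phi> (poly f (v / u)) / \<phi> (poly g (v / u))" using \<phi> fg by (simp add: fhom_def rhom_divide)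
  show "\<phi> h \<in> R \<and> val R (\<phi> h) = val (bl P u v l) h"
    unfolding 3 unfolding fg(4)
    using 1[OF fg(1)] 1[OF fg(2)] 2[OF fg(1)] 2[OF fg(2)] fg(3) R cb by (simp add: cp_simps)
qed

lemma bl_lies_over:
  assumes "regular_point P u v" shows "lies_over (bl P u v l) P"
  using bl_point[OF assms] by (simp add: locmap_def)

lemma val_reciprocal:
  assumes "closed_point R" "h \<in> R" "inverse h \<in> R" "h \<noteq> 0"
  shows "val R h \<noteq> 0"
  using assms inverse_notin by blast

text \<open>
  If \<open>u = s u'\<close> and \<open>v = t u'\<close> for the parameters \<open>u'\<close>, \<open>v'\<close> of the other chart, then \<open>s\<close> and \<open>t\<close> do
  not vanish simultaneously on the exceptional curve, as the transition matrix is invertible. So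
  \<open>t / s\<close> or \<open>s / t\<close> is regular.
\<close>

lemma bl_above:
  assumes P: "regular_point P u v" and P': "regular_point P u' v'"
  shows "(\<exists>l. lies_over (bl P u' v' l') (bl P u v l)) \<or> lies_over (bl P u' v' l') (bl P v u 0)"
proof -
  define R where "R = bl P u' v' l'"
  note B = bl_point[OF P', where l = l', folded R_def]
  note cp = regular_point_cp[OF P] and cR = regular_point_cp[OF B(1)]
  note uv = regular_point_params[OF P] and uv' = regular_point_params[OF P']
  have over: "lies_over R P" unfolding R_def by (rule bl_lies_over[OF P'])
  have "max_ideal P = ideal2 P u v" using P by (simp add: regular_point_def)
  then obtain \<alpha> \<beta> \<gamma> \<delta> where m: "\<alpha> \<in> P" "\<beta> \<in> P" "\<gamma> \<in> P" "\<delta> \<in> P" "val P (\<alpha> * \<delta> - \<beta> * \<gamma>) \<noteq> 0"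
    and u: "u = \<alpha> * u' + \<beta> * v'" and v: "v = \<gamma> * u' + \<delta> * v'"
    by (rule generators_change[OF P'])
  define s t where "s = \<alpha> + \<beta> * (v' / u')" and "t = \<gamma> + \<delta> * (v' / u')"
  have us: "u = s * u'" "v = t * u'" using u v uv' by (simp_all add: s_def t_def field_simps)
  have "s \<in> R" "t \<in> R" using m B cR by (simp_all add: s_def t_def cp_simps del: times_divide_eq_right)
  have st: "val R s = val P \<alpha> + val P \<beta> * l'" "val R t = val P \<gamma> + val P \<delta> * l'"
    using m B cR by (simp_all add: s_def t_def cp_simps del: times_divide_eq_right)
  have "val P \<alpha> * val P \<delta> - val P \<beta> * val P \<gamma> \<noteq> 0" using m cp by (simp add: cp_simps)
  then have "val R s \<noteq> 0 \<or> val R t \<noteq> 0" unfolding st by algebra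
  moreover have ?thesis if "val R s \<noteq> 0"
  proof -
    have "v / u = t / s" using us uv' by simp
    then have "v / u \<in> R" using that \<open>s \<in> R\<close> \<open>t \<in> R\<close> cR by (simp add: cp_simps)
    then show ?thesis using locmap_bl[OF P fhom_id cR over] by (auto simp: R_def)
  qed
  moreover have ?thesis if "val R s = 0" "val R t \<noteq> 0"
  proof -
    have "u / v = s / t" using us uv' by simp
    then have "u / v \<in> R" "val R (u / v) = 0" using that \<open>s \<in> R\<close> \<open>t \<in> R\<close> cR by (simp_all add: cp_simps)
    then show ?thesis using locmap_bl[OF regular_point_commute[OF P] fhom_id cR over] by (auto simp: R_def)
  qed
  ultimately show ?thesis by blast
qed

lemma lies_over_bl_eq:
  assumes P: "regular_point P u v"
  shows "lies_over (bl P u v l) (bl P u v l') \<Longrightarrow> l = l'"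
    and "\<not> lies_over (bl P u v l) (bl P v u 0)"
proof -
  note B = bl_point[OF P] and B' = bl_point[OF regular_point_commute[OF P]]
  show "lies_over (bl P u v l) (bl P u v l') \<Longrightarrow> l = l'"
    using lies_overD[of _ _ "v / u"] B(4,5) by metis
  show "\<not> lies_over (bl P u v l) (bl P v u 0)"
  proof
    assume "lies_over (bl P u v l) (bl P v u 0)"
    then have "u / v \<in> bl P u v l" "val (bl P u v l) (u / v) = 0"
      using lies_overD[of _ _ "u / v"] B'(4,5)[of 0] by auto
    then have "inverse (u / v) \<notin> bl P u v l"
      using regular_point_params[OF P] by (intro inverse_notin[OF regular_point_cp[OF B(1)]]) auto
    then show False using B(4)[of l] by simp
  qed
qed

text \<open>
  A point described by other parameters lies over a point described by \<open>u\<close>, \<open>v\<close>, which in turn lies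
  over a point described by the other parameters. No point of one chart lies over a different one, so
  all three coincide.
\<close>

lemma exc_cases:
  assumes P: "regular_point P u v"
  shows "R \<in> exc P \<longleftrightarrow> (\<exists>l. R = bl P u v l) \<or> R = bl P v u 0"
proof
  assume "R \<in> exc P"
  then obtain u' v' l' where max: "max_ideal P = ideal2 P u' v'" and R: "R = bl P u' v' l'"
    by (auto simp: exc_def bl_def)
  have P': "regular_point P u' v'" by (rule regular_point_gens[OF P max])
  obtain a b l where ab: "a = u \<and> b = v \<or> a = v \<and> b = u \<and> l = 0" and over: "lies_over R (bl P a b l)"
    using bl_above[OF P P', of l'] R by blast
  have Pab: "regular_point P a b" using ab P regular_point_commute by auto
  have "lies_over (bl P a b l) R"
    using bl_above[OF P' Pab, of l]
  proof
    assume "\<exists>l''. lies_over (bl P a b l) (bl P u' v' l'')"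
    then obtain l'' where *: "lies_over (bl P a b l) (bl P u' v' l'')" by blast
    then have "l' = l''" using lies_over_trans[OF over] lies_over_bl_eq(1)[OF P'] R by blast
    then show ?thesis using * R by simp
  next
    assume "lies_over (bl P a b l) (bl P v' u' 0)"
    then show ?thesis using lies_over_trans[OF over] lies_over_bl_eq(2)[OF P'] R by blast
  qed
  then have "R = bl P a b l" using over lies_over_subset by blast
  then show "(\<exists>l. R = bl P u v l) \<or> R = bl P v u 0" using ab by auto
next
  have *: "bl P u v l \<in> exc P" if "regular_point P u v" for u v l
    using that unfolding exc_def bl_def regular_point_def by blast
  assume "(\<exists>l. R = bl P u v l) \<or> R = bl P v u 0"
  then show "R \<in> exc P" using * P regular_point_commute by blast
qed

lemma exc_point:
  assumes P: "regular_point P u v" and R: "R \<in> exc P"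
  shows "closed_point R" "lies_over R P" and "v / u \<in> R \<Longrightarrow> R = bl P u v (val R (v / u))"
proof -
  have P': "regular_point P v u" by (rule regular_point_commute[OF P])
  note B = bl_point[OF P] and B' = bl_point[OF P']
  have c: "(\<exists>l. R = bl P u v l) \<or> R = bl P v u 0" using exc_cases[OF P] R by blast
  then show "closed_point R" "lies_over R P"
    using regular_point_cp[OF B(1)] regular_point_cp[OF B'(1)] bl_lies_over[OF P] bl_lies_over[OF P'] by auto
  show "R = bl P u v (val R (v / u))" if "v / u \<in> R"
  proof (cases "\<exists>l. R = bl P u v l")
    case True
    then show ?thesis using B(5) by auto
  next
    case False
    then have R0: "R = bl P v u 0" using c by blast
    have "inverse (u / v) \<notin> R"
      unfolding R0 using regular_point_params[OF P] B'(4,5)[of 0]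
      by (intro inverse_notin[OF regular_point_cp[OF B'(1)]]) auto
    then show ?thesis using that by simp
  qed
qed

section \<open>The Zariski topology\<close>

text \<open>
  Models whose elements are rings of closed points. Every such ring contains \<open>0\<close>, which guarantees that
  the domains of rational functions cover the model.
\<close>

definition points :: "model \<Rightarrow> bool" where
  "points X \<longleftrightarrow> (\<forall>P\<in>X. closed_point P)"

lemma pointsD: "points X \<Longrightarrow> P \<in> X \<Longrightarrow> closed_point P"
  by (simp add: points_def)

lemma topspace_zariski: "points X \<Longrightarrow> topspace (zariski X) = X"
  unfolding zariski_def topology_generated_by_topspace
  by (auto simp: points_def intro!: exI[of _ "{P \<in> X. 0 \<in> P}"] exI[of _ "0::ratfun"] cp_0)

lemma openin_domain:
  assumes X: "points X" and H: "finite H" shows "openin (zariski X) {P \<in> X. H \<subseteq> P}"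
  using H
proof (induction H)
  case empty
  have "{P \<in> X. {} \<subseteq> P} = X" by auto
  then show ?case using topspace_zariski[OF X] openin_topspace by metis
next
  case (insert h H)
  have "openin (zariski X) {P \<in> X. h \<in> P}"
    unfolding zariski_def by (rule topology_generated_by_Basis) auto
  moreover have "{P \<in> X. insert h H \<subseteq> P} = {P \<in> X. h \<in> P} \<inter> {P \<in> X. H \<subseteq> P}" by auto
  ultimately show ?case using insert.IH by (simp add: openin_Int)
qed

text \<open>
  The common domains of finitely many rational functions form a basis of the topology.
\<close>

lemma zariski_nbhd:
  assumes "openin (zariski X) U" "P \<in> U"
  obtains H where "finite H" "H \<subseteq> P" "{Q \<in> X. H \<subseteq> Q} \<subseteq> U"
proof -
  have "\<exists>H. finite H \<and> H \<subseteq> P \<and> {Q \<in> X. H \<subseteq> Q} \<subseteq> U"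
    using assms unfolding zariski_def openin_topology_generated_by_iff
  proof (induction U)
    case Empty
    then show ?case by simp
  next
    case (Int U V)
    then obtain H K where "finite H" "H \<subseteq> P" "{Q \<in> X. H \<subseteq> Q} \<subseteq> U" "finite K" "K \<subseteq> P" "{Q \<in> X. K \<subseteq> Q} \<subseteq> V"
      by auto
    then show ?case by (intro exI[of _ "H \<union> K"]) auto
  next
    case (UN K)
    then obtain U where "U \<in> K" "P \<in> U" by blast
    then obtain H where "finite H" "H \<subseteq> P" "{Q \<in> X. H \<subseteq> Q} \<subseteq> U"
      using UN.IH[OF \<open>U \<in> K\<close> \<open>P \<in> U\<close>] by (elim exE conjE)
    then have "{Q \<in> X. H \<subseteq> Q} \<subseteq> \<Union>K" using \<open>U \<in> K\<close> by auto
    then show ?case using \<open>finite H\<close> \<open>H \<subseteq> P\<close> by (intro exI[of _ H]) simp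
  next
    case (Basis s)
    then obtain h where "s = {P \<in> X. h \<in> P}" by auto
    then show ?case using Basis by (intro exI[of _ "{h}"]) auto
  qed
  then show thesis using that by blast
qed

lemma zariski_closure:
  assumes X: "points X"
  shows "R \<in> zariski X closure_of Z \<longleftrightarrow> R \<in> X \<and> (\<forall>H. finite H \<and> H \<subseteq> R \<longrightarrow> (\<exists>Q\<in>Z \<inter> X. H \<subseteq> Q))"
proof
  assume R: "R \<in> zariski X closure_of Z"
  show "R \<in> X \<and> (\<forall>H. finite H \<and> H \<subseteq> R \<longrightarrow> (\<exists>Q\<in>Z \<inter> X. H \<subseteq> Q))"
  proof (intro conjI allI impI)
    show RX: "R \<in> X" using R topspace_zariski[OF X] by (auto simp: in_closure_of)
    fix H assume "finite H \<and> H \<subseteq> R"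
    then have "openin (zariski X) {P \<in> X. H \<subseteq> P}" "R \<in> {P \<in> X. H \<subseteq> P}"
      using openin_domain[OF X] RX by auto
    moreover have "\<forall>T. R \<in> T \<and> openin (zariski X) T \<longrightarrow> (\<exists>y. y \<in> Z \<and> y \<in> T)"
      using R by (simp add: in_closure_of)
    ultimately obtain Q where "Q \<in> Z" "Q \<in> {P \<in> X. H \<subseteq> P}" by meson
    then show "\<exists>Q\<in>Z \<inter> X. H \<subseteq> Q" by auto
  qed
next
  assume R: "R \<in> X \<and> (\<forall>H. finite H \<and> H \<subseteq> R \<longrightarrow> (\<exists>Q\<in>Z \<inter> X. H \<subseteq> Q))"
  show "R \<in> zariski X closure_of Z" unfolding in_closure_of
  proof (intro conjI allI impI)
    show "R \<in> topspace (zariski X)" using R topspace_zariski[OF X] by simp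
    fix T assume T: "R \<in> T \<and> openin (zariski X) T"
    obtain H where "finite H" "H \<subseteq> R" "{Q \<in> X. H \<subseteq> Q} \<subseteq> T"
      by (rule zariski_nbhd[of X T R]) (use T in auto)
    then show "\<exists>y. y \<in> Z \<and> y \<in> T" using R by blast
  qed
qed

section \<open>Coordinate rings\<close>

text \<open>
  The algebra over the complex numbers generated by \<open>G\<close>.
\<close>

inductive_set alg :: "ratfun set \<Rightarrow> ratfun set" for G where
  alg_const: "const c \<in> alg G"
| alg_gen: "g \<in> G \<Longrightarrow> g \<in> alg G"
| alg_add: "a \<in> alg G \<Longrightarrow> b \<in> alg G \<Longrightarrow> a + b \<in> alg G"
| alg_mult: "a \<in> alg G \<Longrightarrow> b \<in> alg G \<Longrightarrow> a * b \<in> alg G"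

lemma alg_mono:
  assumes "G \<subseteq> H" shows "a \<in> alg G \<Longrightarrow> a \<in> alg H"
  by (induction rule: alg.induct) (use assms in \<open>auto intro: alg.intros\<close>)

lemma alg_subset:
  assumes "closed_point P" "G \<subseteq> P" shows "a \<in> alg G \<Longrightarrow> a \<in> P"
  by (induction rule: alg.induct) (use assms in \<open>auto intro: cp_simps\<close>)

text \<open>
  \<open>G\<close> generates the coordinate ring of an affine neighbourhood of the point. In contrast to the
  iterated localizations that define the points of a blowup, such quotients are accessible to
  induction.
\<close>

definition frac_of :: "ratfun set \<Rightarrow> point \<Rightarrow> bool" where
  "frac_of G P \<longleftrightarrow> G \<subseteq> P \<and> (\<forall>h\<in>P. \<exists>f\<in>alg G. \<exists>g\<in>alg G. val P g \<noteq> 0 \<and> h = f / g)"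

text \<open>
  The denominators of the finitely many coefficients of a polynomial in \<open>v / u\<close> can be cleared.
\<close>

lemma frac_of_bl:
  assumes P: "regular_point P u v" and G: "frac_of G P"
  shows "frac_of (insert (v / u) G) (bl P u v l)"
proof -
  define \<tau> where "\<tau> = v / u"
  note cp = regular_point_cp[OF P]
  note B = bl_point[OF P, where l = l]
  note cb = regular_point_cp[OF B(1)]
  have GP: "G \<subseteq> P" using G by (simp add: frac_of_def)
  have clear: "f \<in> pcoef P \<Longrightarrow> \<exists>d\<in>alg G. val P d \<noteq> 0 \<and> d * poly f \<tau> \<in> alg (insert \<tau> G)" for f
  proof (induction f)
    case 0
    show ?case using alg_const[of 1 G] alg_const[of 0 "insert \<tau> G"] cp
      by (intro bexI[of _ 1]) (auto simp: cp_simps)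
  next
    case (pCons c f)
    then have c: "c \<in> P" and f: "f \<in> pcoef P" using pcoef_ops(7)[OF cp] by auto
    obtain d where d: "d \<in> alg G" "val P d \<noteq> 0" "d * poly f \<tau> \<in> alg (insert \<tau> G)"
      using pCons.IH[OF f] by blast
    obtain a b where ab: "a \<in> alg G" "b \<in> alg G" "val P b \<noteq> 0" "c = a / b"
      using G c unfolding frac_of_def by blast
    have b0: "b \<noteq> 0" using ab cp by (auto simp: cp_simps)
    have PG: "d \<in> P" "b \<in> P" using alg_subset[OF cp GP] d ab by auto
    have m: "z \<in> alg G \<Longrightarrow> z \<in> alg (insert \<tau> G)" for z by (rule alg_mono[of G]) auto
    have "d * b * poly (pCons c f) \<tau> = d * a + b * (\<tau> * (d * poly f \<tau>))"
      using b0 ab by (simp add: field_simps)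
    also have "\<dots> \<in> alg (insert \<tau> G)"
      by (rule alg_add[OF alg_mult[OF m[OF d(1)] m[OF ab(1)]]
            alg_mult[OF m[OF ab(2)] alg_mult[OF alg_gen d(3)]]]) simp
    finally show ?case
      using d ab cp PG by (intro bexI[of _ "d * b"]) (auto intro: alg_mult simp: cp_simps)
  qed
  show ?thesis unfolding frac_of_def \<tau>_def[symmetric]
  proof (intro conjI ballI)
    show "insert \<tau> G \<subseteq> bl P u v l" using B GP by (auto simp: \<tau>_def)
    fix h assume h: "h \<in> bl P u v l"
    obtain f g where fg: "f \<in> pcoef P" "g \<in> pcoef P" "poly (vm P g) l \<noteq> 0" "h = poly f \<tau> / poly g \<tau>"
      using B(6)[OF h] by (auto simp: \<tau>_def)
    obtain d where d: "d \<in> alg G" "val P d \<noteq> 0" "d * poly f \<tau> \<in> alg (insert \<tau> G)" using clear[OF fg(1)] by blast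
    obtain e where e: "e \<in> alg G" "val P e \<noteq> 0" "e * poly g \<tau> \<in> alg (insert \<tau> G)" using clear[OF fg(2)] by blast
    have m: "z \<in> alg G \<Longrightarrow> z \<in> alg (insert \<tau> G)" for z by (rule alg_mono[of G]) auto
    have PG: "d \<in> P" "e \<in> P" using alg_subset[OF cp GP] d e by auto
    have de0: "d \<noteq> 0" "e \<noteq> 0" using d e cp by (auto simp: cp_simps)
    have h': "h = (e * (d * poly f \<tau>)) / (d * (e * poly g \<tau>))" using de0 fg by simp
    have "poly g \<tau> \<in> bl P u v l \<and> val (bl P u v l) (poly g \<tau>) = poly (vm P g) l"
      using locmap_poly[OF fhom_id cb cp bl_lies_over[OF P] B(4) fg(2)] B(5) by (simp add: \<tau>_def)
    then have "val (bl P u v l) (d * (e * poly g \<tau>)) \<noteq> 0"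
      using B(2,3) PG d e fg(3) cb by (simp add: cp_simps)
    moreover have "e * (d * poly f \<tau>) \<in> alg (insert \<tau> G)" "d * (e * poly g \<tau>) \<in> alg (insert \<tau> G)"
      by (rule alg_mult[OF m[OF e(1)] d(3)] alg_mult[OF m[OF d(1)] e(3)])+
    ultimately show "\<exists>f\<in>alg (insert \<tau> G). \<exists>g\<in>alg (insert \<tau> G). val (bl P u v l) g \<noteq> 0 \<and> h = f / g"
      using h' by blast
  qed
qed

section \<open>Points of an affine plane\<close>

lemma adjoin_range:
  assumes F: "rhom F" shows "adjoin (range F) w = range (hev F w)"
proof -
  have *: "\<exists>p. map_poly F p = f" if "\<forall>i. coeff f i \<in> range F" for f
    using that
  proof (induction f)
    case 0
    show ?case by (rule exI[of _ 0]) simp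
  next
    case (pCons c f)
    have "\<forall>i. coeff f i \<in> range F" using pCons.prems by (metis coeff_pCons_Suc)
    then obtain p where "map_poly F p = f" using pCons.IH by blast
    moreover obtain a where "c = F a" using pCons.prems[rule_format, of 0] by auto
    ultimately have "map_poly F (pCons a p) = pCons c f" by (simp add: map_poly_pCons rhom_0[OF F])
    then show ?case by blast
  qed
  then show ?thesis
  proof -
    have "hev F w p \<in> adjoin (range F) w" for p
      unfolding adjoin_def hev_def using coeff_map_poly[of F, OF rhom_0[OF F]] by auto
    moreover have "h \<in> range (hev F w)" if hA: "h \<in> adjoin (range F) w" for h
    proof -
      obtain f where f: "h = poly f w" "\<forall>i. coeff f i \<in> range F" using hA unfolding adjoin_def by blast
      obtain p where "map_poly F p = f" using * f(2) by blast
      then have "h = hev F w p" using f(1) by (simp add: hev_def)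
      then show ?thesis by simp
    qed
    ultimately show ?thesis by blast
  qed
qed

lemma adjoin_adjoin: "adjoin (adjoin (range const) x) y = range (ev x y)"
  unfolding ev_def adjoin_range[OF rhom_const] adjoin_range[OF rhom_px] ..

text \<open>
  Divide by \<open>Y - c\<close>, and divide the remainder by \<open>X - a\<close>.
\<close>

lemma pv_kernel:
  assumes "pv a c p = 0"
  obtains r s where "p = [:[:- a, 1:]:] * r + [:[:- c:], 1:] * s"
proof -
  define s where "s = synthetic_div p [:c:]"
  have "p = pCons (poly p [:c:]) 0 + [:- [:c:], 1:] * s"
    using synthetic_div_correct'[of "[:c:]" p] by (simp add: s_def add.commute)
  moreover have "[:- a, 1:] dvd poly p [:c:]"
    using assms by (simp add: pv_altdef poly_eq_0_iff_dvd)
  then obtain r where "poly p [:c:] = [:- a, 1:] * r" by (rule dvdE)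
  ultimately have "p = [:[:- a, 1:]:] * [:r:] + [:[:- c:], 1:] * s" by simp
  then show thesis by (rule that)
qed

lemma ev_X: "ev x y [:[:- a, 1:]:] = x - const a" and ev_Y: "ev x y [:[:- c:], 1:] = y - const c"
  and ev_px: "ev x y [:q:] = hev const x q" and ev_y: "ev x y [:0, 1:] = y"
  by (simp_all add: ev_pCons px_pCons const_minus rhom_1[OF rhom_px])

lemma pv_X: "pv a' c' [:[:- a, 1:]:] = a' - a" and pv_Y: "pv a' c' [:[:- c:], 1:] = c' - c"
  by (simp_all add: pv_pCons)

text \<open>
  Algebraic independence identifies the coordinate ring with a polynomial ring, where the maximal ideal
  and the regularity of the sequence can be computed by division with remainder.
\<close>

lemma plane_pt_point:
  assumes xy: "indep x y"
  shows "regular_point (plane_pt x y a c) (x - const a) (y - const c)"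
    and "x \<in> plane_pt x y a c" "val (plane_pt x y a c) x = a"
    and "y \<in> plane_pt x y a c" "val (plane_pt x y a c) y = c"
    and "\<And>h. h \<in> plane_pt x y a c \<longleftrightarrow> (\<exists>p q. pv a c q \<noteq> 0 \<and> h = ev x y p / ev x y q)"
proof -
  define A where "A = range (ev x y)"
  define e where "e h = pv a c (SOME p. h = ev x y p)" for h
  let ?P = "plane_pt x y a c"
  have inj: "p = q" if "ev x y p = ev x y q" for p q
  proof -
    have "ev x y (p - q) = 0" by (simp add: rhom_diff[OF rhom_ev] that)
    then have "p - q = 0" using xy unfolding indep_def by blast
    then show ?thesis by simp
  qed
  have e: "e (ev x y p) = pv a c p" for p
    unfolding e_def by (metis (mono_tags, lifting) inj someI)
  have evc: "ev x y [:[:k:]:] = const k" and pvc: "pv a c [:[:k:]:] = k" for k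
    by (simp_all add: ev_px pv_pCons px_pCons)
  have eval: "eval_on A e"
    unfolding eval_on_def A_def
    by (auto simp: e rhom_simps[OF rhom_pv] simp flip: rhom_add[OF rhom_ev] rhom_mult[OF rhom_ev] evc)
      (simp_all add: evc pvc)
  have uv: "x - const a = ev x y [:[:- a, 1:]:]" "y - const c = ev x y [:[:- c:], 1:]"
    by (simp_all only: ev_X ev_Y)
  then have uvA: "x - const a \<in> A" "y - const c \<in> A" by (auto simp: A_def)
  have ker: "ideal2 A (x - const a) (y - const c) = {h \<in> A. e h = 0}"
  proof (intro equalityI subsetI)
    fix h assume "h \<in> ideal2 A (x - const a) (y - const c)"
    then obtain r s where "h = ev x y r * ev x y [:[:- a, 1:]:] + ev x y s * ev x y [:[:- c:], 1:]"
      unfolding ideal2_def A_def uv by auto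
    then have h: "h = ev x y (r * [:[:- a, 1:]:] + s * [:[:- c:], 1:])"
      by (simp only: rhom_simps[OF rhom_ev])
    then show "h \<in> {h \<in> A. e h = 0}"
      by (simp add: A_def e rhom_add[OF rhom_pv] rhom_mult[OF rhom_pv] pv_X pv_Y del: mult_pCons_right mult_pCons_left)
  next
    fix h assume "h \<in> {h \<in> A. e h = 0}"
    then obtain p where p: "h = ev x y p" "pv a c p = 0" by (auto simp: A_def e)
    obtain r s where "p = [:[:- a, 1:]:] * r + [:[:- c:], 1:] * s" by (rule pv_kernel[OF p(2)])
    then have "h = ev x y r * (x - const a) + ev x y s * (y - const c)"
      unfolding p(1) by (simp only: rhom_simps[OF rhom_ev] ev_X ev_Y mult.commute)
    then show "h \<in> ideal2 A (x - const a) (y - const c)" by (auto simp: A_def intro: ideal2_memI)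
  qed
  have P: "?P = local_at A (x - const a) (y - const c)"
    by (simp add: plane_pt_def adjoin_adjoin A_def)
  note L = local_at_point[OF eval ker uvA, folded P]
  show mem: "h \<in> ?P \<longleftrightarrow> (\<exists>p q. pv a c q \<noteq> 0 \<and> h = ev x y p / ev x y q)" for h
    unfolding L(4) by (auto simp: A_def e)
  have x: "x = ev x y [:[:0, 1:]:]" and y: "y = ev x y [:0, 1:]"
    by (simp_all add: ev_px ev_y px_pCons)
  show "x \<in> ?P" "val ?P x = a" using L(2)[of x] e[of "[:[:0,1:]:]"] x by (auto simp: A_def pv_pCons)
  show "y \<in> ?P" "val ?P y = c" using L(2)[of y] e[of "[:0,1:]"] y by (auto simp: A_def pv_pCons)
  show "regular_point ?P (x - const a) (y - const c)"
    unfolding regular_point_def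
  proof (intro conjI ballI impI)
    show "closed_point ?P" "max_ideal ?P = ideal2 ?P (x - const a) (y - const c)" using L by auto
    have ne: "ev x y p \<noteq> 0" if "p \<noteq> 0" for p using xy that by (auto simp: indep_def)
    show "x - const a \<noteq> 0" "y - const c \<noteq> 0" unfolding uv by (rule ne; simp)+
    fix p q assume p: "p \<in> ?P" and q: "q \<in> ?P" and pq: "p * (x - const a) = q * (y - const c)"
    obtain f g where fg: "pv a c g \<noteq> 0" "p = ev x y f / ev x y g" using p mem[of p] by blast
    obtain f' g' where fg': "pv a c g' \<noteq> 0" "q = ev x y f' / ev x y g'" using q mem[of q] by blast
    have "g \<noteq> 0" "g' \<noteq> 0" using fg(1) fg'(1) by auto
    then have g0: "ev x y g \<noteq> 0" "ev x y g' \<noteq> 0" using ne by simp_all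
    have "(ev x y f * ev x y g') * (x - const a) = (ev x y f' * ev x y g) * (y - const c)"
      using pq g0 unfolding fg(2) fg'(2) by (simp add: divide_simps mult_ac)
    then have "ev x y (f * g' * [:[:- a, 1:]:]) = ev x y (f' * g * [:[:- c:], 1:])"
      by (simp only: rhom_mult[OF rhom_ev] ev_X ev_Y)
    then have eq: "f * g' * [:[:- a, 1:]:] = f' * g * [:- [:c:], 1:]" using inj by fastforce
    have "poly (f * g' * [:[:- a, 1:]:]) [:c:] = 0" unfolding eq by simp
    moreover have "poly (f * g' * [:[:- a, 1:]:]) [:c:] = poly (f * g') [:c:] * [:- a, 1:]" by simp
    ultimately have "poly (f * g') [:c:] = 0 \<or> [:- a, 1:] = 0" by (metis mult_eq_0_iff)
    then have "poly (f * g') [:c:] = 0" by simp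
    then obtain r where r: "f * g' = [:- [:c:], 1:] * r" using poly_eq_0_iff_dvd by (metis dvdE)
    have "(r * [:[:- a, 1:]:]) * [:- [:c:], 1:] = (f' * g) * [:- [:c:], 1:]"
      using eq unfolding r by (simp only: mult_ac)
    then have r': "f' * g = r * [:[:- a, 1:]:]" by (metis mult_right_cancel one_neq_zero pCons_eq_0_iff)
    define k where "k = ev x y r / ev x y (g * g')"
    have "k \<in> ?P" unfolding mem k_def using fg fg' by (intro exI[of _ r] exI[of _ "g * g'"]) (simp add: rhom_mult[OF rhom_pv])
    moreover have "ev x y f * ev x y g' = (y - const c) * ev x y r"
      using arg_cong[OF r, of "ev x y"] ev_Y[of x y c] by (simp only: rhom_mult[OF rhom_ev]) simp
    then have "p = k * (y - const c)"
      using g0 unfolding fg(2) k_def by (simp add: rhom_mult[OF rhom_ev] field_simps)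
    moreover have "ev x y f' * ev x y g = ev x y r * (x - const a)"
      using arg_cong[OF r', of "ev x y"] by (simp only: rhom_mult[OF rhom_ev] ev_X)
    then have "q = k * (x - const a)"
      using g0 unfolding fg'(2) k_def by (simp add: rhom_mult[OF rhom_ev] field_simps)
    ultimately show "\<exists>r\<in>?P. p = r * (y - const c) \<and> q = r * (x - const a)" by blast
  qed
qed

lemma fhom_simps:
  assumes "fhom \<phi>"
  shows "\<phi> 0 = 0" "\<phi> 1 = 1" "\<phi> (const c) = const c" "\<phi> (a + b) = \<phi> a + \<phi> b" "\<phi> (a * b) = \<phi> a * \<phi> b"
    "\<phi> (a - b) = \<phi> a - \<phi> b" "\<phi> (- a) = - \<phi> a" "\<phi> (a ^ n) = \<phi> a ^ n" "\<phi> (a / b) = \<phi> a / \<phi> b"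
    "\<phi> (inverse a) = inverse (\<phi> a)" "\<phi> a = 0 \<longleftrightarrow> a = 0"
  using assms by (auto simp: fhom_def rhom_simps rhom_divide rhom_inverse rhom_field_eq_0_iff)

lemma fhom_px: "fhom \<phi> \<Longrightarrow> \<phi> (hev const x q) = hev const (\<phi> x) q"
  by (induction q) (simp_all add: fhom_simps px_pCons)

lemma fhom_ev: "fhom \<phi> \<Longrightarrow> \<phi> (ev x y p) = ev (\<phi> x) (\<phi> y) p"
  by (induction p) (simp_all add: ev_pCons fhom_px fhom_simps)

lemma locmap_plane:
  assumes xy: "indep x y" and \<phi>: "fhom \<phi>" and R: "closed_point R"
    and x: "\<phi> x \<in> R" "val R (\<phi> x) = a" and y: "\<phi> y \<in> R" "val R (\<phi> y) = c"
  shows "locmap \<phi> (plane_pt x y a c) R"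
  unfolding locmap_def
proof
  fix h assume "h \<in> plane_pt x y a c"
  note P = plane_pt_point[OF xy, where a = a and c = c]
  note cp = regular_point_cp[OF P(1)]
  obtain p q where pq: "pv a c q \<noteq> 0" "h = ev x y p / ev x y q" using \<open>h \<in> _\<close> P(6) by auto
  have 1: "ev x y p \<in> plane_pt x y a c \<and> val (plane_pt x y a c) (ev x y p) = pv a c p" for p
    using cp_ev[OF cp P(2) P(4)] P(3,5) by simp
  have 2: "\<phi> (ev x y p) \<in> R \<and> val R (\<phi> (ev x y p)) = pv a c p" for p
    using cp_ev[OF R x(1) y(1)] x y by (simp add: fhom_ev[OF \<phi>])
  have 3: "\<phi> h = \<phi> (ev x y p) / \<phi> (ev x y q)" using \<phi> pq by (simp add: fhom_def rhom_divide)
  show "\<phi> h \<in> R \<and> val R (\<phi> h) = val (plane_pt x y a c) h"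
    unfolding 3 unfolding pq(2) using 1[of p] 1[of q] 2[of p] 2[of q] pq(1) R cp by (simp add: cp_simps)
qed

lemma alg_ev: "x \<in> G \<Longrightarrow> y \<in> G \<Longrightarrow> ev x y p \<in> alg G"
proof -
  assume G: "x \<in> G" "y \<in> G"
  have px: "hev const x q \<in> alg G" for q
  proof (induction q)
    case 0 then show ?case using alg_const[of 0 G] by simp
  next
    case (pCons c q) then show ?case using G by (auto simp: px_pCons intro: alg.intros)
  qed
  show "ev x y p \<in> alg G"
  proof (induction p)
    case 0 then show ?case using alg_const[of 0 G] by simp
  next
    case (pCons q p) then show ?case using G px by (auto simp: ev_pCons intro: alg.intros)
  qed
qed

lemma frac_of_plane:
  assumes "indep x y" shows "frac_of {x, y} (plane_pt x y a c)"
proof -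
  note P = plane_pt_point[OF assms, where a = a and c = c]
  note cp = regular_point_cp[OF P(1)]
  have 1: "val (plane_pt x y a c) (ev x y p) = pv a c p" for p
    using cp_ev[OF cp P(2) P(4)] P(3,5) by simp
  show ?thesis unfolding frac_of_def
  proof (intro conjI ballI)
    show "{x, y} \<subseteq> plane_pt x y a c" using P by auto
    fix h assume "h \<in> plane_pt x y a c"
    then obtain p q where "pv a c q \<noteq> 0" "h = ev x y p / ev x y q" using P(6) by auto
    then show "\<exists>f\<in>alg {x, y}. \<exists>g\<in>alg {x, y}. val (plane_pt x y a c) g \<noteq> 0 \<and> h = f / g"
      using 1 by (intro bexI[of _ "ev x y p"] bexI[of _ "ev x y q"] alg_ev) auto
  qed
qed

lemma lies_over_plane:
  assumes "indep x y" "closed_point R"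
  shows "lies_over R (plane_pt x y a c) \<longleftrightarrow> x \<in> R \<and> y \<in> R \<and> val R x = a \<and> val R y = c"
  using locmap_plane[OF assms(1) fhom_id assms(2)] plane_pt_point[OF assms(1), where a = a and c = c] lies_overD by metis

section \<open>Points of the projective plane\<close>

lemma hcoord_nth: "hcoord $ 1 = 1" "hcoord $ 2 = to_fract [:[:0, 1:]:]" "hcoord $ 3 = to_fract [:0, 1:]"
  by (simp_all add: hcoord_def)

lemma lin_altdef: "lin l = const (l $ 1) + const (l $ 2) * hcoord $ 2 + const (l $ 3) * hcoord $ 3"
  by (simp add: lin_def sum_3 hcoord_nth)

lemma dot_altdef: "dot l a = l $ 1 * a $ 1 + l $ 2 * a $ 2 + l $ 3 * a $ 3"
  by (simp add: dot_def sum_3)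

lemma lin_eq_0_iff: "lin l = 0 \<longleftrightarrow> l = 0"
proof -
  have "lin l = to_fract [:[:l $ 1, l $ 2:], [:l $ 3:]:]"
    unfolding lin_altdef hcoord_nth const_def by (simp flip: to_fract_add to_fract_mult)
  then show ?thesis by (simp add: vec_eq_iff forall_3)
qed

lemma lin_simps: "lin (u + v) = lin u + lin v" "lin (k *s u) = const k * lin u" "lin (u - v) = lin u - lin v"
  by (simp_all add: lin_def const_add const_mult const_diff algebra_simps sum.distrib sum_subtractf sum_distrib_left)

lemma lin_axis: "lin (axis i 1) = hcoord $ i"
  by (simp add: lin_def axis_def if_distrib[of const] if_distrib[of "\<lambda>z. z * _"] cong: if_cong)

lemma dot_simps: "dot (u + v) a = dot u a + dot v a" "dot (k *s u) a = k * dot u a" "dot (u - v) a = dot u a - dot v a"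
  "dot u (a + b) = dot u a + dot u b" "dot u (k *s a) = k * dot u a" "dot u (a - b) = dot u a - dot u b"
  "dot u 0 = 0" "dot 0 a = 0"
  by (simp_all add: dot_def algebra_simps sum.distrib sum_subtractf sum_distrib_left)

lemma dot_axis: "dot (axis i 1) a = a $ i"
  by (simp add: dot_def axis_def if_distrib[of "\<lambda>z. z * _"] cong: if_cong)

lemma dot_commute: "dot u a = dot a u"
  by (simp add: dot_def mult.commute)

lemma covector_eqI: "(\<And>a. dot u a = dot v a) \<Longrightarrow> u = v"
  by (metis dot_commute dot_axis vec_eq_iff)

text \<open>
  Linear independence of three covectors, stated through the triviality of their common kernel.
\<close>

definition frame :: "complex ^ 3 \<Rightarrow> complex ^ 3 \<Rightarrow> complex ^ 3 \<Rightarrow> bool" where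
  "frame m l g \<longleftrightarrow> (\<forall>a. dot m a = 0 \<and> dot l a = 0 \<and> dot g a = 0 \<longrightarrow> a = 0)"

lemma frame_swap: "frame m l g \<Longrightarrow> frame l m g" "frame m l g \<Longrightarrow> frame g l m"
  by (auto simp: frame_def)

lemma frame_dual:
  assumes F: "frame m l g"
  obtains p q r where "dot m p = 1" "dot l p = 0" "dot g p = 0" "dot m q = 0" "dot l q = 1" "dot g q = 0"
    "dot m r = 0" "dot l r = 0" "dot g r = 1" "\<And>a. a = dot m a *s p + dot l a *s q + dot g a *s r"
proof -
  define C :: "complex ^ 3 ^ 3" where "C = vector [m, l, g]"
  have C: "(C *v a) $ 1 = dot m a" "(C *v a) $ 2 = dot l a" "(C *v a) $ 3 = dot g a" for a
    by (simp_all add: C_def matrix_vector_mult_def dot_def)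
  have "\<forall>a. C *v a = 0 \<longrightarrow> a = 0"
    using F C unfolding frame_def by (metis zero_index)
  then obtain N where "N ** C = mat 1" using matrix_left_invertible_ker[of C] by blast
  then have "C ** N = mat 1" using matrix_left_right_inverse by blast
  then have CN: "C *v (N *v e) = e" for e by (simp add: matrix_vector_mul_assoc)
  define p q r where "p = N *v axis 1 1" and "q = N *v axis 2 1" and "r = N *v axis 3 1"
  have p: "dot m p = 1" "dot l p = 0" "dot g p = 0"
    using C[of p] CN[of "axis 1 1"] by (simp_all add: p_def axis_def)
  have q: "dot m q = 0" "dot l q = 1" "dot g q = 0"
    using C[of q] CN[of "axis 2 1"] by (simp_all add: q_def axis_def)
  have r: "dot m r = 0" "dot l r = 0" "dot g r = 1"
    using C[of r] CN[of "axis 3 1"] by (simp_all add: r_def axis_def)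
  have "a = dot m a *s p + dot l a *s q + dot g a *s r" for a
  proof -
    have "a - (dot m a *s p + dot l a *s q + dot g a *s r) = 0"
      using F[unfolded frame_def, rule_format, of "a - (dot m a *s p + dot l a *s q + dot g a *s r)"]
      by (simp add: dot_simps p q r)
    then show ?thesis by simp
  qed
  then show thesis using that p q r by blast
qed

lemma frame_nonzero: "frame m l g \<Longrightarrow> m \<noteq> 0" "frame m l g \<Longrightarrow> lin m \<noteq> 0"
proof -
  have "m \<noteq> 0" if "frame m l g"
    by (rule frame_dual[OF that]) (auto simp: dot_simps)
  then show "frame m l g \<Longrightarrow> m \<noteq> 0" "frame m l g \<Longrightarrow> lin m \<noteq> 0" by (auto simp: lin_eq_0_iff)
qed

abbreviation "ss \<equiv> hcoord $ 2"
abbreviation "tt \<equiv> hcoord $ 3"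

lemma ev_coords: "ev ss tt p = to_fract p"
proof -
  have px: "hev const ss q = to_fract [:q:]" for q
  proof (induction q)
    case (pCons c q)
    have "[:pCons c q:] = [:[:c:]:] + [:[:0, 1:]:] * [:q:]" by simp
    then show ?case
      unfolding px_pCons pCons.IH unfolding hcoord_nth const_def[of c] by (simp only: to_fract_add to_fract_mult)
  qed simp
  show ?thesis
  proof (induction p)
    case (pCons q p)
    have "pCons q p = [:q:] + [:0, 1:] * p" by simp
    then show ?case
      unfolding ev_pCons pCons.IH px unfolding hcoord_nth(3) by (simp only: to_fract_add to_fract_mult)
  qed simp
qed

lemma indep_coords: "indep ss tt"
  by (simp add: indep_def ev_coords)

text \<open>
  A relation holds in the local ring of every point of the standard chart at which the denominator \<open>m\<close>
  does not vanish; so the polynomial vanishes outside the zeros of \<open>D\<close>, the image of the line at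
  infinity of that chart.
\<close>

lemma frame_indep:
  assumes F: "frame m l g"
  shows "indep (lin l / lin m) (lin g / lin m)"
  unfolding indep_def
proof (intro allI impI)
  fix p assume p: "ev (lin l / lin m) (lin g / lin m) p = 0"
  obtain v1 v2 v3 where v: "dot m v1 = 1" "dot l v1 = 0" "dot g v1 = 0" "dot m v2 = 0" "dot l v2 = 1" "dot g v2 = 0"
    "dot m v3 = 0" "dot l v3 = 0" "dot g v3 = 1" and ex: "\<And>a. a = dot m a *s v1 + dot l a *s v2 + dot g a *s v3"
    using frame_dual[OF F] by metis
  define D where "D = [:[:v1 $ 1, v2 $ 1:], [:v3 $ 1:]:]"
  have "v1 $ 1 \<noteq> 0 \<or> v2 $ 1 \<noteq> 0 \<or> v3 $ 1 \<noteq> 0"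
    using arg_cong[OF ex[of "axis 1 1"], of "\<lambda>a :: complex ^ 3. a $ 1"] by auto
  then have D0: "D \<noteq> 0" by (auto simp: D_def)
  have "pv a c (p * D) = 0" for a c
  proof (cases "pv a c D = 0")
    case False
    define w where "w = v1 + a *s v2 + c *s v3"
    have w1: "w $ 1 \<noteq> 0" using False by (simp add: w_def D_def pv_pCons mult.commute)
    have w: "dot m w = 1" "dot l w = a" "dot g w = c" by (simp_all add: w_def dot_simps v)
    note P = plane_pt_point[OF indep_coords, where a = "w $ 2 / w $ 1" and c = "w $ 3 / w $ 1"]
    note cp = regular_point_cp[OF P(1)]
    have lin: "lin f \<in> plane_pt ss tt (w $ 2 / w $ 1) (w $ 3 / w $ 1)"
      "val (plane_pt ss tt (w $ 2 / w $ 1) (w $ 3 / w $ 1)) (lin f) = dot f w / w $ 1" for f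
    proof -
      have "val (plane_pt ss tt (w $ 2 / w $ 1) (w $ 3 / w $ 1)) (lin f) = f $ 1 + f $ 2 * (w $ 2 / w $ 1) + f $ 3 * (w $ 3 / w $ 1)"
        using P(2-5) cp by (simp add: lin_altdef cp_simps)
      also have "\<dots> = dot f w / w $ 1" using w1 by (simp add: dot_altdef add_divide_distrib)
      finally show "val (plane_pt ss tt (w $ 2 / w $ 1) (w $ 3 / w $ 1)) (lin f) = dot f w / w $ 1" .
      show "lin f \<in> plane_pt ss tt (w $ 2 / w $ 1) (w $ 3 / w $ 1)"
        using P(2-5) cp by (simp add: lin_altdef cp_simps)
    qed
    have "pv a c p = val (plane_pt ss tt (w $ 2 / w $ 1) (w $ 3 / w $ 1)) (ev (lin l / lin m) (lin g / lin m) p)"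
      using lin w w1 by (subst cp_ev[OF cp]) (simp_all add: cp_simps[OF cp])
    then show ?thesis using p cp by (simp add: cp_simps rhom_mult[OF rhom_pv])
  qed (simp add: rhom_mult[OF rhom_pv])
  then have "p * D = 0" by (rule pv_eq_0_imp)
  then show "p = 0" using D0 by simp
qed

subsection \<open>Forms\<close>

text \<open>
  The symmetric index set makes the shifts of coefficients below mere reindexings.
\<close>

lemma form_altdef:
  "form d c v = (\<Sum>(i, j)\<in>{(i, j). i + j \<le> d}. c i j * (v $ 1) ^ (d - i - j) * (v $ 2) ^ i * (v $ 3) ^ j)"
proof -
  have "(SIGMA i:{..d}. {..d - i}) = {(i, j). i + j \<le> d}" by auto
  then show ?thesis unfolding form_def by (subst sum.Sigma) auto
qed

lemma finite_triangle: "finite {(i, j). i + j \<le> (d::nat)}"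
  by (rule finite_subset[of _ "{..d} \<times> {..d}"]) auto

lemma form_0: "form 0 c v = c 0 0"
  by (simp add: form_def)

lemma form_add: "form d (\<lambda>i j. c i j + c' i j) v = form d c v + form d c' v"
  by (simp add: form_def algebra_simps sum.distrib)

lemma form_cmult: "form d (\<lambda>i j. k * c i j) v = k * form d c v"
  by (simp add: form_def sum_distrib_left mult_ac)

lemma form_scale: "form d c (k *s v) = k ^ d * form d c v"
proof -
  have "c i j * (k * v $ 1) ^ (d - i - j) * (k * v $ 2) ^ i * (k * v $ 3) ^ j
      = k ^ d * (c i j * (v $ 1) ^ (d - i - j) * (v $ 2) ^ i * (v $ 3) ^ j)" if "i + j \<le> d" for i j
  proof -
    have "k ^ d = k ^ (d - i - j) * k ^ i * k ^ j" using that by (simp flip: power_add)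
    then show ?thesis by (simp add: power_mult_distrib mult_ac)
  qed
  then show ?thesis unfolding form_altdef sum_distrib_left by (intro sum.cong) auto
qed

lemma form_shift1: "form (Suc d) (\<lambda>i j. if i + j \<le> d then c i j else 0) v = v $ 1 * form d c v"
  unfolding form_altdef sum_distrib_left
  by (rule sum.mono_neutral_cong_right) (auto simp: finite_triangle Suc_diff_le mult_ac split: if_splits)

lemma form_shift2: "form (Suc d) (\<lambda>i j. if i = 0 then 0 else c (i - 1) j) v = v $ 2 * form d c v"
proof -
  have "v $ 2 * form d c v = (\<Sum>(i, j)\<in>(\<lambda>(i, j). (Suc i, j)) ` {(i, j). i + j \<le> d}.
      (if i = 0 then 0 else c (i - 1) j) * (v $ 1) ^ (Suc d - i - j) * (v $ 2) ^ i * (v $ 3) ^ j)"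
    unfolding form_altdef sum_distrib_left
    by (subst sum.reindex) (auto simp: inj_on_def mult_ac intro!: sum.cong)
  also have "\<dots> = form (Suc d) (\<lambda>i j. if i = 0 then 0 else c (i - 1) j) v"
    unfolding form_altdef
  proof (rule sum.mono_neutral_left[OF finite_triangle])
    show "\<forall>z\<in>{(i, j). i + j \<le> Suc d} - (\<lambda>(i, j). (Suc i, j)) ` {(i, j). i + j \<le> d}.
      (case z of (i, j) \<Rightarrow> (if i = 0 then 0 else c (i - 1) j) * v $ 1 ^ (Suc d - i - j) * v $ 2 ^ i * v $ 3 ^ j) = 0"
    proof
      fix z assume z: "z \<in> {(i, j). i + j \<le> Suc d} - (\<lambda>(i, j). (Suc i, j)) ` {(i, j). i + j \<le> d}"
      obtain i j where ij: "z = (i, j)" by (cases z)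
      then show "(case z of (i, j) \<Rightarrow> (if i = 0 then 0 else c (i - 1) j) * v $ 1 ^ (Suc d - i - j) * v $ 2 ^ i * v $ 3 ^ j) = 0"
        using z by (cases i) (auto simp: image_iff)
    qed
  qed auto
  finally show ?thesis by simp
qed

lemma form_shift3: "form (Suc d) (\<lambda>i j. if j = 0 then 0 else c i (j - 1)) v = v $ 3 * form d c v"
proof -
  have "v $ 3 * form d c v = (\<Sum>(i, j)\<in>(\<lambda>(i, j). (i, Suc j)) ` {(i, j). i + j \<le> d}.
      (if j = 0 then 0 else c i (j - 1)) * (v $ 1) ^ (Suc d - i - j) * (v $ 2) ^ i * (v $ 3) ^ j)"
    unfolding form_altdef sum_distrib_left
    by (subst sum.reindex) (auto simp: inj_on_def mult_ac intro!: sum.cong)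
  also have "\<dots> = form (Suc d) (\<lambda>i j. if j = 0 then 0 else c i (j - 1)) v"
    unfolding form_altdef
  proof (rule sum.mono_neutral_left[OF finite_triangle])
    show "\<forall>z\<in>{(i, j). i + j \<le> Suc d} - (\<lambda>(i, j). (i, Suc j)) ` {(i, j). i + j \<le> d}.
      (case z of (i, j) \<Rightarrow> (if j = 0 then 0 else c i (j - 1)) * v $ 1 ^ (Suc d - i - j) * v $ 2 ^ i * v $ 3 ^ j) = 0"
    proof
      fix z assume z: "z \<in> {(i, j). i + j \<le> Suc d} - (\<lambda>(i, j). (i, Suc j)) ` {(i, j). i + j \<le> d}"
      obtain i j where ij: "z = (i, j)" by (cases z)
      then show "(case z of (i, j) \<Rightarrow> (if j = 0 then 0 else c i (j - 1)) * v $ 1 ^ (Suc d - i - j) * v $ 2 ^ i * v $ 3 ^ j) = 0"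
        using z by (cases j) (auto simp: image_iff)
    qed
  qed auto
  finally show ?thesis by simp
qed

text \<open>
  \<open>h\<close> is a form of degree \<open>d\<close> in the homogeneous coordinates whose value at the vector \<open>a\<close> is \<open>c\<close>.
\<close>

definition hform :: "complex ^ 3 \<Rightarrow> nat \<Rightarrow> ratfun \<Rightarrow> complex \<Rightarrow> bool" where
  "hform a d h c \<longleftrightarrow> (\<exists>f. h = form d (\<lambda>i j. const (f i j)) hcoord \<and> c = form d f a)"

lemma hform_const: "hform a 0 (const k) k"
  unfolding hform_def by (rule exI[of _ "\<lambda>i j. k"]) (simp add: form_0)

lemma hform_add:
  assumes "hform a d h c" "hform a d h' c'" shows "hform a d (h + h') (c + c')"
proof -
  obtain f where "h = form d (\<lambda>i j. const (f i j)) hcoord" "c = form d f a"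
    using assms(1) by (auto simp: hform_def)
  moreover obtain f' where "h' = form d (\<lambda>i j. const (f' i j)) hcoord" "c' = form d f' a"
    using assms(2) by (auto simp: hform_def)
  ultimately show ?thesis
    unfolding hform_def by (intro exI[of _ "\<lambda>i j. f i j + f' i j"]) (simp add: form_add const_add)
qed

lemma hform_cmult:
  assumes "hform a d h c" shows "hform a d (const k * h) (k * c)"
proof -
  obtain f where "h = form d (\<lambda>i j. const (f i j)) hcoord" "c = form d f a" using assms by (auto simp: hform_def)
  then show ?thesis unfolding hform_def by (intro exI[of _ "\<lambda>i j. k * f i j"]) (simp add: form_cmult const_mult)
qed

lemma hform_coord:
  assumes "hform a d h c" shows "hform a (Suc d) (hcoord $ i * h) (a $ i * c)"
proof -
  obtain f where f: "h = form d (\<lambda>i j. const (f i j)) hcoord" "c = form d f a" using assms by (auto simp: hform_def)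
  consider "i = 1" | "i = 2" | "i = 3" using exhaust_3 by blast
  then show ?thesis
  proof cases
    case 1
    show ?thesis unfolding hform_def 1 f form_shift1[symmetric]
      by (rule exI[of _ "\<lambda>i j. if i + j \<le> d then f i j else 0"]) (simp add: if_distrib[of const] cong: if_cong)
  next
    case 2
    show ?thesis unfolding hform_def 2 f form_shift2[symmetric]
      by (rule exI[of _ "\<lambda>i j. if i = 0 then 0 else f (i - 1) j"]) (simp add: if_distrib[of const] cong: if_cong)
  next
    case 3
    show ?thesis unfolding hform_def 3 f form_shift3[symmetric]
      by (rule exI[of _ "\<lambda>i j. if j = 0 then 0 else f i (j - 1)"]) (simp add: if_distrib[of const] cong: if_cong)
  qed
qed

lemma hform_lin:
  assumes "hform a d h c" shows "hform a (Suc d) (lin l * h) (dot l a * c)"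
proof -
  have "hform a (Suc d) (const (l $ 1) * (hcoord $ 1 * h) + const (l $ 2) * (hcoord $ 2 * h) + const (l $ 3) * (hcoord $ 3 * h))
    (l $ 1 * (a $ 1 * c) + l $ 2 * (a $ 2 * c) + l $ 3 * (a $ 3 * c))"
    by (rule hform_add[OF hform_add[OF hform_cmult[OF hform_coord[OF assms]]
          hform_cmult[OF hform_coord[OF assms]]] hform_cmult[OF hform_coord[OF assms]]])
  then show ?thesis by (simp add: lin_altdef dot_altdef hcoord_nth algebra_simps)
qed

lemma hform_lin_power: "hform a k (lin m ^ k) (dot m a ^ k)"
proof (induction k)
  case 0 then show ?case using hform_const[of a 1] by simp
next
  case (Suc k) then show ?case using hform_lin[of a k "lin m ^ k" "dot m a ^ k" m] by simp
qed

lemma clear_denominator: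
  fixes D :: "'a::field"
  assumes "D \<noteq> 0" shows "D ^ Suc k * (c + L / D * h) = D ^ Suc k * c + L * (D ^ k * h)"
  using assms by (simp add: field_simps)

lemma homogenize_px:
  assumes "lin m \<noteq> 0" "dot m a \<noteq> 0"
  shows "\<exists>d. \<forall>e\<ge>d. hform a e (lin m ^ e * hev const (lin l / lin m) q) (dot m a ^ e * poly q (dot l a / dot m a))"
proof (induction q)
  case 0
  have "hform a e (const 0 * lin m ^ e) (0 * dot m a ^ e)" for e by (intro hform_cmult hform_lin_power)
  then show ?case by auto
next
  case (pCons c q)
  then obtain d where d: "hform a e (lin m ^ e * hev const (lin l / lin m) q) (dot m a ^ e * poly q (dot l a / dot m a))"
    if "e \<ge> d" for e by blast
  show ?case
  proof (intro exI[of _ "Suc d"] allI impI)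
    fix e assume "Suc d \<le> e"
    then obtain k where k: "e = Suc k" "d \<le> k" by (cases e) auto
    have "hform a (Suc k) (const c * lin m ^ Suc k + lin l * (lin m ^ k * hev const (lin l / lin m) q))
       (c * dot m a ^ Suc k + dot l a * (dot m a ^ k * poly q (dot l a / dot m a)))"
      by (intro hform_add hform_cmult hform_lin_power hform_lin d k)
    then show "hform a e (lin m ^ e * hev const (lin l / lin m) (pCons c q)) (dot m a ^ e * poly (pCons c q) (dot l a / dot m a))"
      unfolding k px_pCons poly_pCons clear_denominator[OF assms(1)] clear_denominator[OF assms(2)]
      by (simp only: mult.commute[of _ "lin m ^ Suc k"] mult.commute[of _ "dot m a ^ Suc k"])
  qed
qed

text \<open>
  Multiplying by a high power of the linear form \<open>m\<close> turns a polynomial in the affine coordinates into a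
  form. The statement covers all large degrees, so that numerators and denominators can be brought to
  the same degree.
\<close>

lemma homogenize:
  assumes "lin m \<noteq> 0" "dot m a \<noteq> 0"
  shows "\<exists>d. \<forall>e\<ge>d. hform a e (lin m ^ e * ev (lin l / lin m) (lin g / lin m) p) (dot m a ^ e * pv (dot l a / dot m a) (dot g a / dot m a) p)"
proof (induction p)
  case 0
  have "hform a e (const 0 * lin m ^ e) (0 * dot m a ^ e)" for e by (intro hform_cmult hform_lin_power)
  then show ?case by auto
next
  case (pCons q p)
  then obtain d where d: "hform a e (lin m ^ e * ev (lin l / lin m) (lin g / lin m) p) (dot m a ^ e * pv (dot l a / dot m a) (dot g a / dot m a) p)"
    if "e \<ge> d" for e by blast
  obtain d' where d': "hform a e (lin m ^ e * hev const (lin l / lin m) q) (dot m a ^ e * poly q (dot l a / dot m a))"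
    if "e \<ge> d'" for e using homogenize_px[OF assms] by blast
  show ?case
  proof (intro exI[of _ "Suc d + d'"] allI impI)
    fix e assume "Suc d + d' \<le> e"
    then obtain k where k: "e = Suc k" "d \<le> k" "d' \<le> e" by (cases e) auto
    have "hform a (Suc k) (lin m ^ Suc k * hev const (lin l / lin m) q + lin g * (lin m ^ k * ev (lin l / lin m) (lin g / lin m) p))
       (dot m a ^ Suc k * poly q (dot l a / dot m a) + dot g a * (dot m a ^ k * pv (dot l a / dot m a) (dot g a / dot m a) p))"
      unfolding k(1)[symmetric] by (intro hform_add d'[OF k(3)]) (unfold k(1), intro hform_lin d k(2))
    then show "hform a e (lin m ^ e * ev (lin l / lin m) (lin g / lin m) (pCons q p)) (dot m a ^ e * pv (dot l a / dot m a) (dot g a / dot m a) (pCons q p))"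
      unfolding k ev_pCons pv_pCons clear_denominator[OF assms(1)] clear_denominator[OF assms(2)] .
  qed
qed

lemma cp_form:
  fixes V :: "ratfun ^ 3" and b :: "complex ^ 3"
  assumes P: "closed_point P" and V: "\<And>i. V $ i \<in> P" "\<And>i. val P (V $ i) = b $ i"
  shows "form d (\<lambda>i j. const (f i j)) V \<in> P" "val P (form d (\<lambda>i j. const (f i j)) V) = form d f b"
proof -
  have *: "const (f i j) * V $ 1 ^ (d - i - j) * V $ 2 ^ i * V $ 3 ^ j \<in> P"
    "val P (const (f i j) * V $ 1 ^ (d - i - j) * V $ 2 ^ i * V $ 3 ^ j) = f i j * b $ 1 ^ (d - i - j) * b $ 2 ^ i * b $ 3 ^ j" for i j
    using P V by (simp_all add: cp_simps)
  show "form d (\<lambda>i j. const (f i j)) V \<in> P" unfolding form_def using P * by (intro cp_sum) auto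
  show "val P (form d (\<lambda>i j. const (f i j)) V) = form d f b"
    unfolding form_def using P * by (simp add: val_sum cp_sum)
qed

text \<open>
  Dehomogenizing and homogenizing with respect to \<open>m\<close> identifies quotients of forms of equal degree
  with quotients of polynomials in the affine coordinates.
\<close>

lemma pt_chart:
  assumes F: "frame m l g" and a: "dot m a \<noteq> 0"
  shows "pt a = plane_pt (lin l / lin m) (lin g / lin m) (dot l a / dot m a) (dot g a / dot m a)"
proof -
  define X Y where "X = lin l / lin m" and "Y = lin g / lin m"
  define P where "P = plane_pt X Y (dot l a / dot m a) (dot g a / dot m a)"
  have XY: "indep X Y" unfolding X_def Y_def by (rule frame_indep[OF F])
  note PP = plane_pt_point[OF XY, where a = "dot l a / dot m a" and c = "dot g a / dot m a", folded P_def]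
  note cp = regular_point_cp[OF PP(1)]
  have m0: "lin m \<noteq> 0" by (rule frame_nonzero(2)[OF F])
  obtain p q r where ex: "\<And>a. a = dot m a *s p + dot l a *s q + dot g a *s r"
    using frame_dual[OF F] by metis
  define V where "V = (1 / lin m) *s hcoord"
  define b where "b = (1 / dot m a) *s a"
  have "axis i 1 = p $ i *s m + q $ i *s l + r $ i *s g" for i :: 3
    by (rule covector_eqI, subst ex) (simp add: dot_simps dot_axis mult_ac)
  then have "hcoord $ i = const (p $ i) * lin m + const (q $ i) * lin l + const (r $ i) * lin g" for i :: 3
    by (metis lin_simps(1,2) lin_axis)
  then have Vi: "V $ i = const (p $ i) + const (q $ i) * X + const (r $ i) * Y" for i
    using m0 by (simp add: V_def X_def Y_def add_divide_distrib)
  have bi: "b $ i = p $ i + q $ i * (dot l a / dot m a) + r $ i * (dot g a / dot m a)" for i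
  proof -
    have "a $ i = dot m a * p $ i + dot l a * q $ i + dot g a * r $ i"
      using arg_cong[OF ex[of a], of "\<lambda>v :: complex ^ 3. v $ i"] by simp
    then show ?thesis using a by (simp add: b_def add_divide_distrib mult.commute)
  qed
  have V: "V $ i \<in> P" "val P (V $ i) = b $ i" for i
    unfolding Vi bi using PP(2-5) cp by (simp_all add: cp_simps)
  note fV = cp_form[OF cp V]
  have hc: "hcoord = lin m *s V" using m0 by (simp add: V_def)
  have "pt a \<subseteq> P"
  proof
    fix h assume "h \<in> pt a"
    then obtain d f g where h: "h = form d (\<lambda>i j. const (f i j)) hcoord / form d (\<lambda>i j. const (g i j)) hcoord"
      and g: "form d g a \<noteq> 0" by (auto simp: pt_def)
    have "h = form d (\<lambda>i j. const (f i j)) V / form d (\<lambda>i j. const (g i j)) V"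
      unfolding h by (subst (1 2) hc) (use m0 in \<open>simp add: form_scale\<close>)
    moreover have "form d g b \<noteq> 0" unfolding b_def form_scale using g a by simp
    ultimately show "h \<in> P" using fV cp by (simp add: cp_simps)
  qed
  moreover have "P \<subseteq> pt a"
  proof
    fix h assume "h \<in> P"
    then obtain f k where fk: "pv (dot l a / dot m a) (dot g a / dot m a) k \<noteq> 0" "h = ev X Y f / ev X Y k"
      using PP(6)[of h] by blast
    obtain d where d: "\<forall>e\<ge>d. hform a e (lin m ^ e * ev X Y f) (dot m a ^ e * pv (dot l a / dot m a) (dot g a / dot m a) f)"
      using homogenize[OF m0 a] unfolding X_def Y_def by blast
    obtain d' where d': "\<forall>e\<ge>d'. hform a e (lin m ^ e * ev X Y k) (dot m a ^ e * pv (dot l a / dot m a) (dot g a / dot m a) k)"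
      using homogenize[OF m0 a] unfolding X_def Y_def by blast
    define e where "e = max d d'"
    obtain F where F: "lin m ^ e * ev X Y f = form e (\<lambda>i j. const (F i j)) hcoord"
      using d unfolding hform_def e_def by (meson max.cobounded1)
    obtain G where G: "lin m ^ e * ev X Y k = form e (\<lambda>i j. const (G i j)) hcoord"
      "dot m a ^ e * pv (dot l a / dot m a) (dot g a / dot m a) k = form e G a"
      using d' unfolding hform_def e_def by (meson max.cobounded2)
    have "h = form e (\<lambda>i j. const (F i j)) hcoord / form e (\<lambda>i j. const (G i j)) hcoord"
      unfolding fk(2) F[symmetric] G(1)[symmetric] using m0 by simp
    moreover have "form e G a \<noteq> 0" using G(2) fk(1) a by (metis mult_eq_0_iff power_not_zero)
    ultimately show "h \<in> pt a" by (auto simp: pt_def)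
  qed
  ultimately show ?thesis by (auto simp: P_def X_def Y_def)
qed

lemma exists_frame:
  assumes "frame m l g" "a \<noteq> 0"
  obtains m' l' g' where "frame m' l' g'" "dot m' a \<noteq> 0"
proof -
  have "dot m a \<noteq> 0 \<or> dot l a \<noteq> 0 \<or> dot g a \<noteq> 0" using assms by (auto simp: frame_def)
  then show thesis using that assms(1) frame_swap[OF assms(1)] by blast
qed

lemma pt_lin:
  assumes F: "frame m l g" and a: "dot k a \<noteq> 0"
  shows "closed_point (pt a)" "lin f / lin k \<in> pt a" "val (pt a) (lin f / lin k) = dot f a / dot k a"
proof -
  have "a \<noteq> 0" using a by (auto simp: dot_simps)
  then obtain m' l' g' where F': "frame m' l' g'" and m': "dot m' a \<noteq> 0" by (rule exists_frame[OF F])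
  define X Y where "X = lin l' / lin m'" and "Y = lin g' / lin m'"
  have XY: "indep X Y" unfolding X_def Y_def by (rule frame_indep[OF F'])
  have P: "pt a = plane_pt X Y (dot l' a / dot m' a) (dot g' a / dot m' a)"
    unfolding X_def Y_def by (rule pt_chart[OF F' m'])
  note PP = plane_pt_point[OF XY, where a = "dot l' a / dot m' a" and c = "dot g' a / dot m' a", folded P]
  note cp = regular_point_cp[OF PP(1)]
  have m0: "lin m' \<noteq> 0" by (rule frame_nonzero(2)[OF F'])
  obtain p q r where ex: "\<And>a. a = dot m' a *s p + dot l' a *s q + dot g' a *s r"
    using frame_dual[OF F'] by metis
  have cf: "f = dot f p *s m' + dot f q *s l' + dot f r *s g'" for f
    by (rule covector_eqI, subst ex) (simp add: dot_simps mult_ac)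
  have lf: "lin f / lin m' = const (dot f p) + const (dot f q) * X + const (dot f r) * Y" for f
    using m0 by (subst (1) cf) (simp add: lin_simps X_def Y_def add_divide_distrib)
  have df: "dot f a / dot m' a = dot f p + dot f q * (dot l' a / dot m' a) + dot f r * (dot g' a / dot m' a)" for f
    by (subst ex[of a]) (use m' in \<open>simp add: dot_simps add_divide_distrib mult_ac\<close>)
  have l: "lin f / lin m' \<in> pt a" "val (pt a) (lin f / lin m') = dot f a / dot m' a" for f
    unfolding lf[of f] df[of f] using PP(2-5) cp by (simp_all add: cp_simps)
  show "closed_point (pt a)" by (rule cp)
  have e: "lin f / lin k = (lin f / lin m') / (lin k / lin m')" using m0 by simp
  have v: "dot f a / dot k a = (dot f a / dot m' a) / (dot k a / dot m' a)" using m' by simp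
  have "dot k a / dot m' a \<noteq> 0" using a m' by simp
  then have k: "val (pt a) (lin k / lin m') \<noteq> 0" using l(2)[of k] by simp
  show "lin f / lin k \<in> pt a" unfolding e by (rule cp_divide[OF cp l(1) l(1) k])
  show "val (pt a) (lin f / lin k) = dot f a / dot k a"
    unfolding e v val_divide[OF cp l(1) l(1) k] l(2) ..
qed

section \<open>The tower of infinitely near points\<close>

lemma points_blowup:
  assumes "points X" "regular_point P u v" shows "points (blowup X P)"
  using assms exc_point(1)[OF assms(2)] by (auto simp: points_def blowup_def)

text \<open>
  In the application, \<open>x\<close> and \<open>y\<close> are affine coordinates in which the conic is \<open>w = y\<^sup>2\<close>. For \<open>e = \<plusminus>1\<close>, \<open>p e\<close>, \<open>P1 e\<close>, \<open>P2 e\<close> are the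
  three centres over \<open>(e, 0)\<close>. The points of the last exceptional curve are \<open>E e l\<close>, where \<open>l\<close> is the
  value of \<open>z\<close>, and \<open>Einf e\<close>, its intersection with the preceding exceptional curve.
\<close>

locale chart =
  fixes x y :: ratfun
  assumes xy: "indep x y"
begin

definition w :: ratfun where "w = x\<^sup>2 - 1"
definition p :: "complex \<Rightarrow> point" where "p e = plane_pt x y e 0"
definition P1 :: "complex \<Rightarrow> point" where "P1 e = bl (p e) y w 0"
definition P2 :: "complex \<Rightarrow> point" where "P2 e = bl (P1 e) y (w / y) 1"
definition z :: ratfun where "z = (w / y / y - 1) / y"
definition E :: "complex \<Rightarrow> complex \<Rightarrow> point" where "E e l = bl (P2 e) y (w / y / y - 1) l"
definition Einf :: "complex \<Rightarrow> point" where "Einf e = bl (P2 e) (w / y / y - 1) y 0"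

text \<open>
  This will turn out to be Miyanishi's surface.
\<close>

definition surface :: model where
  "surface = {plane_pt x y a c | a c. a\<^sup>2 \<noteq> 1} \<union> {E e t | e t. e\<^sup>2 = 1}"

lemmas plane = plane_pt_point[OF xy]

lemma plane_cp: "closed_point (plane_pt x y a c)"
  using plane(1) by (rule regular_point_cp)

lemma plane_w: "w \<in> plane_pt x y a c" "val (plane_pt x y a c) w = a\<^sup>2 - 1"
  using plane(2,3) plane_cp by (simp_all add: w_def cp_simps)

lemma nonzero: "y \<noteq> 0" "w \<noteq> 0" "w - y\<^sup>2 \<noteq> 0" "x + const e \<noteq> 0" "x - const e \<noteq> 0"
proof -
  have *: "h \<noteq> 0" if "val (plane_pt x y a c) h \<noteq> 0" for h a c
    using that val_0[OF plane_cp] by auto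
  show "y \<noteq> 0" by (rule *[of 0 1]) (simp add: plane(2-5))
  show "w \<noteq> 0" by (rule *[of 0 1]) (simp add: plane_w)
  show "w - y\<^sup>2 \<noteq> 0" by (rule *[of 0 0]) (simp add: plane(2-5) plane_w plane_cp cp_simps)
  show "x + const e \<noteq> 0" by (rule *[of "1 - e" 0]) (simp add: plane(2-5) plane_cp cp_simps)
  show "x - const e \<noteq> 0" by (rule *[of "1 + e" 0]) (simp add: plane(2-5) plane_cp cp_simps)
qed

context
  fixes e :: complex assumes e: "e\<^sup>2 = 1"
begin

lemma e_nz: "e \<noteq> 0" "e + e \<noteq> 0"
  using e by auto

lemma w_factor: "w = (x + const e) * (x - const e)"
proof -
  have "const e * const e = 1" using e by (simp add: power2_eq_square flip: const_mult)
  then show ?thesis by (simp add: w_def power2_eq_square algebra_simps)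
qed

lemma reg_p: "regular_point (p e) y w"
proof (rule regular_point_change[of "p e" "x - const e" "y - const 0" 0 1 "x + const e" 0])
  note P = plane[where a = e and c = 0, folded p_def]
  note cp = regular_point_cp[OF P(1)]
  show "regular_point (p e) (x - const e) (y - const 0)" by (rule P(1))
  show "0 \<in> p e" "1 \<in> p e" "x + const e \<in> p e" "0 \<in> p e" using P(2) cp by (simp_all add: cp_simps)
  show "val (p e) (0 * 0 - 1 * (x + const e)) \<noteq> 0"
    using P(2,3) cp e_nz by (simp add: cp_simps)
  show "w = (x + const e) * (x - const e) + 0 * (y - const 0)" by (simp add: w_factor)
qed simp

lemma reg_P1: "regular_point (P1 e) y (w / y)"
  using bl_point(1)[OF reg_p, of 0] by (simp add: P1_def)

lemma reg_P2: "regular_point (P2 e) y (w / y / y - 1)"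
  using bl_point(1)[OF reg_P1, of 1] by (simp add: P2_def)

lemma reg_E: "regular_point (E e l) y (z - const l)"
  using bl_point(1)[OF reg_P2, of l] by (simp add: E_def z_def)

lemma P1_over: "lies_over (P1 e) (p e)" "w / y \<in> P1 e" "val (P1 e) (w / y) = 0"
  using bl_lies_over[OF reg_p] bl_point(4,5)[OF reg_p] by (auto simp: P1_def)

lemma P2_over: "lies_over (P2 e) (P1 e)" "w / y / y \<in> P2 e" "val (P2 e) (w / y / y) = 1"
  using bl_lies_over[OF reg_P1] bl_point(4,5)[OF reg_P1] by (auto simp: P2_def)

lemma over_p:
  assumes "lies_over R (p e)"
  shows "x \<in> R" "val R x = e" "y \<in> R" "val R y = 0"
  using lies_overD[OF assms] plane[where a = e and c = 0, folded p_def] by auto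

lemma over_P1:
  assumes "lies_over R (P1 e)"
  shows "x \<in> R" "val R x = e" "y \<in> R" "val R y = 0" "w / y \<in> R" "val R (w / y) = 0"
  using over_p[OF lies_over_trans[OF assms P1_over(1)]] lies_overD[OF assms P1_over(2)] P1_over(3) by auto

lemma over_P2:
  assumes "lies_over R (P2 e)"
  shows "x \<in> R" "val R x = e" "y \<in> R" "val R y = 0" "w / y \<in> R" "val R (w / y) = 0"
    "w / y / y \<in> R" "val R (w / y / y) = 1"
  using over_P1[OF lies_over_trans[OF assms P2_over(1)]] lies_overD[OF assms P2_over(2)] P2_over(3) by auto

lemma E_point:
  shows "closed_point (E e l)" "lies_over (E e l) (P2 e)" "z \<in> E e l" "val (E e l) z = l"
  using regular_point_cp[OF reg_E] bl_lies_over[OF reg_P2] bl_point(4,5)[OF reg_P2]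
  by (auto simp: E_def z_def)

lemmas E_vals = over_P2[OF E_point(2)]

lemma exc_p: "R \<in> exc (p e) \<Longrightarrow> closed_point R" "R \<in> exc (p e) \<Longrightarrow> lies_over R (p e)"
    "R \<in> exc (p e) \<Longrightarrow> w / y \<in> R \<Longrightarrow> val R (w / y) = 0 \<Longrightarrow> R = P1 e"
  using exc_point[OF reg_p, of R] by (auto simp: P1_def)

lemma exc_P1: "R \<in> exc (P1 e) \<Longrightarrow> closed_point R" "R \<in> exc (P1 e) \<Longrightarrow> lies_over R (P1 e)"
    "R \<in> exc (P1 e) \<Longrightarrow> w / y / y \<in> R \<Longrightarrow> val R (w / y / y) = 1 \<Longrightarrow> R = P2 e"
  using exc_point[OF reg_P1, of R] by (auto simp: P2_def)

lemma exc_P2: "R \<in> exc (P2 e) \<Longrightarrow> closed_point R" "R \<in> exc (P2 e) \<Longrightarrow> lies_over R (P2 e)"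
    "R \<in> exc (P2 e) \<longleftrightarrow> (\<exists>l. R = E e l) \<or> R = Einf e"
  using exc_point[OF reg_P2, of R] exc_cases[OF reg_P2, of R] by (auto simp: E_def Einf_def)

lemma frac_P2: "frac_of {w / y / y, w / y, x, y} (P2 e)"
  using frac_of_bl[OF reg_P1 frac_of_bl[OF reg_p frac_of_plane[OF xy, of e 0, folded p_def], of 0, folded P1_def], of 1, folded P2_def] .

lemma frac_E: "frac_of {z, w / y / y, w / y, x, y} (E e l)"
  using frac_of_bl[OF reg_P2 frac_P2, of l] by (simp add: E_def z_def)

text \<open>
  The preceding exceptional curve passes through \<open>Einf e\<close>, so all functions regular at \<open>Einf e\<close> are
  regular at most of its points \<open>w / y\<^sup>2 = 1 + \<mu>\<close>. The restrictions of the generators of the coordinate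
  ring to this curve are polynomials in \<open>\<mu>\<close>.
\<close>

lemma Einf_limit:
  assumes "finite H" "H \<subseteq> Einf e"
  shows "\<exists>\<mu>. \<mu> \<noteq> 0 \<and> H \<subseteq> bl (P1 e) y (w / y) (1 + \<mu>)"
proof -
  define G where "G = {y / (w / y / y - 1), w / y / y, w / y, x, y}"
  note reg_P2' = regular_point_commute[OF reg_P2]
  have fr: "frac_of G (Einf e)"
    using frac_of_bl[OF reg_P2' frac_P2, of 0] by (simp add: Einf_def G_def)
  have cI: "closed_point (Einf e)" using regular_point_cp[OF bl_point(1)[OF reg_P2']] by (simp add: Einf_def)
  have oI: "lies_over (Einf e) (P2 e)" using bl_lies_over[OF reg_P2'] by (simp add: Einf_def)
  have yI: "y / (w / y / y - 1) \<in> Einf e" "val (Einf e) (y / (w / y / y - 1)) = 0"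
    using bl_point(4,5)[OF reg_P2', of 0] by (auto simp: Einf_def)
  define R where "R \<mu> = bl (P1 e) y (w / y) (1 + \<mu>)" for \<mu>
  have cR: "closed_point (R \<mu>)" for \<mu> using regular_point_cp[OF bl_point(1)[OF reg_P1]] by (simp add: R_def)
  have oR: "lies_over (R \<mu>) (P1 e)" for \<mu> using bl_lies_over[OF reg_P1] by (simp add: R_def)
  have vR: "w / y / y \<in> R \<mu>" "val (R \<mu>) (w / y / y) = 1 + \<mu>" for \<mu>
    using bl_point(4,5)[OF reg_P1] by (auto simp: R_def)
  have key: "g \<in> alg G \<Longrightarrow> g \<in> Einf e \<and> (\<exists>q. val (Einf e) g = poly q 0 \<and> (\<forall>\<mu>. \<mu> \<noteq> 0 \<longrightarrow> g \<in> R \<mu> \<and> val (R \<mu>) g = poly q \<mu>))" for g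
  proof (induction rule: alg.induct)
    case (alg_const c)
    show ?case using cI cR by (intro conjI exI[of _ "[:c:]"]) (simp_all add: cp_simps)
  next
    case (alg_gen g)
    have yR: "y / (w / y / y - 1) \<in> R \<mu>" "val (R \<mu>) (y / (w / y / y - 1)) = 0" if "\<mu> \<noteq> 0" for \<mu>
    proof -
      have "w / y / y - 1 \<in> R \<mu>" "val (R \<mu>) (w / y / y - 1) = \<mu>"
        using vR[of \<mu>] cR by (simp_all add: cp_simps)
      then show "y / (w / y / y - 1) \<in> R \<mu>" "val (R \<mu>) (y / (w / y / y - 1)) = 0"
        using over_P1(3,4)[OF oR, of \<mu>] that cp_divide[OF cR] val_divide[OF cR] by auto
    qed
    note I = over_P2[OF oI] yI and RR = over_P1[OF oR] vR yR
    consider "g = y / (w / y / y - 1)" | "g = w / y / y" | "g = w / y" | "g = x" | "g = y"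
      using alg_gen by (auto simp: G_def)
    then show ?case
    proof cases
      case 1 show ?thesis unfolding 1 using I RR by (intro conjI exI[of _ "0"]) auto
    next
      case 2 show ?thesis unfolding 2 using I RR by (intro conjI exI[of _ "[:1, 1:]"]) auto
    next
      case 3 show ?thesis unfolding 3 using I RR by (intro conjI exI[of _ "0"]) auto
    next
      case 4 show ?thesis unfolding 4 using I RR by (intro conjI exI[of _ "[:e:]"]) auto
    next
      case 5 show ?thesis unfolding 5 using I RR by (intro conjI exI[of _ "0"]) auto
    qed
  next
    case (alg_add a b)
    then obtain q r where "val (Einf e) a = poly q 0" "\<forall>\<mu>. \<mu> \<noteq> 0 \<longrightarrow> a \<in> R \<mu> \<and> val (R \<mu>) a = poly q \<mu>"
      "val (Einf e) b = poly r 0" "\<forall>\<mu>. \<mu> \<noteq> 0 \<longrightarrow> b \<in> R \<mu> \<and> val (R \<mu>) b = poly r \<mu>" by blast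
    then show ?case using alg_add.IH cI cR by (intro conjI exI[of _ "q + r"]) (simp_all add: cp_simps)
  next
    case (alg_mult a b)
    then obtain q r where "val (Einf e) a = poly q 0" "\<forall>\<mu>. \<mu> \<noteq> 0 \<longrightarrow> a \<in> R \<mu> \<and> val (R \<mu>) a = poly q \<mu>"
      "val (Einf e) b = poly r 0" "\<forall>\<mu>. \<mu> \<noteq> 0 \<longrightarrow> b \<in> R \<mu> \<and> val (R \<mu>) b = poly r \<mu>" by blast
    then show ?case using alg_mult.IH cI cR by (intro conjI exI[of _ "q * r"]) (simp_all add: cp_simps)
  qed
  \<comment> \<open>The product of the restrictions of the denominators; it does not vanish at \<open>\<mu> = 0\<close>, hence is nonzero.\<close>
  have "\<exists>q. q \<noteq> 0 \<and> (\<forall>\<mu>. \<mu> \<noteq> 0 \<and> poly q \<mu> \<noteq> 0 \<longrightarrow> H \<subseteq> R \<mu>)"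
    using assms
  proof (induction H)
    case empty
    show ?case by (intro exI[of _ 1]) simp
  next
    case (insert h H)
    then obtain q where q: "q \<noteq> 0" "\<forall>\<mu>. \<mu> \<noteq> 0 \<and> poly q \<mu> \<noteq> 0 \<longrightarrow> H \<subseteq> R \<mu>" by auto
    obtain f k where fk: "f \<in> alg G" "k \<in> alg G" "val (Einf e) k \<noteq> 0" "h = f / k"
      using fr insert.prems unfolding frac_of_def by blast
    obtain s where s: "val (Einf e) k = poly s 0" "\<forall>\<mu>. \<mu> \<noteq> 0 \<longrightarrow> k \<in> R \<mu> \<and> val (R \<mu>) k = poly s \<mu>"
      using key[OF fk(2)] by blast
    have f: "f \<in> R \<mu>" if "\<mu> \<noteq> 0" for \<mu> using key[OF fk(1)] that by blast
    have "s \<noteq> 0" using s fk by auto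
    moreover have "insert h H \<subseteq> R \<mu>" if "\<mu> \<noteq> 0" "poly (q * s) \<mu> \<noteq> 0" for \<mu>
    proof -
      have "h \<in> R \<mu>" unfolding fk(4) using f s(2) that cp_divide[OF cR] by auto
      then show ?thesis using q(2) that by simp
    qed
    ultimately show ?case using q(1) by (intro exI[of _ "q * s"]) simp
  qed
  then obtain q where q: "q \<noteq> 0" "\<And>\<mu>. \<mu> \<noteq> 0 \<Longrightarrow> poly q \<mu> \<noteq> 0 \<Longrightarrow> H \<subseteq> R \<mu>" by blast
  have "finite {\<mu>. poly (q * [:0, 1:]) \<mu> = 0}" using q(1) by (intro poly_roots_finite) simp
  then obtain \<mu> :: complex where "\<mu> \<notin> {\<mu>. poly (q * [:0, 1:]) \<mu> = 0}"
    using ex_new_if_finite infinite_UNIV_char_0 by blast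
  then show ?thesis using q(2)[of \<mu>] by (auto simp: R_def)
qed

end

subsection \<open>The infinitely near points of a conic\<close>

text \<open>
  In the part of the model where \<open>x\<close>, \<open>y\<close> are regular and \<open>x \<noteq> -e\<close>, nothing has been blown up yet.
\<close>

definition planar :: "model \<Rightarrow> complex \<Rightarrow> bool" where
  "planar X e \<longleftrightarrow> (\<forall>R\<in>X. x \<in> R \<and> y \<in> R \<and> inverse (x + const e) \<in> R \<longrightarrow> (\<exists>a c. R = plane_pt x y a c))"

text \<open>
  The equation \<open>w - y\<^sup>2\<close> of the conic is nowhere a unit on \<open>Z\<close>, as long as \<open>x\<close> and \<open>y\<close> are regular. This
  condition is closed in every model, and so it passes to proper transforms.
\<close>

definition on_conic :: "model \<Rightarrow> bool" where
  "on_conic Z \<longleftrightarrow> (\<forall>R\<in>Z. \<not> (x \<in> R \<and> y \<in> R \<and> inverse (w - y\<^sup>2) \<in> R))"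

lemma on_conic_closure:
  assumes "points X" "on_conic Z" shows "on_conic (zariski X closure_of Z)"
  unfolding on_conic_def
proof (intro ballI notI)
  fix R assume "R \<in> zariski X closure_of Z" and "x \<in> R \<and> y \<in> R \<and> inverse (w - y\<^sup>2) \<in> R"
  then obtain Q where "Q \<in> Z" "{x, y, inverse (w - y\<^sup>2)} \<subseteq> Q"
    using zariski_closure[OF assms(1), of R Z] by (elim iffE impE) (auto dest: spec[of _ "{x, y, inverse (w - y\<^sup>2)}"])
  then show False using assms(2) by (auto simp: on_conic_def)
qed

text \<open>
  If \<open>y\<close>, \<open>w\<close> or \<open>y\<^sup>2\<close> is a multiple of the equation of the conic, then it vanishes on the conic, which
  leaves only the two points with \<open>y = 0\<close>; one of them is excluded by \<open>x \<noteq> - e\<close>.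
\<close>

lemma conic_point:
  assumes e: "e\<^sup>2 = 1" and X: "planar X e" and Q: "Q \<in> X" "on_conic {Q}"
    and H: "{x, y, inverse (x + const e), h} \<subseteq> Q" and h: "h * (w - y\<^sup>2) = k" and k: "k = y \<or> k = w \<or> k = y\<^sup>2"
  shows "Q = p e"
proof -
  obtain a c where Qac: "Q = plane_pt x y a c" using X Q H by (auto simp: planar_def)
  have cp: "closed_point Q" unfolding Qac by (rule plane_cp)
  note P = plane[where a = a and c = c, folded Qac] and W = plane_w[where a = a and c = c, folded Qac]
  have wy: "w - y\<^sup>2 \<in> Q" "val Q (w - y\<^sup>2) = a\<^sup>2 - 1 - c\<^sup>2" using P(2-5) W cp by (simp_all add: cp_simps)
  have "inverse (w - y\<^sup>2) \<notin> Q" using Q(2) H by (auto simp: on_conic_def)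
  then have 0: "a\<^sup>2 - 1 - c\<^sup>2 = 0" using cp_inverse[OF cp wy(1)] wy(2) by auto
  have "val Q k = 0" unfolding h[symmetric] using val_mult[OF cp _ wy(1), of h] H wy(2) 0 by simp
  then have c: "c = 0" "a\<^sup>2 = 1" using k P(2-5) W cp 0 by (auto simp: cp_simps)
  have "val Q (x + const e) \<noteq> 0"
    using val_reciprocal[OF cp, of "x + const e"] H P(2) cp nonzero(4) by (auto simp: cp_simps)
  then have "a + e \<noteq> 0" using P(2,3) cp by (simp add: cp_simps)
  moreover have "(a + e) * (a - e) = 0" using c e by (simp add: power2_eq_square algebra_simps)
  ultimately have "a = e" by simp
  then show ?thesis using c Qac by (simp add: p_def)
qed

text \<open>
  At any other point of the exceptional curve the equation \<open>w - y\<^sup>2\<close> of the conic is a unit times \<open>y\<close>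
  or \<open>w\<close>, that is, times an equation of the exceptional curve. By \<open>conic_point\<close> the conic stays away
  from a neighbourhood of such a point.
\<close>

lemma near_point1:
  assumes e: "e\<^sup>2 = 1" and pts: "points X" and X: "planar X e" and Z: "Z \<subseteq> X" "on_conic Z"
    and R: "R \<in> zariski (blowup X (p e)) closure_of (Z - {p e})" "R \<in> exc (p e)"
  shows "R = P1 e"
proof (rule ccontr)
  assume ne: "R \<noteq> P1 e"
  note reg = reg_p[OF e]
  have cp: "closed_point R" and over: "lies_over R (p e)" using exc_p[OF e] R by auto
  note xy = over_p[OF e over]
  have "\<exists>h\<in>R. h * (w - y\<^sup>2) = y \<or> h * (w - y\<^sup>2) = w"
  proof (cases "w / y \<in> R")
    case True
    then have "val R (w / y) \<noteq> 0" using exc_p(3)[OF e R(2)] ne by auto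
    then have "val R (w / y - y) \<noteq> 0" "w / y - y \<in> R" using True xy cp by (simp_all add: cp_simps)
    then have "inverse (w / y - y) \<in> R" "w / y - y \<noteq> 0" using cp by (auto simp: cp_simps)
    moreover have "w - y\<^sup>2 = y * (w / y - y)" using nonzero by (simp add: field_simps power2_eq_square)
    ultimately show ?thesis by (intro bexI[of _ "inverse (w / y - y)"]) auto
  next
    case False
    then have "R = bl (p e) w y 0"
      using exc_cases[OF reg, of R] R(2) bl_point(4)[OF reg] by auto
    then have yw: "y / w \<in> R" using bl_point(4)[OF regular_point_commute[OF reg]] by simp
    then have "val R (1 - y * (y / w)) \<noteq> 0" "1 - y * (y / w) \<in> R"
      using xy cp by (simp_all add: cp_simps del: times_divide_eq_right)
    then have "inverse (1 - y * (y / w)) \<in> R" "1 - y * (y / w) \<noteq> 0" using cp by (auto simp: cp_simps)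
    moreover have "w - y\<^sup>2 = w * (1 - y * (y / w))" using nonzero by (simp add: field_simps power2_eq_square)
    ultimately show ?thesis by (intro bexI[of _ "inverse (1 - y * (y / w))"]) auto
  qed
  then obtain h where h: "h \<in> R" "h * (w - y\<^sup>2) = y \<or> h * (w - y\<^sup>2) = w" by blast
  have "val R (x + const e) \<noteq> 0" using xy cp e_nz[OF e] by (simp add: cp_simps)
  then have "inverse (x + const e) \<in> R" using xy cp by (simp add: cp_simps)
  then have "{x, y, inverse (x + const e), h} \<subseteq> R" using h xy by auto
  then obtain Q where Q: "Q \<in> Z - {p e}" "{x, y, inverse (x + const e), h} \<subseteq> Q"
    using R(1) zariski_closure[OF points_blowup[OF pts reg]] by (metis IntD1 finite.emptyI finite.insertI)
  then have "on_conic {Q}" "Q \<in> X" using Z by (auto simp: on_conic_def)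
  then have "Q = p e" using conic_point[OF e X _ _ Q(2) refl] h(2) by blast
  then show False using Q by simp
qed

text \<open>
  As before; on the second exceptional curve, \<open>w - y\<^sup>2\<close> is a unit times \<open>y\<^sup>2\<close> or \<open>w\<close>, except where
  \<open>w / y\<^sup>2 = 1\<close>.
\<close>

lemma near_point2:
  assumes e: "e\<^sup>2 = 1" and pts: "points X" and X: "planar X e" and Z: "Z \<subseteq> X" "on_conic Z"
    and Z1: "Z1 = zariski (blowup X (p e)) closure_of (Z - {p e})"
    and R: "R \<in> zariski (blowup (blowup X (p e)) (P1 e)) closure_of (Z1 - {P1 e})" "R \<in> exc (P1 e)"
  shows "R = P2 e"
proof (rule ccontr)
  assume ne: "R \<noteq> P2 e"
  note reg = reg_P1[OF e]
  have cp: "closed_point R" and over: "lies_over R (P1 e)" using exc_P1[OF e] R by auto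
  note xy = over_P1[OF e over]
  have "\<exists>h\<in>R. h * (w - y\<^sup>2) = y\<^sup>2 \<or> h * (w - y\<^sup>2) = w"
  proof (cases "w / y / y \<in> R")
    case True
    then have "val R (w / y / y) \<noteq> 1" using exc_P1(3)[OF e R(2)] ne by auto
    then have "val R (w / y / y - 1) \<noteq> 0" "w / y / y - 1 \<in> R" using True cp val_diff[OF cp True cp_1[OF cp]] by (simp_all add: cp_simps)
    then have "inverse (w / y / y - 1) \<in> R" "w / y / y - 1 \<noteq> 0" using cp by (auto simp: cp_simps)
    moreover have "w - y\<^sup>2 = y\<^sup>2 * (w / y / y - 1)" using nonzero by (simp add: field_simps power2_eq_square)
    ultimately show ?thesis by (intro bexI[of _ "inverse (w / y / y - 1)"]) auto
  next
    case False
    then have "R = bl (P1 e) (w / y) y 0"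
      using exc_cases[OF reg, of R] R(2) bl_point(4)[OF reg] by auto
    then have yw: "y / (w / y) \<in> R" "val R (y / (w / y)) = 0" using bl_point(4,5)[OF regular_point_commute[OF reg]] by simp_all
    then have "val R (1 - y / (w / y)) \<noteq> 0" "1 - y / (w / y) \<in> R"
      using val_diff[OF cp cp_1[OF cp] yw(1)] cp_diff[OF cp cp_1[OF cp] yw(1)] cp by (simp_all add: cp_simps)
    then have "inverse (1 - y / (w / y)) \<in> R" "1 - y / (w / y) \<noteq> 0" using cp cp_inverse by (auto simp: cp_simps)
    moreover have "w - y\<^sup>2 = w * (1 - y / (w / y))" using nonzero by (simp add: field_simps power2_eq_square)
    ultimately show ?thesis by (intro bexI[of _ "inverse (1 - y / (w / y))"]) auto
  qed
  then obtain h where h: "h \<in> R" "h * (w - y\<^sup>2) = y\<^sup>2 \<or> h * (w - y\<^sup>2) = w" by blast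
  have "val R (x + const e) \<noteq> 0" using xy cp e_nz[OF e] by (simp add: cp_simps)
  then have "inverse (x + const e) \<in> R" using xy cp by (simp add: cp_simps)
  then have "{x, y, inverse (x + const e), h} \<subseteq> R" using h xy by auto
  moreover note pts1 = points_blowup[OF pts reg_p[OF e]]
  ultimately obtain Q where Q: "Q \<in> Z1 - {P1 e}" "{x, y, inverse (x + const e), h} \<subseteq> Q"
    using R(1) zariski_closure[OF points_blowup[OF pts1 reg]] by (metis IntD1 finite.emptyI finite.insertI)
  have "on_conic Z1" unfolding Z1 using Z(2) by (intro on_conic_closure[OF pts1]) (auto simp: on_conic_def)
  then have Qc: "on_conic {Q}" using Q by (auto simp: on_conic_def)
  have "Q \<in> blowup X (p e)" using Q Z1 zariski_closure[OF pts1] by blast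
  then consider "Q \<in> X - {p e}" | "Q \<in> exc (p e)" by (auto simp: blowup_def)
  then show False
  proof cases
    case 1
    then show False using conic_point[OF e X _ Qc Q(2) refl] h(2) by blast
  next
    case 2
    then show False using near_point1[OF e pts X Z, of Q] Q Z1 by auto
  qed
qed

end

section \<open>Coordinates adapted to the conic\<close>

lemma frame_axes: "frame (axis 1 1) (axis 2 1) (axis 3 1)"
  by (simp add: frame_def dot_axis vec_eq_iff forall_3)

lemma pt_closed: "a \<noteq> 0 \<Longrightarrow> closed_point (pt a)"
proof -
  assume "a \<noteq> 0"
  then obtain m l g where "frame m l g" "dot m a \<noteq> 0" by (rule exists_frame[OF frame_axes])
  then show ?thesis by (rule pt_lin(1))
qed

text \<open>
  The values of the quotients of the coordinates recover the point.
\<close>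

lemma pt_eqD:
  assumes a: "a \<noteq> 0" and b: "b \<noteq> 0" and eq: "pt a = pt b"
  obtains c where "c \<noteq> 0" "b = c *s a"
proof -
  note cp = pt_closed[OF a]
  note L = pt_lin[OF frame_axes]
  obtain i where i: "a $ i \<noteq> 0" using a by (auto simp: vec_eq_iff)
  have bi: "b $ i \<noteq> 0"
  proof
    assume "b $ i = 0"
    obtain j where j: "b $ j \<noteq> 0" using b by (auto simp: vec_eq_iff)
    have "lin (axis i 1) / lin (axis j 1) \<in> pt a" "val (pt a) (lin (axis i 1) / lin (axis j 1)) = 0"
      using L(2,3)[of "axis j 1" b "axis i 1"] j \<open>b $ i = 0\<close> eq by (simp_all add: dot_axis)
    moreover have "inverse (lin (axis i 1) / lin (axis j 1)) \<in> pt a"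
      using L(2)[of "axis i 1" a "axis j 1"] i by (simp add: dot_axis)
    moreover have "lin (axis i 1) / lin (axis j 1) \<noteq> 0" by (simp add: lin_eq_0_iff axis_eq_0_iff)
    ultimately show False using val_reciprocal[OF cp] by blast
  qed
  have "a $ j / a $ i = b $ j / b $ i" for j
    using L(3)[of "axis i 1" a "axis j 1"] L(3)[of "axis i 1" b "axis j 1"] i bi eq by (simp add: dot_axis)
  then have "b = (b $ i / a $ i) *s a" using i bi by (simp add: vec_eq_iff field_simps)
  then show thesis using that[of "b $ i / a $ i"] i bi by simp
qed

lemma pt_in_line:
  assumes a: "a \<noteq> 0" shows "pt a \<in> line k \<longleftrightarrow> dot k a = 0"
proof
  assume "pt a \<in> line k"
  then obtain b where b: "b \<noteq> 0" "dot k b = 0" "pt a = pt b" unfolding line_def by blast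
  obtain c where "c \<noteq> 0" "b = c *s a" by (rule pt_eqD[OF a b(1,3)])
  then show "dot k a = 0" using b by (simp add: dot_simps)
next
  assume "dot k a = 0"
  then show "pt a \<in> line k" using a unfolding line_def by blast
qed

lemma line_eqD:
  assumes "line u = line v" "v \<noteq> 0"
  obtains k where "k \<noteq> 0" "u = k *s v"
proof -
  have ker: "dot u a = 0 \<longleftrightarrow> dot v a = 0" for a
    using pt_in_line[of a u] pt_in_line[of a v] assms(1) by (cases "a = 0") (auto simp: dot_simps)
  obtain a where a: "dot v a \<noteq> 0" using assms(2) covector_eqI[of v 0] by (auto simp: dot_simps)
  define k where "k = dot u a / dot v a"
  have "dot u b = dot (k *s v) b" for b
  proof -
    have "dot v (b - (dot v b / dot v a) *s a) = 0" using a by (simp add: dot_simps)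
    then have "dot u (b - (dot v b / dot v a) *s a) = 0" using ker by simp
    then show ?thesis by (simp add: dot_simps k_def)
  qed
  then have "u = k *s v" by (rule covector_eqI)
  moreover have "k \<noteq> 0" using ker a by (simp add: k_def)
  ultimately show thesis using that by blast
qed

lemma dot_mult_sym:
  assumes "transpose M = M" shows "dot u (M *v v) = dot v (M *v u)"
proof -
  have M: "M $ i $ j = M $ j $ i" for i j     using arg_cong[OF assms, of "\<lambda>N. N $ j $ i"] by (simp add: transpose_def)
  have "dot u (M *v v) = (\<Sum>i\<in>UNIV. \<Sum>j\<in>UNIV. u $ i * (M $ i $ j * v $ j))"
    by (simp add: dot_def matrix_vector_mult_def sum_distrib_left)
  also have "\<dots> = (\<Sum>j\<in>UNIV. \<Sum>i\<in>UNIV. u $ i * (M $ i $ j * v $ j))" by (rule sum.swap)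
  also have "\<dots> = (\<Sum>j\<in>UNIV. \<Sum>i\<in>UNIV. v $ j * (M $ j $ i * u $ i))"
    by (intro sum.cong) (auto simp: M mult_ac)
  also have "\<dots> = dot v (M *v u)" by (simp add: dot_def matrix_vector_mult_def sum_distrib_left)
  finally show ?thesis .
qed

lemma frame_of_basis:
  assumes "\<And>\<alpha> \<beta> \<gamma>. \<alpha> *s a + \<beta> *s b + \<gamma> *s c = 0 \<Longrightarrow> \<alpha> = 0 \<and> \<beta> = 0 \<and> \<gamma> = 0"
  shows "frame a b c"
proof -
  define C :: "complex ^ 3 ^ 3" where "C = vector [a, b, c]"
  have T: "transpose C *v u = u $ 1 *s a + u $ 2 *s b + u $ 3 *s c" for u
    by (simp add: vec_eq_iff C_def matrix_vector_mult_def transpose_def sum_3 mult.commute)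
  have "\<forall>u. transpose C *v u = 0 \<longrightarrow> u = 0"
  proof (intro allI impI)
    fix u assume "transpose C *v u = 0"
    then have "u $ 1 = 0 \<and> u $ 2 = 0 \<and> u $ 3 = 0" using assms unfolding T by blast
    then show "u = 0" by (simp add: vec_eq_iff forall_3)
  qed
  then obtain N where "N ** transpose C = mat 1" using matrix_left_invertible_ker[of "transpose C"] by blast
  then have "C ** transpose N = mat 1" by (metis matrix_transpose_mul transpose_mat transpose_transpose)
  then have "transpose N ** C = mat 1" using matrix_left_right_inverse by blast
  then have ker: "C *v v = 0 \<Longrightarrow> v = 0" for v using matrix_left_invertible_ker[of C] by blast
  have "C *v v = vector [dot a v, dot b v, dot c v]" for v
    by (simp add: vec_eq_iff forall_3 C_def matrix_vector_mult_def dot_def)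
  then show ?thesis unfolding frame_def using ker by (simp add: vec_eq_iff forall_3)
qed

text \<open>
  Covectors such that \<open>l / m\<close> is the pencil coordinate and the conic is \<open>l\<^sup>2 - m\<^sup>2 = g\<^sup>2\<close>.
\<close>

definition adapted :: "datum \<Rightarrow> complex ^ 3 \<Rightarrow> complex ^ 3 \<Rightarrow> complex ^ 3 \<Rightarrow> bool" where
  "adapted d m l g \<longleftrightarrow> frame m l g \<and>
     (\<forall>a. a \<noteq> 0 \<longrightarrow> (pt a \<in> conic d \<longleftrightarrow> (dot l a)\<^sup>2 - (dot m a)\<^sup>2 = (dot g a)\<^sup>2)) \<and>
     F_plus d = line (l - m) \<and> F_minus d = line (l + m) \<and> F_inf d = line m \<and>
     dot l (pp d) = dot m (pp d) \<and> dot g (pp d) = 0 \<and> dot l (pm d) = - dot m (pm d) \<and> dot g (pm d) = 0 \<and>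
     dot l (qq d) = 0 \<and> dot m (qq d) = 0"

lemma conic_rescaling:
  fixes b h :: "'a::field_char_0"
  assumes "b \<noteq> 0" "h \<noteq> 0"
  shows "k * c - - (k * b / (2 * h)) * t = k * b / 2 * (2 * c / b + t / h)"
  using assms by (simp add: field_simps)

text \<open>
  The vectors of $p_1$, $p_{-1}$ and $q$ form a basis with respect to which the conic is
  $2 b \alpha \beta + h \gamma^2 = 0$, because \<open>q\<close> is the pole of the chord. The pencil coordinate
  determines multiples \<open>l - m\<close> and \<open>l + m\<close> of \<open>\<beta>\<close> and \<open>\<alpha>\<close>, and \<open>\<gamma>\<close> can be rescaled to absorb the
  constants.
\<close>

lemma adapted_exists:
  assumes d: "miyanishi_datum d" and x: "pencil_coord d x"
  obtains m l g where "adapted d m l g" "x = lin l / lin m"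
proof -
  define M where "M = conic_mat d"
  have sym: "transpose M = M" and det: "det M \<noteq> 0" and nz: "pp d \<noteq> 0" "pm d \<noteq> 0" "qq d \<noteq> 0"
    and con: "pt (pp d) \<in> conic d" "pt (pm d) \<in> conic d" and ne: "pt (pp d) \<noteq> pt (pm d)"
    and FF: "F_plus d \<inter> F_minus d = {pt (qq d)}"
    using d by (auto simp: miyanishi_datum_def M_def)
  have ker: "v = 0" if "M *v v = 0" for v
  proof -
    obtain N where "N ** M = mat 1" using det unfolding invertible_det_nz[symmetric] invertible_def by blast
    then show ?thesis using matrix_left_invertible_ker[of M] that by blast
  qed
  define B where "B u v = dot u (M *v v)" for u v
  have Bs: "B u v = B v u" for u v unfolding B_def by (rule dot_mult_sym[OF sym])
  have Bd: "dot (M *v u) v = B u v" for u v unfolding B_def by (metis dot_commute dot_mult_sym[OF sym])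
  have Bl: "B (u + v) w = B u w + B v w" "B (c *s u) w = c * B u w" for u v w c
    by (simp_all add: B_def dot_simps)
  have conic: "pt a \<in> conic d \<longleftrightarrow> B a a = 0" if a0: "a \<noteq> 0" for a
  proof
    assume "pt a \<in> conic d"
    then obtain b where b: "b \<noteq> 0" "B b b = 0" "pt a = pt b" by (auto simp: conic_def B_def M_def)
    obtain c where "c \<noteq> 0" "b = c *s a" by (rule pt_eqD[OF a0 b(1,3)])
    then show "B a a = 0" using b(2) Bs[of a "c *s a"] by (simp add: Bl)
  qed (use that in \<open>auto simp: conic_def B_def M_def\<close>)
  have Fp: "F_plus d = line (M *v pp d)" and Fm: "F_minus d = line (M *v pm d)"
    by (simp_all add: F_plus_def F_minus_def M_def)
  have "pt (qq d) \<in> F_plus d" "pt (qq d) \<in> F_minus d" using FF by auto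
  then have q0: "B (pp d) (qq d) = 0" "B (pm d) (qq d) = 0"
    by (simp_all add: Fp Fm pt_in_line nz Bd)
  have p0: "B (pp d) (pp d) = 0" "B (pm d) (pm d) = 0" using con conic nz by auto
  define b where "b = B (pp d) (pm d)"
  have b: "b \<noteq> 0"
  proof
    assume "b = 0"
    then have "pt (pp d) \<in> F_plus d \<inter> F_minus d" "pt (pm d) \<in> F_plus d \<inter> F_minus d"
      using p0 Bs[of "pp d" "pm d"] by (simp_all add: Fp Fm pt_in_line nz Bd b_def)
    then show False using FF ne by auto
  qed
  have bas: "frame (pp d) (pm d) (qq d)"
  proof (rule frame_of_basis)
    fix \<alpha> \<beta> \<gamma> assume 0: "\<alpha> *s pp d + \<beta> *s pm d + \<gamma> *s qq d = 0"
    have "B 0 w = 0" for w by (simp add: B_def dot_simps)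
    then have "\<alpha> * b = 0" "\<beta> * b = 0"
      using arg_cong[OF 0, of "\<lambda>v. B v (pm d)"] arg_cong[OF 0, of "\<lambda>v. B v (pp d)"] p0 q0
        Bs[of "qq d" "pp d"] Bs[of "qq d" "pm d"] Bs[of "pm d" "pp d"] by (simp_all add: Bl b_def)
    then have "\<alpha> = 0" "\<beta> = 0" using b by auto
    then show "\<alpha> = 0 \<and> \<beta> = 0 \<and> \<gamma> = 0" using 0 nz(3) by (auto simp: vec_eq_iff)
  qed
  have fr: "v = 0" if "B (pp d) v = 0" "B (pm d) v = 0" "B (qq d) v = 0" for v
    using bas[unfolded frame_def, rule_format, of "M *v v"] that ker[of v] by (simp add: B_def)
  define h where "h = B (qq d) (qq d)"
  have h: "h \<noteq> 0" using fr[of "qq d"] q0 nz(3) by (auto simp: h_def)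
  have Q: "B v v = 2 * (B (pm d) v * B (pp d) v) / b + (B (qq d) v)\<^sup>2 / h" for v
  proof -
    define u where "u = (B (pm d) v / b) *s pp d + (B (pp d) v / b) *s pm d + (B (qq d) v / h) *s qq d"
    have u: "B u w = B (pm d) v / b * B (pp d) w + B (pp d) v / b * B (pm d) w + B (qq d) v / h * B (qq d) w" for w
      by (simp add: u_def Bl)
    have Bm: "B w (v - u) = B w v - B u w" for w
      using Bs[of w v] Bs[of w "v - u"] Bl(1)[of "v - u" u w] by simp
    have c: "B (pp d) (pm d) = b" "B (pm d) (pp d) = b" "B (qq d) (pp d) = 0" "B (qq d) (pm d) = 0"
      "B (qq d) (qq d) = h"
      using q0 Bs[of "qq d" "pp d"] Bs[of "qq d" "pm d"] Bs[of "pm d" "pp d"] by (simp_all add: b_def h_def)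
    have "v - u = 0"
      using b h by (intro fr) (simp_all add: Bm u p0 q0 c)
    then have "B v v = B u v" by simp
    also have "\<dots> = 2 * (B (pm d) v * B (pp d) v) / b + (B (qq d) v)\<^sup>2 / h"
      unfolding u by (simp add: power2_eq_square field_simps)
    finally show ?thesis .
  qed
  obtain l m where x: "x = lin l / lin m" and Fi: "F_inf d = line m" and
    Fp': "F_plus d = line (l - m)" and Fm': "F_minus d = line (l + m)"
    using x by (auto simp: pencil_coord_def)
  obtain k1 where k1: "k1 \<noteq> 0" "l - m = k1 *s (M *v pp d)"
    by (rule line_eqD[of "l - m" "M *v pp d"]) (use Fp Fp' ker nz in auto)
  obtain k2 where k2: "k2 \<noteq> 0" "l + m = k2 *s (M *v pm d)"
    by (rule line_eqD[of "l + m" "M *v pm d"]) (use Fm Fm' ker nz in auto)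
  have lm: "dot l v - dot m v = k1 * B (pp d) v" "dot l v + dot m v = k2 * B (pm d) v" for v
    using arg_cong[OF k1(2), of "\<lambda>u. dot u v"] arg_cong[OF k2(2), of "\<lambda>u. dot u v"] by (simp_all add: dot_simps Bd)
  \<comment> \<open>The scaling that turns the restriction of \<open>l\<^sup>2 - m\<^sup>2\<close> to the conic into a square.\<close>
  define \<kappa> where "\<kappa> = csqrt (- (k1 * k2 * b / (2 * h)))"
  have \<kappa>: "\<kappa>\<^sup>2 = - (k1 * k2 * b / (2 * h))" by (simp add: \<kappa>_def)
  have \<kappa>0: "\<kappa> \<noteq> 0" using \<kappa> k1 k2 b h by auto
  define g where "g = \<kappa> *s (M *v qq d)"
  have g: "dot g v = \<kappa> * B (qq d) v" for v by (simp add: g_def dot_simps Bd)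
  have "adapted d m l g"
    unfolding adapted_def
  proof (intro conjI allI impI)
    show "frame m l g" unfolding frame_def
    proof (intro allI impI)
      fix v assume "dot m v = 0 \<and> dot l v = 0 \<and> dot g v = 0"
      then show "v = 0" using lm[of v] g[of v] k1 k2 \<kappa>0 by (intro fr) auto
    qed
    show "pt v \<in> conic d \<longleftrightarrow> (dot l v)\<^sup>2 - (dot m v)\<^sup>2 = (dot g v)\<^sup>2" if "v \<noteq> 0" for v
    proof -
      have "(dot l v)\<^sup>2 - (dot m v)\<^sup>2 = (dot l v - dot m v) * (dot l v + dot m v)"
        by (simp add: power2_eq_square algebra_simps)
      also have "\<dots> = k1 * k2 * (B (pm d) v * B (pp d) v)" unfolding lm by simp
      finally have lm2: "(dot l v)\<^sup>2 - (dot m v)\<^sup>2 = k1 * k2 * (B (pm d) v * B (pp d) v)" .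
      have 1: "(dot l v)\<^sup>2 - (dot m v)\<^sup>2 - (dot g v)\<^sup>2 = k1 * k2 * b / 2 * B v v"
        unfolding lm2 g power_mult_distrib \<kappa> Q by (rule conic_rescaling[OF b h])
      have "pt v \<in> conic d \<longleftrightarrow> B v v = 0" by (rule conic[OF that])
      also have "\<dots> \<longleftrightarrow> (dot l v)\<^sup>2 - (dot m v)\<^sup>2 - (dot g v)\<^sup>2 = 0" unfolding 1 using k1 k2 b by simp
      finally show ?thesis by simp
    qed
    show "F_plus d = line (l - m)" "F_minus d = line (l + m)" "F_inf d = line m" by fact+
    show "dot l (pp d) = dot m (pp d)" using lm(1)[of "pp d"] p0 by simp
    show "dot g (pp d) = 0" "dot g (pm d) = 0" using g q0 Bs[of "qq d" "pp d"] Bs[of "qq d" "pm d"] by simp_all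
    show "dot l (pm d) = - dot m (pm d)" using lm(2)[of "pm d"] p0 by (simp add: add_eq_0_iff2)
    have "dot l (qq d) = dot m (qq d)" "dot l (qq d) + dot m (qq d) = 0" using lm[of "qq d"] q0 by simp_all
    then show "dot l (qq d) = 0" "dot m (qq d) = 0" by auto
  qed
  then show thesis using that x by blast
qed

section \<open>Miyanishi's surface in coordinates\<close>

text \<open>
  Blowing up really changes the ring; this distinguishes the points above a centre from the centre.
\<close>

lemma quotient_notin:
  assumes P: "regular_point P u v" shows "v / u \<notin> P"
proof
  note cp = regular_point_cp[OF P] and uv = regular_point_params[OF P]
  assume "v / u \<in> P"
  moreover have "v / u * u = 1 * v" using uv by simp
  ultimately obtain r where "r \<in> P" "1 = r * u" using regular_point_rel[OF P _ cp_1[OF cp]] by metis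
  then show False using uv cp val_1[OF cp] val_mult[OF cp, of r u] by simp
qed

lemma closure_witness:
  assumes "points X" "R \<in> zariski X closure_of Z" "finite H" "H \<subseteq> R"
  obtains Q where "Q \<in> Z" "Q \<in> X" "H \<subseteq> Q"
  using assms zariski_closure[OF assms(1), of R Z] by (metis Int_iff)

locale adapted_datum =
  fixes d :: datum and m l g :: "complex ^ 3"
  assumes miy: "miyanishi_datum d" and adapted: "adapted d m l g"
begin

abbreviation (input) "x \<equiv> lin l / lin m"
abbreviation (input) "y \<equiv> lin g / lin m"

lemma fr: "frame m l g"
  using adapted by (simp add: adapted_def)

sublocale chart x y
  by unfold_locales (rule frame_indep[OF fr])

lemma pt_finite:
  assumes "dot m a \<noteq> 0" shows "pt a = plane_pt x y (dot l a / dot m a) (dot g a / dot m a)"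
  by (rule pt_chart[OF fr assms])

text \<open>
  At a point with \<open>m = 0\<close>, the inverse of \<open>x\<close> or of \<open>y\<close> is regular and vanishes; this persists at all
  points above it.
\<close>

lemma finite_part:
  assumes a: "a \<noteq> 0" and R: "closed_point R" "lies_over R (pt a)" and xyR: "x \<in> R" "y \<in> R"
  shows "dot m a \<noteq> 0"
proof
  assume m: "dot m a = 0"
  have *: False if "dot k a \<noteq> 0" "lin k / lin m \<in> R" for k
  proof -
    have k: "k \<noteq> 0" using that(1) by (auto simp: dot_simps)
    have "lin m / lin k \<in> R" "val R (lin m / lin k) = 0"
      using pt_lin(2,3)[OF fr that(1), of m] m lies_overD[OF R(2)] by auto
    moreover have "inverse (lin m / lin k) \<in> R" using that by simp
    moreover have "lin m / lin k \<noteq> 0" using k frame_nonzero[OF fr] by (simp add: lin_eq_0_iff)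
    ultimately show False using inverse_notin[OF R(1)] by blast
  qed
  have "dot l a = 0" "dot g a = 0" using *[of l] *[of g] xyR by auto
  then show False using fr m a by (auto simp: frame_def)
qed

lemma plane_is_pt:
  obtains a where "dot m a = 1" "dot l a = s" "dot g a = t" "a \<noteq> 0" "plane_pt x y s t = pt a"
proof -
  obtain u v r where b: "dot m u = 1" "dot l u = 0" "dot g u = 0" "dot m v = 0" "dot l v = 1" "dot g v = 0"
    "dot m r = 0" "dot l r = 0" "dot g r = 1" using frame_dual[OF fr] by metis
  define a where "a = u + s *s v + t *s r"
  have a: "dot m a = 1" "dot l a = s" "dot g a = t" by (simp_all add: a_def dot_simps b)
  then have "a \<noteq> 0" "plane_pt x y s t = pt a" using pt_finite[of a] by (auto simp: dot_simps)
  then show thesis using that a by blast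
qed

definition q :: point where "q = pt (qq d)"

lemma data: "pp d \<noteq> 0" "pm d \<noteq> 0" "qq d \<noteq> 0"
  "dot l (pp d) = dot m (pp d)" "dot g (pp d) = 0" "dot l (pm d) = - dot m (pm d)" "dot g (pm d) = 0"
  "dot l (qq d) = 0" "dot m (qq d) = 0"
  "F_plus d = line (l - m)" "F_minus d = line (l + m)" "F_inf d = line m"
  using miy adapted by (auto simp: miyanishi_datum_def adapted_def)

lemma conic_iff: "a \<noteq> 0 \<Longrightarrow> pt a \<in> conic d \<longleftrightarrow> (dot l a)\<^sup>2 - (dot m a)\<^sup>2 = (dot g a)\<^sup>2"
  using adapted by (simp add: adapted_def)

lemma pt_pp: "pt (pp d) = p 1" and pt_pm: "pt (pm d) = p (- 1)"
proof -
  have "dot m (pp d) \<noteq> 0" "dot m (pm d) \<noteq> 0" using fr data by (auto simp: frame_def)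
  then show "pt (pp d) = p 1" "pt (pm d) = p (- 1)"
    using pt_finite[of "pp d"] pt_finite[of "pm d"] data by (simp_all add: p_def)
qed

lemma g_q: "dot g (qq d) \<noteq> 0"
  using fr data by (auto simp: frame_def)

lemma reg_q: "regular_point q (lin l / lin g) (lin m / lin g)"
proof -
  have f: "frame g l m" using fr by (auto simp: frame_def)
  have "q = plane_pt (lin l / lin g) (lin m / lin g) 0 0"
    using pt_chart[OF f g_q] data by (simp add: q_def)
  then show ?thesis using plane_pt_point(1)[OF frame_indep[OF f], of 0 0] by simp
qed

lemma exc_q:
  assumes "R \<in> exc q" shows "closed_point R" "lies_over R q" "\<not> (x \<in> R \<and> y \<in> R)"
  using exc_point(1,2)[OF reg_q assms] finite_part[OF data(3), of R] data by (auto simp: q_def)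

text \<open>
  The stages of the construction of the projective surface, in the order of the list of centres: the
  blowup at \<open>q\<close>, the three blowups over $p_1$ and the three blowups over $p_{-1}$. \<open>Z0\<close> to \<open>Z3\<close> are the
  proper transforms of the conic in the first four of them.
\<close>

definition X0 :: model where "X0 = blowup proj_plane q"
definition X1 :: model where "X1 = blowup X0 (p 1)"
definition X2 :: model where "X2 = blowup X1 (P1 1)"
definition X3 :: model where "X3 = blowup X2 (P2 1)"
definition X4 :: model where "X4 = blowup X3 (p (- 1))"
definition X5 :: model where "X5 = blowup X4 (P1 (- 1))"
definition X6 :: model where "X6 = blowup X5 (P2 (- 1))"
definition Z0 :: model where "Z0 = zariski X0 closure_of (conic d - {q})"
definition Z1 :: model where "Z1 = zariski X1 closure_of (Z0 - {p 1})"
definition Z2 :: model where "Z2 = zariski X2 closure_of (Z1 - {P1 1})"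
definition Z3 :: model where "Z3 = zariski X3 closure_of (Z2 - {P2 1})"

lemma points_X: "points X0" "points X1" "points X2" "points X3" "points X4" "points X5" "points X6"
proof -
  have e: "(1::complex)\<^sup>2 = 1" "(-1::complex)\<^sup>2 = 1" by simp_all
  have "points proj_plane" by (auto simp: points_def proj_plane_def pt_closed)
  then show X0: "points X0" unfolding X0_def by (rule points_blowup[OF _ reg_q])
  show X1: "points X1" unfolding X1_def by (rule points_blowup[OF X0 reg_p[OF e(1)]])
  show X2: "points X2" unfolding X2_def by (rule points_blowup[OF X1 reg_P1[OF e(1)]])
  show X3: "points X3" unfolding X3_def by (rule points_blowup[OF X2 reg_P2[OF e(1)]])
  show X4: "points X4" unfolding X4_def by (rule points_blowup[OF X3 reg_p[OF e(2)]])
  show X5: "points X5" unfolding X5_def by (rule points_blowup[OF X4 reg_P1[OF e(2)]])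
  show X6: "points X6" unfolding X6_def by (rule points_blowup[OF X5 reg_P2[OF e(2)]])
qed

lemma X0_cases:
  assumes "R \<in> X0"
  obtains a where "a \<noteq> 0" "R = pt a" "R \<noteq> q" | "R \<in> exc q"
  using assms by (auto simp: X0_def blowup_def proj_plane_def)

lemma X0_plane:
  assumes R: "R \<in> X0" and xyR: "x \<in> R" "y \<in> R" shows "R = plane_pt x y (val R x) (val R y)"
  using R
proof (cases rule: X0_cases)
  case (1 a)
  have "dot m a \<noteq> 0" using finite_part[OF 1(1) pt_closed[OF 1(1)] lies_over_refl] xyR 1 by simp
  then have "R = plane_pt x y (dot l a / dot m a) (dot g a / dot m a)" using pt_finite 1 by simp
  then show ?thesis using plane(3,5) by metis
next
  case 2
  then show ?thesis using exc_q xyR by blast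
qed

lemma plane_in_X0: "plane_pt x y s t \<in> X0" "plane_pt x y s t \<noteq> q"
proof -
  obtain a where a: "dot m a = 1" "a \<noteq> 0" "plane_pt x y s t = pt a" by (rule plane_is_pt)
  have "x \<in> q \<and> y \<in> q \<Longrightarrow> False"
    using finite_part[OF data(3) pt_closed[OF data(3)] lies_over_refl] data by (auto simp: q_def)
  then show "plane_pt x y s t \<noteq> q" using plane(2,4) by metis
  then show "plane_pt x y s t \<in> X0" using a by (auto simp: X0_def blowup_def proj_plane_def)
qed

lemma planar_X0: "planar X0 e"
  using X0_plane by (auto simp: planar_def)

lemma X3_cases:
  assumes "R \<in> X3"
  shows "R \<in> X0 \<or> closed_point R \<and> lies_over R (p 1)"
proof -
  have e: "(1::complex)\<^sup>2 = 1" by simp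
  have "R \<in> X0 \<or> R \<in> exc (p 1) \<or> R \<in> exc (P1 1) \<or> R \<in> exc (P2 1)"
    using assms by (auto simp: X3_def X2_def X1_def blowup_def)
  then show ?thesis
    using exc_p(1,2)[OF e] exc_P1(1,2)[OF e] exc_P2(1,2)[OF e] P1_over(1)[OF e] P2_over(1)[OF e]
      lies_over_trans by metis
qed

lemma planar_X3: "planar X3 (- 1)"
  unfolding planar_def
proof (intro ballI impI)
  fix R assume R: "R \<in> X3" "x \<in> R \<and> y \<in> R \<and> inverse (x + const (- 1)) \<in> R"
  show "\<exists>a c. R = plane_pt x y a c"
    using X3_cases[OF R(1)]
  proof
    assume "R \<in> X0"
    then show ?thesis using X0_plane R by blast
  next
    assume 1: "closed_point R \<and> lies_over R (p 1)"
    then have "x + const (- 1) \<in> R" "val R (x + const (- 1)) = 0"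
      using over_p[of 1 R] by (simp_all add: cp_simps)
    then show ?thesis using inverse_notin[of R "x + const (- 1)"] 1 R nonzero(4) by blast
  qed
qed

lemma on_conic_conic: "on_conic (conic d)"
  unfolding on_conic_def
proof (intro ballI notI)
  fix R assume "R \<in> conic d" and R: "x \<in> R \<and> y \<in> R \<and> inverse (w - y\<^sup>2) \<in> R"
  then obtain a where a: "a \<noteq> 0" "R = pt a" by (auto simp: conic_def)
  have cp: "closed_point R" using a pt_closed by simp
  have ma: "dot m a \<noteq> 0" using finite_part[OF a(1) cp] R a lies_over_refl by simp
  have "(dot l a)\<^sup>2 - (dot m a)\<^sup>2 = (dot g a)\<^sup>2" using conic_iff[OF a(1)] \<open>R \<in> conic d\<close> a by simp
  then have 0: "(dot l a / dot m a)\<^sup>2 - 1 - (dot g a / dot m a)\<^sup>2 = 0"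
    using ma by (simp add: field_simps)
  have Rp: "R = plane_pt x y (dot l a / dot m a) (dot g a / dot m a)" using pt_finite[OF ma] a by simp
  have "w - y\<^sup>2 \<in> R" "val R (w - y\<^sup>2) = 0"
    using 0 cp plane(4,5)[of "dot l a / dot m a" "dot g a / dot m a"] plane_w[of "dot l a / dot m a" "dot g a / dot m a"]
    unfolding Rp[symmetric] by (simp_all add: cp_simps)
  then show False using inverse_notin[OF cp] R nonzero(3) by blast
qed

lemma Z_on_conic: "on_conic Z0" "on_conic Z1" "on_conic Z2" "on_conic Z3"
proof -
  have sub: "on_conic (Z - A)" if "on_conic Z" for Z A using that by (auto simp: on_conic_def)
  show 0: "on_conic Z0" unfolding Z0_def by (intro on_conic_closure points_X sub on_conic_conic)
  show 1: "on_conic Z1" unfolding Z1_def by (intro on_conic_closure points_X sub 0)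
  show 2: "on_conic Z2" unfolding Z2_def by (intro on_conic_closure points_X sub 1)
  show 3: "on_conic Z3" unfolding Z3_def by (intro on_conic_closure points_X sub 2)
qed

lemma Z_subset: "Z0 \<subseteq> X0" "Z3 \<subseteq> X3"
  using zariski_closure[OF points_X(1)] zariski_closure[OF points_X(4)] by (auto simp: Z0_def Z3_def)

lemma pp2: "pp2 d = P1 1" and pp3: "pp3 d = P2 1" and pm2: "pm2 d = P1 (- 1)" and pm3: "pm3 d = P2 (- 1)"
proof -
  have e: "(1::complex)\<^sup>2 = 1" "(-1::complex)\<^sup>2 = 1" by simp_all
  have c: "pp2 d \<in> exc (pt (pp d)) \<inter> proper_transform proj_plane (take 2 (centres d)) (conic d)"
     "pp3 d \<in> exc (pp2 d) \<inter> proper_transform proj_plane (take 3 (centres d)) (conic d)"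
     "pm2 d \<in> exc (pt (pm d)) \<inter> proper_transform proj_plane (take 5 (centres d)) (conic d)"
     "pm3 d \<in> exc (pm2 d) \<inter> proper_transform proj_plane (take 6 (centres d)) (conic d)"
    using miy by (auto simp: miyanishi_datum_def)
  note defs = centres_def pt_pp pt_pm q_def[symmetric] X0_def[symmetric] Z0_def[symmetric] X1_def[symmetric] Z1_def[symmetric]
  have "pp2 d \<in> exc (p 1)" "pp2 d \<in> Z1" using c(1) by (simp_all add: defs)
  then show pp2: "pp2 d = P1 1"
    using near_point1[OF e(1) points_X(1) planar_X0 Z_subset(1) Z_on_conic(1), folded X1_def, folded Z1_def] by blast
  note defs = defs pp2 X2_def[symmetric] Z2_def[symmetric]
  have "pp3 d \<in> exc (P1 1)" "pp3 d \<in> Z2" using c(2) by (simp_all add: defs)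
  then show pp3: "pp3 d = P2 1"
    using near_point2[OF e(1) points_X(1) planar_X0 Z_subset(1) Z_on_conic(1) Z1_def[unfolded X1_def], folded X1_def, folded X2_def, folded Z2_def] by blast
  note defs = defs pp3 X3_def[symmetric] Z3_def[symmetric] X4_def[symmetric]
  have "pm2 d \<in> exc (p (- 1))" "pm2 d \<in> zariski X4 closure_of (Z3 - {p (- 1)})" using c(3) by (simp_all add: defs)
  then show pm2: "pm2 d = P1 (- 1)"
    using near_point1[OF e(2) points_X(4) planar_X3 Z_subset(2) Z_on_conic(4), folded X4_def] by blast
  note defs = defs pm2 X5_def[symmetric]
  have "pm3 d \<in> exc (P1 (- 1))"
    "pm3 d \<in> zariski X5 closure_of (zariski X4 closure_of (Z3 - {p (- 1)}) - {P1 (- 1)})"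
    using c(4) by (simp_all add: defs)
  then show "pm3 d = P2 (- 1)"
    using near_point2[OF e(2) points_X(4) planar_X3 Z_subset(2) Z_on_conic(4) refl, folded X4_def, folded X5_def] by blast
qed

lemma S_bar_eq: "S_bar d = X6"
  by (simp add: S_bar_def blowups_def centres_def pt_pp pt_pm pp2 pp3 pm2 pm3 q_def[symmetric]
      X0_def X1_def X2_def X3_def X4_def X5_def X6_def)

lemma signs: "(e::complex)\<^sup>2 = 1 \<longleftrightarrow> e = 1 \<or> e = - 1"
  by (rule power2_eq_1_iff)

lemma X6_cases:
  assumes "R \<in> X6"
  obtains "R \<in> X0" "\<And>e. e\<^sup>2 = 1 \<Longrightarrow> R \<noteq> p e"
  | e where "e\<^sup>2 = 1" "R \<in> exc (p e)" "R \<noteq> P1 e"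
  | e where "e\<^sup>2 = 1" "R \<in> exc (P1 e)" "R \<noteq> P2 e"
  | e where "e\<^sup>2 = 1" "R \<in> exc (P2 e)"
proof -
  have b: "R \<in> blowup X P \<longleftrightarrow> R \<in> X \<and> R \<noteq> P \<or> R \<in> exc P" for X P by (simp add: blowup_def)
  have "R \<in> X0 \<and> R \<noteq> p 1 \<and> R \<noteq> p (- 1) \<or> R \<in> exc (p 1) \<and> R \<noteq> P1 1 \<or> R \<in> exc (P1 1) \<and> R \<noteq> P2 1 \<or>
    R \<in> exc (P2 1) \<or> R \<in> exc (p (- 1)) \<and> R \<noteq> P1 (- 1) \<or> R \<in> exc (P1 (- 1)) \<and> R \<noteq> P2 (- 1) \<or> R \<in> exc (P2 (- 1))"
    using assms unfolding X6_def X5_def X4_def X3_def X2_def X1_def b by argo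
  then consider (a) "R \<in> X0" "R \<noteq> p 1" "R \<noteq> p (- 1)"
    | "R \<in> exc (p 1)" "R \<noteq> P1 1" | "R \<in> exc (P1 1)" "R \<noteq> P2 1" | "R \<in> exc (P2 1)"
    | "R \<in> exc (p (- 1))" "R \<noteq> P1 (- 1)" | "R \<in> exc (P1 (- 1))" "R \<noteq> P2 (- 1)" | "R \<in> exc (P2 (- 1))"
    by blast
  then show thesis
  proof cases
    case a
    have "R \<noteq> p e" if "e\<^sup>2 = 1" for e using that a signs[of e] by auto
    then show thesis using that(1) a by blast
  qed (auto intro: that(2)[of 1] that(3)[of 1] that(4)[of 1] that(2)[of "- 1"] that(3)[of "- 1"] that(4)[of "- 1"])
qed

lemma in_X6:
  assumes "R \<in> X0 \<or> (\<exists>e. e\<^sup>2 = 1 \<and> (R \<in> exc (p e) \<or> R \<in> exc (P1 e) \<or> R \<in> exc (P2 e)))"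
    and "\<And>e. e\<^sup>2 = 1 \<Longrightarrow> R \<noteq> p e" "\<And>e. e\<^sup>2 = 1 \<Longrightarrow> R \<noteq> P1 e" "\<And>e. e\<^sup>2 = 1 \<Longrightarrow> R \<noteq> P2 e"
  shows "R \<in> X6"
  using assms(1) assms(2)[of 1] assms(2)[of "- 1"] assms(3)[of 1] assms(3)[of "- 1"] assms(4)[of 1] assms(4)[of "- 1"]
  unfolding X6_def X5_def X4_def X3_def X2_def X1_def blowup_def signs by auto

lemma plane_in_X6:
  assumes "a\<^sup>2 \<noteq> 1" shows "plane_pt x y a c \<in> X6"
proof (rule in_X6)
  show "plane_pt x y a c \<in> X0 \<or> (\<exists>e. e\<^sup>2 = 1 \<and> (plane_pt x y a c \<in> exc (p e) \<or> plane_pt x y a c \<in> exc (P1 e) \<or> plane_pt x y a c \<in> exc (P2 e)))"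
    using plane_in_X0 by blast
  have "\<not> lies_over (plane_pt x y a c) (p e)" if "e\<^sup>2 = 1" for e
    using over_p(2)[OF that] plane(3)[of a c] assms that by auto
  then show "plane_pt x y a c \<noteq> p e" "plane_pt x y a c \<noteq> P1 e" "plane_pt x y a c \<noteq> P2 e" if "e\<^sup>2 = 1" for e
    using that P1_over(1)[OF that] P2_over(1)[OF that] lies_over_trans lies_over_refl by metis+
qed

lemma near_in_X6:
  assumes e: "e\<^sup>2 = 1" and R: "R \<in> exc (P1 e) \<or> R \<in> exc (P2 e)" and in_R: "w / y \<in> R" "w / y / y \<in> R"
    and ne: "\<And>e. e\<^sup>2 = 1 \<Longrightarrow> R \<noteq> P2 e"
  shows "R \<in> X6"
proof (rule in_X6)
  show "R \<in> X0 \<or> (\<exists>e. e\<^sup>2 = 1 \<and> (R \<in> exc (p e) \<or> R \<in> exc (P1 e) \<or> R \<in> exc (P2 e)))" using e R by blast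
  show "R \<noteq> p e" if "e\<^sup>2 = 1" for e using quotient_notin[OF reg_p[OF that]] in_R by auto
  show "R \<noteq> P1 e" if "e\<^sup>2 = 1" for e using quotient_notin[OF reg_P1[OF that]] in_R by auto
qed (rule ne)

lemma E_in_X6: assumes e: "e\<^sup>2 = 1" shows "E e t \<in> X6"
proof (rule near_in_X6[OF e])
  show "E e t \<in> exc (P1 e) \<or> E e t \<in> exc (P2 e)" using exc_P2(3)[OF e] by blast
  show "w / y \<in> E e t" "w / y / y \<in> E e t" using E_vals[OF e] by auto
  show "E e t \<noteq> P2 f" if "f\<^sup>2 = 1" for f using quotient_notin[OF reg_P2[OF that]] E_point(3)[OF e, of t] by (auto simp: z_def)
qed

abbreviation "D \<equiv> total_transform d - (E_plus d \<union> E_minus d)"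

lemma exceptional: "R \<in> E_plus d \<union> E_minus d \<longleftrightarrow> (\<exists>e. e\<^sup>2 = 1 \<and> R \<in> exc (P2 e))"
  by (auto simp: E_plus_def E_minus_def pp3 pm3 signs)

lemma total_iff:
  "R \<in> total_transform d \<longleftrightarrow> R \<in> X6 \<and>
     (\<exists>a. a \<noteq> 0 \<and> (dot (l - m) a = 0 \<or> dot m a = 0 \<or> dot (l + m) a = 0) \<and> lies_over R (pt a))"
proof -
  have "dominates R P \<longleftrightarrow> lies_over R P" if "R \<in> X6" "P \<in> line k" for P k
    using that points_X(7) dominates_iff pt_closed by (auto simp: points_def line_def)
  then show ?thesis
    unfolding total_transform_def S_bar_eq data by (auto simp: line_def)
qed

text \<open>
  Where \<open>x\<close> and \<open>y\<close> are regular, the boundary lines reduce to \<open>x = \<plusminus>1\<close>.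
\<close>

lemma total_val:
  assumes R: "R \<in> total_transform d" and xyR: "x \<in> R" "y \<in> R"
  shows "w \<in> R" "val R w = 0"
proof -
  obtain a where a: "a \<noteq> 0" "dot (l - m) a = 0 \<or> dot m a = 0 \<or> dot (l + m) a = 0" and over: "lies_over R (pt a)"
    and "R \<in> X6" using R total_iff by blast
  then have cp: "closed_point R" using points_X(7) pointsD by blast
  have ma: "dot m a \<noteq> 0" by (rule finite_part[OF a(1) cp over xyR])
  then have "dot l a = dot m a \<or> dot l a = - dot m a" using a by (auto simp: dot_simps add_eq_0_iff2)
  then have "(dot l a / dot m a)\<^sup>2 = 1" using ma by (auto simp: power_divide)
  then show "w \<in> R" "val R w = 0"
    using lies_overD[OF over, of w] plane_w[of "dot l a / dot m a" "dot g a / dot m a"] pt_finite[OF ma] by auto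
qed

lemma total_over_p:
  assumes "e\<^sup>2 = 1" "R \<in> X6" "lies_over R (p e)" shows "R \<in> total_transform d"
proof -
  have "dot (l - m) (pp d) = 0" "dot (l + m) (pm d) = 0" using data by (simp_all add: dot_simps)
  then show ?thesis using assms data(1,2) unfolding total_iff signs pt_pp[symmetric] pt_pm[symmetric]
    by (metis pt_pm pt_pp)
qed

text \<open>
  Each point has a neighbourhood, the common domain of the functions in \<open>H\<close>, that
  avoids all components of the total transform but the last exceptional curves.
\<close>

lemma surface_disjoint:
  assumes "R \<in> surface" shows "R \<in> X6" "R \<notin> zariski X6 closure_of D"
proof -
  have "R \<in> X6 \<and> R \<notin> zariski X6 closure_of D"
    using assms unfolding surface_def
  proof (elim UnE CollectE exE conjE)
    fix a c assume R: "R = plane_pt x y a c" and a: "a\<^sup>2 \<noteq> 1"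
    have RX: "R \<in> X6" unfolding R by (rule plane_in_X6[OF a])
    moreover have "R \<notin> zariski X6 closure_of D"
    proof
      assume cl: "R \<in> zariski X6 closure_of D"
      have "inverse w \<in> R" using cp_inverse[OF plane_cp plane_w(1)] plane_w(2) a R by auto
      then have H: "{x, y, inverse w} \<subseteq> R" using plane(2,4) R by auto
      obtain Q where Q: "Q \<in> D" "Q \<in> X6" "{x, y, inverse w} \<subseteq> Q"
        by (rule closure_witness[OF points_X(7) cl _ H]) auto
      then have "w \<in> Q" "val Q w = 0" using total_val[of Q] by auto
      then show False using inverse_notin[OF pointsD[OF points_X(7) Q(2)]] Q nonzero(2) by auto
    qed
    ultimately show ?thesis by blast
  next
    fix e t assume R: "R = E e t" and e: "e\<^sup>2 = 1"
    have RX: "R \<in> X6" unfolding R by (rule E_in_X6[OF e])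
    moreover have "R \<notin> zariski X6 closure_of D"
    proof
      assume cl: "R \<in> zariski X6 closure_of D"
      \<comment> \<open>Apart from the coordinate \<open>z\<close>, the function \<open>y\<^sup>2 / w\<close> is needed: it has poles on the rest of the fibre.\<close>
      have "inverse (w / y / y) \<in> R" unfolding R
        by (rule cp_inverse[OF E_point(1)[OF e] E_vals(7)[OF e]]) (simp only: E_vals(8)[OF e], simp)
      then have H: "{x, y, z, inverse (w / y / y)} \<subseteq> R" using E_vals[OF e] E_point(3)[OF e] R by auto
      obtain Q where Q: "Q \<in> D" "Q \<in> X6" "{x, y, z, inverse (w / y / y)} \<subseteq> Q"
        by (rule closure_witness[OF points_X(7) cl _ H]) auto
      have cp: "closed_point Q" using Q points_X(7) pointsD by blast
      have wQ: "w \<in> Q" "val Q w = 0" using total_val[of Q] Q by auto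
      have wyy: "w / y / y = 1 + y * z" and wy: "w / y = y * (1 + y * z)"
        using nonzero(1) by (simp_all add: z_def field_simps)
      have yz: "1 + y * z \<in> Q" "y \<in> Q" "z \<in> Q" using Q cp by (simp_all add: cp_simps del: times_divide_eq_left times_divide_eq_right)
      have y2: "inverse (w / y / y) * w = y\<^sup>2" using nonzero by (simp add: field_simps power2_eq_square)
      then have y0: "val Q y = 0"
        using val_mult[OF cp, of "inverse (w / y / y)" w] val_power[OF cp yz(2), of 2] Q wQ by simp
      have wyQ: "w / y / y \<in> Q" "val Q (w / y / y) = 1"
        unfolding wyy using yz y0 cp by (simp_all add: cp_simps del: times_divide_eq_left times_divide_eq_right)
      have wyQ': "w / y \<in> Q" "val Q (w / y) = 0"
        unfolding wy using yz y0 cp by (simp_all add: cp_simps del: times_divide_eq_left times_divide_eq_right)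
      show False
        using Q(2)
      proof (cases rule: X6_cases)
        case 1
        then have Qp: "Q = plane_pt x y (val Q x) (val Q y)" using X0_plane Q by blast
        have "val Q w = (val Q x)\<^sup>2 - 1" using plane_w(2) Qp by metis
        then have "(val Q x)\<^sup>2 = 1" using wQ by simp
        then show False using 1(2) Qp y0 by (simp add: p_def)
      next
        case (2 f)
        then show False using exc_p(3)[OF 2(1,2)] wyQ' 2(3) by blast
      next
        case (3 f)
        then show False using exc_P1(3)[OF 3(1,2)] wyQ 3(3) by blast
      next
        case (4 f)
        then show False using Q exceptional by blast
      qed
    qed
    ultimately show ?thesis by blast
  qed
  then show "R \<in> X6" "R \<notin> zariski X6 closure_of D" by auto
qed

lemma D_closure: "R \<in> D \<Longrightarrow> R \<in> zariski X6 closure_of D"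
  using zariski_closure[OF points_X(7), of R D] total_iff by blast

text \<open>
  All these points lie over the three lines. Only those of the last exceptional curves need an argument:
  \<open>Einf e\<close> is a limit of points of the preceding exceptional curve by \<open>Einf_limit\<close>.
\<close>

lemma not_surface:
  assumes R: "R \<in> X6" "R \<notin> surface" shows "R \<in> zariski X6 closure_of D"
  using R(1)
proof (cases rule: X6_cases)
  case 1
  have nE: "R \<notin> exc (P2 e)" if "e\<^sup>2 = 1" for e
  proof
    assume RE: "R \<in> exc (P2 e)"
    note o = over_P2[OF that exc_P2(2)[OF that RE]]
    have "R = plane_pt x y e 0" using X0_plane[OF 1(1)] o by simp
    then show False using 1(2)[OF that] by (simp add: p_def)
  qed
  have "R \<in> total_transform d"
    using 1(1)
  proof (cases rule: X0_cases)
    case (1 a)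
    have "dot (l - m) a = 0 \<or> dot m a = 0 \<or> dot (l + m) a = 0"
    proof (rule ccontr)
      assume n: "\<not> (dot (l - m) a = 0 \<or> dot m a = 0 \<or> dot (l + m) a = 0)"
      then have "(dot l a / dot m a)\<^sup>2 \<noteq> 1"
        by (auto simp: dot_simps power2_eq_iff power_divide add_eq_0_iff2)
      then show False using R(2) pt_finite[of a] n 1 unfolding surface_def by blast
    qed
    then show ?thesis unfolding total_iff using R 1 lies_over_refl by blast
  next
    case 2
    then show ?thesis unfolding total_iff using R exc_q(2) data by (auto simp: q_def)
  qed
  then show ?thesis using D_closure nE exceptional by blast
next
  case (2 e)
  note o = exc_p(1,2)[OF 2(1,2)]
  have "R \<in> total_transform d" by (rule total_over_p[OF 2(1) R(1) o(2)])
  moreover have "R \<notin> exc (P2 f)" if "f\<^sup>2 = 1" for f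
  proof
    assume "R \<in> exc (P2 f)"
    note o2 = over_P2[OF that exc_P2(2)[OF that this]]
    then show False using exc_p(3)[OF 2(1,2)] 2(3) by blast
  qed
  ultimately show ?thesis using D_closure exceptional by blast
next
  case (3 e)
  note o = exc_P1(1,2)[OF 3(1,2)]
  have "R \<in> total_transform d"
    by (rule total_over_p[OF 3(1) R(1) lies_over_trans[OF o(2) P1_over(1)[OF 3(1)]]])
  moreover have "R \<notin> exc (P2 f)" if "f\<^sup>2 = 1" for f
  proof
    assume "R \<in> exc (P2 f)"
    note o2 = over_P2[OF that exc_P2(2)[OF that this]]
    then show False using exc_P1(3)[OF 3(1,2)] 3(3) by blast
  qed
  ultimately show ?thesis using D_closure exceptional by blast
next
  case (4 e)
  then have R_inf: "R = Einf e" using exc_P2(3)[OF 4(1)] R(2) unfolding surface_def by blast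
  show ?thesis unfolding zariski_closure[OF points_X(7)]
  proof (intro conjI allI impI)
    fix H assume "finite H \<and> H \<subseteq> R"
    then obtain \<mu> where \<mu>: "\<mu> \<noteq> 0" "H \<subseteq> bl (P1 e) y (w / y) (1 + \<mu>)"
      using Einf_limit[OF 4(1)] R_inf by blast
    define Q where "Q = bl (P1 e) y (w / y) (1 + \<mu>)"
    note reg = reg_P1[OF 4(1)]
    have Qe: "Q \<in> exc (P1 e)" using exc_cases[OF reg] by (auto simp: Q_def)
    have wyy: "w / y / y \<in> Q" "val Q (w / y / y) = 1 + \<mu>" using bl_point(4,5)[OF reg] by (auto simp: Q_def)
    note o = over_P1[OF 4(1) exc_P1(2)[OF 4(1) Qe]]
    have nP2: "\<not> lies_over Q (P2 f)" if "f\<^sup>2 = 1" for f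
      using over_P2(8)[OF that] wyy \<mu> by auto
    have QX: "Q \<in> X6"
      by (rule near_in_X6[OF 4(1)]) (use Qe o wyy nP2 lies_over_refl in auto)
    have "Q \<in> total_transform d"
      by (rule total_over_p[OF 4(1) QX lies_over_trans[OF exc_P1(2)[OF 4(1) Qe] P1_over(1)[OF 4(1)]]])
    moreover have "Q \<notin> exc (P2 f)" if "f\<^sup>2 = 1" for f using nP2[OF that] exc_P2(2)[OF that] by blast
    ultimately have "Q \<in> D \<inter> X6" using QX exceptional by blast
    then show "\<exists>Q\<in>D \<inter> X6. H \<subseteq> Q" using \<mu> Q_def by blast
  qed (rule R(1))
qed

theorem surf_eq: "surf d = surface"
  unfolding surf_def bdry_def S_bar_eq using surface_disjoint not_surface by blast

text \<open>
  Outside the exceptional curve over \<open>q\<close>, the proper transform of the line at infinity is that line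
  itself: \<open>x\<close> and \<open>y\<close> are regular at the points of the plane, but not simultaneously at any point of the
  line.
\<close>

lemma base_plane_eq: "base_plane d = affine_plane x y"
proof -
  define F where "F = zariski X0 closure_of (F_inf d - {q})"
  have bp: "base_plane d = X0 - (exc q \<union> F)"
    by (simp add: base_plane_def ruled_surface_def blowups_def F_def q_def[symmetric] X0_def)
  have "R \<in> affine_plane x y" if R: "R \<in> X0" "R \<notin> exc q" "R \<notin> F" for R
    using R(1)
  proof (cases rule: X0_cases)
    case (1 a)
    have "dot m a \<noteq> 0"
    proof
      assume "dot m a = 0"
      then have "R \<in> F_inf d - {q}" using 1 data pt_in_line by auto
      then have "R \<in> F" unfolding F_def zariski_closure[OF points_X(1)] using R by blast
      then show False using R by blast
    qed
    then show ?thesis using pt_finite 1 unfolding affine_plane_def by blast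
  qed (use R in blast)
  moreover have "plane_pt x y a c \<notin> exc q \<union> F" for a c
  proof
    assume "plane_pt x y a c \<in> exc q \<union> F"
    then have cl: "plane_pt x y a c \<in> zariski X0 closure_of (F_inf d - {q})"
      using exc_q(3) plane(2,4) unfolding F_def by blast
    have H: "{x, y} \<subseteq> plane_pt x y a c" using plane(2,4) by blast
    obtain Q where Q: "Q \<in> F_inf d - {q}" "{x, y} \<subseteq> Q"
      by (rule closure_witness[OF points_X(1) cl _ H]) auto
    then obtain a where a: "a \<noteq> 0" "dot m a = 0" "Q = pt a" unfolding data line_def by blast
    then show False using finite_part[OF a(1) pt_closed[OF a(1)] lies_over_refl] Q by auto
  qed
  ultimately show ?thesis unfolding bp affine_plane_def using plane_in_X0(1) by blast
qed

end

section \<open>Chebyshev polynomials\<close>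

text \<open>
  Both sides agree at all points \<open>\<noteq> \<plusminus>1\<close>, since these are of the form \<open>cos \<theta>\<close> with \<open>sin \<theta> \<noteq> 0\<close>.
\<close>

lemma cheb_eqI:
  fixes p q :: "complex poly"
  assumes "\<And>\<theta>. sin \<theta> \<noteq> 0 \<Longrightarrow> poly p (cos \<theta>) = poly q (cos \<theta>)"
  shows "p = q"
proof -
  have "poly ((p - q) * [:- 1, 0, 1:]) a = 0" for a
  proof (cases "sin (Arccos a) = 0")
    case True
    then have "a\<^sup>2 = 1" using sin_cos_squared_add[of "Arccos a"] by simp
    then have "poly [:- 1, 0, 1:] a = 0" by (simp add: power2_eq_square)
    then show ?thesis by (simp only: poly_mult) simp
  next
    case False
    then show ?thesis using assms[of "Arccos a"] by simp
  qed
  then have "(p - q) * [:- 1, 0, 1:] = 0" by (metis poly_all_0_iff_0)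
  then have "p - q = 0 \<or> [:- 1, 0, 1 :: complex:] = 0" by (simp only: mult_eq_0_iff)
  then show ?thesis by simp
qed

lemma cheb_U_sin: "poly (cheb_U m) (cos \<theta>) * sin \<theta> = sin (of_nat (Suc m) * \<theta>)" if "sin \<theta> \<noteq> 0"
  using cheb_U_cos[OF that, of m] that by simp

lemma cheb_T_1: "cheb_T 1 = [:0, 1:]" and cheb_U_0: "cheb_U 0 = 1"
  by (rule cheb_eqI; simp add: cheb_T_cos cheb_U_cos)+

lemma cheb_U_Suc: "cheb_U (Suc m) = [:0, 1:] * cheb_U m + cheb_T (Suc m)"
proof (rule cheb_eqI)
  fix \<theta> :: complex assume s: "sin \<theta> \<noteq> 0"
  have "of_nat (Suc (Suc m)) * \<theta> = of_nat (Suc m) * \<theta> + \<theta>" by (simp add: algebra_simps)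
  then have "poly (cheb_U (Suc m)) (cos \<theta>) * sin \<theta>
      = sin (of_nat (Suc m) * \<theta>) * cos \<theta> + cos (of_nat (Suc m) * \<theta>) * sin \<theta>"
    using cheb_U_sin[OF s, of "Suc m"] by (simp only: sin_add)
  also have "\<dots> = poly ([:0, 1:] * cheb_U m + cheb_T (Suc m)) (cos \<theta>) * sin \<theta>"
    unfolding cheb_U_sin[OF s, symmetric] cheb_T_cos[symmetric] by (simp add: algebra_simps)
  finally show "poly (cheb_U (Suc m)) (cos \<theta>) = poly ([:0, 1:] * cheb_U m + cheb_T (Suc m)) (cos \<theta>)"
    using s by simp
qed

lemma cheb_T_Suc: "cheb_T (Suc (Suc m)) = [:0, 1:] * cheb_T (Suc m) + [:- 1, 0, 1:] * cheb_U m"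
proof (rule cheb_eqI)
  fix \<theta> :: complex assume s: "sin \<theta> \<noteq> 0"
  have W: "poly [:- 1, 0, 1:] (cos \<theta>) = - (sin \<theta> * sin \<theta>)"
    using sin_cos_squared_add[of \<theta>] by (simp add: power2_eq_square algebra_simps)
  have "of_nat (Suc (Suc m)) * \<theta> = of_nat (Suc m) * \<theta> + \<theta>" by (simp add: algebra_simps)
  then have "poly (cheb_T (Suc (Suc m))) (cos \<theta>)
      = cos (of_nat (Suc m) * \<theta>) * cos \<theta> - sin (of_nat (Suc m) * \<theta>) * sin \<theta>"
    unfolding cheb_T_cos by (simp only: cos_add)
  also have "\<dots> = poly ([:0, 1:] * cheb_T (Suc m) + [:- 1, 0, 1:] * cheb_U m) (cos \<theta>)"
    unfolding cheb_U_sin[OF s, symmetric] cheb_T_cos[symmetric] poly_add poly_mult W by (simp add: algebra_simps)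
  finally show "poly (cheb_T (Suc (Suc m))) (cos \<theta>) = poly ([:0, 1:] * cheb_T (Suc m) + [:- 1, 0, 1:] * cheb_U m) (cos \<theta>)" .
qed

text \<open>
  By a common induction along the addition theorems \<open>cheb_T_Suc\<close> and \<open>cheb_U_Suc\<close>. The first two
  identities need each other, and the third is Pell's equation.
\<close>

lemma cheb_identities:
  defines "X \<equiv> [:0, 1 :: complex:]" and "W \<equiv> [:- 1, 0, 1 :: complex:]"
  shows "pderiv (cheb_T (Suc m)) = of_nat (Suc m) * cheb_U m"
    and "W * pderiv (cheb_U m) = of_nat (Suc m) * cheb_T (Suc m) - X * cheb_U m"
    and "cheb_T (Suc m) ^ 2 - 1 = W * cheb_U m ^ 2"
proof -
  have W: "W = X\<^sup>2 - 1" by (simp add: W_def X_def power2_eq_square one_pCons)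
  have dX: "pderiv X = 1" "pderiv W = 2 * X"
    by (simp_all add: W_def X_def pderiv_pCons one_pCons numeral_poly)
  have T: "cheb_T (Suc (Suc m)) = X * cheb_T (Suc m) + W * cheb_U m"
    and U: "cheb_U (Suc m) = X * cheb_U m + cheb_T (Suc m)" for m
    by (simp_all only: cheb_T_Suc cheb_U_Suc X_def W_def)
  have "pderiv (cheb_T (Suc m)) = of_nat (Suc m) * cheb_U m \<and>
     W * pderiv (cheb_U m) = of_nat (Suc m) * cheb_T (Suc m) - X * cheb_U m \<and>
     cheb_T (Suc m) ^ 2 - 1 = W * cheb_U m ^ 2"
  proof (induction m)
    case 0
    show ?case using cheb_T_1 by (simp add: cheb_U_0 dX W flip: X_def)
  next
    case (Suc m)
    define t u N where "t = cheb_T (Suc m)" and "u = cheb_U m" and "N = (of_nat (Suc m) :: complex poly)"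
    have IH: "pderiv t = N * u" "W * pderiv u = N * t - X * u" "t\<^sup>2 - 1 = W * u\<^sup>2"
      using Suc by (auto simp: t_def u_def N_def)
    have T': "cheb_T (Suc (Suc m)) = X * t + W * u" and U': "cheb_U (Suc m) = X * u + t"
      by (simp_all only: T U t_def u_def)
    have N: "of_nat (Suc (Suc m)) = N + 1" by (simp add: N_def)
    have 1: "pderiv (X * t + W * u) = (N + 1) * (X * u + t)"
      unfolding pderiv_add pderiv_mult dX IH by (simp add: algebra_simps)
    have "W * pderiv (X * u + t) = W * u + X * (W * pderiv u) + W * pderiv t"
      unfolding pderiv_add pderiv_mult dX by (simp add: algebra_simps)
    also have "\<dots> = (N + 1) * (X * t + W * u) - X * (X * u + t)"
      unfolding IH unfolding W by (simp add: algebra_simps power2_eq_square)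
    finally have 2: "W * pderiv (X * u + t) = (N + 1) * (X * t + W * u) - X * (X * u + t)" .
    have "(X * t + W * u)\<^sup>2 - 1 - W * (X * u + t)\<^sup>2 = t\<^sup>2 - 1 - W * u\<^sup>2"
      unfolding W by (simp add: algebra_simps power2_eq_square)
    then have 3: "(X * t + W * u)\<^sup>2 - 1 = W * (X * u + t)\<^sup>2" using IH by simp
    show ?case unfolding T' U' N using 1 2 3 by blast
  qed
  then show "pderiv (cheb_T (Suc m)) = of_nat (Suc m) * cheb_U m"
    and "W * pderiv (cheb_U m) = of_nat (Suc m) * cheb_T (Suc m) - X * cheb_U m"
    and "cheb_T (Suc m) ^ 2 - 1 = W * cheb_U m ^ 2" by auto
qed

lemma cheb_degree: "degree (cheb_T (Suc m)) = Suc m"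
proof -
  have "degree (cheb_T (Suc m)) \<le> Suc m \<and> degree (cheb_U m) \<le> m \<and>
    coeff (cheb_T (Suc m)) (Suc m) = 2 ^ m \<and> coeff (cheb_U m) m = 2 ^ m"
  proof (induction m)
    case 0
    show ?case using cheb_T_1 by (simp add: cheb_U_0)
  next
    case (Suc m)
    have T: "cheb_T (Suc (Suc m)) = pCons 0 (cheb_T (Suc m)) + (pCons 0 (pCons 0 (cheb_U m)) - cheb_U m)"
      unfolding cheb_T_Suc by simp
    have U: "cheb_U (Suc m) = pCons 0 (cheb_U m) + cheb_T (Suc m)" unfolding cheb_U_Suc by simp
    have d: "degree (pCons 0 p) \<le> Suc k" if "degree p \<le> k" for p :: "complex poly" and k
      using that degree_pCons_le[of 0 p] by linarith
    have "degree (cheb_T (Suc (Suc m))) \<le> Suc (Suc m)"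
      unfolding T using Suc d by (intro degree_add_le degree_diff_le) (auto intro: le_trans)
    moreover have "degree (cheb_U (Suc m)) \<le> Suc m"
      unfolding U using Suc d by (intro degree_add_le) auto
    moreover have "coeff (cheb_U m) (Suc (Suc m)) = 0" using Suc by (intro coeff_eq_0) auto
    moreover have "coeff (cheb_T (Suc (Suc m))) (Suc (Suc m)) = 2 ^ Suc m"
      unfolding T using Suc calculation(3) by simp
    moreover have "coeff (cheb_U (Suc m)) (Suc m) = 2 ^ Suc m"
      unfolding U using Suc by simp
    ultimately show ?case by blast
  qed
  then show ?thesis using le_degree[of "cheb_T (Suc m)" "Suc m"] by auto
qed

lemma cheb_U_pm1:
  assumes "e\<^sup>2 = 1" shows "(poly (cheb_U m) e)\<^sup>2 = (of_nat (Suc m))\<^sup>2"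
proof -
  have "poly (cheb_T (Suc m) ^ 2 - 1) e = 0" "poly ([:- 1, 0, 1:] * pderiv (cheb_U m)) e = 0"
    unfolding cheb_identities(3) using assms by (simp_all add: power2_eq_square)
  then have T: "(poly (cheb_T (Suc m)) e)\<^sup>2 = 1" and "of_nat (Suc m) * poly (cheb_T (Suc m)) e = e * poly (cheb_U m) e"
    unfolding cheb_identities(2) by (simp_all add: poly_power)
  then have "(of_nat (Suc m))\<^sup>2 * (poly (cheb_T (Suc m)) e)\<^sup>2 = e\<^sup>2 * (poly (cheb_U m) e)\<^sup>2"
    by (metis power_mult_distrib)
  then show ?thesis using T assms by simp
qed

lemma cheb_U_simple_root:
  assumes "a\<^sup>2 \<noteq> 1" "poly (cheb_U m) a = 0" shows "poly (pderiv (cheb_U m)) a \<noteq> 0"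
proof
  assume "poly (pderiv (cheb_U m)) a = 0"
  then have "poly ([:- 1, 0, 1:] * pderiv (cheb_U m)) a = 0" by simp
  then have "of_nat (Suc m) * poly (cheb_T (Suc m)) a = 0"
    unfolding cheb_identities(2) using assms by simp
  then have "poly (cheb_T (Suc m)) a = 0" by (metis mult_eq_0_iff of_nat_neq_0)
  moreover have "poly (cheb_T (Suc m) ^ 2 - 1) a = 0"
    unfolding cheb_identities(3) using assms by (simp add: poly_power)
  ultimately show False by (simp add: poly_power)
qed

lemma cheb_U_root:
  assumes a: "a\<^sup>2 \<noteq> 1" and U: "poly (cheb_U (n - 1)) a = 0" and n: "n > 0"
  obtains k where "k \<in> {1..n - 1}" "a = cos (of_real (real k * pi / real n))"
proof -
  define \<theta> where "\<theta> = Arccos a"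
  have c: "cos \<theta> = a" by (simp add: \<theta>_def)
  have "sin \<theta> \<noteq> 0" using sin_cos_squared_add[of \<theta>] a c by auto
  then have "sin (of_nat n * \<theta>) = 0" using cheb_U_sin[of \<theta> "n - 1"] U n c by simp
  then obtain j :: int where "of_nat n * \<theta> = of_int j * of_real pi" by (auto simp: sin_eq_0 mult_ac)
  then have \<theta>: "\<theta> = of_real (real_of_int j * pi / real n)" using n by (simp add: field_simps)
  \<comment> \<open>By periodicity and symmetry of the cosine, \<open>k\<close> can be moved into the range \<open>0 < k < n\<close>.\<close>
  define r where "r = j mod (2 * int n)"
  have r: "0 \<le> r" "r < 2 * int n" using n by (simp_all add: r_def)
  have "cos \<theta> = of_real (cos (real_of_int r * pi / real n))"
  proof -
    have "real_of_int j = real_of_int (r + 2 * int n * (j div (2 * int n)))" by (simp add: r_def)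
    then have "real_of_int j = real_of_int r + 2 * real n * real_of_int (j div (2 * int n))" by simp
    then have "real_of_int j * pi / real n = real_of_int r * pi / real n + 2 * pi * real_of_int (j div (2 * int n))"
      using n by (simp add: field_simps)
    then have "cos (real_of_int j * pi / real n) = cos (real_of_int r * pi / real n)"
      using cos_int_2pin[of "j div (2 * int n)"] sin_int_2pin[of "j div (2 * int n)"] by (simp add: cos_add)
    then show ?thesis unfolding \<theta> cos_of_real by simp
  qed
  then have ar: "a = of_real (cos (real_of_int r * pi / real n))" using c by simp
  have "r \<noteq> 0" "r \<noteq> int n" using a ar n by auto
  show thesis
  proof (cases "r < int n")
    case True
    have k: "nat r \<in> {1..n - 1}" using True r(1) \<open>r \<noteq> 0\<close> unfolding atLeastAtMost_iff by linarith
    have "real (nat r) = real_of_int r" using r(1) by simp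
    then have "a = cos (of_real (real (nat r) * pi / real n))" unfolding cos_of_real using ar by simp
    then show ?thesis using that k by blast
  next
    case False
    have "cos (real_of_int r * pi / real n) = cos (2 * pi - real_of_int r * pi / real n)"
      by (simp add: cos_diff)
    also have "2 * pi - real_of_int r * pi / real n = real (nat (2 * int n - r)) * pi / real n"
      using r n by (simp add: field_simps)
    finally have "a = cos (of_real (real (nat (2 * int n - r)) * pi / real n))"
      unfolding cos_of_real using ar by simp
    moreover have "nat (2 * int n - r) \<in> {1..n - 1}"
      using False r(2) \<open>r \<noteq> int n\<close> unfolding atLeastAtMost_iff by linarith
    ultimately show ?thesis using that by blast
  qed
qed

section \<open>Endomorphisms given by a comorphism\<close>

text \<open>
  Expand one factor of each product in terms of the generators.
\<close>

lemma max_ideal_sq_iff: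
  assumes P: "closed_point P" and max: "max_ideal P = ideal2 P u v"
  shows "k \<in> max_ideal_sq P \<longleftrightarrow> (\<exists>r\<in>max_ideal P. \<exists>s\<in>max_ideal P. k = r * u + s * v)"
proof
  note mi = max_ideal_iff[OF P]
  assume "k \<in> max_ideal_sq P"
  then obtain N a b where k: "k = (\<Sum>i<(N::nat). a i * b i)" and ab: "\<forall>i<N. a i \<in> max_ideal P \<and> b i \<in> max_ideal P"
    unfolding max_ideal_sq_def by blast
  have "\<exists>r\<in>max_ideal P. \<exists>s\<in>max_ideal P. (\<Sum>i<j. a i * b i) = r * u + s * v" if "j \<le> N" for j
    using that
  proof (induction j)
    case 0
    show ?case using P by (intro bexI[of _ 0]) (auto simp: mi cp_simps)
  next
    case (Suc j)
    then obtain r s where rs: "r \<in> max_ideal P" "s \<in> max_ideal P" "(\<Sum>i<j. a i * b i) = r * u + s * v" by auto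
    have aj: "a j \<in> max_ideal P" "b j \<in> ideal2 P u v" using ab Suc.prems max by auto
    then obtain c c' where c: "c \<in> P" "c' \<in> P" "b j = c * u + c' * v" by (auto simp: ideal2_def)
    have "(\<Sum>i<Suc j. a i * b i) = (r + a j * c) * u + (s + a j * c') * v"
      using rs c by (simp add: algebra_simps)
    moreover have "r + a j * c \<in> max_ideal P" "s + a j * c' \<in> max_ideal P"
      using rs aj c P by (auto simp: mi cp_simps)
    ultimately show ?case by blast
  qed
  then show "\<exists>r\<in>max_ideal P. \<exists>s\<in>max_ideal P. k = r * u + s * v" using k by blast
next
  assume "\<exists>r\<in>max_ideal P. \<exists>s\<in>max_ideal P. k = r * u + s * v"
  then obtain r s where rs: "r \<in> max_ideal P" "s \<in> max_ideal P" "k = r * u + s * v" by blast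
  have uv: "u \<in> max_ideal P" "v \<in> max_ideal P" unfolding max by (rule ideal2_gens[OF P])+
  define a where "a i = (if i = 0 then r else s)" for i :: nat
  define b where "b i = (if i = 0 then u else v)" for i :: nat
  have "k = (\<Sum>i<2. a i * b i)" using rs by (simp add: a_def b_def numeral_2_eq_2)
  moreover have "\<forall>i<2. a i \<in> max_ideal P \<and> b i \<in> max_ideal P" using rs uv by (simp add: a_def b_def)
  ultimately show "k \<in> max_ideal_sq P" unfolding max_ideal_sq_def by blast
qed

text \<open>
  A map of a model into itself that is described by its comorphism: the ring of \<open>f P\<close> is mapped by \<open>\<phi>\<close> into
  the ring of \<open>P\<close>. The condition \<open>domain\<close> says that a germ at \<open>f P\<close> is regular at the images of all
  points near \<open>P\<close>, which amounts to continuity; \<open>dense\<close> says that nonempty open sets meet; and \<open>params\<close>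
  says that the differential is invertible.
\<close>

locale local_endo =
  fixes X :: model and f :: "point \<Rightarrow> point" and \<phi> :: "ratfun \<Rightarrow> ratfun"
  assumes pts: "points X" and maps: "\<And>P. P \<in> X \<Longrightarrow> f P \<in> X" and \<phi>: "fhom \<phi>"
    and loc: "\<And>P. P \<in> X \<Longrightarrow> locmap \<phi> (f P) P"
    and dense: "\<And>H. finite H \<Longrightarrow> \<exists>Q\<in>X. H \<subseteq> Q"
    and domain: "\<And>P h. P \<in> X \<Longrightarrow> h \<in> f P \<Longrightarrow>
      \<exists>K. finite K \<and> K \<subseteq> P \<and> (\<forall>P'\<in>X. K \<subseteq> P' \<longrightarrow> h \<in> f P')"
    and params: "\<And>P. P \<in> X \<Longrightarrow> \<exists>u v. max_ideal (f P) = ideal2 (f P) u v \<and> regular_point P (\<phi> u) (\<phi> v)"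
begin

lemma domain_finite:
  assumes P: "P \<in> X" and H: "finite H" "H \<subseteq> f P"
  shows "\<exists>K. finite K \<and> K \<subseteq> P \<and> (\<forall>P'\<in>X. K \<subseteq> P' \<longrightarrow> H \<subseteq> f P')"
  using H
proof (induction H)
  case empty
  show ?case by (intro exI[of _ "{}"]) simp
next
  case (insert h H)
  then obtain K where K: "finite K" "K \<subseteq> P" "\<forall>P'\<in>X. K \<subseteq> P' \<longrightarrow> H \<subseteq> f P'" by auto
  have "h \<in> f P" using insert.prems by simp
  then obtain L where L: "finite L" "L \<subseteq> P" "\<forall>P'\<in>X. L \<subseteq> P' \<longrightarrow> h \<in> f P'"
    using domain[OF P \<open>h \<in> f P\<close>] by (elim exE conjE)
  show ?case using K L by (intro exI[of _ "K \<union> L"]) auto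
qed

lemma pullback_comorphism:
  assumes P: "P \<in> X" and h: "h \<in> f P" shows "pullback X f P h (\<phi> h)"
proof -
  obtain K where K: "finite K" "K \<subseteq> P" "\<forall>P'\<in>X. K \<subseteq> P' \<longrightarrow> h \<in> f P'"
    using domain[OF P h] by (elim exE conjE)
  have "openin (zariski X) {P' \<in> X. K \<subseteq> P'}" by (rule openin_domain[OF pts K(1)])
  moreover have "\<forall>Q\<in>{P' \<in> X. K \<subseteq> P'}. h \<in> f Q \<and> \<phi> h \<in> Q \<and> val Q (\<phi> h) = val (f Q) h"
    using K loc by (auto simp: locmap_def)
  ultimately show ?thesis unfolding pullback_def using P K by (intro exI[of _ "{P' \<in> X. K \<subseteq> P'}"]) blast
qed

text \<open>
  Pullbacks are only determined by their values on a neighbourhood. The difference of two of them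
  vanishes at all points of an open set, but a nonzero rational function is invertible somewhere on
  it.
\<close>

lemma pullback_unique:
  assumes P: "P \<in> X" and pb: "pullback X f P h k" shows "k = \<phi> h"
proof (rule ccontr)
  assume ne: "k \<noteq> \<phi> h"
  obtain U where U: "openin (zariski X) U" "P \<in> U" "\<forall>Q\<in>U. h \<in> f Q \<and> k \<in> Q \<and> val Q k = val (f Q) h"
    using pb unfolding pullback_def by blast
  obtain H where H: "finite H" "H \<subseteq> P" "{Q \<in> X. H \<subseteq> Q} \<subseteq> U" by (rule zariski_nbhd[OF U(1,2)])
  obtain Q where Q: "Q \<in> X" "insert (inverse (k - \<phi> h)) H \<subseteq> Q"
    using dense[of "insert (inverse (k - \<phi> h)) H"] H(1) by auto
  then have "Q \<in> U" using H by auto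
  then have *: "h \<in> f Q" "k \<in> Q" "val Q k = val (f Q) h" using U by auto
  have cp: "closed_point Q" by (rule pointsD[OF pts Q(1)])
  have "\<phi> h \<in> Q" "val Q (\<phi> h) = val (f Q) h" using loc[OF Q(1)] * by (auto simp: locmap_def)
  then have "k - \<phi> h \<in> Q" "val Q (k - \<phi> h) = 0" using * cp by (simp_all add: cp_simps)
  then show False using inverse_notin[OF cp] Q ne by auto
qed

lemma morphism: "morphism X X f"
proof -
  have "openin (zariski X) {P \<in> X. f P \<in> V}" if V: "openin (zariski X) V" for V
  proof (subst openin_subopen, intro ballI)
    fix P assume "P \<in> {P \<in> X. f P \<in> V}"
    then have P: "P \<in> X" "f P \<in> V" by auto
    obtain H where H: "finite H" "H \<subseteq> f P" "{Q \<in> X. H \<subseteq> Q} \<subseteq> V" by (rule zariski_nbhd[OF V P(2)])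
    obtain K where K: "finite K" "K \<subseteq> P" "\<forall>P'\<in>X. K \<subseteq> P' \<longrightarrow> H \<subseteq> f P'"
      using domain_finite[OF P(1) H(1,2)] by (elim exE conjE)
    have "{P' \<in> X. K \<subseteq> P'} \<subseteq> {P \<in> X. f P \<in> V}" using K(3) H(3) maps by blast
    then show "\<exists>T. openin (zariski X) T \<and> P \<in> T \<and> T \<subseteq> {P \<in> X. f P \<in> V}"
      using openin_domain[OF pts K(1)] P(1) K(2) by (intro exI[of _ "{P' \<in> X. K \<subseteq> P'}"]) simp
  qed
  then have "continuous_map (zariski X) (zariski X) f"
    using maps by (simp add: continuous_map_def topspace_zariski[OF pts] Pi_iff)
  moreover have "\<exists>k. \<forall>P\<in>X. f P \<in> V \<longrightarrow> k \<in> P \<and> val P k = val (f P) h" if "\<forall>Q\<in>V. h \<in> Q" for V h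
    using that loc by (intro exI[of _ "\<phi> h"]) (auto simp: locmap_def)
  ultimately show ?thesis by (simp add: morphism_def)
qed

text \<open>
  The images of local parameters are local parameters, hence a basis of the cotangent space.
\<close>

lemma etale: "etale X X f"
  unfolding etale_def
proof (intro conjI ballI impI)
  show "morphism X X f" by (rule morphism)
next
  fix P h k assume P: "P \<in> X" and h: "h \<in> max_ideal (f P)" and k: "k \<in> max_ideal_sq P" and pb: "pullback X f P h k"
  obtain u v where uv: "max_ideal (f P) = ideal2 (f P) u v" and reg: "regular_point P (\<phi> u) (\<phi> v)"
    using params[OF P] by blast
  note cp = regular_point_cp[OF reg] and cf = pointsD[OF pts maps[OF P]]
  obtain a b where ab: "a \<in> f P" "b \<in> f P" "h = a * u + b * v" using h uv by (auto simp: ideal2_def)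
  have l: "\<phi> a \<in> P" "val P (\<phi> a) = val (f P) a" "\<phi> b \<in> P" "val P (\<phi> b) = val (f P) b"
    using loc[OF P] ab by (auto simp: locmap_def)
  have "max_ideal P = ideal2 P (\<phi> u) (\<phi> v)" using reg by (simp add: regular_point_def)
  then obtain r s where rs: "r \<in> max_ideal P" "s \<in> max_ideal P" "k = r * \<phi> u + s * \<phi> v"
    using k max_ideal_sq_iff[OF cp] by blast
  have rs': "r \<in> P" "val P r = 0" "s \<in> P" "val P s = 0" using rs max_ideal_iff[OF cp] by auto
  have "k = \<phi> a * \<phi> u + \<phi> b * \<phi> v" using pullback_unique[OF P pb] ab \<phi> by (simp add: fhom_simps)
  then have "(\<phi> a - r) * \<phi> u + (\<phi> b - s) * \<phi> v = 0" using rs by (simp add: algebra_simps)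
  then have "val P (\<phi> a - r) = 0" "val P (\<phi> b - s) = 0"
    using regular_point_rel_val[OF reg, of "\<phi> a - r" "\<phi> b - s"] l rs' cp by (simp_all add: cp_simps)
  then have "a \<in> max_ideal (f P)" "b \<in> max_ideal (f P)"
    using l rs' ab cp max_ideal_iff[OF cf] by (simp_all add: cp_simps)
  then show "h \<in> max_ideal_sq (f P)" using max_ideal_sq_iff[OF cf uv] ab by blast
next
  fix P k assume P: "P \<in> X" and k: "k \<in> max_ideal P"
  obtain u v where uv: "max_ideal (f P) = ideal2 (f P) u v" and reg: "regular_point P (\<phi> u) (\<phi> v)"
    using params[OF P] by blast
  note cp = regular_point_cp[OF reg] and cf = pointsD[OF pts maps[OF P]]
  have max: "max_ideal P = ideal2 P (\<phi> u) (\<phi> v)" using reg by (simp add: regular_point_def)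
  then obtain a b where ab: "a \<in> P" "b \<in> P" "k = a * \<phi> u + b * \<phi> v" using k by (auto simp: ideal2_def)
  define h where "h = const (val P a) * u + const (val P b) * v"
  have h: "h \<in> max_ideal (f P)" unfolding uv h_def using cf by (intro ideal2_memI) (simp_all add: cp_simps)
  have "k - \<phi> h = (a - const (val P a)) * \<phi> u + (b - const (val P b)) * \<phi> v"
    using \<phi> ab by (simp add: h_def fhom_simps algebra_simps)
  moreover have "a - const (val P a) \<in> max_ideal P" "b - const (val P b) \<in> max_ideal P"
    using ab cp by (simp_all add: max_ideal_iff[OF cp] cp_simps)
  ultimately have "k - \<phi> h \<in> max_ideal_sq P" using max_ideal_sq_iff[OF cp max] by blast
  moreover have "h \<in> f P" using h max_ideal_iff[OF cf] by blast
  ultimately show "\<exists>h\<in>max_ideal (f P). \<exists>k'. pullback X f P h k' \<and> k - k' \<in> max_ideal_sq P"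
    using h pullback_comorphism[OF P] by blast
qed

lemma comorphism: "comorphism X f \<phi>"
  using \<phi> loc by (simp add: comorphism_def fhom_simps locmap_def)

end

section \<open>Congruences along a curve through a point\<close>

text \<open>
  Congruence modulo \<open>u\<close> in the ring of a point, that is, equality on the curve \<open>u = 0\<close>.
\<close>

definition cong_mod :: "point \<Rightarrow> ratfun \<Rightarrow> ratfun \<Rightarrow> ratfun \<Rightarrow> bool" where
  "cong_mod R u h k \<longleftrightarrow> h \<in> R \<and> k \<in> R \<and> (\<exists>r\<in>R. h - k = u * r)"

lemma cong_modI: "h \<in> R \<Longrightarrow> k \<in> R \<Longrightarrow> r \<in> R \<Longrightarrow> h - k = u * r \<Longrightarrow> cong_mod R u h k"
  by (auto simp: cong_mod_def)

lemma cong_mod_refl: "closed_point R \<Longrightarrow> h \<in> R \<Longrightarrow> cong_mod R u h h"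
  by (rule cong_modI[of _ _ _ 0]) (auto simp: cp_simps)

lemma cong_mod_add:
  assumes R: "closed_point R" and "cong_mod R u h k" "cong_mod R u h' k'"
  shows "cong_mod R u (h + h') (k + k')"
proof -
  obtain r s where rs: "r \<in> R" "s \<in> R" "h - k = u * r" "h' - k' = u * s" "h \<in> R" "k \<in> R" "h' \<in> R" "k' \<in> R"
    using assms(2,3) by (auto simp: cong_mod_def)
  have "h + h' - (k + k') = (h - k) + (h' - k')" by simp
  also have "\<dots> = u * (r + s)" unfolding rs by (simp add: algebra_simps)
  finally show ?thesis using rs R by (intro cong_modI[of _ _ _ "r + s"]) (auto simp: cp_simps)
qed

lemma cong_mod_diff:
  assumes R: "closed_point R" and "cong_mod R u h k" "cong_mod R u h' k'"
  shows "cong_mod R u (h - h') (k - k')"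
proof -
  obtain r s where rs: "r \<in> R" "s \<in> R" "h - k = u * r" "h' - k' = u * s" "h \<in> R" "k \<in> R" "h' \<in> R" "k' \<in> R"
    using assms(2,3) by (auto simp: cong_mod_def)
  have "h - h' - (k - k') = (h - k) - (h' - k')" by simp
  also have "\<dots> = u * (r - s)" unfolding rs by (simp add: algebra_simps)
  finally show ?thesis using rs R by (intro cong_modI[of _ _ _ "r - s"]) (auto simp: cp_simps)
qed

lemma cong_mod_mult:
  assumes R: "closed_point R" and "cong_mod R u h k" "cong_mod R u h' k'"
  shows "cong_mod R u (h * h') (k * k')"
proof -
  obtain r s where rs: "r \<in> R" "s \<in> R" "h - k = u * r" "h' - k' = u * s" "h \<in> R" "k \<in> R" "h' \<in> R" "k' \<in> R"
    using assms(2,3) by (auto simp: cong_mod_def)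
  have "h * h' - k * k' = (h - k) * h' + k * (h' - k')" by (simp add: algebra_simps)
  also have "\<dots> = u * (r * h' + k * s)" unfolding rs by (simp add: algebra_simps)
  finally show ?thesis using rs R by (intro cong_modI[of _ _ _ "r * h' + k * s"]) (auto simp: cp_simps)
qed

lemma cong_mod_power:
  assumes R: "closed_point R" and "cong_mod R u h k" shows "cong_mod R u (h ^ j) (k ^ j)"
  by (induction j) (use assms in \<open>auto intro: cong_mod_mult cong_mod_refl simp: cp_simps\<close>)

lemma cong_mod_val:
  assumes R: "closed_point R" and u: "u \<in> R" "val R u = 0" and c: "cong_mod R u h k"
  shows "val R h = val R k"
proof -
  obtain r where r: "r \<in> R" "h - k = u * r" "h \<in> R" "k \<in> R" using c by (auto simp: cong_mod_def)
  then have "h = k + u * r" by (simp add: algebra_simps)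
  then show ?thesis using r u R by (simp add: cp_simps)
qed

lemma cong_mod_inverse:
  assumes R: "closed_point R" and u: "u \<in> R" "val R u = 0" and c: "cong_mod R u h k" and k: "val R k \<noteq> 0"
  shows "cong_mod R u (inverse h) (inverse k)"
proof -
  obtain r where r: "r \<in> R" "h - k = u * r" "h \<in> R" "k \<in> R" using c by (auto simp: cong_mod_def)
  have h: "val R h \<noteq> 0" using cong_mod_val[OF R u c] k by simp
  have "h \<noteq> 0" "k \<noteq> 0" using h k R by (auto simp: cp_simps)
  then have "inverse h - inverse k = - (h - k) * (inverse h * inverse k)" by (simp add: field_simps)
  also have "\<dots> = u * (- r * inverse h * inverse k)" unfolding r(2) by simp
  finally show ?thesis
    using r h k R by (intro cong_modI[of _ _ _ "- r * inverse h * inverse k"]) (auto simp: cp_simps)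
qed

lemma cong_mod_px:
  assumes R: "closed_point R" and x: "cong_mod R u x (const a)"
  shows "cong_mod R u (hev const x q) (const (poly q a))"
proof (induction q)
  case 0
  then show ?case using cong_mod_refl[OF R cp_0[OF R]] by simp
next
  case (pCons c q)
  have "cong_mod R u (const c + x * hev const x q) (const c + const a * const (poly q a))"
    by (intro cong_mod_add[OF R] cong_mod_mult[OF R] cong_mod_refl[OF R] x pCons.IH cp_const[OF R])
  then show ?case by (simp add: px_pCons const_add const_mult)
qed

text \<open>
  On the curve \<open>u = 0\<close>, where \<open>t\<close> is a local parameter, \<open>h\<close> is an affine function of \<open>t\<close> of slope
  \<open>k1 \<noteq> 0\<close>. So the transition matrix from \<open>u\<close>, \<open>t - c\<close> to \<open>\<alpha> u\<close>, \<open>h\<close> is triangular with units on the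
  diagonal.
\<close>

lemma regular_by_cong:
  assumes R: "regular_point R u (t - const c)" and t: "t \<in> R"
    and \<alpha>: "\<alpha> \<in> R" "val R \<alpha> \<noteq> 0"
    and h: "cong_mod R u h (const k0 + const k1 * t)" and k1: "k1 \<noteq> 0"
  shows "h \<in> R" "regular_point R (\<alpha> * u) (h - const (val R h))"
proof -
  note cp = regular_point_cp[OF R] and uv = regular_point_params[OF R]
  have "val R t = c" using uv(4) t cp by (simp add: cp_simps)
  obtain r where r: "r \<in> R" "h - (const k0 + const k1 * t) = u * r" "h \<in> R" using h by (auto simp: cong_mod_def)
  show "h \<in> R" by (rule r(3))
  have "val R h = val R (const k0 + const k1 * t)" by (rule cong_mod_val[OF cp uv(1,3) h])
  also have "\<dots> = k0 + k1 * c" using t cp \<open>val R t = c\<close> by (simp add: cp_simps)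
  finally have "h - const (val R h) = h - (const k0 + const k1 * const c)" by (simp add: const_add const_mult)
  also have "\<dots> = r * u + const k1 * (t - const c)" using r(2) by (simp add: algebra_simps)
  finally have h: "h - const (val R h) = r * u + const k1 * (t - const c)" .
  show "regular_point R (\<alpha> * u) (h - const (val R h))"
    by (rule regular_point_change[OF R \<alpha>(1) cp_0[OF cp] r(1) cp_const[OF cp, of k1] _ _ h])
      (use \<alpha> k1 cp r in \<open>auto simp: cp_simps\<close>)
qed

section \<open>The endomorphism near each point\<close>

lemma poly_taylor:
  fixes q :: "complex poly"
  obtains r where "q = [:poly q a:] + [:- a, 1:] * r" "poly r a = poly (pderiv q) a"
proof -
  define r where "r = synthetic_div q a"
  have 1: "q = [:poly q a:] + [:- a, 1:] * r"
    using synthetic_div_correct'[of a q] by (simp add: r_def add.commute)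
  have "pderiv q = pderiv ([:poly q a:] + [:- a, 1:] * r)" using 1 by simp
  also have "\<dots> = r + [:- a, 1:] * pderiv r"
    by (simp only: pderiv_add pderiv_mult) (simp add: pderiv_pCons)
  finally have "poly (pderiv q) a = poly r a" by simp
  then show thesis using that 1 by simp
qed

lemma px_taylor:
  obtains r where "hev const x q = const (poly q a) + (x - const a) * hev const x r" "poly r a = poly (pderiv q) a"
proof -
  obtain r where r: "q = [:poly q a:] + [:- a, 1:] * r" "poly r a = poly (pderiv q) a" by (rule poly_taylor)
  have "hev const x q = hev const x ([:poly q a:] + [:- a, 1:] * r)" using r(1) by simp
  also have "\<dots> = const (poly q a) + (x - const a) * hev const x r"
    unfolding rhom_add[OF rhom_px] rhom_mult[OF rhom_px] by (simp add: px_pCons const_minus)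
  finally show thesis using that r(2) by blast
qed

text \<open>
  The comorphism of the endomorphism of degree \<open>n = m + 1\<close>. The hypothesis \<open>root\<close> is the condition on
  \<open>b\<close> with the sines eliminated: \<open>sin\<^sup>2 = - w\<close>.
\<close>

locale cheb_endo = chart x y for x y :: ratfun +
  fixes m :: nat and b :: "complex poly" and \<phi> :: "ratfun \<Rightarrow> ratfun"
  assumes root: "\<And>a. a\<^sup>2 \<noteq> 1 \<Longrightarrow> poly (cheb_U m) a = 0 \<Longrightarrow> (a\<^sup>2 - 1) * (poly b a)\<^sup>2 = 1"
    and \<phi>: "fhom \<phi>" and \<phi>x: "\<phi> x = hev const x (cheb_T (Suc m))"
    and \<phi>y: "\<phi> y = const (1 / of_nat (Suc m)) * (hev const x (cheb_U m))\<^sup>2 * y + w * hev const x (cheb_U m) * hev const x b"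
begin

abbreviation "px \<equiv> hev const x"
abbreviation "T \<equiv> cheb_T (Suc m)"
abbreviation "U \<equiv> cheb_U m"
abbreviation "n \<equiv> of_nat (Suc m) :: complex"
definition \<kappa> :: complex where "\<kappa> = 1 / n"
definition V :: ratfun where "V = const \<kappa> * px U * y + w * px b"

lemma n_nz: "n \<noteq> 0" and \<kappa>_nz: "\<kappa> \<noteq> 0" and \<kappa>n: "\<kappa> * n = 1"
  using of_nat_neq_0[of m] unfolding \<kappa>_def by (simp_all del: of_nat_Suc)

lemma px_W: "px [:- 1, 0, 1:] = w"
  by (simp add: px_pCons w_def power2_eq_square const_minus)

lemma cheb_val: "(poly T a)\<^sup>2 - 1 = (a\<^sup>2 - 1) * (poly U a)\<^sup>2"
  using arg_cong[OF cheb_identities(3)[of m], of "\<lambda>q. poly q a"] by (simp add: poly_power power2_eq_square algebra_simps)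

lemma \<phi>w: "\<phi> w = w * (px U)\<^sup>2"
proof -
  have "\<phi> w = px (T\<^sup>2 - 1)" using \<phi> by (simp add: w_def fhom_simps \<phi>x rhom_simps[OF rhom_px])
  also have "\<dots> = px [:- 1, 0, 1:] * px U ^ 2"
    unfolding cheb_identities(3) by (simp only: rhom_mult[OF rhom_px] rhom_power[OF rhom_px])
  finally show ?thesis unfolding px_W .
qed

lemma \<phi>y': "\<phi> y = px U * V"
  by (simp add: \<phi>y V_def \<kappa>_def power2_eq_square algebra_simps)

lemma UV_nz: "px U \<noteq> 0" "V \<noteq> 0"
proof -
  have "\<phi> y \<noteq> 0" using \<phi> nonzero(1) by (simp add: fhom_simps)
  then show "px U \<noteq> 0" "V \<noteq> 0" unfolding \<phi>y' by auto
qed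

lemma \<phi>z: "\<phi> z = (w - V\<^sup>2) / (px U * V ^ 3)"
proof -
  have "\<phi> z = (\<phi> w / \<phi> y / \<phi> y - 1) / \<phi> y" using \<phi> by (simp add: z_def fhom_simps)
  also have "\<dots> = (w - V\<^sup>2) / (px U * V ^ 3)"
    unfolding \<phi>w \<phi>y' using UV_nz by (simp add: field_simps power2_eq_square power3_eq_cube)
  finally show ?thesis .
qed

lemma plane_image:
  fixes a c :: complex
  defines "R \<equiv> plane_pt x y a c"
  shows "\<phi> x \<in> R" "val R (\<phi> x) = poly T a" "\<phi> y \<in> R"
    "val R (\<phi> y) = \<kappa> * (poly U a)\<^sup>2 * c + (a\<^sup>2 - 1) * poly U a * poly b a"
proof -
  have cp: "closed_point R" unfolding R_def by (rule plane_cp)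
  note P = plane[where a = a and c = c, folded R_def] and W = plane_w[of a c, folded R_def]
  note p = cp_px[OF cp P(2)]
  show "\<phi> x \<in> R" "val R (\<phi> x) = poly T a" unfolding \<phi>x using p P(3) by auto
  show "\<phi> y \<in> R" "val R (\<phi> y) = \<kappa> * (poly U a)\<^sup>2 * c + (a\<^sup>2 - 1) * poly U a * poly b a"
    unfolding \<phi>y \<kappa>_def[symmetric] using p P(3-5) W cp by (simp_all add: cp_simps)
qed

text \<open>
  Here \<open>U\<close> does not vanish, \<open>\<phi> x\<close> is a unit times \<open>x - a\<close> up to a constant because \<open>T' = n U\<close>, and \<open>\<phi> y\<close>
  is affine in \<open>y\<close> with slope \<open>U\<^sup>2 / n\<close> modulo \<open>x - a\<close>.
\<close>

lemma params_open:
  fixes a c :: complex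
  assumes a: "a\<^sup>2 \<noteq> 1" and Ta: "(poly T a)\<^sup>2 \<noteq> 1"
  defines "R \<equiv> plane_pt x y a c"
  shows "regular_point R (\<phi> x - const (val R (\<phi> x))) (\<phi> y - const (val R (\<phi> y)))"
proof -
  have cp: "closed_point R" unfolding R_def by (rule plane_cp)
  note P = plane[where a = a and c = c, folded R_def] and W = plane_w[of a c, folded R_def]
  note p = cp_px[OF cp P(2)]
  have Ua: "poly U a \<noteq> 0" using Ta cheb_val[of a] by auto
  obtain t where t: "px T = const (poly T a) + (x - const a) * px t" "poly t a = poly (pderiv T) a"
    by (rule px_taylor)
  have "poly t a = n * poly U a" unfolding t(2) cheb_identities(1) by simp
  then have t0: "val R (px t) \<noteq> 0" using p P(3) Ua n_nz by simp
  have "val R (\<phi> x) = poly T a" using plane_image(2)[of a c] by (simp add: R_def)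
  then have X: "\<phi> x - const (val R (\<phi> x)) = px t * (x - const a)" unfolding \<phi>x t(1) by simp
  have xc: "cong_mod R (x - const a) x (const a)"
    by (rule cong_modI[of _ _ _ 1]) (use P(2-5) cp in \<open>simp_all add: cp_simps\<close>)
  note C = cong_mod_px[OF cp xc]
  have "cong_mod R (x - const a) (const \<kappa> * (px U)\<^sup>2 * y + px [:- 1, 0, 1:] * px U * px b)
    (const \<kappa> * (const (poly U a))\<^sup>2 * y + const (poly [:- 1, 0, 1:] a) * const (poly U a) * const (poly b a))"
    by (intro cong_mod_add[OF cp] cong_mod_mult[OF cp] cong_mod_power[OF cp] C cong_mod_refl[OF cp] cp_const[OF cp] P(4))
  moreover have "const \<kappa> * (const (poly U a))\<^sup>2 * y + const (poly [:- 1, 0, 1:] a) * const (poly U a) * const (poly b a)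
     = const (poly [:- 1, 0, 1:] a * poly U a * poly b a) + const (\<kappa> * (poly U a)\<^sup>2) * y"
    by (simp add: const_mult const_power)
  ultimately have "cong_mod R (x - const a) (\<phi> y) (const (poly [:- 1, 0, 1:] a * poly U a * poly b a) + const (\<kappa> * (poly U a)\<^sup>2) * y)"
    unfolding \<phi>y px_W \<kappa>_def[symmetric] by simp
  then show ?thesis unfolding X
    by (rule regular_by_cong(2)[OF P(1) P(4) p(1) t0]) (use Ua \<kappa>_nz in simp)
qed

text \<open>
  Write \<open>U = (x - a) U1\<close> and \<open>1 - w b\<^sup>2 = (x - a) C1\<close>, with \<open>U1\<close> a unit since the zero of \<open>U\<close> is simple.
  Then \<open>w - V\<^sup>2 = U N\<close> with \<open>N\<close> regular, whence \<open>\<phi> z = N / V\<^sup>3\<close>. Modulo \<open>x - a\<close>, \<open>V\<close> is the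
  nonzero constant \<open>w b\<close> and \<open>N\<close> is affine in \<open>y\<close> with slope \<open>- 2 w b / n\<close>.
\<close>

lemma params_root:
  fixes a c :: complex
  assumes a: "a\<^sup>2 \<noteq> 1" and Ta: "(poly T a)\<^sup>2 = 1"
  defines "R \<equiv> plane_pt x y a c"
  shows "val R (\<phi> y) = 0" "\<phi> z \<in> R" "regular_point R (\<phi> y) (\<phi> z - const (val R (\<phi> z)))"
proof -
  have cp: "closed_point R" unfolding R_def by (rule plane_cp)
  note P = plane[where a = a and c = c, folded R_def] and W = plane_w[of a c, folded R_def]
  note p = cp_px[OF cp P(2)]
  have Ua: "poly U a = 0" using Ta cheb_val[of a] a by auto
  show "val R (\<phi> y) = 0" using plane_image(4)[of a c] Ua by (simp add: R_def)
  obtain U1 where U1: "px U = const (poly U a) + (x - const a) * px U1" "poly U1 a = poly (pderiv U) a"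
    by (rule px_taylor)
  have U10: "poly U1 a \<noteq> 0" unfolding U1(2) by (rule cheb_U_simple_root[OF a Ua])
  have vU1: "val R (px U1) \<noteq> 0" using p P(3) U10 by simp
  then have U1nz: "px U1 \<noteq> 0" using cp by (auto simp: cp_simps)
  have b: "(a\<^sup>2 - 1) * (poly b a)\<^sup>2 = 1" by (rule root[OF a Ua])
  obtain C1 where C1: "px (1 - [:- 1, 0, 1:] * b\<^sup>2) = const (poly (1 - [:- 1, 0, 1:] * b\<^sup>2) a) + (x - const a) * px C1"
    by (rule px_taylor)
  have "poly (1 - [:- 1, 0, 1:] * b\<^sup>2) a = 0"
    using b by (simp add: poly_power power2_eq_square algebra_simps)
  then have C1': "1 - w * (px b)\<^sup>2 = (x - const a) * px C1"
    using C1 unfolding rhom_diff[OF rhom_px] rhom_mult[OF rhom_px] rhom_power[OF rhom_px] px_W rhom_1[OF rhom_px] by simp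
  have U1': "px U = (x - const a) * px U1" using U1(1) Ua by simp
  define N where "N = px [:- 1, 0, 1:] * (px C1 * inverse (px U1)) - const (2 * \<kappa>) * px [:- 1, 0, 1:] * px b * y - const (\<kappa>\<^sup>2) * px U * y\<^sup>2"
  have key: "w - V\<^sup>2 = px U * N"
  proof -
    have q: "px U * (px C1 * inverse (px U1)) = (x - const a) * px C1" unfolding U1' using U1nz by simp
    have "px U * N = w * (px U * (px C1 * inverse (px U1))) - const (2 * \<kappa>) * w * px b * px U * y - const (\<kappa>\<^sup>2) * (px U)\<^sup>2 * y\<^sup>2"
      unfolding N_def px_W by (simp add: algebra_simps power2_eq_square)
    also have "\<dots> = w * ((x - const a) * px C1) - const (2 * \<kappa>) * w * px b * px U * y - const (\<kappa>\<^sup>2) * (px U)\<^sup>2 * y\<^sup>2"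
      unfolding q ..
    also have "\<dots> = w - V\<^sup>2"
      unfolding C1'[symmetric] V_def by (simp add: const_mult const_power power2_eq_square algebra_simps const_add[of 1 1, simplified])
    finally show ?thesis by simp
  qed
  have z: "\<phi> z = N * inverse (V ^ 3)" unfolding \<phi>z key using UV_nz by (simp add: divide_inverse)
  define V0 where "V0 = (a\<^sup>2 - 1) * poly b a"
  have V0: "V0 \<noteq> 0" using b a by (auto simp: V0_def)
  define w0 where "w0 = poly [:- 1, 0, 1:] a"
  have w0: "w0 = a\<^sup>2 - 1" by (simp add: w0_def power2_eq_square)
  have xc: "cong_mod R (x - const a) x (const a)"
    by (rule cong_modI[of _ _ _ 1]) (use P(2-5) cp in \<open>simp_all add: cp_simps\<close>)
  note C = cong_mod_px[OF cp xc]
  have u: "x - const a \<in> R" "val R (x - const a) = 0" using P(2-5) cp by (simp_all add: cp_simps)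
  note rules = cong_mod_add[OF cp] cong_mod_mult[OF cp] cong_mod_diff[OF cp] cong_mod_power[OF cp] cong_mod_inverse[OF cp u]
    C cong_mod_refl[OF cp] cp_const[OF cp] P(4)
  have cN: "cong_mod R (x - const a) N (const w0 * (const (poly C1 a) * inverse (const (poly U1 a)))
      - const (2 * \<kappa>) * const w0 * const (poly b a) * y - const (\<kappa>\<^sup>2) * const (poly U a) * y\<^sup>2)"
    unfolding N_def w0_def by (intro rules) (use U10 cp in \<open>simp add: cp_simps\<close>)
  have "cong_mod R (x - const a) (const \<kappa> * px U * y + px [:- 1, 0, 1:] * px b) (const \<kappa> * const (poly U a) * y + const w0 * const (poly b a))"
    unfolding w0_def by (intro rules)
  then have cV: "cong_mod R (x - const a) V (const V0)"
    by (simp add: V_def px_W Ua V0_def w0 const_mult)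
  have "cong_mod R (x - const a) (\<phi> z) ((const w0 * (const (poly C1 a) * inverse (const (poly U1 a)))
      - const (2 * \<kappa>) * const w0 * const (poly b a) * y - const (\<kappa>\<^sup>2) * const (poly U a) * y\<^sup>2) * inverse (const V0 ^ 3))"
    unfolding z by (intro rules cN cV) (use V0 cp in \<open>simp add: cp_simps\<close>)
  also have "(const w0 * (const (poly C1 a) * inverse (const (poly U1 a)))
      - const (2 * \<kappa>) * const w0 * const (poly b a) * y - const (\<kappa>\<^sup>2) * const (poly U a) * y\<^sup>2) * inverse (const V0 ^ 3)
     = const (w0 * (poly C1 a * inverse (poly U1 a)) * inverse (V0 ^ 3))
       + const (- (2 * \<kappa> * w0 * poly b a * inverse (V0 ^ 3))) * y"
    unfolding Ua by (simp add: const_mult const_power const_inverse const_minus algebra_simps)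
  finally have cz: "cong_mod R (x - const a) (\<phi> z) (const (w0 * (poly C1 a * inverse (poly U1 a)) * inverse (V0 ^ 3))
       + const (- (2 * \<kappa> * w0 * poly b a * inverse (V0 ^ 3))) * y)" .
  have k1: "- (2 * \<kappa> * w0 * poly b a * inverse (V0 ^ 3)) \<noteq> 0"
    using V0 \<kappa>_nz unfolding w0 V0_def by auto
  have vV: "V \<in> R" "val R V = V0"
    using cV cong_mod_val[OF cp u cV] cp by (auto simp: cong_mod_def cp_simps)
  have \<alpha>: "px U1 * V \<in> R" "val R (px U1 * V) \<noteq> 0" using p(1) vU1 vV V0 cp by (simp_all add: cp_simps)
  have Y: "\<phi> y = (px U1 * V) * (x - const a)" unfolding \<phi>y' U1' by (simp add: mult_ac)
  show "\<phi> z \<in> R" by (rule regular_by_cong(1)[OF P(1) P(4) \<alpha> cz k1])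
  show "regular_point R (\<phi> y) (\<phi> z - const (val R (\<phi> z)))"
    unfolding Y by (rule regular_by_cong(2)[OF P(1) P(4) \<alpha> cz k1])
qed

text \<open>
  \<open>U\<^sup>2 - n\<^sup>2\<close> vanishes at both zeros of \<open>w\<close>.
\<close>

lemma U_sq_minus: obtains U2 where "(px U)\<^sup>2 = const (n\<^sup>2) + w * px U2"
proof -
  define q where "q = U\<^sup>2 - [:n\<^sup>2:]"
  have q: "poly q 1 = 0" "poly q (- 1) = 0"
    using cheb_U_pm1[of 1 m] cheb_U_pm1[of "- 1" m] by (simp_all add: q_def poly_power)
  obtain r where r: "q = [:- 1, 1:] * r" using q(1) poly_eq_0_iff_dvd[of q 1] by (auto elim: dvdE)
  then have "poly r (- 1) = 0" using q(2) by simp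
  then obtain s where s: "r = [:1, 1:] * s" using poly_eq_0_iff_dvd[of r "- 1"] by (auto elim: dvdE)
  have "U\<^sup>2 = [:n\<^sup>2:] + ([:- 1, 1:] * [:1, 1:]) * s" using r s unfolding q_def by (simp only: mult.assoc) (metis add.commute diff_add_cancel)
  also have "[:- 1, 1:] * [:1, 1:] = [:- 1, 0, 1 :: complex:]" by simp
  finally have "px (U\<^sup>2) = px ([:n\<^sup>2:] + [:- 1, 0, 1:] * s)" by simp
  then have "(px U)\<^sup>2 = const (n\<^sup>2) + w * px s"
    unfolding rhom_add[OF rhom_px] rhom_mult[OF rhom_px] rhom_power[OF rhom_px] px_W by (simp add: px_pCons del: of_nat_Suc)
  then show thesis by (rule that)
qed

text \<open>
  With \<open>s = 1 + y z\<close> one has \<open>w = y\<^sup>2 s\<close> and \<open>V = y V'\<close>, where \<open>V' = U / n + y s b\<close>. Since \<open>U\<^sup>2\<close> is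
  congruent to \<open>n\<^sup>2\<close> even modulo \<open>y\<^sup>2\<close>, the difference \<open>s - V'\<^sup>2\<close> is divisible by \<open>y\<close>, with quotient
  \<open>N\<close> congruent to \<open>z\<close> plus a constant modulo \<open>y\<close>. Therefore \<open>\<phi> z = N / (U V'\<^sup>3)\<close> is affine in \<open>z\<close>
  modulo \<open>y\<close>.
\<close>

lemma params_special:
  fixes e t :: complex
  assumes e: "e\<^sup>2 = 1"
  defines "R \<equiv> E e t"
  shows "\<phi> x \<in> R" "val R (\<phi> x) = poly T e" "(poly T e)\<^sup>2 = 1" "\<phi> y \<in> R" "val R (\<phi> y) = 0" "\<phi> z \<in> R"
    "regular_point R (\<phi> y) (\<phi> z - const (val R (\<phi> z)))"
proof -
  note EP = E_point[OF e, of t, folded R_def] and EV = E_vals[OF e, of t, folded R_def]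
  note reg = reg_E[OF e, of t, folded R_def]
  have cp: "closed_point R" by (rule EP(1))
  note p = cp_px[OF cp EV(1)]
  show "\<phi> x \<in> R" "val R (\<phi> x) = poly T e" unfolding \<phi>x using p EV(2) by auto
  show "(poly T e)\<^sup>2 = 1" using cheb_val[of e] e by simp
  define s where "s = 1 + y * z"
  have sR: "s \<in> R" using EV(3) EP(3) cp by (simp add: s_def cp_simps)
  have ws: "w = y\<^sup>2 * s" using nonzero(1) by (simp add: s_def z_def field_simps power2_eq_square)
  have xe: "x + const e \<in> R" "val R (x + const e) \<noteq> 0" using EV(1,2) cp e_nz[OF e] by (simp_all add: cp_simps)
  have xc: "cong_mod R y x (const e)"
  proof (rule cong_modI)
    show "x \<in> R" by (rule EV(1))
    show "const e \<in> R" using cp by (rule cp_const)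
    show "w / y * inverse (x + const e) \<in> R" by (rule cp_mult[OF cp EV(5) cp_inverse[OF cp xe]])
    show "x - const e = y * (w / y * inverse (x + const e))"
      unfolding w_factor[OF e] using nonzero(1) nonzero(4)[of e] by simp
  qed
  note C = cong_mod_px[OF cp xc]
  define \<nu> where "\<nu> = poly U e"
  have \<nu>2: "\<nu>\<^sup>2 = n\<^sup>2" unfolding \<nu>_def by (rule cheb_U_pm1[OF e])
  then have \<nu>: "\<nu> \<noteq> 0" using n_nz by auto
  obtain U2 where U2: "(px U)\<^sup>2 = const (n\<^sup>2) + w * px U2" by (rule U_sq_minus)
  have kn: "\<kappa>\<^sup>2 * n\<^sup>2 = 1" using \<kappa>n by (metis power_mult_distrib power_one)
  define V' where "V' = const \<kappa> * px U + y * s * px b"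
  have V: "V = y * V'" unfolding V_def V'_def ws by (simp add: power2_eq_square algebra_simps)
  define N where "N = z - const (\<kappa>\<^sup>2) * (y * s) * px U2 - const (2 * \<kappa>) * px U * s * px b - y * s\<^sup>2 * (px b)\<^sup>2"
  have key: "w - V\<^sup>2 = y ^ 3 * N"
  proof -
    have U2': "const (\<kappa>\<^sup>2) * (px U)\<^sup>2 = 1 + const (\<kappa>\<^sup>2) * (y\<^sup>2 * s) * px U2"
      unfolding U2 ws using kn by (simp add: distrib_left mult.assoc del: of_nat_Suc flip: const_mult)
    have "V'\<^sup>2 = const (\<kappa>\<^sup>2) * (px U)\<^sup>2 + const (2 * \<kappa>) * px U * (y * s) * px b + y\<^sup>2 * s\<^sup>2 * (px b)\<^sup>2"
      unfolding V'_def by (simp add: const_mult const_power power2_eq_square algebra_simps const_add[of 1 1, simplified])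
    then have "V'\<^sup>2 = 1 + const (\<kappa>\<^sup>2) * (y\<^sup>2 * s) * px U2 + const (2 * \<kappa>) * px U * (y * s) * px b + y\<^sup>2 * s\<^sup>2 * (px b)\<^sup>2"
      unfolding U2' .
    then have "s - V'\<^sup>2 = y * N" unfolding N_def s_def by (simp add: power2_eq_square algebra_simps)
    then have "y\<^sup>2 * (s - V'\<^sup>2) = y ^ 3 * N" by (simp add: power2_eq_square power3_eq_cube)
    moreover have "w - V\<^sup>2 = y\<^sup>2 * (s - V'\<^sup>2)" unfolding V ws by (simp add: power2_eq_square algebra_simps)
    ultimately show ?thesis by simp
  qed
  have z: "\<phi> z = N * inverse (px U * V' ^ 3)"
    unfolding \<phi>z key unfolding V using nonzero(1) UV_nz V by (simp add: power_mult_distrib field_simps)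
  note u = EV(3,4)
  have yc: "cong_mod R y y (const 0)" by (rule cong_modI[of _ _ _ 1]) (use EV cp in \<open>simp_all add: cp_simps\<close>)
  note rules = cong_mod_add[OF cp] cong_mod_mult[OF cp] cong_mod_diff[OF cp] cong_mod_power[OF cp] cong_mod_inverse[OF cp u]
    C cong_mod_refl[OF cp EP(3)] cong_mod_refl[OF cp cp_const[OF cp]] yc
  have "cong_mod R y (const 1 + y * z) (const 1 + const 0 * z)" by (intro rules)
  then have sc: "cong_mod R y s (const 1)" by (simp add: s_def)
  have "cong_mod R y N (z - const (\<kappa>\<^sup>2) * (const 0 * const 1) * const (poly U2 e)
      - const (2 * \<kappa>) * const \<nu> * const 1 * const (poly b e) - const 0 * (const 1)\<^sup>2 * (const (poly b e))\<^sup>2)"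
    unfolding N_def \<nu>_def by (intro rules sc)
  then have Nc: "cong_mod R y N (z - const (2 * \<kappa> * \<nu> * poly b e))" by (simp add: const_mult)
  have "cong_mod R y V' (const \<kappa> * const \<nu> + const 0 * const 1 * const (poly b e))"
    unfolding V'_def \<nu>_def by (intro rules sc)
  then have Vc: "cong_mod R y V' (const (\<kappa> * \<nu>))" by (simp add: const_mult)
  define k where "k = inverse (\<nu> * (\<kappa> * \<nu>) ^ 3)"
  have k: "k \<noteq> 0" using \<nu> \<kappa>_nz by (simp add: k_def)
  have "cong_mod R y (\<phi> z) ((z - const (2 * \<kappa> * \<nu> * poly b e)) * inverse (const \<nu> * const (\<kappa> * \<nu>) ^ 3))"
    unfolding z \<nu>_def by (intro rules Nc[unfolded \<nu>_def] Vc[unfolded \<nu>_def])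
      (use \<nu> \<kappa>_nz cp in \<open>simp add: cp_simps flip: \<nu>_def\<close>)
  moreover have "(z - const (2 * \<kappa> * \<nu> * poly b e)) * inverse (const \<nu> * const (\<kappa> * \<nu>) ^ 3)
      = const (- (2 * \<kappa> * \<nu> * poly b e) * k) + const k * z"
    unfolding k_def const_inverse[symmetric] const_mult[symmetric] const_power[symmetric]
    by (simp add: const_mult const_minus algebra_simps)
  ultimately have zc: "cong_mod R y (\<phi> z) (const (- (2 * \<kappa> * \<nu> * poly b e) * k) + const k * z)" by simp
  have Y: "\<phi> y = (px U * V') * y" unfolding \<phi>y' V by (simp add: mult_ac)
  have vV: "V' \<in> R" "val R V' = \<kappa> * \<nu>"
    using Vc cong_mod_val[OF cp u Vc] cp by (auto simp: cong_mod_def cp_simps)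
  have \<alpha>: "px U * V' \<in> R" "val R (px U * V') \<noteq> 0"
    using p EV(2) vV \<nu> \<kappa>_nz cp by (simp_all add: cp_simps flip: \<nu>_def)
  show "\<phi> y \<in> R" "val R (\<phi> y) = 0" unfolding Y using \<alpha> u cp by (simp_all add: cp_simps)
  show "\<phi> z \<in> R" by (rule regular_by_cong(1)[OF reg EP(3) \<alpha> zc k])
  show "regular_point R (\<phi> y) (\<phi> z - const (val R (\<phi> z)))"
    unfolding Y by (rule regular_by_cong(2)[OF reg EP(3) \<alpha> zc k])
qed

end

section \<open>The endomorphism of the surface\<close>

context chart
begin

lemma surface_cases:
  assumes "R \<in> surface"
  obtains (plane_point) a c where "a\<^sup>2 \<noteq> 1" "R = plane_pt x y a c" | (special) e t where "e\<^sup>2 = 1" "R = E e t"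
  using assms unfolding surface_def by blast

lemma surface_point:
  assumes "R \<in> surface" shows "closed_point R" "x \<in> R" "y \<in> R" "(val R x)\<^sup>2 = 1 \<Longrightarrow> val R y = 0"
proof -
  have "closed_point R \<and> x \<in> R \<and> y \<in> R \<and> ((val R x)\<^sup>2 = 1 \<longrightarrow> val R y = 0)"
    using assms
  proof (cases rule: surface_cases)
    case (plane_point a c)
    then show ?thesis using plane_cp plane(2-5)[of a c] by auto
  next
    case (special e t)
    then show ?thesis using E_point(1)[OF special(1)] E_vals(1-4)[OF special(1)] by auto
  qed
  then show "closed_point R" "x \<in> R" "y \<in> R" "(val R x)\<^sup>2 = 1 \<Longrightarrow> val R y = 0" by auto
qed

lemma points_surface: "points surface"
  using surface_point(1) by (simp add: points_def)

end

text \<open>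
  \<open>x\<close> and \<open>y\<close> generate the function field.
\<close>

definition birational :: "ratfun \<Rightarrow> ratfun \<Rightarrow> bool" where
  "birational x y \<longleftrightarrow> (\<forall>h. \<exists>p q. q \<noteq> 0 \<and> h = ev x y p / ev x y q)"

text \<open>
  Clear denominators and choose a point of the plane at which neither they nor \<open>w\<close> vanish.
\<close>

lemma (in chart) surface_dense:
  assumes bir: "birational x y" and H: "finite H"
  shows "\<exists>Q\<in>surface. H \<subseteq> Q"
proof -
  have "\<exists>D. D \<noteq> 0 \<and> (\<forall>a c. pv a c D \<noteq> 0 \<longrightarrow> H \<subseteq> plane_pt x y a c)"
    using H
  proof (induction H)
    case empty
    show ?case by (intro exI[of _ 1]) simp
  next
    case (insert h H)
    then obtain D where D: "D \<noteq> 0" "\<forall>a c. pv a c D \<noteq> 0 \<longrightarrow> H \<subseteq> plane_pt x y a c" by blast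
    obtain r s where rs: "s \<noteq> 0" "h = ev x y r / ev x y s" using bir unfolding birational_def by blast
    have "insert h H \<subseteq> plane_pt x y a c" if "pv a c (s * D) \<noteq> 0" for a c
    proof -
      have "pv a c s \<noteq> 0" "pv a c D \<noteq> 0" using that by (auto simp: rhom_mult[OF rhom_pv])
      moreover from this have "h \<in> plane_pt x y a c" unfolding plane(6) using rs(2) by blast
      ultimately show ?thesis using D(2) by simp
    qed
    then show ?case using D(1) rs(1) by (intro exI[of _ "s * D"]) simp
  qed
  then obtain D where D: "D \<noteq> 0" "\<forall>a c. pv a c D \<noteq> 0 \<longrightarrow> H \<subseteq> plane_pt x y a c" by blast
  have "D * [:[:- 1, 0, 1:]:] \<noteq> 0" using D(1) by (simp only: mult_eq_0_iff) simp
  then obtain a c where "pv a c (D * [:[:- 1, 0, 1:]:]) \<noteq> 0" using pv_eq_0_imp by blast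
  then have "pv a c D \<noteq> 0" "pv a c [:[:- 1, 0, 1:]:] \<noteq> 0" unfolding rhom_mult[OF rhom_pv] by auto
  then have "H \<subseteq> plane_pt x y a c" "a\<^sup>2 \<noteq> 1" using D(2) by (auto simp: pv_pCons power2_eq_square)
  then show ?thesis unfolding surface_def by blast
qed

context cheb_endo
begin

text \<open>
  The image point has the coordinates that \<open>\<phi>\<close> prescribes: in the plane if \<open>\<phi> x \<noteq> \<plusminus>1\<close>, and with coordinate
  \<open>\<phi> z\<close> on one of the two affine lines otherwise.
\<close>

definition eta :: "point \<Rightarrow> point" where
  "eta R = (if (val R (\<phi> x))\<^sup>2 \<noteq> 1 then plane_pt x y (val R (\<phi> x)) (val R (\<phi> y))
            else E (val R (\<phi> x)) (val R (\<phi> z)))"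

lemma image_coords:
  assumes "R \<in> surface"
  shows "\<phi> x \<in> R" "\<phi> y \<in> R" "val R (\<phi> x) = poly T (val R x)"
proof -
  have "\<phi> x \<in> R \<and> \<phi> y \<in> R \<and> val R (\<phi> x) = poly T (val R x)"
    using assms
  proof (cases rule: surface_cases)
    case (plane_point a c)
    then show ?thesis using plane_image(1,2,3)[of a c] plane(3)[of a c] by auto
  next
    case (special e t)
    then show ?thesis using params_special(1,2,4)[OF special(1), of t] E_vals(2)[OF special(1), of t] by auto
  qed
  then show "\<phi> x \<in> R" "\<phi> y \<in> R" "val R (\<phi> x) = poly T (val R x)" by auto
qed

lemma image_open:
  assumes R: "R \<in> surface" and a: "(val R (\<phi> x))\<^sup>2 \<noteq> 1"
  shows "regular_point R (\<phi> x - const (val R (\<phi> x))) (\<phi> y - const (val R (\<phi> y)))"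
  using R
proof (cases rule: surface_cases)
  case (plane_point u c)
  then show ?thesis using params_open[OF plane_point(1), of c] a plane_image(2)[of u c] by simp
next
  case (special e t)
  then show ?thesis using params_special(2)[OF special(1), of t] params_special(3)[OF special(1)] a by simp
qed

lemma image_special:
  assumes R: "R \<in> surface" and a: "(val R (\<phi> x))\<^sup>2 = 1"
  shows "val R (\<phi> y) = 0" "\<phi> z \<in> R" "regular_point R (\<phi> y) (\<phi> z - const (val R (\<phi> z)))"
proof -
  have "val R (\<phi> y) = 0 \<and> \<phi> z \<in> R \<and> regular_point R (\<phi> y) (\<phi> z - const (val R (\<phi> z)))"
    using R
  proof (cases rule: surface_cases)
    case (plane_point u c)
    then show ?thesis using params_root[OF plane_point(1), of c] a plane_image(2)[of u c] by simp
  next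
    case (special e t)
    then show ?thesis using params_special(5,6,7)[OF special(1), of t] by simp
  qed
  then show "val R (\<phi> y) = 0" "\<phi> z \<in> R" "regular_point R (\<phi> y) (\<phi> z - const (val R (\<phi> z)))" by auto
qed

lemma eta_surface: "eta R \<in> surface"
  unfolding eta_def surface_def by auto

lemma w_over_y: "w / y / y = 1 + y * z" "w / y = y * (1 + y * z)"
  using nonzero(1) by (simp_all add: z_def field_simps)

lemma locmap_eta:
  assumes R: "R \<in> surface" shows "locmap \<phi> (eta R) R"
proof (cases "(val R (\<phi> x))\<^sup>2 = 1")
  case False
  then show ?thesis unfolding eta_def
    using locmap_plane[OF xy \<phi> surface_point(1)[OF R] image_coords(1)[OF R] refl image_coords(2)[OF R] refl] by simp
next
  case True
  note cp = surface_point(1)[OF R] and I = image_special[OF R True] and C = image_coords[OF R]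
  define e where "e = val R (\<phi> x)"
  have e: "e\<^sup>2 = 1" using True by (simp add: e_def)
  have 0: "locmap \<phi> (p e) R" unfolding p_def e_def by (rule locmap_plane[OF xy \<phi> cp C(1) refl C(2) I(1)])
  have wy: "\<phi> (w / y) = \<phi> y * (1 + \<phi> y * \<phi> z)" and wyy: "\<phi> (w / y / y) = 1 + \<phi> y * \<phi> z"
    unfolding w_over_y(1) by (simp_all only: w_over_y(2) fhom_simps[OF \<phi>])
  have "\<phi> (w / y) \<in> R" "val R (\<phi> (w / y)) = 0" unfolding wy using I C cp by (simp_all add: cp_simps)
  then have 1: "locmap \<phi> (P1 e) R" unfolding P1_def by (rule locmap_bl[OF reg_p[OF e] \<phi> cp 0])
  have "\<phi> (w / y / y) \<in> R" "val R (\<phi> (w / y / y)) = 1" unfolding wyy using I C cp by (simp_all add: cp_simps)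
  then have 2: "locmap \<phi> (P2 e) R" unfolding P2_def by (rule locmap_bl[OF reg_P1[OF e] \<phi> cp 1])
  have "locmap \<phi> (E e (val R (\<phi> z))) R"
    unfolding E_def by (rule locmap_bl[OF reg_P2[OF e] \<phi> cp 2]) (use I(2) in \<open>simp_all add: z_def\<close>)
  then show ?thesis using True by (simp add: eta_def e_def)
qed

text \<open>
  A germ at the image is a quotient of elements of the coordinate ring of a chart. It remains regular at
  the image of a point if this image lies in the chart and the denominator does not vanish there. Both
  can be read off from the regularity of functions at the original point: the image lies in the plane
  as soon as \<open>1 / \<phi> w\<close> is regular, and the functions \<open>z\<close>, \<open>w / y\<^sup>2\<close>, \<open>w / y\<close> are regular at the image
  as soon as \<open>\<phi> z\<close> is, because \<open>w - y\<^sup>2 = y\<^sup>3 z\<close> excludes images with \<open>y = 0\<close> and \<open>w \<noteq> 0\<close>.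
\<close>

lemma eta_domain:
  assumes R: "R \<in> surface" and h: "h \<in> eta R"
  shows "\<exists>K. finite K \<and> K \<subseteq> R \<and> (\<forall>R'\<in>surface. K \<subseteq> R' \<longrightarrow> h \<in> eta R')"
proof -
  note cp = surface_point(1)[OF R]
  have ce: "closed_point (eta Q)" for Q using surface_point(1)[OF eta_surface] .
  have step: "f / k \<in> eta Q" if Q: "Q \<in> surface" and G: "G \<subseteq> eta Q" and fk: "f \<in> alg G" "k \<in> alg G"
    and inv: "inverse (\<phi> k) \<in> Q" and k: "\<phi> k \<noteq> 0" for f k G Q
  proof -
    have *: "f \<in> eta Q" "k \<in> eta Q" using alg_subset[OF ce G] fk by auto
    then have "\<phi> k \<in> Q" "val Q (\<phi> k) = val (eta Q) k" using locmap_eta[OF Q] by (auto simp: locmap_def)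
    then have "val (eta Q) k \<noteq> 0" using val_reciprocal[OF surface_point(1)[OF Q] _ inv k] by simp
    then show ?thesis using * ce by (simp add: cp_simps)
  qed
  have inv: "inverse (\<phi> k) \<in> R \<and> \<phi> k \<noteq> 0" if "k \<in> eta R" "val (eta R) k \<noteq> 0" for k
  proof -
    have "\<phi> k \<in> R" "val R (\<phi> k) \<noteq> 0" using locmap_eta[OF R] that by (auto simp: locmap_def)
    then show ?thesis using cp by (auto simp: cp_simps)
  qed
  have \<phi>w_val: "\<phi> w \<in> Q" "val Q (\<phi> w) = (val Q (\<phi> x))\<^sup>2 - 1" if Q: "Q \<in> surface" for Q
    using image_coords[OF Q] surface_point(1)[OF Q] \<phi> by (simp_all add: w_def fhom_simps cp_simps)
  show ?thesis
  proof (cases "(val R (\<phi> x))\<^sup>2 = 1")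
    case False
    then have eR: "eta R = plane_pt x y (val R (\<phi> x)) (val R (\<phi> y))" by (simp add: eta_def)
    obtain f k where fk: "f \<in> alg {x, y}" "k \<in> alg {x, y}" "val (eta R) k \<noteq> 0" "h = f / k"
      using frac_of_plane[OF xy] h unfolding eR frac_of_def by blast
    have "{x, y} \<subseteq> eta R" unfolding eR using plane(2,4) by simp
    then have k: "inverse (\<phi> k) \<in> R" "\<phi> k \<noteq> 0" using inv alg_subset[OF ce _ fk(2)] fk(3) by auto
    have "inverse (\<phi> w) \<in> R" using cp_inverse[OF cp \<phi>w_val(1)[OF R]] \<phi>w_val(2)[OF R] False by simp
    moreover have "h \<in> eta Q" if Q: "Q \<in> surface" "{inverse (\<phi> w), inverse (\<phi> k)} \<subseteq> Q" for Q
    proof -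
      have "\<phi> w \<noteq> 0" using \<phi> nonzero(2) by (simp add: fhom_simps)
      then have "val Q (\<phi> w) \<noteq> 0"
        using val_reciprocal[OF surface_point(1)[OF Q(1)] \<phi>w_val(1)[OF Q(1)]] Q(2) by auto
      then have "{x, y} \<subseteq> eta Q" unfolding eta_def \<phi>w_val(2)[OF Q(1)] using plane(2,4) by simp
      then show ?thesis unfolding fk(4) using step[OF Q(1) _ fk(1,2)] Q(2) k by simp
    qed
    ultimately show ?thesis using k(1) by (intro exI[of _ "{inverse (\<phi> w), inverse (\<phi> k)}"]) simp
  next
    case True
    define e where "e = val R (\<phi> x)"
    have e: "e\<^sup>2 = 1" using True by (simp add: e_def)
    have eR: "eta R = E e (val R (\<phi> z))" using True by (simp add: eta_def e_def)
    define G where "G = {z, w / y / y, w / y, x, y}"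
    have fr: "frac_of G (eta R)" unfolding eR G_def by (rule frac_E[OF e])
    then obtain f k where fk: "f \<in> alg G" "k \<in> alg G" "val (eta R) k \<noteq> 0" "h = f / k"
      using h unfolding frac_of_def by blast
    have "G \<subseteq> eta R" using fr by (simp add: frac_of_def)
    then have k: "inverse (\<phi> k) \<in> R" "\<phi> k \<noteq> 0" using inv alg_subset[OF ce _ fk(2)] fk(3) by auto
    have "h \<in> eta Q" if Q: "Q \<in> surface" "{\<phi> z, inverse (\<phi> k)} \<subseteq> Q" for Q
    proof -
      have "G \<subseteq> eta Q"
      proof (cases "(val Q (\<phi> x))\<^sup>2 = 1")
        case True
        then show ?thesis using frac_E[OF True] by (simp add: eta_def G_def frac_of_def)
      next
        case False
        then have eQ: "eta Q = plane_pt x y (val Q (\<phi> x)) (val Q (\<phi> y))" by (simp add: eta_def)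
        note cq = surface_point(1)[OF Q(1)] and C = image_coords[OF Q(1)]
        have "w - y\<^sup>2 = y ^ 3 * z" using nonzero(1) by (simp add: z_def field_simps power2_eq_square power3_eq_cube)
        then have "\<phi> w - \<phi> y ^ 2 = \<phi> y ^ 3 * \<phi> z" using fhom_simps[OF \<phi>] by metis
        then have "val Q (\<phi> w - \<phi> y ^ 2) = val Q (\<phi> y ^ 3 * \<phi> z)" by simp
        then have "(val Q (\<phi> x))\<^sup>2 - 1 - (val Q (\<phi> y))\<^sup>2 = (val Q (\<phi> y)) ^ 3 * val Q (\<phi> z)"
          using cq C \<phi>w_val[OF Q(1)] Q(2) by (simp add: cp_simps)
        then have "val Q (\<phi> y) \<noteq> 0" using False by auto
        then have v: "val (eta Q) y \<noteq> 0" unfolding eQ by (simp add: plane(5))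
        have m: "x \<in> eta Q" "y \<in> eta Q" "w \<in> eta Q" unfolding eQ by (rule plane(2) plane(4) plane_w(1))+
        have wy: "w / y \<in> eta Q" by (rule cp_divide[OF ce m(3,2) v])
        have wyy: "w / y / y \<in> eta Q" by (rule cp_divide[OF ce wy m(2) v])
        have "z \<in> eta Q" unfolding z_def by (rule cp_divide[OF ce cp_diff[OF ce wyy cp_1[OF ce]] m(2) v])
        then show ?thesis using m wy wyy by (simp add: G_def)
      qed
      then show ?thesis unfolding fk(4) using step[OF Q(1) _ fk(1,2)] Q(2) k by simp
    qed
    moreover have "\<phi> z \<in> R" by (rule image_special(2)[OF R True])
    ultimately show ?thesis using k(1) by (intro exI[of _ "{\<phi> z, inverse (\<phi> k)}"]) simp
  qed
qed

lemma eta_params: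
  assumes R: "R \<in> surface"
  shows "\<exists>u v. max_ideal (eta R) = ideal2 (eta R) u v \<and> regular_point R (\<phi> u) (\<phi> v)"
proof (cases "(val R (\<phi> x))\<^sup>2 = 1")
  case False
  then have eR: "eta R = plane_pt x y (val R (\<phi> x)) (val R (\<phi> y))" by (simp add: eta_def)
  have "regular_point R (\<phi> (x - const (val R (\<phi> x)))) (\<phi> (y - const (val R (\<phi> y))))"
    using image_open[OF R False] \<phi> by (simp add: fhom_simps)
  then show ?thesis using plane(1) unfolding eR regular_point_def by blast
next
  case True
  have eR: "eta R = E (val R (\<phi> x)) (val R (\<phi> z))" using True by (simp add: eta_def)
  have "regular_point R (\<phi> y) (\<phi> (z - const (val R (\<phi> z))))"
    using image_special(3)[OF R True] \<phi> by (simp add: fhom_simps)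
  then show ?thesis using reg_E[OF True] unfolding eR regular_point_def by blast
qed

lemma local_endo_eta: assumes "birational x y" shows "local_endo surface eta \<phi>"
  by unfold_locales (rule points_surface eta_surface \<phi> locmap_eta surface_dense[OF assms] eta_domain eta_params; assumption)+

lemma eta_coords:
  assumes R: "R \<in> surface"
  shows "val (eta R) x = poly T (val R x)"
    and "val (eta R) y = \<kappa> * (poly U (val R x))\<^sup>2 * val R y + ((val R x)\<^sup>2 - 1) * poly U (val R x) * poly b (val R x)"
proof -
  have m: "x \<in> eta R" "y \<in> eta R" using surface_point(2,3)[OF eta_surface] by auto
  then have v: "val (eta R) x = val R (\<phi> x)" "val (eta R) y = val R (\<phi> y)"
    using locmap_eta[OF R] by (auto simp: locmap_def)
  show "val (eta R) x = poly T (val R x)" unfolding v by (rule image_coords(3)[OF R])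
  note cp = surface_point(1)[OF R] and xyR = surface_point(2,3)[OF R]
  have w: "w \<in> R" "val R w = (val R x)\<^sup>2 - 1" using xyR cp by (simp_all add: w_def cp_simps)
  show "val (eta R) y = \<kappa> * (poly U (val R x))\<^sup>2 * val R y + ((val R x)\<^sup>2 - 1) * poly U (val R x) * poly b (val R x)"
    unfolding v \<phi>y \<kappa>_def[symmetric] using cp_px[OF cp xyR(1)] xyR w cp by (simp add: cp_simps)
qed

end

section \<open>The comorphism and its degree\<close>

text \<open>
  The substitution is injective on polynomials and extends to their quotients.
\<close>

lemma field_hom_exists:
  assumes xy: "indep x y" "birational x y" and x'y': "indep x' y'"
  obtains \<phi> where "fhom \<phi>" "\<phi> x = x'" "\<phi> y = y'"
proof -
  define \<phi> where "\<phi> h = (SOME k. \<exists>p q. q \<noteq> 0 \<and> h = ev x y p / ev x y q \<and> k = ev x' y' p / ev x' y' q)" for h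
  have ne: "ev x y q \<noteq> 0" "ev x' y' q \<noteq> 0" if "q \<noteq> 0" for q using xy(1) x'y' that by (auto simp: indep_def)
  have \<phi>: "\<phi> (ev x y p / ev x y q) = ev x' y' p / ev x' y' q" if q: "q \<noteq> 0" for p q
    unfolding \<phi>_def
  proof (rule some_equality)
    show "\<exists>p' q'. q' \<noteq> 0 \<and> ev x y p / ev x y q = ev x y p' / ev x y q' \<and> ev x' y' p / ev x' y' q = ev x' y' p' / ev x' y' q'"
      using q by blast
    fix k assume "\<exists>p' q'. q' \<noteq> 0 \<and> ev x y p / ev x y q = ev x y p' / ev x y q' \<and> k = ev x' y' p' / ev x' y' q'"
    then obtain p' q' where *: "q' \<noteq> 0" "ev x y p / ev x y q = ev x y p' / ev x y q'" "k = ev x' y' p' / ev x' y' q'" by blast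
    have "ev x y p * ev x y q' = ev x y p' * ev x y q" using *(2) ne(1)[OF q] ne(1)[OF *(1)] by (simp add: frac_eq_eq)
    then have "ev x y (p * q' - p' * q) = 0" by (simp add: rhom_mult[OF rhom_ev] rhom_diff[OF rhom_ev])
    then have "p * q' = p' * q" using xy(1) unfolding indep_def by fastforce
    then have "ev x' y' p * ev x' y' q' = ev x' y' p' * ev x' y' q" by (metis rhom_mult[OF rhom_ev])
    then show "k = ev x' y' p / ev x' y' q" unfolding *(3) using ne(2)[OF q] ne(2)[OF *(1)] by (simp add: frac_eq_eq)
  qed
  have poly: "\<phi> (ev x y p) = ev x' y' p" for p
    using \<phi>[of 1 p] by (simp add: rhom_1[OF rhom_ev])
  have c: "\<phi> (const k) = const k" for k
    using poly[of "[:[:k:]:]"] by (simp add: ev_pCons px_pCons)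
  have "\<phi> (a + b) = \<phi> a + \<phi> b \<and> \<phi> (a * b) = \<phi> a * \<phi> b" for a b
  proof -
    obtain p q where a: "q \<noteq> 0" "a = ev x y p / ev x y q" using xy(2) unfolding birational_def by blast
    obtain r s where b: "s \<noteq> 0" "b = ev x y r / ev x y s" using xy(2) unfolding birational_def by blast
    have qs: "q * s \<noteq> 0" using a b by simp
    have "a + b = ev x y (p * s + r * q) / ev x y (q * s)"
      unfolding a(2) b(2) using ne(1)[OF a(1)] ne(1)[OF b(1)] by (simp add: rhom_simps[OF rhom_ev] add_frac_eq)
    then have 1: "\<phi> (a + b) = ev x' y' (p * s + r * q) / ev x' y' (q * s)" using \<phi>[OF qs] by simp
    have "a * b = ev x y (p * r) / ev x y (q * s)" unfolding a(2) b(2) by (simp add: rhom_simps[OF rhom_ev])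
    then have 2: "\<phi> (a * b) = ev x' y' (p * r) / ev x' y' (q * s)" using \<phi>[OF qs] by simp
    show ?thesis unfolding 1 2 unfolding a(2) b(2) \<phi>[OF a(1)] \<phi>[OF b(1)]
      using ne(2)[OF a(1)] ne(2)[OF b(1)] by (simp add: rhom_simps[OF rhom_ev] add_frac_eq)
  qed
  then have "fhom \<phi>" using c[of 1] by (simp add: fhom_def rhom_def c)
  moreover have "\<phi> x = x'" using poly[of "[:[:0, 1:]:]"] by (simp add: ev_pCons px_pCons)
  moreover have "\<phi> y = y'" using poly[of "[:0, 1:]"] by (simp add: ev_y)
  ultimately show thesis using that by blast
qed

lemma px_pcompose: "hev const (hev const x t) q = hev const x (pcompose q t)"
  by (induction q) (simp_all add: px_pCons pcompose_pCons rhom_add[OF rhom_px] rhom_mult[OF rhom_px])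

lemma ev_map_pcompose: "ev (hev const x t) y p = ev x y (map_poly (\<lambda>c. pcompose c t) p)"
  by (induction p) (simp_all add: ev_pCons map_poly_pCons px_pcompose)

lemma ev_affine: "ev x (ev x y q) p = ev x y (pcompose p q)"
  by (induction p) (simp_all add: ev_pCons pcompose_pCons rhom_add[OF rhom_ev] rhom_mult[OF rhom_ev] ev_px)

lemma map_pcompose_eq_0:
  fixes t :: "complex poly"
  assumes "map_poly (\<lambda>c. pcompose c t) p = 0" "degree t > 0" shows "p = 0"
proof (rule poly_eqI)
  fix i
  have "pcompose (coeff p i) t = 0"
    using arg_cong[OF assms(1), of "\<lambda>q. coeff q i"] by (simp add: coeff_map_poly)
  then show "coeff p i = coeff 0 i" using pcompose_eq_0[OF _ assms(2)] by simp
qed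

lemma indep_affine:
  assumes xy: "indep x y" and "\<alpha> \<noteq> 0" shows "indep x (hev const x \<beta> + hev const x \<alpha> * y)"
  unfolding indep_def
proof (intro allI impI)
  fix p assume p: "ev x (hev const x \<beta> + hev const x \<alpha> * y) p = 0"
  have "hev const x \<beta> + hev const x \<alpha> * y = ev x y [:\<beta>, \<alpha>:]" by (simp add: ev_pCons mult.commute)
  then have "ev x y (pcompose p [:\<beta>, \<alpha>:]) = 0" using p by (simp add: ev_affine)
  then have "pcompose p [:\<beta>, \<alpha>:] = 0" using xy by (simp add: indep_def)
  then show "p = 0" by (rule pcompose_eq_0) (use assms in simp)
qed

lemma indep_pcompose:
  assumes xy: "indep x y" and "degree t > 0" shows "indep (hev const x t) y"
  using xy map_pcompose_eq_0[OF _ assms(2)] unfolding indep_def ev_map_pcompose by blast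

text \<open>
  The powers of the variable below the degree of \<open>t\<close> are independent over $\mathbf{C}[t]$. Splitting off
  the constant terms of the coefficients gives \<open>L + t S = 0\<close> with the degree of \<open>L\<close> less than that of
  \<open>t\<close>; so \<open>L = S = 0\<close>, and \<open>S\<close> is a relation with coefficients of smaller degree.
\<close>

lemma pcompose_powers_independent:
  fixes t :: "complex poly" and c :: "nat \<Rightarrow> complex poly"
  assumes t: "degree t = n" "n > 0"
  shows "(\<forall>i<n. c i = 0 \<or> degree (c i) < N) \<Longrightarrow> (\<Sum>i<n. pcompose (c i) t * monom 1 i) = 0 \<Longrightarrow> \<forall>i<n. c i = 0"
proof (induction N arbitrary: c)
  case 0
  then show ?case by auto
next
  case (Suc N)
  define h where "h i = coeff (c i) 0" for i
  define c' where "c' i = poly_shift 1 (c i)" for i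
  have ci: "c i = pCons (h i) (c' i)" for i
    by (rule poly_eqI) (simp add: h_def c'_def coeff_pCons coeff_poly_shift split: nat.split)
  define S where "S = (\<Sum>i<n. pcompose (c' i) t * monom 1 i)"
  define L where "L = (\<Sum>i<n. monom (h i) i)"
  have "(\<Sum>i<n. pcompose (c i) t * monom 1 i) = (\<Sum>i<n. monom (h i) i + t * (pcompose (c' i) t * monom 1 i))"
  proof (rule sum.cong)
    fix i
    show "pcompose (c i) t * monom 1 i = monom (h i) i + t * (pcompose (c' i) t * monom 1 i)"
      by (subst ci) (simp add: pcompose_pCons algebra_simps smult_monom)
  qed simp
  then have LS: "L + t * S = 0" using Suc.prems(2) by (simp add: L_def S_def sum.distrib sum_distrib_left)
  have "degree (monom (h i) i) \<le> n - 1" if "i < n" for i using that degree_monom_le[of "h i" i] by linarith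
  then have dL: "degree L \<le> n - 1" unfolding L_def by (intro degree_sum_le) auto
  have S: "S = 0"
  proof (rule ccontr)
    assume "S \<noteq> 0"
    then have "degree (t * S) \<ge> n" using t by (subst degree_mult_eq) auto
    moreover have "t * S = - L" using LS by (simp add: eq_neg_iff_add_eq_0 add.commute)
    ultimately show False using dL t(2) by simp
  qed
  then have L: "L = 0" using LS by simp
  have "h i = 0" if "i < n" for i
  proof -
    have "coeff L i = (\<Sum>j<n. if j = i then h j else 0)" by (simp add: L_def coeff_sum)
    then show ?thesis using L that by simp
  qed
  moreover have "\<forall>i<n. c' i = 0"
  proof (rule Suc.IH)
    show "\<forall>i<n. c' i = 0 \<or> degree (c' i) < N"
    proof (intro allI impI)
      fix i assume "i < n"
      then show "c' i = 0 \<or> degree (c' i) < N" using Suc.prems(1) ci[of i] by (cases "c' i = 0") (auto split: if_splits)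
    qed
    show "(\<Sum>i<n. pcompose (c' i) t * monom 1 i) = 0" using S by (simp add: S_def)
  qed
  ultimately show ?case using ci by simp
qed

context cheb_endo
begin

lemma T_degree: "degree T = Suc m" by (rule cheb_degree)

lemma U_nz: "U \<noteq> 0" using UV_nz(1) by auto

text \<open>
  After clearing denominators, a relation becomes a polynomial in \<open>x\<close> and \<open>\<phi> y\<close>, which are algebraically
  independent as \<open>\<phi> y\<close> is affine in \<open>y\<close>. Its coefficients with respect to \<open>\<phi> y\<close> are relations over
  $\mathbf{C}[T]$.
\<close>

lemma powers_independent:
  assumes bir: "birational x y" and sum: "(\<Sum>i<Suc m. \<phi> (k i) * x ^ i) = 0"
  shows "\<forall>i<Suc m. k i = 0"
proof -
  have ne: "q \<noteq> 0 \<Longrightarrow> ev x y q \<noteq> 0" for q using xy by (auto simp: indep_def)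
  have "\<exists>Q P. Q \<noteq> 0 \<and> (\<forall>i<j. k i = ev x y (P i) / ev x y Q)" for j
  proof (induction j)
    case 0
    show ?case by (intro exI[of _ 1]) simp
  next
    case (Suc j)
    then obtain Q P where QP: "Q \<noteq> 0" "\<And>i. i < j \<Longrightarrow> k i = ev x y (P i) / ev x y Q" by blast
    obtain r s where rs: "s \<noteq> 0" "k j = ev x y r / ev x y s" using bir unfolding birational_def by blast
    define P' where "P' i = (if i = j then r * Q else P i * s)" for i
    have "k i = ev x y (P' i) / ev x y (Q * s)" if "i < Suc j" for i
      using that QP(2)[of i] rs ne[OF QP(1)] ne[OF rs(1)]
      by (cases "i = j") (auto simp: P'_def rhom_mult[OF rhom_ev])
    then show ?case using QP(1) rs(1) by (intro exI[of _ "Q * s"] exI[of _ P']) simp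
  qed
  then obtain Q P where QP: "Q \<noteq> 0" "\<And>i. i < Suc m \<Longrightarrow> k i = ev x y (P i) / ev x y Q" by blast
  define C where "C i = map_poly (\<lambda>c. pcompose c T) (P i)" for i
  have \<phi>ev: "\<phi> (ev x y (P i)) = ev x (\<phi> y) (C i)" for i
    unfolding fhom_ev[OF \<phi>] \<phi>x ev_map_pcompose C_def ..
  have yy: "\<phi> y = px ([:- 1, 0, 1:] * U * b) + px (smult \<kappa> (U\<^sup>2)) * y"
  proof -
    have "px (smult \<kappa> (U\<^sup>2)) = const \<kappa> * (px U)\<^sup>2"
      by (simp add: hev_smult[OF rhom_const] rhom_power[OF rhom_px])
    moreover have "px ([:- 1, 0, 1:] * U * b) = w * px U * px b"
      unfolding rhom_mult[OF rhom_px] px_W ..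
    ultimately show ?thesis unfolding \<phi>y \<kappa>_def[symmetric] by simp
  qed
  have "smult \<kappa> (U\<^sup>2) \<noteq> 0" using \<kappa>_nz U_nz by simp
  then have ind: "indep x (\<phi> y)" unfolding yy by (rule indep_affine[OF xy])
  have "\<phi> (ev x y Q) \<noteq> 0" using ne[OF QP(1)] \<phi> by (simp add: fhom_simps)
  have "(\<Sum>i<Suc m. \<phi> (k i) * x ^ i) = (\<Sum>i<Suc m. \<phi> (ev x y (P i)) * x ^ i) / \<phi> (ev x y Q)"
    unfolding sum_divide_distrib by (intro sum.cong) (use QP(2) \<phi> in \<open>auto simp: fhom_simps\<close>)
  then have S: "(\<Sum>i<Suc m. \<phi> (ev x y (P i)) * x ^ i) = 0" using sum \<open>\<phi> (ev x y Q) \<noteq> 0\<close> by simp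
  have xi: "x ^ i = ev x (\<phi> y) [:monom 1 i:]" for i
  proof -
    have "px [:0, 1:] ^ i = px ([:0, 1:] ^ i)" by (simp only: rhom_power[OF rhom_px])
    moreover have "[:0, 1:] ^ i = monom (1::complex) i" by (simp add: monom_altdef)
    moreover have "px [:0, 1:] = x" by (simp add: px_pCons)
    ultimately show ?thesis by (simp add: ev_px)
  qed
  have "ev x (\<phi> y) (\<Sum>i<Suc m. C i * [:monom 1 i:]) = 0"
    using S unfolding rhom_sum[OF rhom_ev] rhom_mult[OF rhom_ev] \<phi>ev xi[symmetric] .
  then have 0: "(\<Sum>i<Suc m. C i * [:monom 1 i:]) = 0" using ind unfolding indep_def by blast
  have "coeff (P i) j = 0" if "i < Suc m" for i j
  proof -
    have "coeff (\<Sum>i<Suc m. C i * [:monom 1 i:]) j = (\<Sum>i<Suc m. pcompose (coeff (P i) j) T * monom 1 i)"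
      unfolding coeff_sum by (intro sum.cong) (auto simp: C_def coeff_map_poly mult.commute)
    then have z: "(\<Sum>i<Suc m. pcompose (coeff (P i) j) T * monom 1 i) = 0" unfolding 0 by simp
    define N where "N = Suc (Max ((\<lambda>i. degree (coeff (P i) j)) ` {..<Suc m}))"
    have "\<forall>i<Suc m. coeff (P i) j = 0 \<or> degree (coeff (P i) j) < N"
      unfolding N_def by (auto intro!: le_imp_less_Suc Max_ge)
    then show ?thesis using pcompose_powers_independent[OF T_degree _ _ z] that by blast
  qed
  then have "P i = 0" if "i < Suc m" for i using that by (intro poly_eqI) simp
  then show ?thesis using QP(2) by simp
qed

text \<open>
  The span \<open>W\<close> of the powers of \<open>x\<close> is closed under multiplication, as \<open>T\<close> has degree \<open>n\<close> and \<open>T = \<phi> x\<close>. It is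
  closed under inversion because multiplication by a nonzero element of \<open>W\<close> maps a basis to a basis.
  So it is a field containing \<open>x\<close> and \<open>\<phi> y\<close>, and hence \<open>y\<close>.
\<close>

lemma degree_eta:
  assumes bir: "birational x y"
  shows "vector_space.dim (\<lambda>a h. \<phi> a * h) (UNIV :: ratfun set) = Suc m"
proof -
  interpret vs: vector_space "\<lambda>a h. \<phi> a * h"
    by unfold_locales (simp_all add: fhom_simps[OF \<phi>] algebra_simps)
  define B where "B = (\<lambda>i. x ^ i) ` {..<Suc m}"
  have fin: "finite B" by (simp add: B_def)
  have inj: "inj_on (\<lambda>i. x ^ i) {..<Suc m}"
  proof (rule inj_onI, rule ccontr)
    fix i j assume ij: "i \<in> {..<Suc m}" "j \<in> {..<Suc m}" "x ^ i = x ^ j" "i \<noteq> j"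
    define k :: "nat \<Rightarrow> ratfun" where "k l = (if l = i then 1 else if l = j then - 1 else 0)" for l
    have "(\<Sum>l<Suc m. \<phi> (k l) * x ^ l) = (\<Sum>l<Suc m. (if l = i then x ^ i else 0) - (if l = j then x ^ j else 0))"
      by (intro sum.cong) (use ij \<phi> in \<open>auto simp: k_def fhom_simps\<close>)
    also have "\<dots> = 0" using ij by (simp only: sum_subtractf sum.delta finite_lessThan) simp
    finally have "k i = 0" using powers_independent[OF bir] ij(1) by blast
    then show False by (simp add: k_def)
  qed
  have card: "card B = Suc m" unfolding B_def by (simp add: card_image[OF inj])
  have indep_mult: "\<not> vs.dependent ((*) g ` B)" if g: "g \<noteq> 0" for g
  proof
    have fg: "finite ((*) g ` B)" using fin by simp
    have injg: "inj_on (\<lambda>i. g * x ^ i) {..<Suc m}" using inj g by (auto simp: inj_on_def)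
    assume "vs.dependent ((*) g ` B)"
    then obtain u where u: "\<exists>v\<in>(*) g ` B. u v \<noteq> 0" "(\<Sum>v\<in>(*) g ` B. \<phi> (u v) * v) = 0"
      unfolding vs.dependent_finite[OF fg] by blast
    have "(\<Sum>v\<in>(\<lambda>i. g * x ^ i) ` {..<Suc m}. \<phi> (u v) * v) = (\<Sum>i<Suc m. \<phi> (u (g * x ^ i)) * (g * x ^ i))"
      using sum.reindex[OF injg, of "\<lambda>v. \<phi> (u v) * v"] by simp
    moreover have im: "(*) g ` B = (\<lambda>i. g * x ^ i) ` {..<Suc m}" by (auto simp: B_def)
    ultimately have e1: "(\<Sum>i<Suc m. \<phi> (u (g * x ^ i)) * (g * x ^ i)) = 0" using u(2) by (simp only:)
    have e2: "(\<Sum>i<Suc m. \<phi> (u (g * x ^ i)) * (g * x ^ i)) = g * (\<Sum>i<Suc m. \<phi> (u (g * x ^ i)) * x ^ i)"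
      by (simp only: sum_distrib_left mult.left_commute)
    have "g * (\<Sum>i<Suc m. \<phi> (u (g * x ^ i)) * x ^ i) = 0" using e1 unfolding e2 .
    then have "(\<Sum>i<Suc m. \<phi> (u (g * x ^ i)) * x ^ i) = 0" using g unfolding mult_eq_0_iff by blast
    then have "\<forall>i<Suc m. u (g * x ^ i) = 0" by (rule powers_independent[OF bir])
    then show False using u(1) unfolding im by auto
  qed
  have indB: "vs.independent B" using indep_mult[of 1] by simp
  define W where "W = vs.span B"
  have scale: "\<phi> a * v \<in> W" if "v \<in> W" for a v using that unfolding W_def by (rule vs.span_scale)
  have add: "u + v \<in> W" "u - v \<in> W" if "u \<in> W" "v \<in> W" for u v
    using that unfolding W_def by (auto intro: vs.span_add vs.span_diff)
  have base: "x ^ i \<in> W" if "i < Suc m" for i unfolding W_def by (rule vs.span_base) (use that in \<open>auto simp: B_def\<close>)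
  have one: "1 \<in> W" using base[of 0] by simp
  have cW: "const c * v \<in> W" if "v \<in> W" for c v using scale[OF that, of "const c"] \<phi> by (simp add: fhom_simps)
  \<comment> \<open>Solve \<open>\<phi> x = T\<close> for the highest power of \<open>x\<close>.\<close>
  have top: "x ^ Suc m \<in> W"
  proof -
    have "\<phi> x = (\<Sum>i\<le>Suc m. const (coeff T i) * x ^ i)"
      unfolding \<phi>x hev_def
      by (subst poly_sum_upto[of _ "Suc m"]) (auto simp: degree_map_poly T_degree coeff_map_poly)
    then have "const (coeff T (Suc m)) * x ^ Suc m = \<phi> x * 1 - (\<Sum>i\<le>m. const (coeff T i) * x ^ i)"
      by (simp add: sum.atMost_Suc)
    also have "\<dots> \<in> W"
    proof (intro add scale one)
      show "(\<Sum>i\<le>m. const (coeff T i) * x ^ i) \<in> W"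
        unfolding W_def by (rule vs.span_sum) (use cW base in \<open>auto simp: W_def\<close>)
    qed
    finally have "const (inverse (coeff T (Suc m))) * (const (coeff T (Suc m)) * x ^ Suc m) \<in> W" by (rule cW)
    moreover have "coeff T (Suc m) \<noteq> 0" using T_degree by (metis degree_0 leading_coeff_neq_0 nat.distinct(1))
    ultimately show ?thesis by (simp add: const_inverse mult.assoc[symmetric])
  qed
  have xW: "x * v \<in> W" if "v \<in> W" for v
    using that[unfolded W_def]
  proof (induction rule: vs.span_induct_alt)
    case base
    show ?case using cW[OF one, of 0] by simp
  next
    case (step c b v)
    then obtain i where i: "b = x ^ i" "i < Suc m" by (auto simp: B_def)
    have "x * b \<in> W" using top base[of "Suc i"] i by (cases "i = m") auto
    then have "\<phi> c * (x * b) + x * v \<in> W" using step by (intro add scale)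
    then show ?case by (simp add: algebra_simps)
  qed
  have powW: "x ^ i * v \<in> W" if "v \<in> W" for i v
    by (induction i) (use that xW in \<open>auto simp: mult.assoc\<close>)
  have multW: "u * v \<in> W" if "u \<in> W" "v \<in> W" for u v
    using that(1)[unfolded W_def]
  proof (induction rule: vs.span_induct_alt)
    case base
    show ?case using cW[OF one, of 0] by simp
  next
    case (step c b u)
    then obtain i where i: "b = x ^ i" by (auto simp: B_def)
    have "\<phi> c * (b * v) + u * v \<in> W" using step powW[OF that(2)] i by (intro add scale) auto
    then show ?case by (simp add: algebra_simps)
  qed
  have invW: "inverse g \<in> W" if g: "g \<in> W" "g \<noteq> 0" for g
  proof -
    have gB: "(*) g ` B \<subseteq> W" using multW[OF g(1)] by (auto simp: W_def intro: vs.span_base)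
    \<comment> \<open>Otherwise there would be one more independent element than the dimension of \<open>W\<close> allows.\<close>
    have "1 \<in> vs.span ((*) g ` B)"
    proof (rule ccontr)
      assume n: "1 \<notin> vs.span ((*) g ` B)"
      then have i: "vs.independent (insert 1 ((*) g ` B))"
        using indep_mult[OF g(2)] by (simp add: vs.independent_insert)
      have "1 \<notin> (*) g ` B" using n vs.span_base[of 1 "(*) g ` B"] by (rule contrapos_nn)
      then have "card (insert 1 ((*) g ` B)) = Suc (Suc m)"
        using fin card card_image[of "(*) g" B] g(2) by (simp add: inj_on_def)
      moreover have "card (insert 1 ((*) g ` B)) \<le> card B"
        using vs.independent_span_bound[OF fin i] gB one unfolding W_def by simp
      ultimately show False using card by simp
    qed
    then have "inverse g * 1 \<in> W"
    proof (induction rule: vs.span_induct_alt)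
      case base
      show ?case using cW[OF one, of 0] by simp
    next
      case (step c b u)
      then obtain v where v: "v \<in> B" "b = g * v" by blast
      have "inverse g * b = v" unfolding v(2) using g(2) by (simp flip: mult.assoc)
      then have "inverse g * b \<in> B" using v(1) by simp
      then have "inverse g * b \<in> W" unfolding W_def by (rule vs.span_base)
      then have "\<phi> c * (inverse g * b) + inverse g * u \<in> W" using step by (intro add scale)
      then show ?case by (simp add: algebra_simps)
    qed
    then show ?thesis by simp
  qed
  have pxW: "px q \<in> W" for q
  proof (induction q)
    case 0
    show ?case using cW[OF one, of 0] by simp
  next
    case (pCons c q)
    show ?case unfolding px_pCons using cW[OF one, of c] xW[OF pCons.IH] by (intro add) auto
  qed
  have yW: "y \<in> W"
  proof -
    have "const \<kappa> * (px U)\<^sup>2 \<noteq> 0" using \<kappa>_nz UV_nz(1) by simp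
    have "\<phi> y - w * px U * px b = const \<kappa> * (px U)\<^sup>2 * y" unfolding \<phi>y \<kappa>_def by simp
    then have "y = inverse (const \<kappa> * (px U)\<^sup>2) * (\<phi> y * 1 - px [:- 1, 0, 1:] * px U * px b)"
      unfolding px_W using \<open>const \<kappa> * (px U)\<^sup>2 \<noteq> 0\<close> by (simp add: field_simps)
    also have "\<dots> \<in> W"
      using \<open>const \<kappa> * (px U)\<^sup>2 \<noteq> 0\<close>
      by (intro multW invW add scale one pxW cW) (simp_all add: power2_eq_square cW multW pxW)
    finally show ?thesis .
  qed
  have evW: "ev x y q \<in> W" for q
  proof (induction q)
    case 0
    show ?case using cW[OF one, of 0] by simp
  next
    case (pCons c q)
    show ?case unfolding ev_pCons using pxW multW[OF yW pCons.IH] by (intro add)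
  qed
  have "h \<in> W" for h
  proof -
    obtain r s where rs: "s \<noteq> 0" "h = ev x y r / ev x y s" using bir unfolding birational_def by blast
    then have "ev x y s \<noteq> 0" using xy by (auto simp: indep_def)
    then show ?thesis unfolding rs(2) divide_inverse using multW[OF evW invW[OF evW]] by blast
  qed
  then have "vs.span B = vs.span UNIV" unfolding W_def by auto
  then show ?thesis using vs.dim_eq_card[OF _ indB, of UNIV] card by simp
qed

lemma has_degree_eta:
  assumes bir: "birational x y" shows "has_degree surface eta (Suc m)"
  unfolding has_degree_def
  using local_endo.comorphism[OF local_endo_eta[OF bir]] degree_eta[OF bir] by blast

end

lemma cheb_endo_exists:
  assumes xy: "indep x y" and bir: "birational x y"
    and root: "\<And>a. a\<^sup>2 \<noteq> 1 \<Longrightarrow> poly (cheb_U m) a = 0 \<Longrightarrow> (a\<^sup>2 - 1) * (poly b a)\<^sup>2 = 1"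
  obtains \<phi> where "cheb_endo x y m b \<phi>"
proof -
  interpret chart x y by unfold_locales (rule xy)
  define \<alpha> where "\<alpha> = smult (1 / of_nat (Suc m)) ((cheb_U m)\<^sup>2)"
  define \<beta> where "\<beta> = [:- 1, 0, 1:] * cheb_U m * b"
  have "poly (cheb_U m) 1 \<noteq> 0" using cheb_U_pm1[of 1 m] of_nat_neq_0[of m, where 'a = complex] by (auto simp del: of_nat_Suc)
  then have "\<alpha> \<noteq> 0" unfolding \<alpha>_def by (auto simp del: of_nat_Suc)
  then have "indep x (hev const x \<beta> + hev const x \<alpha> * y)" by (rule indep_affine[OF xy])
  then have ind: "indep (hev const x (cheb_T (Suc m))) (hev const x \<beta> + hev const x \<alpha> * y)"
    by (rule indep_pcompose) (simp add: cheb_degree)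
  obtain \<phi> where \<phi>: "fhom \<phi>" "\<phi> x = hev const x (cheb_T (Suc m))" "\<phi> y = hev const x \<beta> + hev const x \<alpha> * y"
    by (rule field_hom_exists[OF xy bir ind])
  have "hev const x \<beta> = w * hev const x (cheb_U m) * hev const x b"
    unfolding \<beta>_def rhom_mult[OF rhom_px] by (simp add: px_pCons w_def power2_eq_square const_minus)
  moreover have "hev const x \<alpha> = const (1 / of_nat (Suc m)) * (hev const x (cheb_U m))\<^sup>2"
    unfolding \<alpha>_def by (simp only: hev_smult[OF rhom_const] rhom_power[OF rhom_px])
  ultimately have "cheb_endo x y m b \<phi>"
    using \<phi> root by unfold_locales simp_all
  then show thesis by (rule that)
qed

section \<open>Coordinates along the fibres\<close>

text \<open>
  A polynomial of positive degree in either variable has a zero over the complex numbers.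
\<close>

lemma no_zeros_const:
  assumes "\<And>a c. pv a c q \<noteq> 0" obtains k where "k \<noteq> 0" "q = [:[:k:]:]"
proof -
  have q0: "q \<noteq> 0" using assms[of 0 0] by auto
  have "degree q = 0"
  proof (rule ccontr)
    assume d: "degree q \<noteq> 0"
    obtain a where a: "poly (lead_coeff q) a \<noteq> 0" using q0 by (metis leading_coeff_0_iff poly_all_0_iff_0)
    define r where "r = map_poly (\<lambda>s. poly s a) q"
    have "coeff r (degree q) \<noteq> 0" using a by (simp add: r_def coeff_map_poly)
    then have "degree r \<ge> degree q" by (rule le_degree)
    then have "degree r > 0" using d by simp
    then obtain c where "poly r c = 0" using alg_closed_imp_poly_has_root by blast
    then show False using assms[of a c] by (simp add: pv_def hev_def r_def)
  qed
  then obtain s where s: "q = [:s:]" by (rule degree_eq_zeroE)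
  have "degree s = 0"
  proof (rule ccontr)
    assume "degree s \<noteq> 0"
    then obtain a where "poly s a = 0" using alg_closed_imp_poly_has_root[of s] by auto
    then show False using assms[of a 0] s by (simp add: pv_pCons)
  qed
  then obtain k where "s = [:k:]" by (rule degree_eq_zeroE)
  then show thesis using that[of k] s q0 by auto
qed

text \<open>
  The denominator of a reduced fraction divides every other denominator, so it has no zero.
\<close>

lemma regular_on_plane:
  assumes xy: "indep x y" and h: "\<And>a c. h \<in> plane_pt x y a c"
  obtains p where "h = ev x y p"
proof -
  note P = plane_pt_point[OF xy]
  have inj: "r = s" if "ev x y r = ev x y s" for r s
  proof -
    have "ev x y (r - s) = 0" by (simp add: rhom_diff[OF rhom_ev] that)
    then have "r - s = 0" using xy unfolding indep_def by blast
    then show ?thesis by simp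
  qed
  have ne: "ev x y r \<noteq> 0" if "r \<noteq> 0" for r using xy that by (auto simp: indep_def)
  obtain p q where pq: "pv 0 0 q \<noteq> 0" "h = ev x y p / ev x y q" using h[of 0 0] unfolding P(6) by blast
  then have q0: "q \<noteq> 0" by auto
  then have "gcd p q \<noteq> 0" by simp
  then obtain p' q' where p'q': "p = p' * gcd p q" "q = q' * gcd p q" "coprime p' q'"
    using gcd_coprime_exists by blast
  have q'0: "q' \<noteq> 0" using q0 p'q'(2) by auto
  have h': "h = ev x y p' / ev x y q'"
    unfolding pq(2) using ne[OF \<open>gcd p q \<noteq> 0\<close>] by (subst p'q'(1), subst p'q'(2)) (simp add: rhom_mult[OF rhom_ev])
  have "pv a c q' \<noteq> 0" for a c
  proof -
    obtain r s where rs: "pv a c s \<noteq> 0" "h = ev x y r / ev x y s" using h[of a c] unfolding P(6) by blast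
    have "s \<noteq> 0" using rs(1) by auto
    then have "ev x y p' * ev x y s = ev x y r * ev x y q'"
      using h' rs(2) ne[OF q'0] ne[of s] by (simp add: frac_eq_eq)
    then have "p' * s = r * q'" by (intro inj) (simp add: rhom_mult[OF rhom_ev])
    then have "q' dvd p' * s" by simp
    moreover have "coprime q' p'" using p'q'(3) by (rule coprime_commute[THEN iffD1])
    ultimately have "q' dvd s" using coprime_dvd_mult_right_iff by blast
    then show ?thesis using rs(1) by (auto elim!: dvdE simp: rhom_mult[OF rhom_pv])
  qed
  then obtain k where k: "k \<noteq> 0" "q' = [:[:k:]:]" by (rule no_zeros_const)
  have "ev x y ([:[:inverse k:]:] * p') = h"
    unfolding h' k(2) rhom_mult[OF rhom_ev]
    by (simp add: ev_px px_pCons const_inverse divide_inverse mult.commute)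
  then show thesis using that by metis
qed

text \<open>
  A localization that is the ring of a closed point is not empty; so the ideal generated by \<open>x - a\<close> and
  \<open>y - c\<close> is proper, and these two elements cannot become units.
\<close>

lemma plane_pt_weak:
  assumes P: "closed_point P" "P = plane_pt x y a c" and nz: "x - const a \<noteq> 0"
  shows "x \<in> P" "y \<in> P" "val P x = a" "val P y = c"
proof -
  define A where "A = range (ev x y)"
  define I where "I = ideal2 A (x - const a) (y - const c)"
  have PA: "P = {f / g | f g. f \<in> A \<and> g \<in> A - I}"
    unfolding P(2) plane_pt_def adjoin_adjoin local_at_def A_def I_def ..
  have A: "u * v \<in> A" if "u \<in> A" "v \<in> A" for u v
    using that by (auto simp: A_def simp flip: rhom_mult[OF rhom_ev])
  have evA: "ev x y r \<in> A" for r by (simp add: A_def)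
  have xA: "x \<in> A" "y \<in> A" "1 \<in> A" "0 \<in> A"
    using evA[of "[:[:0, 1:]:]"] evA[of "[:0, 1:]"] evA[of 1] evA[of 0]
    by (simp_all add: ev_px ev_y px_pCons rhom_1[OF rhom_ev])
  have "P \<noteq> {}" using cp_0[OF P(1)] by auto
  then obtain g where g: "g \<in> A" "g \<notin> I" using PA by blast
  have "1 \<notin> I"
  proof
    assume "1 \<in> I"
    then obtain r s where rs: "r \<in> A" "s \<in> A" "1 = r * (x - const a) + s * (y - const c)" by (auto simp: I_def ideal2_def)
    have "g = g * (r * (x - const a) + s * (y - const c))" unfolding rs(3)[symmetric] by simp
    also have "\<dots> = (g * r) * (x - const a) + (g * s) * (y - const c)" by (simp add: algebra_simps)
    also have "\<dots> \<in> I" unfolding I_def by (intro ideal2_memI A g rs)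
    finally show False using g by simp
  qed
  then have "f / 1 \<in> P" if "f \<in> A" for f unfolding PA using that xA(3) by blast
  then show xP: "x \<in> P" and yP: "y \<in> P" using xA by auto
  have *: "val P k = 0" if k: "k \<in> P" "k \<noteq> 0" "\<And>f. f \<in> A \<Longrightarrow> f * k \<in> I" for k
  proof (rule ccontr)
    assume "val P k \<noteq> 0"
    then have "inverse k \<in> P" using P(1) k(1) by (simp add: cp_simps)
    then obtain f g where fg: "f \<in> A" "g \<in> A" "g \<notin> I" "inverse k = f / g" using PA by blast
    have "f \<noteq> 0" "g \<noteq> 0" using fg(4) k(2) by auto
    then have "g = f * k" using fg(4) k(2) by (simp add: field_simps)
    then show False using fg k(3) by blast
  qed
  have "val P (x - const a) = 0"
  proof (rule *[OF _ nz])
    show "x - const a \<in> P" using xP P(1) by (simp add: cp_simps)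
    show "f * (x - const a) \<in> I" if "f \<in> A" for f
      using ideal2_memI[OF that xA(4), of "x - const a" "y - const c"] by (simp add: I_def)
  qed
  then show "val P x = a" using xP P(1) by (simp add: cp_simps)
  have "val P (y - const c) = 0"
  proof (cases "y - const c = 0")
    case True
    then show ?thesis using val_0[OF P(1)] by simp
  next
    case False
    show ?thesis
    proof (rule *[OF _ False])
      show "y - const c \<in> P" using yP P(1) by (simp add: cp_simps)
      show "f * (y - const c) \<in> I" if "f \<in> A" for f
        using ideal2_memI[OF xA(4) that, of "x - const a" "y - const c"] by (simp add: I_def)
    qed
  qed
  then show "val P y = c" using yP P(1) by (simp add: cp_simps)
qed

text \<open>
  The functions regular on the whole plane are the polynomials, so each of \<open>y\<close>, \<open>y'\<close> is a polynomial in
  \<open>x\<close> and the other. The degrees in the fibre coordinate multiply to \<open>1\<close> under composition. To be able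
  to express \<open>y\<close> by \<open>y'\<close>, one needs the independence of \<open>x\<close> and \<open>y'\<close>; it holds since \<open>y'\<close> is injective
  on each fibre, and so, being a nonconstant polynomial there, surjective.
\<close>

lemma (in chart) other_fibre_coordinate:
  assumes eq: "affine_plane x y' = affine_plane x y"
  obtains r \<beta> where "\<beta> \<noteq> 0" "y' = hev const x r + const \<beta> * y"
    "\<And>a c. plane_pt x y' a (poly r a + \<beta> * c) = plane_pt x y a c" "indep x y'"
proof -
  have same: "plane_pt x y a c = plane_pt x y' a (val (plane_pt x y a c) y') \<and> y' \<in> plane_pt x y a c" for a c
  proof -
    have "plane_pt x y a c \<in> affine_plane x y" unfolding affine_plane_def by blast
    then have "plane_pt x y a c \<in> affine_plane x y'" using eq by simp
    then obtain a' c' where ac: "plane_pt x y a c = plane_pt x y' a' c'" unfolding affine_plane_def by blast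
    note W = plane_pt_weak[OF plane_cp ac nonzero(5)]
    have "a' = a" using W(3) plane(3) by simp
    then show ?thesis using W(2,4) ac by simp
  qed
  obtain p where p: "y' = ev x y p" using regular_on_plane[OF xy, of y'] same by blast
  have val_y': "val (plane_pt x y a c) y' = pv a c p" for a c
    unfolding p using cp_ev(2)[OF plane_cp plane(2) plane(4)] by (simp add: plane(3,5))
  have same': "plane_pt x y a c = plane_pt x y' a (pv a c p)" for a c using same[of a c] val_y' by simp
  \<comment> \<open>Different points of a fibre have different \<open>y'\<close>, since they are determined by \<open>x\<close> and \<open>y'\<close>.\<close>
  have surj: "\<exists>c. pv a c p = k" for a k
  proof -
    define f where "f = map_poly (\<lambda>q. poly q a) p"
    have f: "pv a c p = poly f c" for c by (simp add: pv_def hev_def f_def)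
    have "pv a 0 p \<noteq> pv a 1 p"
    proof
      assume "pv a 0 p = pv a 1 p"
      then have "plane_pt x y a 0 = plane_pt x y a 1" using same'[of a 0] same'[of a 1] by simp
      then show False using plane(5)[of a 0] plane(5)[of a 1] by simp
    qed
    then have "degree f > 0" unfolding f by (cases "degree f = 0") (auto elim!: degree_eq_zeroE)
    moreover have "f = (f - [:k:]) + [:k:]" by simp
    ultimately have "degree (f - [:k:]) > 0"
      by (metis degree_add_le degree_pCons_0 le_zero_eq not_gr_zero order_refl)
    then obtain c where "poly (f - [:k:]) c = 0" using alg_closed_imp_poly_has_root by blast
    then show ?thesis using f by auto
  qed
  have xy': "indep x y'" unfolding indep_def
  proof (intro allI impI)
    fix f assume f: "ev x y' f = 0"
    have "pv a k f = 0" for a k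
    proof -
      obtain c where c: "pv a c p = k" using surj by blast
      have "val (plane_pt x y a c) (ev x y' f) = pv a k f"
        using cp_ev(2)[OF plane_cp plane(2), of y' a c f] same[of a c] val_y' c by (simp add: plane(3))
      then show ?thesis using f val_0[OF plane_cp] by simp
    qed
    then show "f = 0" by (rule pv_eq_0_imp)
  qed
  have "y \<in> plane_pt x y' a k" for a k
  proof -
    obtain c where c: "pv a c p = k" using surj by blast
    then show ?thesis using same'[of a c] plane(4)[of a c] by simp
  qed
  then obtain p' where p': "y = ev x y' p'" using regular_on_plane[OF xy'] by blast
  have "ev x y [:0, 1:] = ev x y (pcompose p' p)" using p' unfolding p ev_affine ev_y .
  then have "ev x y ([:0, 1:] - pcompose p' p) = 0" by (simp only: rhom_diff[OF rhom_ev] right_minus_eq)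
  then have "[:0, 1:] - pcompose p' p = 0" using xy unfolding indep_def by blast
  then have comp: "pcompose p' p = [:0, 1:]" by simp
  have "degree p' * degree p = 1" using arg_cong[OF comp, of degree] by (simp add: degree_pcompose)
  then have "degree p' = 1" "degree p = 1" by auto
  then obtain r b r' b' where pr: "p = [:r, b:]" and pr': "p' = [:r', b':]" by (metis degree1_coeffs)
  have "b * b' = 1" using comp unfolding pr pr' by (simp add: pcompose_pCons mult.commute)
  then have "is_unit b" by (metis dvd_triv_left)
  then obtain \<beta> where \<beta>: "b = [:\<beta>:]" by (metis degree_eq_zeroE is_unit_iff_degree not_is_unit_0)
  have "\<beta> \<noteq> 0" using \<open>b * b' = 1\<close> \<beta> by auto
  moreover have "y' = hev const x r + const \<beta> * y" unfolding p pr \<beta> by (simp add: ev_pCons px_pCons mult.commute)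
  moreover have "plane_pt x y' a (poly r a + \<beta> * c) = plane_pt x y a c" for a c
    unfolding same' pr \<beta> by (simp add: pv_pCons mult.commute)
  ultimately show thesis using that xy' by blast
qed

lemma interpolation:
  fixes g :: "complex \<Rightarrow> complex"
  assumes "finite S" shows "\<exists>p. \<forall>a\<in>S. poly p a = g a"
  using assms
proof (induction S)
  case (insert a S)
  then obtain p where p: "\<forall>b\<in>S. poly p b = g b" by blast
  define q where "q = (\<Prod>b\<in>S. [:- b, 1:])"
  have q: "poly q b = 0" if "b \<in> S" for b using that insert.hyps by (auto simp: q_def poly_prod)
  have qa: "poly q a \<noteq> 0" using insert.hyps by (auto simp: q_def poly_prod)
  show ?case
    by (intro exI[of _ "p + smult ((g a - poly p a) / poly q a) q"]) (use p q qa in auto)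
qed simp

section \<open>Lifting the endomorphism of the plane\<close>

context adapted_datum
begin

text \<open>
  The quotients of polynomials in \<open>x\<close> and \<open>y\<close> form a field, which contains the local ring of a point of
  the plane and therefore the quotients of the homogeneous coordinates.
\<close>

lemma birational_xy: "birational x y"
proof -
  define F where "F = {ev x y p / ev x y q | p q. q \<noteq> 0}"
  have ne: "q \<noteq> 0 \<Longrightarrow> ev x y q \<noteq> 0" for q using xy by (auto simp: indep_def)
  have F: "a + b \<in> F \<and> a * b \<in> F \<and> a / b \<in> F" if ab: "a \<in> F" "b \<in> F" for a b
  proof -
    obtain p q where a: "q \<noteq> 0" "a = ev x y p / ev x y q" using ab(1) by (auto simp: F_def)
    obtain r s where b: "s \<noteq> 0" "b = ev x y r / ev x y s" using ab(2) by (auto simp: F_def)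
    have "a + b = ev x y (p * s + r * q) / ev x y (q * s)"
      unfolding a(2) b(2) using ne[OF a(1)] ne[OF b(1)] by (simp add: rhom_simps[OF rhom_ev] add_frac_eq)
    moreover have "a * b = ev x y (p * r) / ev x y (q * s)" unfolding a(2) b(2) by (simp add: rhom_simps[OF rhom_ev])
    moreover have "a / b = ev x y (p * s) / ev x y (q * r)" unfolding a(2) b(2) by (simp add: rhom_simps[OF rhom_ev])
    moreover have "0 / 1 \<in> F" unfolding F_def using rhom_1[OF rhom_ev] ev_0 by (metis (mono_tags, lifting) mem_Collect_eq one_neq_zero)
    ultimately show ?thesis
      using a(1) b(1) unfolding F_def by (cases "r = 0") (auto, (metis mult_eq_0_iff)+)
  qed
  have plane_F: "plane_pt x y a c \<subseteq> F" for a c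
    unfolding F_def using plane(6) by fastforce
  obtain a where a: "dot m a = 1" "plane_pt x y 0 0 = pt a" by (rule plane_is_pt)
  have lin_F: "lin f / lin m \<in> F" for f
    using pt_lin(2)[OF fr, of m a f] a plane_F[of 0 0] by auto
  have m0: "lin m \<noteq> 0" by (rule frame_nonzero(2)[OF fr])
  have hc: "hcoord $ i \<in> F" for i
  proof -
    have "hcoord $ i = (lin (axis i 1) / lin m) / (lin (axis 1 1) / lin m)"
      using m0 by (simp add: lin_axis hcoord_nth)
    then show ?thesis using F lin_F by metis
  qed
  have cF: "const k \<in> F" for k using cp_const[OF plane_cp] plane_F by blast
  have pxF: "hev const ss q \<in> F" for q
    by (induction q) (use cF[of 0] cF hc F in \<open>auto simp: px_pCons\<close>)
  have evF: "ev ss tt p \<in> F" for p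
    by (induction p) (use cF[of 0] pxF hc F in \<open>auto simp: ev_pCons\<close>)
  have "h \<in> F" for h
  proof -
    obtain p q where h: "h = Fract p q" "q \<noteq> 0" by (cases h) auto
    have "h = ev ss tt p / ev ss tt q" unfolding ev_coords h(1) using Fract_conv_to_fract by blast
    then show ?thesis using F evF by simp
  qed
  then show ?thesis unfolding birational_def F_def by blast
qed

lemma sigma_map_eq:
  assumes R: "R \<in> surface" shows "sigma_map d R = plane_pt x y (val R x) (val R y)"
  unfolding sigma_map_def base_plane_eq
proof (rule the_equality)
  note S = surface_point(1-3)[OF R]
  have *: "dominates R (plane_pt x y a c) \<longleftrightarrow> val R x = a \<and> val R y = c" for a c
    unfolding dominates_iff[OF S(1) plane_cp] lies_over_plane[OF xy S(1)] using S by blast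
  show "plane_pt x y (val R x) (val R y) \<in> affine_plane x y \<and> dominates R (plane_pt x y (val R x) (val R y))"
    using * unfolding affine_plane_def by blast
  fix Q assume "Q \<in> affine_plane x y \<and> dominates R Q"
  then obtain a c where Q: "Q = plane_pt x y a c" "dominates R (plane_pt x y a c)" unfolding affine_plane_def by blast
  then have "val R x = a" "val R y = c" using * by blast+
  then show "Q = plane_pt x y (val R x) (val R y)" using Q(1) by simp
qed

lemma endomorphism:
  assumes root: "\<And>a. a\<^sup>2 \<noteq> 1 \<Longrightarrow> poly (cheb_U k) a = 0 \<Longrightarrow> (a\<^sup>2 - 1) * (poly b a)\<^sup>2 = 1"
  obtains \<eta> where "etale (surf d) (surf d) \<eta>" "has_degree (surf d) \<eta> (Suc k)" "respects_rho d x \<eta>"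
    "\<And>R. R \<in> surf d \<Longrightarrow> \<eta> R \<in> surf d"
    "\<And>R. R \<in> surf d \<Longrightarrow> val (\<eta> R) x = poly (cheb_T (Suc k)) (val R x)"
    "\<And>R. R \<in> surf d \<Longrightarrow> val (\<eta> R) y = 1 / of_nat (Suc k) * (poly (cheb_U k) (val R x))\<^sup>2 * val R y
       + ((val R x)\<^sup>2 - 1) * poly (cheb_U k) (val R x) * poly b (val R x)"
proof -
  obtain \<phi> where "cheb_endo x y k b \<phi>" by (rule cheb_endo_exists[OF xy birational_xy root])
  then interpret ce: cheb_endo x y k b \<phi> .
  show thesis
  proof (rule that)
    show "etale (surf d) (surf d) ce.eta"
      unfolding surf_eq by (rule local_endo.etale[OF ce.local_endo_eta[OF birational_xy]])
    show "has_degree (surf d) ce.eta (Suc k)"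
      unfolding surf_eq by (rule ce.has_degree_eta[OF birational_xy])
    show "respects_rho d x ce.eta"
      unfolding respects_rho_def rho_def surf_eq using ce.eta_coords(1) by blast
    fix R assume "R \<in> surf d"
    then have R: "R \<in> surface" by (simp add: surf_eq)
    show "ce.eta R \<in> surf d" unfolding surf_eq by (rule ce.eta_surface)
    show "val (ce.eta R) x = poly (cheb_T (Suc k)) (val R x)" by (rule ce.eta_coords(1)[OF R])
    show "val (ce.eta R) y = 1 / of_nat (Suc k) * (poly (cheb_U k) (val R x))\<^sup>2 * val R y
       + ((val R x)\<^sup>2 - 1) * poly (cheb_U k) (val R x) * poly b (val R x)"
      using ce.eta_coords(2)[OF R] unfolding ce.\<kappa>_def .
  qed
qed

text \<open>
  The choice of the zeros on $F_{\pm 1}$ makes the summand depending on \<open>x\<close> divisible by \<open>w\<close>. Along the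
  last blowups \<open>w / y\<close> vanishes, so that there \<open>y' / y\<close> has value \<open>\<beta>\<close>, and comparing the two
  normalizations gives \<open>\<beta>\<^sup>2 = 1\<close>.
\<close>

lemma normalized_coordinate:
  assumes fc: "fibre_coord d x y'" and norm: "normalized d x y'"
  obtains r \<beta> where "\<beta>\<^sup>2 = 1" "y' = w * hev const x r + const \<beta> * y" "indep x y'"
    "\<And>a c. plane_pt x y' a ((a\<^sup>2 - 1) * poly r a + \<beta> * c) = plane_pt x y a c"
proof -
  have "affine_plane x y' = affine_plane x y" using fc base_plane_eq by (simp add: fibre_coord_def)
  then obtain s \<beta> where \<beta>: "\<beta> \<noteq> 0" and y': "y' = hev const x s + const \<beta> * y"
    and pts: "\<And>a c. plane_pt x y' a (poly s a + \<beta> * c) = plane_pt x y a c" and ind: "indep x y'"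
    by (rule other_fibre_coordinate) (rule that; assumption)
  have s0: "poly s e = 0" if "p e = plane_pt x y' e 0" for e
  proof -
    have "plane_pt x y' e (poly s e) = plane_pt x y' e 0" using that pts[of e 0] by (simp add: p_def)
    then show ?thesis using plane_pt_point(5)[OF ind] by metis
  qed
  have s: "poly s 1 = 0" "poly s (- 1) = 0"
    using fc s0[of 1] s0[of "- 1"] pt_pp pt_pm by (simp_all add: fibre_coord_def)
  obtain s1 where s1: "s = [:- 1, 1:] * s1" using s(1) poly_eq_0_iff_dvd[of s 1] by (auto elim: dvdE)
  then have "poly s1 (- 1) = 0" using s(2) by simp
  then obtain r where r: "s1 = [:1, 1:] * r" using poly_eq_0_iff_dvd[of s1 "- 1"] by (auto elim: dvdE)
  have "s = ([:- 1, 1:] * [:1, 1:]) * r" unfolding s1 r by (simp only: mult.assoc)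
  also have "[:- 1, 1:] * [:1, 1:] = [:- 1, 0, 1 :: complex:]" by simp
  finally have sr: "s = [:- 1, 0, 1:] * r" .
  have pxs: "hev const x s = w * hev const x r"
    unfolding sr rhom_mult[OF rhom_px] by (simp add: px_pCons w_def power2_eq_square const_minus)
  have y'r: "y' = w * hev const x r + const \<beta> * y" using y' pxs by simp
  have pts': "plane_pt x y' a ((a\<^sup>2 - 1) * poly r a + \<beta> * c) = plane_pt x y a c" for a c
    using pts[of a c] unfolding sr by (simp add: power2_eq_square algebra_simps)
  have e: "(1::complex)\<^sup>2 = 1" by simp
  define P where "P = P2 1"
  have cp: "closed_point P" unfolding P_def by (rule regular_point_cp[OF reg_P2[OF e]])
  note o = over_P2[OF e lies_over_refl, folded P_def]
  define t where "t = w / y * hev const x r + const \<beta>"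
  have t: "t \<in> P" "val P t = \<beta>"
    unfolding t_def using o(5,6) cp_px[OF cp o(1)] cp by (simp_all add: cp_simps del: times_divide_eq_left times_divide_eq_right)
  have yt: "y' = y * t" unfolding y'r t_def using nonzero(1) by (simp add: field_simps)
  have "(x\<^sup>2 - 1) / y'\<^sup>2 = w / y / y / t\<^sup>2"
    unfolding yt w_def by (simp only: power_mult_distrib power2_eq_square[of y] divide_divide_eq_left)
  moreover have "val P (t\<^sup>2) = \<beta>\<^sup>2" "t\<^sup>2 \<in> P" using t cp by (simp_all add: cp_simps)
  then have "val P (w / y / y / t\<^sup>2) = 1 / \<beta>\<^sup>2" using val_divide[OF cp o(7)] o(8) \<beta> by simp
  moreover have "val P ((x\<^sup>2 - 1) / y'\<^sup>2) = 1"
    using norm pp3 has_value_iff[OF cp] by (simp add: normalized_def P_def)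
  ultimately have "\<beta>\<^sup>2 = 1" using \<beta> by simp
  then show thesis using that y'r ind pts' by blast
qed

text \<open>
  In terms of the coordinate \<open>y\<close>, the endomorphism of the plane has the same form with \<open>b\<close> replaced by
  \<open>b' = \<beta> (U r / n + b - U (r \<circ> T))\<close>, which is \<open>\<plusminus>b\<close> at the zeros of \<open>U\<close>.
\<close>

lemma lift_of_eta0:
  assumes fc: "fibre_coord d x y'" and norm: "normalized d x y'"
    and root: "\<And>a. a\<^sup>2 \<noteq> 1 \<Longrightarrow> poly (cheb_U k) a = 0 \<Longrightarrow> (a\<^sup>2 - 1) * (poly b a)\<^sup>2 = 1"
  shows "\<exists>\<eta>. etale (surf d) (surf d) \<eta> \<and>
     (\<forall>R\<in>surf d. sigma_map d (\<eta> R) = eta0 x y' (Suc k) b (sigma_map d R)) \<and>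
     has_degree (surf d) \<eta> (Suc k) \<and> respects_rho d x \<eta>"
proof -
  obtain r \<beta> where \<beta>: "\<beta>\<^sup>2 = 1" and y': "y' = w * hev const x r + const \<beta> * y" and ind: "indep x y'"
    and pts: "\<And>a c. plane_pt x y' a ((a\<^sup>2 - 1) * poly r a + \<beta> * c) = plane_pt x y a c"
    by (rule normalized_coordinate[OF fc norm]) (rule that; assumption)
  define T U where "T = cheb_T (Suc k)" and "U = cheb_U k"
  define \<kappa> :: complex where "\<kappa> = 1 / of_nat (Suc k)"
  define b' where "b' = smult \<beta> (smult \<kappa> (U * r) + b - U * pcompose r T)"
  have b': "poly b' a = \<beta> * (\<kappa> * poly U a * poly r a + poly b a - poly U a * poly r (poly T a))" for a
    by (simp add: b'_def poly_pcompose algebra_simps)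
  have root': "(a\<^sup>2 - 1) * (poly b' a)\<^sup>2 = 1" if "a\<^sup>2 \<noteq> 1" "poly (cheb_U k) a = 0" for a
    using root[OF that] that \<beta> unfolding b' U_def by (simp add: power_mult_distrib)
  obtain \<eta> where \<eta>: "etale (surf d) (surf d) \<eta>" "has_degree (surf d) \<eta> (Suc k)" "respects_rho d x \<eta>"
    "\<And>R. R \<in> surf d \<Longrightarrow> \<eta> R \<in> surf d"
    "\<And>R. R \<in> surf d \<Longrightarrow> val (\<eta> R) x = poly (cheb_T (Suc k)) (val R x)"
    "\<And>R. R \<in> surf d \<Longrightarrow> val (\<eta> R) y = 1 / of_nat (Suc k) * (poly (cheb_U k) (val R x))\<^sup>2 * val R y
       + ((val R x)\<^sup>2 - 1) * poly (cheb_U k) (val R x) * poly b' (val R x)"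
    by (rule endomorphism[OF root']) (assumption | rule that)+
  have "sigma_map d (\<eta> R) = eta0 x y' (Suc k) b (sigma_map d R)" if R: "R \<in> surf d" for R
  proof -
    define a c where "a = val R x" and "c = val R y"
    define Q where "Q = plane_pt x y a c"
    have Q: "sigma_map d R = Q" using sigma_map_eq R by (simp add: surf_eq a_def c_def Q_def)
    define c2 where "c2 = \<kappa> * (poly U a)\<^sup>2 * c + (a\<^sup>2 - 1) * poly U a * poly b' a"
    have 1: "sigma_map d (\<eta> R) = plane_pt x y (poly T a) c2"
      using sigma_map_eq[of "\<eta> R"] \<eta>(4-6)[OF R] by (simp add: surf_eq T_def U_def \<kappa>_def c2_def a_def c_def)
    have wQ: "w \<in> Q" "val Q w = a\<^sup>2 - 1" unfolding Q_def by (rule plane_w)+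
    have pxQ: "hev const x r \<in> Q" "val Q (hev const x r) = poly r a"
      unfolding Q_def using cp_px[OF plane_cp plane(2)] plane(3) by simp_all
    have vQ: "val Q x = a" "val Q y' = (a\<^sup>2 - 1) * poly r a + \<beta> * c"
      unfolding y' using plane(2-5)[of a c, folded Q_def] wQ plane_cp[of a c, folded Q_def] pxQ
      by (simp_all add: cp_simps del: times_divide_eq_right)
    have TT: "(poly T a)\<^sup>2 - 1 = (a\<^sup>2 - 1) * (poly U a)\<^sup>2"
      using arg_cong[OF cheb_identities(3)[of k], of "\<lambda>q. poly q a"]
      by (simp add: T_def U_def poly_power power2_eq_square algebra_simps)
    have bb: "\<beta> * \<beta> = 1" using \<beta> by (simp add: power2_eq_square)
    have bb': "\<beta> * poly b' a = \<kappa> * poly U a * poly r a + poly b a - poly U a * poly r (poly T a)"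
      unfolding b' mult.assoc[symmetric] bb by simp
    have "((poly T a)\<^sup>2 - 1) * poly r (poly T a) + \<beta> * c2
        = (a\<^sup>2 - 1) * (poly U a)\<^sup>2 * poly r (poly T a) + \<kappa> * (poly U a)\<^sup>2 * (\<beta> * c) + (a\<^sup>2 - 1) * poly U a * (\<beta> * poly b' a)"
      unfolding TT c2_def by (simp add: algebra_simps)
    also have "\<dots> = \<kappa> * (poly U a)\<^sup>2 * ((a\<^sup>2 - 1) * poly r a + \<beta> * c) + (a\<^sup>2 - 1) * poly U a * poly b a"
      unfolding bb' by (simp add: algebra_simps power2_eq_square)
    finally have "plane_pt x y (poly T a) c2
        = plane_pt x y' (poly T a) (\<kappa> * (poly U a)\<^sup>2 * ((a\<^sup>2 - 1) * poly r a + \<beta> * c) + (a\<^sup>2 - 1) * poly U a * poly b a)"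
      using pts[of "poly T a" c2] by simp
    then show ?thesis
      unfolding 1 Q eta0_def Let_def vQ by (simp add: T_def U_def \<kappa>_def)
  qed
  then show ?thesis using \<eta>(1-3) by blast
qed

end

lemma root_condition:
  assumes n: "n > 0" and b: "\<forall>k\<in>{1..n - 1}.
      poly b (cos (of_real (real k * pi / real n))) = \<i> / sin (of_real (real k * pi / real n)) \<or>
      poly b (cos (of_real (real k * pi / real n))) = - \<i> / sin (of_real (real k * pi / real n))"
    and a: "a\<^sup>2 \<noteq> 1" "poly (cheb_U (n - 1)) a = 0"
  shows "(a\<^sup>2 - 1) * (poly b a)\<^sup>2 = 1"
proof -
  obtain k where k: "k \<in> {1..n - 1}" "a = cos (of_real (real k * pi / real n))"
    by (rule cheb_U_root[OF a n])
  define \<theta> :: complex where "\<theta> = of_real (real k * pi / real n)"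
  have s: "a\<^sup>2 - 1 = - (sin \<theta>)\<^sup>2"
  proof -
    have "(sin \<theta>)\<^sup>2 + a\<^sup>2 = 1" using sin_cos_squared_add[of \<theta>] k(2) by (simp only: \<theta>_def)
    then have "a\<^sup>2 - 1 = a\<^sup>2 - ((sin \<theta>)\<^sup>2 + a\<^sup>2)" by (simp only:)
    then show ?thesis by simp
  qed
  have "poly b a = \<i> / sin \<theta> \<or> poly b a = - \<i> / sin \<theta>" using b k unfolding \<theta>_def by blast
  then have "(poly b a)\<^sup>2 = - 1 / (sin \<theta>)\<^sup>2" by (auto simp: power_divide)
  moreover have "(sin \<theta>)\<^sup>2 \<noteq> 0" using s a(1) by auto
  ultimately show ?thesis unfolding s by simp
qed

text \<open>
  Interpolate square roots of \<open>1 / (a\<^sup>2 - 1)\<close> at the zeros of \<open>U\<close>.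
\<close>

lemma root_condition_solvable: "\<exists>b. \<forall>a. a\<^sup>2 \<noteq> 1 \<and> poly (cheb_U m) a = 0 \<longrightarrow> (a\<^sup>2 - 1) * (poly b a)\<^sup>2 = 1"
proof -
  have "poly (cheb_U m) 1 \<noteq> 0" using cheb_U_pm1[of 1 m] of_nat_neq_0[of m, where 'a = complex] by (auto simp del: of_nat_Suc)
  then have "cheb_U m \<noteq> 0" by auto
  then have "finite {a. poly (cheb_U m) a = 0}" by (rule poly_roots_finite)
  from interpolation[OF this, of "\<lambda>a. csqrt (inverse (a\<^sup>2 - 1))"]
  obtain b where b: "\<forall>a\<in>{a. poly (cheb_U m) a = 0}. poly b a = csqrt (inverse (a\<^sup>2 - 1))" ..
  show ?thesis
  proof (intro exI[of _ b] allI impI)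
    fix a :: complex assume a: "a\<^sup>2 \<noteq> 1 \<and> poly (cheb_U m) a = 0"
    then have "(poly b a)\<^sup>2 = inverse (a\<^sup>2 - 1)" using b by simp
    then show "(a\<^sup>2 - 1) * (poly b a)\<^sup>2 = 1" using a by simp
  qed
qed

theorem proposition3p5:
  fixes d :: datum and x :: ratfun
  assumes "miyanishi_datum d" and "pencil_coord d x"
  shows "(\<forall>(y :: ratfun) (n :: nat) (b :: complex poly).
            fibre_coord d x y \<and> normalized d x y \<and> n \<ge> 2 \<and>
            (\<forall>k\<in>{1..n - 1}.
               poly b (cos (of_real (real k * pi / real n))) = \<i> / sin (of_real (real k * pi / real n)) \<or>
               poly b (cos (of_real (real k * pi / real n))) = - \<i> / sin (of_real (real k * pi / real n)))
            \<longrightarrow> (\<exists>\<eta>. etale (surf d) (surf d) \<eta> \<and>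
                     (\<forall>R\<in>surf d. sigma_map d (\<eta> R) = eta0 x y n b (sigma_map d R)) \<and>
                     has_degree (surf d) \<eta> n \<and> respects_rho d x \<eta>)) \<and>
         (\<forall>n\<ge>(1::nat). \<exists>\<eta>\<in>Et d x. has_degree (surf d) \<eta> n)"
proof -
  obtain m l g where ad: "adapted d m l g" and x: "x = lin l / lin m"
    by (rule adapted_exists[OF assms])
  interpret adapted_datum d m l g by unfold_locales (rule assms(1), rule ad)
  show ?thesis
  proof (intro conjI allI impI, elim conjE)
    fix y n b
    assume fc: "fibre_coord d x y" and norm: "normalized d x y" and n: "n \<ge> 2"
      and b: "\<forall>k\<in>{1..n - 1}.
               poly b (cos (of_real (real k * pi / real n))) = \<i> / sin (of_real (real k * pi / real n)) \<or>
               poly b (cos (of_real (real k * pi / real n))) = - \<i> / sin (of_real (real k * pi / real n))"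
    have n': "n > 0" "n = Suc (n - 1)" using n by auto
    show "\<exists>\<eta>. etale (surf d) (surf d) \<eta> \<and>
                     (\<forall>R\<in>surf d. sigma_map d (\<eta> R) = eta0 x y n b (sigma_map d R)) \<and>
                     has_degree (surf d) \<eta> n \<and> respects_rho d x \<eta>"
    proof -
      have "\<exists>\<eta>. etale (surf d) (surf d) \<eta> \<and>
          (\<forall>R\<in>surf d. sigma_map d (\<eta> R) = eta0 x y (Suc (n - 1)) b (sigma_map d R)) \<and>
          has_degree (surf d) \<eta> (Suc (n - 1)) \<and> respects_rho d x \<eta>"
        unfolding x by (rule lift_of_eta0[OF fc[unfolded x] norm[unfolded x] root_condition[OF n'(1) b]])
      then show ?thesis by (simp only: n'(2)[symmetric])
    qed
  next
    fix n :: nat assume "n \<ge> 1"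
    then have n: "n = Suc (n - 1)" by simp
    obtain b where b: "\<forall>a. a\<^sup>2 \<noteq> 1 \<and> poly (cheb_U (n - 1)) a = 0 \<longrightarrow> (a\<^sup>2 - 1) * (poly b a)\<^sup>2 = 1"
      using root_condition_solvable by blast
    have root: "(a\<^sup>2 - 1) * (poly b a)\<^sup>2 = 1" if "a\<^sup>2 \<noteq> 1" "poly (cheb_U (n - 1)) a = 0" for a
      using b that by blast
    obtain \<eta> where "etale (surf d) (surf d) \<eta>" "has_degree (surf d) \<eta> (Suc (n - 1))" "respects_rho d x \<eta>"
      unfolding x by (rule endomorphism[OF root]) (assumption | rule that)+
    then show "\<exists>\<eta>\<in>Et d x. has_degree (surf d) \<eta> n" using n by (auto simp: Et_def)
  qed
qed

end
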